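(* Let $v\in L^1([0,\pi])$ be complex-valued and let $bc\in\{Per^+,Per^-,Dir\}$. Then there exist $N_*$ and a constant $C>0$, independent of $N$ and $H$, such that for all integers $N\ge N_*$ and all $H$ with $0<H\le N$ $$\|S_N-S_N^0: L^1\to\mathcal{C}\|\le C\left(v^*(H)+\frac HN\right).$$ In particular, for $H=N^\gamma$ with $0<\gamma<1$, $$\|S_N-S_N^0: L^1\to\mathcal{C}\|\le C\left(v^*(N^\gamma)+N^{\gamma-1}\right).$$
   Context: For $bc=Per^\pm$ put $v^*(n)=\sup\{|V(k)|:\ k\in2\mathbb{Z},\ |k|\ge n\}$, where $V(k)=\frac1\pi\int_0^\pi v(x)e^{-ikx}dx$, $k\in2\mathbb{Z}$. For $bc=Dir$ put $v^*(n)=\sup\{|\tilde V(k)|:\ k\in\mathbb{N},\ k\ge n\}$, where $\tilde V(k)=\frac1\pi\int_0^\pi v(x)\sqrt2\cos kx\,dx$. $L^a=L^a([0,\pi])$ with normalized Lebesgue measure: $\|f\|_a=\left(\frac1\pi\int_0^\pi|f(x)|^a\,dx\right)^{1/a}$; $\mathcal{C}=C([0,\pi])$ with the sup norm. For complex-valued $v\in L^1([0,\pi])$ and $bc\in\{Per^+,Per^-,Dir\}$, $L=L_{bc}(v)$ is the closed operator in $L^2([0,\pi])$ given by $Ly=-y''+v\,y$ on the domain of all $y$ such that $y,y'$ are absolutely continuous on $[0,\pi]$, $-y''+vy\in L^2([0,\pi])$, and the boundary conditions hold: $Per^{\pm}$: $y(\pi)=\pm y(0)$, $y'(\pi)=\pm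 y'(0)$; $Dir$: $y(0)=y(\pi)=0$. $L^0=L_{bc}(0)$ is the free operator. Their spectra are discrete. Let $R_\lambda=(\lambda-L)^{-1}$, $R^0_\lambda=(\lambda-L^0)^{-1}$. For $\omega,h>0$ let $\Pi_N=\{x+iy:\ -\omega\le x\le N^2+N,\ |y|\le h\}$ and $$S_N=\frac1{2\pi i}\int_{\partial\Pi_N}R_\lambda\,d\lambda,\qquad S_N^0=\frac1{2\pi i}\int_{\partial\Pi_N}R^0_\lambda\,d\lambda,$$ where $\omega,h$ are taken large enough that the interior of $\Pi_N$ contains all eigenvalues of $L$ and $L^0$ with real part at most $N^2+N$, and $N$ is large enough that no eigenvalue lies on the line $\mathrm{Re}\,\lambda=N^2+N$ ($S_N$, $S_N^0$ do not depend on the choice of such $\omega,h$). Operators defined on $L^2$ are regarded as operators from $L^1$ by extension by continuity from the dense subspace $L^2$. *)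

theory Defs
  imports "HOL-Complex_Analysis.Complex_Analysis"
begin

(* All function spaces are over [0,pi]; elements are functions real => complex of which only
   the values on [0,pi] matter. *)

definition L1 :: "(real \<Rightarrow> complex) set" where
  "L1 = {f. f absolutely_integrable_on {0..pi}}"

definition L2 :: "(real \<Rightarrow> complex) set" where
  "L2 = {f. f \<in> borel_measurable (lebesgue_on {0..pi}) \<and>
            integrable (lebesgue_on {0..pi}) (\<lambda>x. (cmod (f x))\<^sup>2)}"

definition norm_L1 :: "(real \<Rightarrow> complex) \<Rightarrow> real" where
  "norm_L1 f = (1 / pi) * integral {0..pi} (\<lambda>x. cmod (f x))"

definition norm_C :: "(real \<Rightarrow> complex) \<Rightarrow> ennreal" where
  "norm_C g = (SUP x\<in>{0..pi}. ennreal (cmod (g x)))"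

(* A division is a finite family of non-overlapping closed intervals. *)
definition abs_continuous_on :: "real set \<Rightarrow> (real \<Rightarrow> complex) \<Rightarrow> bool" where
  "abs_continuous_on S f \<longleftrightarrow>
     (\<forall>\<epsilon>>0. \<exists>\<delta>>0. \<forall>D. D division_of (\<Union>D) \<and> \<Union>D \<subseteq> S \<and> (\<Sum>K\<in>D. Sup K - Inf K) < \<delta> \<longrightarrow>
        (\<Sum>K\<in>D. cmod (f (Sup K) - f (Inf K))) < \<epsilon>)"

(* One-sided at the end points 0 and pi. *)
definition deriv_on :: "(real \<Rightarrow> complex) \<Rightarrow> real \<Rightarrow> complex" where
  "deriv_on y x = vector_derivative y (at x within {0..pi})"

datatype bcond = Per_plus | Per_minus | Dir

fun satisfies_bc :: "bcond \<Rightarrow> (real \<Rightarrow> complex) \<Rightarrow> bool" where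
  "satisfies_bc Per_plus y \<longleftrightarrow> y pi = y 0 \<and> deriv_on y pi = deriv_on y 0"
| "satisfies_bc Per_minus y \<longleftrightarrow> y pi = - y 0 \<and> deriv_on y pi = - deriv_on y 0"
| "satisfies_bc Dir y \<longleftrightarrow> y 0 = 0 \<and> y pi = 0"

definition hill_op :: "(real \<Rightarrow> complex) \<Rightarrow> (real \<Rightarrow> complex) \<Rightarrow> real \<Rightarrow> complex" where
  "hill_op v y x = - deriv_on (deriv_on y) x + v x * y x"

(* The almost-everywhere clause follows from absolute continuity of y' (Lebesgue); it is spelled
   out because vector_derivative is a total function. *)
definition hill_dom :: "bcond \<Rightarrow> (real \<Rightarrow> complex) \<Rightarrow> (real \<Rightarrow> complex) set" where
  "hill_dom bc v = {y.
     abs_continuous_on {0..pi} y \<and>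
     (\<forall>x\<in>{0..pi}. y differentiable (at x within {0..pi})) \<and>
     abs_continuous_on {0..pi} (deriv_on y) \<and>
     (AE x in lebesgue_on {0..pi}. deriv_on y differentiable (at x within {0..pi})) \<and>
     hill_op v y \<in> L2 \<and>
     satisfies_bc bc y}"

definition is_eigenvalue :: "bcond \<Rightarrow> (real \<Rightarrow> complex) \<Rightarrow> complex \<Rightarrow> bool" where
  "is_eigenvalue bc v z \<longleftrightarrow>
     (\<exists>y\<in>hill_dom bc v. (\<exists>x\<in>{0..pi}. y x \<noteq> 0) \<and>
        (AE x in lebesgue_on {0..pi}. hill_op v y x = z * y x))"

(* For z not an eigenvalue and f in L2, the solution y of (z - L) y = f is unique on [0,pi], so
   the choice operator does not affect the values there. *)
definition resolvent :: "bcond \<Rightarrow> (real \<Rightarrow> complex) \<Rightarrow> complex \<Rightarrow> (real \<Rightarrow> complex) \<Rightarrow> real \<Rightarrow> complex" where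
  "resolvent bc v z f =
     (SOME y. y \<in> hill_dom bc v \<and>
        (AE x in lebesgue_on {0..pi}. z * y x - hill_op v y x = f x))"

definition Pi_rect :: "nat \<Rightarrow> real \<Rightarrow> real \<Rightarrow> complex set" where
  "Pi_rect N \<omega> h = {z. - \<omega> \<le> Re z \<and> Re z \<le> (real N)\<^sup>2 + real N \<and> \<bar>Im z\<bar> \<le> h}"

(* Since the interior excludes the line Re z = N^2 + N, this also says that no eigenvalue of
   L or L^0 lies on that line. *)
definition admissible :: "bcond \<Rightarrow> (real \<Rightarrow> complex) \<Rightarrow> nat \<Rightarrow> real \<Rightarrow> real \<Rightarrow> bool" where
  "admissible bc v N \<omega> h \<longleftrightarrow> \<omega> > 0 \<and> h > 0 \<and>
     (\<forall>z. (is_eigenvalue bc v z \<or> is_eigenvalue bc (\<lambda>_. 0) z) \<and> Re z \<le> (real N)\<^sup>2 + real N \<longrightarrow>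
          z \<in> interior (Pi_rect N \<omega> h))"

(* The operator-valued contour integral, over the counterclockwise boundary of Pi_rect N \<omega> h.
   Each resolvent value is a continuous function on [0,pi] (an element of hill_dom), so the
   integral is taken at every point x; this yields the continuous representative of S_N f. *)
definition spectral_S ::
    "bcond \<Rightarrow> (real \<Rightarrow> complex) \<Rightarrow> nat \<Rightarrow> real \<Rightarrow> real \<Rightarrow> (real \<Rightarrow> complex) \<Rightarrow> real \<Rightarrow> complex" where
  "spectral_S bc v N \<omega> h f x =
     1 / (2 * of_real pi * \<i>) *
       contour_integral (rectpath (Complex (- \<omega>) (- h)) (Complex ((real N)\<^sup>2 + real N) h))
         (\<lambda>z. resolvent bc v z f x)"

(* T' is the extension by continuity to L1 -> C of the operator T given on L2.  Constant
   sequences show T' f = T f on [0,pi] for f in L2. *)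
definition extends_to_L1_C ::
    "((real \<Rightarrow> complex) \<Rightarrow> real \<Rightarrow> complex) \<Rightarrow> ((real \<Rightarrow> complex) \<Rightarrow> real \<Rightarrow> complex) \<Rightarrow> bool" where
  "extends_to_L1_C T T' \<longleftrightarrow>
     (\<forall>f\<in>L1. continuous_on {0..pi} (T' f) \<and>
        (\<forall>F. (\<forall>n. F n \<in> L2) \<and> (\<lambda>n. norm_L1 (\<lambda>x. F n x - f x)) \<longlonglongrightarrow> 0 \<longrightarrow>
           uniform_limit {0..pi} (\<lambda>n. T (F n)) (T' f) sequentially))"

definition opnorm_L1_C :: "((real \<Rightarrow> complex) \<Rightarrow> real \<Rightarrow> complex) \<Rightarrow> ennreal" where
  "opnorm_L1_C T = (SUP f\<in>{f\<in>L1. norm_L1 f \<le> 1}. norm_C (T f))"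

definition V_coeff :: "(real \<Rightarrow> complex) \<Rightarrow> int \<Rightarrow> complex" where
  "V_coeff v k = 1 / of_real pi * integral {0..pi} (\<lambda>x. v x * exp (- \<i> * of_int k * of_real x))"

definition V_tilde :: "(real \<Rightarrow> complex) \<Rightarrow> nat \<Rightarrow> complex" where
  "V_tilde v k = 1 / of_real pi * integral {0..pi} (\<lambda>x. v x * of_real (sqrt 2 * cos (real k * x)))"

fun vstar :: "bcond \<Rightarrow> (real \<Rightarrow> complex) \<Rightarrow> real \<Rightarrow> real" where
  "vstar Dir v r = (SUP k\<in>{k::nat. real k \<ge> r}. cmod (V_tilde v k))"
| "vstar Per_plus v r = (SUP k\<in>{k::int. even k \<and> \<bar>real_of_int k\<bar> \<ge> r}. cmod (V_coeff v k))"
| "vstar Per_minus v r = (SUP k\<in>{k::int. even k \<and> \<bar>real_of_int k\<bar> \<ge> r}. cmod (V_coeff v k))"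

end

theory Submission
  imports Defs
begin

text \<open>The comparison of spectral projections is a first-order perturbation estimate, made uniform by
three facts: the eigenvalues of the free operator are explicit, its resolvent is small on the line
\<open>Re z = N\<^sup>2 + N\<close>, and the second-order remainder of the resolvent decays fast enough to be
integrated over that whole line.

Let \<open>G\<^sub>z\<close> and \<open>G\<^sup>0\<^sub>z\<close> be the resolvents of the operator with potential \<open>v\<close> and of the free operator, as
operators from \<open>L\<^sup>1\<close> to \<open>C\<close>. Both are given by solving a boundary value problem in integral form
(\<open>bvp\<close>), which makes sense for \<open>f \<in> L\<^sup>1\<close>. An ordinary differential equation with integrable
coefficients has a unique solution with given initial data, so the boundary value problem is a
two by two linear system; it is uniquely solvable, with a bound, exactly when \<open>z\<close> is not an eigenvalue
(\<open>bvp_solvable\<close>). The resolvent identity then gives continuity and analyticity in \<open>z\<close>.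

Let \<open>e\<^sub>k\<close> be the normalised eigenfunctions of the free operator, with eigenvalues \<open>k\<^sup>2\<close>. Then
\<open>G\<^sup>0\<^sub>z f = \<Sum> f\<^sub>k e\<^sub>k / (z - k\<^sup>2)\<close> (\<open>bvp_series\<close>), so that \<open>G\<^sup>0\<^sub>z\<close> has norm at most
\<open>2 \<rho>(z)\<close> with \<open>\<rho>(z) = \<Sum> 1 / |z - k\<^sup>2|\<close>. Where \<open>\<rho>(z)\<close> is small compared with \<open>1 / \<parallel>v\<parallel>\<close>, the equation
\<open>G\<^sub>z f = G\<^sup>0\<^sub>z (f + v G\<^sub>z f)\<close> is a contraction. There \<open>z\<close> is not an eigenvalue, and
\<open>G\<^sub>z - G\<^sup>0\<^sub>z = G\<^sup>0\<^sub>z v G\<^sup>0\<^sub>z + E\<^sub>z\<close> with \<open>\<parallel>E\<^sub>z\<parallel> \<le> 16 \<parallel>v\<parallel>\<^sup>2 \<rho>(z)\<^sup>3\<close> (\<open>second_order_remainder_bound\<close>).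
In particular the eigenvalues to the left of the line \<open>Re z = N\<^sup>2 + N\<close> lie in a bounded set, and none
lies on the line, for large \<open>N\<close>.

By analyticity the contour may be replaced by a rectangle with the same right side and with the
other sides at distance \<open>M\<^sup>2\<close>, where \<open>M\<close> is as large as needed. On it the two parts are estimated
separately.

For the first-order part, residues leave only the pairs \<open>(j, k)\<close> of which exactly one index is inside,
that is \<open>|j| \<le> N < |k|\<close> or the reverse, with weight \<open>V\<^sub>j\<^sub>k / (j\<^sup>2 - k\<^sup>2)\<close>. If \<open>|j|\<close> and \<open>|k|\<close> differ by at
least \<open>H\<close> then \<open>|V\<^sub>j\<^sub>k| \<le> 2 v\<^sup>*(H)\<close>, and the sum of the weights is bounded (\<open>double_sum_far\<close>). At
each distance \<open>d < H\<close> there are \<open>O(d)\<close> pairs, each of weight at most \<open>1 / (d N)\<close>; they contribute a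
multiple of \<open>H / N\<close> (\<open>double_sum_near\<close>).

For the remainder, \<open>\<rho>\<^sup>3\<close> integrates to \<open>O(1/N)\<close> over the line (\<open>integral_rho_cube_le\<close>), and it is
\<open>O(M\<^sup>-\<^sup>3)\<close> on the other sides, whose length is \<open>O(M\<^sup>2)\<close>.

The resulting bound is \<open>C (v\<^sup>*(H) + H/N + 1/N)\<close>. The term \<open>1/N\<close> is harmless for \<open>H \<ge> 1\<close>. For \<open>H < 1\<close> it is
absorbed by \<open>v\<^sup>*(H) \<ge> v\<^sup>*(1)\<close>, unless \<open>v\<^sup>*(1) = 0\<close>; in that case \<open>v\<close> is constant, the spectrum is
shifted by that constant, and the two spectral operators agree for large \<open>N\<close>.\<close>

section \<open>Indefinite integrals and absolute continuity\<close>

text \<open>Near a point where the difference quotient of the primitive keeps missing \<open>f x\<close> by more than \<open>e\<close>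
there is an interval, fine for any given gauge and tagged at one of its ends, over which the Riemann
term misses the integral by more than \<open>e\<close> times its length. The Henstock lemma bounds the total
length of disjoint intervals of this kind, and the Vitali covering lemma turns this into a bound for
the outer measure of the bad set.\<close>

lemma lebesgue_differentiation_bad_set:
  fixes f :: "real \<Rightarrow> complex"
  assumes f: "f integrable_on {a..b}" and e: "e > 0"
  defines "F \<equiv> \<lambda>x. integral {a..x} f"
  shows "negligible {x\<in>{a..b}. \<forall>d>0. \<exists>y\<in>{a..b}. 0 < \<bar>y - x\<bar> \<and> \<bar>y - x\<bar> < d \<and>
            norm (F y - F x - (y - x) *\<^sub>R f x) > e * \<bar>y - x\<bar>}" (is "negligible ?B")
  unfolding negligible_outer_le
proof (intro allI impI)
  fix \<eta> :: real assume \<eta>: "\<eta> > 0"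
  \<comment> \<open>The covering lemma enlarges the disjoint intervals five times, hence the 5.\<close>
  define \<delta> where "\<delta> = \<eta> * e / 5"
  have \<delta>: "\<delta> > 0" using \<eta> e by (simp add: \<delta>_def)
  have f': "f integrable_on cbox a b" using f by simp
  obtain \<gamma> where \<gamma>: "gauge \<gamma>"
    and H: "\<And>p. \<lbrakk>p tagged_partial_division_of (cbox a b); \<gamma> fine p\<rbrakk> \<Longrightarrow>
             (\<Sum>(x,k)\<in>p. norm (measure lborel k *\<^sub>R f x - integral k f)) < \<delta>"
    by (rule Henstock_lemma[OF f' \<delta>]) (rule that)
  have "\<exists>y\<in>{a..b}. x \<noteq> y \<and> {min x y..max x y} \<subseteq> \<gamma> x \<and>
          norm (F y - F x - (y - x) *\<^sub>R f x) > e * \<bar>y - x\<bar>" if x: "x \<in> ?B" for x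
  proof -
    obtain d where d: "d > 0" "ball x d \<subseteq> \<gamma> x"
      using gaugeD[OF \<gamma>] by (metis open_contains_ball)
    obtain y where y: "y \<in> {a..b}" "0 < \<bar>y - x\<bar>" "\<bar>y - x\<bar> < d"
        "norm (F y - F x - (y - x) *\<^sub>R f x) > e * \<bar>y - x\<bar>" using x d(1) by blast
    have "{min x y..max x y} \<subseteq> ball x d" using y by (auto simp: dist_real_def)
    then show ?thesis using y d by (intro bexI[of _ y]) auto
  qed
  then have "\<forall>x\<in>?B. \<exists>y. y \<in> {a..b} \<and> x \<noteq> y \<and> {min x y..max x y} \<subseteq> \<gamma> x \<and>
          norm (F y - F x - (y - x) *\<^sub>R f x) > e * \<bar>y - x\<bar>" unfolding Bex_def by (rule ballI)
  from bchoice[OF this] obtain g where g: "\<And>x. x \<in> ?B \<Longrightarrow> g x \<in> {a..b} \<and> x \<noteq> g x \<and> {min x (g x)..max x (g x)} \<subseteq> \<gamma> x \<and>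
          norm (F (g x) - F x - (g x - x) *\<^sub>R f x) > e * \<bar>g x - x\<bar>" by (elim exE) (rule that, erule bspec)
  \<comment> \<open>The interval between \<open>x\<close> and \<open>g x\<close> as a ball, the form needed for the covering lemma.\<close>
  define c where "c x = (x + g x) / 2" for x
  define r where "r x = \<bar>g x - x\<bar> / 2" for x
  define K where "K x = {min x (g x)..max x (g x)}" for x
  have cb: "cball (c x) (r x) = K x" for x
  proof -
    have "c x - r x = min x (g x)" "c x + r x = max x (g x)"
      by (auto simp: c_def r_def min_def max_def abs_if field_simps)
    then show ?thesis by (simp add: cball_eq_atLeastAtMost K_def)
  qed
  have cov: "?B \<subseteq> (\<Union>i\<in>?B. cball (c i) (r i))"
    by (auto simp: cb K_def)
  have r: "0 < r i \<and> r i \<le> b - a" if "i \<in> ?B" for i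
    using g[OF that] that by (auto simp: r_def abs_if)
  obtain C where C: "countable C" "C \<subseteq> ?B"
     "pairwise (\<lambda>i j. disjnt (cball (c i) (r i)) (cball (c j) (r j))) C"
     "?B \<subseteq> (\<Union>i\<in>C. cball (c i) (5 * r i))"
    by (rule Vitali_covering_lemma_cballs[OF cov r]) auto
  have fin: "(\<Sum>i\<in>I. 2 * r i) \<le> \<delta> / e" if I: "I \<subseteq> C" "finite I" for I
  proof -
    define p where "p = (\<lambda>x. (x, K x)) ` I"
    have IB: "i \<in> ?B" if "i \<in> I" for i using that I C by auto
    have pw: "K i \<inter> K j = {}" if "i \<in> I" "j \<in> I" "i \<noteq> j" for i j
      using C(3) that I unfolding pairwise_def cb disjnt_def by blast
    have "p tagged_partial_division_of cbox a b"
      unfolding tagged_partial_division_of_def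
    proof (intro conjI allI impI)
      show "finite p" using I by (simp add: p_def)
      fix x k assume xk: "(x,k) \<in> p"
      then have x: "x \<in> I" "k = K x" by (auto simp: p_def)
      show "x \<in> k" using x by (auto simp: K_def)
      show "k \<subseteq> cbox a b" using g[OF IB[OF x(1)]] IB[OF x(1)] x by (auto simp: K_def)
      show "\<exists>a b. k = cbox a b" using x by (auto simp: K_def)
    next
      fix x k x2 k2 assume "(x,k) \<in> p \<and> (x2,k2) \<in> p \<and> (x, k) \<noteq> (x2,k2)"
      then have x2: "x2 \<in> I" "k2 = K x2" "x \<noteq> x2" and x: "x \<in> I" "k = K x" by (auto simp: p_def)
      then have "k \<inter> k2 = {}" using pw x by blast
      then show "interior k \<inter> interior k2 = {}" using interior_subset by blast
    qed
    moreover have "\<gamma> fine p" using g IB by (auto simp: fine_def p_def K_def)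
    ultimately have "(\<Sum>(x,k)\<in>p. norm (measure lborel k *\<^sub>R f x - integral k f)) < \<delta>" by (rule H)
    also have "(\<Sum>(x,k)\<in>p. norm (measure lborel k *\<^sub>R f x - integral k f)) =
        (\<Sum>x\<in>I. norm (measure lborel (K x) *\<^sub>R f x - integral (K x) f))"
      unfolding p_def by (subst sum.reindex) (auto simp: inj_on_def)
    finally have 1: "(\<Sum>x\<in>I. norm (measure lborel (K x) *\<^sub>R f x - integral (K x) f)) < \<delta>" .
    have 2: "e * (2 * r x) \<le> norm (measure lborel (K x) *\<^sub>R f x - integral (K x) f)" if "x \<in> I" for x
    proof -
      have gx: "g x \<in> {a..b}" "norm (F (g x) - F x - (g x - x) *\<^sub>R f x) > e * \<bar>g x - x\<bar>" and xx: "x \<in> {a..b}"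
        using g[OF IB[OF that]] IB[OF that] by auto
      have F: "integral {u..w} f = F w - F u" if "u \<le> w" "u \<in> {a..b}" "w \<in> {a..b}" for u w
      proof -
        have "f integrable_on {a..w}" using f by (rule integrable_subinterval_real) (use that in auto)
        then show ?thesis unfolding F_def using Henstock_Kurzweil_Integration.integral_combine[of a u w f] that
          by (auto simp: eq_diff_eq add.commute)
      qed
      have "norm (F (g x) - F x - (g x - x) *\<^sub>R f x) = norm (measure lborel (K x) *\<^sub>R f x - integral (K x) f)"
      proof (cases "x \<le> g x")
        case True
        then show ?thesis using F[of x "g x"] gx xx by (simp add: K_def norm_minus_commute)
      next
        case False
        then have "measure lborel (K x) *\<^sub>R f x - integral (K x) f = F (g x) - F x - (g x - x) *\<^sub>R f x"
          using F[of "g x" x] gx xx by (simp add: K_def algebra_simps)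
        then show ?thesis by simp
      qed
      then show ?thesis using gx by (simp add: r_def)
    qed
    have "e * (\<Sum>i\<in>I. 2 * r i) \<le> (\<Sum>x\<in>I. norm (measure lborel (K x) *\<^sub>R f x - integral (K x) f))"
      unfolding sum_distrib_left by (rule sum_mono) (rule 2)
    then show ?thesis using 1 e by (simp add: field_simps)
  qed
  have m1: "(\<Union>i\<in>C. cball (c i) (5 * r i)) \<in> lmeasurable"
    and m2: "measure lebesgue (\<Union>i\<in>C. cball (c i) (5 * r i)) \<le> 5 * (\<delta>/e)"
  proof -
    have *: "measure lebesgue (\<Union>i\<in>I. cball (c i) (5 * r i)) \<le> 5 * (\<delta>/e)" if I: "I \<subseteq> C" "finite I" for I
    proof -
      have "measure lebesgue (\<Union>i\<in>I. cball (c i) (5 * r i)) \<le> (\<Sum>i\<in>I. measure lebesgue (cball (c i) (5 * r i)))"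
        using I by (intro measure_UNION_le) auto
      also have "\<dots> = 5 * (\<Sum>i\<in>I. 2 * r i)"
        unfolding sum_distrib_left
        by (rule sum.cong) (auto simp: cball_eq_atLeastAtMost r_def)
      also have "\<dots> \<le> 5 * (\<delta>/e)" using fin[OF I] by simp
      finally show ?thesis .
    qed
    show "(\<Union>i\<in>C. cball (c i) (5 * r i)) \<in> lmeasurable"
      by (rule fmeasurable_UN_bound[OF C(1) _ *]) auto
    show "measure lebesgue (\<Union>i\<in>C. cball (c i) (5 * r i)) \<le> 5 * (\<delta>/e)"
      by (rule measure_UN_bound[OF C(1) _ *]) auto
  qed
  show "\<exists>T. ?B \<subseteq> T \<and> T \<in> lmeasurable \<and> measure lebesgue T \<le> \<eta>"
    using C(4) m1 m2 e \<eta> by (intro exI[of _ "\<Union>i\<in>C. cball (c i) (5 * r i)"]) (auto simp: \<delta>_def)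
qed

text \<open>The exceptional set is the union of the bad sets for a sequence of thresholds that tends to zero.\<close>

theorem lebesgue_differentiation:
  fixes f :: "real \<Rightarrow> complex"
  assumes f: "f integrable_on {a..b}"
  obtains E where "negligible E"
    "\<And>x. x \<in> {a..b} - E \<Longrightarrow> ((\<lambda>x. integral {a..x} f) has_vector_derivative f x) (at x within {a..b})"
proof -
  define F where "F x = integral {a..x} f" for x
  define B where "B e = {x\<in>{a..b}. \<forall>d>0. \<exists>y\<in>{a..b}. 0 < \<bar>y - x\<bar> \<and> \<bar>y - x\<bar> < d \<and>
            norm (F y - F x - (y - x) *\<^sub>R f x) > e * \<bar>y - x\<bar>}" for e :: real
  have B: "negligible (B e)" if "e > 0" for e
    using lebesgue_differentiation_bad_set[OF f that] by (simp add: B_def F_def)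
  show ?thesis
  proof (rule that[of "\<Union>n::nat. B (1 / real (Suc n))"])
    show "negligible (\<Union>n::nat. B (1 / real (Suc n)))"
      by (intro negligible_countable_Union) (auto intro: B)
    fix x assume x: "x \<in> {a..b} - (\<Union>n::nat. B (1 / real (Suc n)))"
    have "(F has_derivative (\<lambda>h. h *\<^sub>R f x)) (at x within {a..b})"
      unfolding has_derivative_within_alt
    proof (intro conjI allI impI)
      show "bounded_linear (\<lambda>h. h *\<^sub>R f x)" by (rule bounded_linear_scaleR_left)
      fix e :: real assume "e > 0"
      then obtain n where n: "1 / real (Suc n) < e" using nat_approx_posE by blast
      have "x \<notin> B (1 / real (Suc n))" using x by blast
      then have "\<exists>d>0. \<forall>y\<in>{a..b}. 0 < \<bar>y - x\<bar> \<longrightarrow> \<bar>y - x\<bar> < d \<longrightarrow>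
          norm (F y - F x - (y - x) *\<^sub>R f x) \<le> 1 / real (Suc n) * \<bar>y - x\<bar>"
        using x unfolding B_def mem_Collect_eq by (meson DiffD1 not_less)
      then obtain d where d: "d > 0" "\<And>y. y \<in> {a..b} \<Longrightarrow> 0 < \<bar>y - x\<bar> \<Longrightarrow> \<bar>y - x\<bar> < d \<Longrightarrow>
          norm (F y - F x - (y - x) *\<^sub>R f x) \<le> 1 / real (Suc n) * \<bar>y - x\<bar>"
        by blast
      have "norm (F y - F x - (y - x) *\<^sub>R f x) \<le> e * norm (y - x)" if "y \<in> {a..b}" "norm (y - x) < d" for y
      proof (cases "y = x")
        case False
        then have "norm (F y - F x - (y - x) *\<^sub>R f x) \<le> 1 / real (Suc n) * \<bar>y - x\<bar>" using d that by auto
        also have "\<dots> \<le> e * \<bar>y - x\<bar>" using n by (intro mult_right_mono) auto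
        finally show ?thesis by simp
      qed simp
      then show "\<exists>d>0. \<forall>y\<in>{a..b}. norm (y - x) < d \<longrightarrow> norm (F y - F x - (y - x) *\<^sub>R f x) \<le> e * norm (y - x)"
        using d(1) by blast
    qed
    then show "((\<lambda>x. integral {a..x} f) has_vector_derivative f x) (at x within {a..b})"
      unfolding has_vector_derivative_def F_def .
  qed
qed

text \<open>Cut \<open>|f|\<close> off at a height \<open>n\<close> for which the integral of the excess is below \<open>\<epsilon>/2\<close>. The part below the
cut contributes at most \<open>n\<close> times the total length of the intervals.\<close>

lemma abs_continuous_on_indefinite_integral:
  fixes f :: "real \<Rightarrow> complex"
  assumes f: "f absolutely_integrable_on {a..b}"
    and F: "\<And>x. x \<in> {a..b} \<Longrightarrow> F x = c + integral {a..x} f"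
  shows "abs_continuous_on {a..b} F"
  unfolding abs_continuous_on_def
proof (intro allI impI)
  fix \<epsilon> :: real assume \<epsilon>: "\<epsilon> > 0"
  have nf: "(\<lambda>x. norm (f x)) absolutely_integrable_on {a..b}" using f by (rule absolutely_integrable_norm[unfolded o_def])
  define r where "r n x = max (norm (f x) - real n) 0" for n x
  have ri: "r n absolutely_integrable_on {a..b}" for n
    unfolding r_def
    by (intro absolutely_integrable_max_1 set_integral_diff nf) (auto intro!: absolutely_integrable_on_const lmeasurable_interval)
  have "(\<lambda>n. integral {a..b} (r n)) \<longlonglongrightarrow> integral {a..b} (\<lambda>x. 0::real)"
  proof (rule dominated_convergence)
    show "r n integrable_on {a..b}" for n using ri set_lebesgue_integral_eq_integral by blast
    show "(\<lambda>x. norm (f x)) integrable_on {a..b}" using nf set_lebesgue_integral_eq_integral by blast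
    show "norm (r n x) \<le> norm (f x)" for n x by (auto simp: r_def max_def)
    fix x
    obtain m where m: "norm (f x) \<le> real m" using real_arch_simple by blast
    have "eventually (\<lambda>n. r n x = 0) sequentially"
      using eventually_ge_at_top[of m] by eventually_elim (use m in \<open>auto simp: r_def\<close>)
    then show "(\<lambda>n. r n x) \<longlonglongrightarrow> 0" by (rule tendsto_eventually)
  qed
  then have "(\<lambda>n. integral {a..b} (r n)) \<longlonglongrightarrow> 0" by simp
  then have "eventually (\<lambda>n. integral {a..b} (r n) < \<epsilon>/2) sequentially"
    using \<epsilon> by (intro order_tendstoD) auto
  then obtain n where n: "integral {a..b} (r n) < \<epsilon>/2" by (auto simp: eventually_sequentially)
  show "\<exists>\<delta>>0. \<forall>D. D division_of \<Union>D \<and> \<Union>D \<subseteq> {a..b} \<and> (\<Sum>K\<in>D. Sup K - Inf K) < \<delta> \<longrightarrow>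
      (\<Sum>K\<in>D. cmod (F (Sup K) - F (Inf K))) < \<epsilon>"
  proof (intro exI[of _ "\<epsilon> / (2 * (real n + 1))"] conjI allI impI; (elim conjE)?)
    show "\<epsilon> / (2 * (real n + 1)) > 0" using \<epsilon> by auto
    fix D assume D: "D division_of \<Union>D" "\<Union>D \<subseteq> {a..b}" and len: "(\<Sum>K\<in>D. Sup K - Inf K) < \<epsilon> / (2 * (real n + 1))"
    have rint: "r n integrable_on {a..b}" using ri set_lebesgue_integral_eq_integral by blast
    have K: "cmod (F (Sup K) - F (Inf K)) \<le> real n * (Sup K - Inf K) + integral K (r n) \<and> r n integrable_on K"
      if KD: "K \<in> D" for K
    proof -
      obtain u w where "K = cbox u w" "K \<noteq> {}" using division_ofD(3,4)[OF D(1) KD] by metis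
      then have uw: "K = {u..w}" "u \<le> w" by auto
      have sub: "{u..w} \<subseteq> {a..b}" using D KD uw by (metis Sup_upper order_trans)
      then have uab: "u \<in> {a..b}" "w \<in> {a..b}" using uw by auto
      have fi: "f integrable_on {a..w}"
        by (rule integrable_subinterval_real[OF set_lebesgue_integral_eq_integral(1)[OF f]]) (use uab in auto)
      have fi': "f absolutely_integrable_on {u..w}"
        by (rule absolutely_integrable_on_subinterval[OF f sub])
      have "F w - F u = integral {u..w} f" using F uab uw(2) Henstock_Kurzweil_Integration.integral_combine[of a u w f] fi
        by (auto simp: algebra_simps)
      moreover have "norm (integral {u..w} f) \<le> integral {u..w} (\<lambda>x. real n + r n x)"
        by (rule integral_norm_bound_integral)
           (use set_lebesgue_integral_eq_integral(1)[OF fi'] integrable_subinterval_real[OF rint sub] in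
             \<open>auto intro!: integrable_add simp: r_def[abs_def]\<close>)
      moreover have "r n integrable_on {u..w}" using integrable_subinterval_real[OF rint sub] .
      moreover have "integral {u..w} (\<lambda>x. real n + r n x) = real n * (w - u) + integral {u..w} (r n)"
        using uw by (subst Henstock_Kurzweil_Integration.integral_add) (auto simp: integrable_subinterval_real[OF rint sub] content_real)
      ultimately show ?thesis using uw by auto
    qed
    have "(\<Sum>K\<in>D. cmod (F (Sup K) - F (Inf K))) \<le> real n * (\<Sum>K\<in>D. Sup K - Inf K) + (\<Sum>K\<in>D. integral K (r n))"
      unfolding sum_distrib_left sum.distrib[symmetric] by (rule sum_mono) (use K in blast)
    also have "(\<Sum>K\<in>D. integral K (r n)) = integral (\<Union>D) (r n)"
      by (rule integral_combine_division_topdown[symmetric])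
         (use D(1) K in \<open>auto intro: integrable_combine_division\<close>)
    also have "\<dots> \<le> integral {a..b} (r n)"
      by (rule integral_subset_le) (use D K rint in \<open>auto simp: r_def intro: integrable_combine_division\<close>)
    also have "real n * (\<Sum>K\<in>D. Sup K - Inf K) \<le> real n * (\<epsilon> / (2 * (real n + 1)))"
      using len by (intro mult_left_mono) auto
    also have "real n * (\<epsilon> / (2 * (real n + 1))) \<le> \<epsilon>/2" using \<epsilon> by (simp add: field_simps)
    finally show "(\<Sum>K\<in>D. cmod (F (Sup K) - F (Inf K))) < \<epsilon>" using n by simp
  qed
qed

text \<open>The fundamental theorem for absolutely continuous functions, directly with gauges. At a point where
\<open>F\<close> is differentiable the gauge comes from the derivative. At a point of the null set \<open>E\<close> it is an
open set around \<open>E\<close> of small measure, so the intervals tagged there are short in total and absolute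
continuity makes their increments small. The integrand is set to zero on \<open>E\<close>.\<close>

theorem abs_continuous_on_has_integral_derivative:
  fixes F f :: "real \<Rightarrow> complex"
  assumes ac: "abs_continuous_on {a..b} F" and E: "negligible E" and ab: "a \<le> b"
    and D: "\<And>x. x \<in> {a..b} - E \<Longrightarrow> (F has_vector_derivative f x) (at x within {a..b})"
  shows "(f has_integral (F b - F a)) {a..b}"
proof -
  define g where "g x = (if x \<in> E then 0 else f x)" for x
  have "(g has_integral (F b - F a)) {a..b}"
    unfolding has_integral_real
  proof (intro allI impI)
    fix e :: real assume e: "e > 0"
    obtain \<delta> where \<delta>: "\<delta> > 0" and ac\<delta>: "\<And>\<D>. \<D> division_of (\<Union>\<D>) \<Longrightarrow> \<Union>\<D> \<subseteq> {a..b} \<Longrightarrow>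
        (\<Sum>K\<in>\<D>. Sup K - Inf K) < \<delta> \<Longrightarrow> (\<Sum>K\<in>\<D>. cmod (F (Sup K) - F (Inf K))) < e/2"
      using ac e unfolding abs_continuous_on_def by (meson half_gt_zero)
    have Es: "E \<in> sets lebesgue" "measure lebesgue E = 0" "E \<in> lmeasurable"
      using E negligible_imp_measurable negligible_imp_measure0 by auto
    obtain U where U: "open U" "E \<subseteq> U" "U - E \<in> lmeasurable" "emeasure lebesgue (U - E) < ennreal \<delta>"
      using sets_lebesgue_outer_open[OF Es(1) \<delta>] .
    have Um: "U \<in> lmeasurable"
      using fmeasurable.Un[OF U(3) Es(3)] U(2) by (simp add: Un_absorb2)
    have "measure lebesgue (U - E) < \<delta>"
      using U(3,4) \<delta> by (metis emeasure_eq_measure2 ennreal_less_iff measure_nonneg)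
    moreover have "measure lebesgue U = measure lebesgue (U - E)"
      using Es E by (metis measure_Diff_null_set negligible_iff_null_sets fmeasurableD Um)
    ultimately have Ulen: "measure lebesgue U < \<delta>" by simp
    define \<eta> where "\<eta> = e / (2 * (b - a + 1))"
    have \<eta>: "\<eta> > 0" using e ab by (simp add: \<eta>_def)
    have "\<exists>d>0. \<forall>y\<in>{a..b}. norm (y - x) < d \<longrightarrow> norm (F y - F x - (y - x) *\<^sub>R f x) \<le> \<eta> * norm (y - x)"
      if "x \<in> {a..b} - E" for x
      using D[OF that] \<eta> unfolding has_vector_derivative_def has_derivative_within_alt by blast
    then have "\<forall>x\<in>{a..b} - E. \<exists>d. d > 0 \<and> (\<forall>y\<in>{a..b}. norm (y - x) < d \<longrightarrow> norm (F y - F x - (y - x) *\<^sub>R f x) \<le> \<eta> * norm (y - x))"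
      by blast
    from bchoice[OF this] obtain d where d: "\<And>x. x \<in> {a..b} - E \<Longrightarrow> d x > 0 \<and>
        (\<forall>y\<in>{a..b}. norm (y - x) < d x \<longrightarrow> norm (F y - F x - (y - x) *\<^sub>R f x) \<le> \<eta> * norm (y - x))"
      by blast
    define \<gamma> where "\<gamma> x = (if x \<in> E then U else if x \<in> {a..b} then ball x (d x) else ball x 1)" for x
    have gg: "gauge \<gamma>" using d U by (auto simp: gauge_def \<gamma>_def)
    have fin: "norm ((\<Sum>(x, k)\<in>p. measure lborel k *\<^sub>R g x) - (F b - F a)) < e"
      if p: "p tagged_division_of {a..b}" "\<gamma> fine p" for p
    proof -
      define q where "q = {xk \<in> p. fst xk \<in> E}"
      have fp: "finite p" using p(1) by blast
      then have fq: "finite q" by (simp add: q_def)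
      have part: "p tagged_partial_division_of {a..b}" using p(1) by (simp add: tagged_division_of_def)
      have qpart: "q tagged_partial_division_of {a..b}"
        by (rule tagged_partial_division_subset[OF part]) (auto simp: q_def)
      have Kint: "\<exists>u w. K = {u..w} \<and> u \<le> w \<and> x \<in> {u..w} \<and> {u..w} \<subseteq> {a..b} \<and> {u..w} \<subseteq> \<gamma> x" if "(x,K) \<in> p" for x K
      proof -
        obtain u w where "K = cbox u w" using tagged_division_ofD(4)[OF p(1) \<open>(x,K) \<in> p\<close>] by blast
        moreover have "x \<in> K" "K \<subseteq> {a..b}" using tagged_division_ofD(2,3)[OF p(1) \<open>(x,K) \<in> p\<close>] by auto
        moreover have "K \<subseteq> \<gamma> x" using p(2) that by (auto simp: fine_def)
        ultimately show ?thesis by (intro exI[of _ u] exI[of _ w]) auto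
      qed
      have D: "snd ` q division_of \<Union>(snd ` q)"
        by (rule partial_division_of_tagged_division[OF qpart])
      have Dab: "\<Union>(snd ` q) \<subseteq> {a..b}" and DU: "\<Union>(snd ` q) \<subseteq> U"
        using Kint by (fastforce simp: q_def \<gamma>_def)+
      have "(\<Sum>K\<in>snd ` q. Sup K - Inf K) = (\<Sum>K\<in>snd ` q. measure lebesgue K)"
        by (rule sum.cong) (use Kint in \<open>force simp: q_def\<close>)+
      also have "\<dots> = measure lebesgue (\<Union>(snd ` q))"
        by (rule content_division[OF D])
      also have "\<dots> \<le> measure lebesgue U"
        by (rule measure_mono_fmeasurable[OF DU _ Um]) (use D lmeasurable_division in blast)
      finally have len: "(\<Sum>K\<in>snd ` q. Sup K - Inf K) < \<delta>" using Ulen by simp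
      have "(\<Sum>(x,K)\<in>q. cmod (F (Sup K) - F (Inf K))) = (\<Sum>K\<in>snd ` q. cmod (F (Sup K) - F (Inf K)))"
      proof -
        have "(\<Sum>K\<in>snd ` q. cmod (F (Sup K) - F (Inf K))) = (\<Sum>xK\<in>q. ((\<lambda>K. cmod (F (Sup K) - F (Inf K))) \<circ> snd) xK)"
        proof (rule sum.reindex_nontrivial[OF fq])
          fix xK yL assume *: "xK \<in> q" "yL \<in> q" "xK \<noteq> yL" "snd xK = snd yL"
          then have "interior (snd xK) \<inter> interior (snd yL) = {}"
            using tagged_partial_division_ofD(5)[OF qpart] by (metis prod.collapse)
          then have "interior (snd xK) = {}" using * by simp
          moreover have "(fst xK, snd xK) \<in> p" using *(1) by (simp add: q_def)
          then obtain u w where "snd xK = {u..w}" "u \<le> w"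
            using Kint by blast
          ultimately show "cmod (F (Sup (snd xK)) - F (Inf (snd xK))) = 0" by simp
        qed
        then show ?thesis by (simp add: case_prod_unfold)
      qed
      then have q: "(\<Sum>(x,K)\<in>q. cmod (F (Sup K) - F (Inf K))) < e/2"
        using ac\<delta>[OF D Dab len] by simp
      have each: "norm (measure lborel K *\<^sub>R g x - (F (Sup K) - F (Inf K))) \<le>
          \<eta> * measure lborel K + (if x \<in> E then cmod (F (Sup K) - F (Inf K)) else 0)" if xK: "(x,K) \<in> p" for x K
      proof (cases "x \<in> E")
        case True
        then show ?thesis using \<eta> by (simp add: g_def norm_minus_commute)
      next
        case False
        obtain u w where uw: "K = {u..w}" "u \<le> w" "x \<in> {u..w}" "{u..w} \<subseteq> {a..b}" "{u..w} \<subseteq> \<gamma> x"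
          using Kint[OF xK] by blast
        have x: "x \<in> {a..b} - E" using uw False by auto
        have near: "norm (F y - F x - (y - x) *\<^sub>R f x) \<le> \<eta> * norm (y - x)" if "y \<in> {u..w}" for y
        proof -
          have "y \<in> ball x (d x)" using uw(5) x that by (auto simp: \<gamma>_def)
          then show ?thesis using d[OF x] uw(4) that by (auto simp: dist_norm norm_minus_commute)
        qed
        have "measure lborel K *\<^sub>R g x - (F (Sup K) - F (Inf K)) =
           (F u - F x - (u - x) *\<^sub>R f x) - (F w - F x - (w - x) *\<^sub>R f x)"
          using uw x by (simp add: g_def algebra_simps)
        also have "norm \<dots> \<le> \<eta> * norm (u - x) + \<eta> * norm (w - x)"
          by (rule order_trans[OF norm_triangle_ineq4 add_mono]) (use near[of u] near[of w] uw in auto)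
        also have "\<dots> = \<eta> * measure lborel K" using uw by (simp add: algebra_simps)
        finally show ?thesis using False by simp
      qed
      have "(\<Sum>(x, k)\<in>p. measure lborel k *\<^sub>R g x) - (F b - F a) =
          (\<Sum>(x,K)\<in>p. measure lborel K *\<^sub>R g x - (F (Sup K) - F (Inf K)))"
        unfolding additive_tagged_division_1[OF ab p(1), of F, symmetric] sum_subtractf[symmetric]
        by (rule sum.cong) auto
      also have "norm \<dots> \<le> (\<Sum>(x,K)\<in>p. norm (measure lborel K *\<^sub>R g x - (F (Sup K) - F (Inf K))))"
        by (rule order_trans[OF norm_sum]) (simp add: case_prod_unfold)
      also have "\<dots> \<le> (\<Sum>(x,K)\<in>p. \<eta> * measure lborel K + (if x \<in> E then cmod (F (Sup K) - F (Inf K)) else 0))"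
        by (rule sum_mono) (use each in auto)
      also have "\<dots> = \<eta> * (\<Sum>(x,K)\<in>p. measure lborel K) + (\<Sum>(x,K)\<in>q. cmod (F (Sup K) - F (Inf K)))"
        unfolding q_def sum_distrib_left sum.inter_filter[OF fp]
        by (simp add: case_prod_unfold sum.distrib cong: if_cong)
      also have "(\<Sum>(x,K)\<in>p. measure lborel K) = b - a"
        using additive_content_tagged_division[of p a b] p(1) ab by simp
      also have "\<eta> * (b - a) \<le> e/2" using e ab by (simp add: \<eta>_def field_simps)
      finally show ?thesis using q by simp
    qed
    show "\<exists>\<gamma>. gauge \<gamma> \<and> (\<forall>\<D>. \<D> tagged_division_of {a..b} \<and> \<gamma> fine \<D> \<longrightarrow>
              norm ((\<Sum>(x, k)\<in>\<D>. measure lborel k *\<^sub>R g x) - (F b - F a)) < e)"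
      by (rule exI[of _ \<gamma>], rule conjI, rule gg, intro allI impI, erule conjE, rule fin)
  qed
  then show ?thesis
    by (rule has_integral_spike[OF E, rotated]) (simp add: g_def)
qed

lemma abs_continuous_on_imp_continuous_on:
  assumes "abs_continuous_on {a..b} F"
  shows "continuous_on {a..b} F"
  unfolding continuous_on_iff
proof (intro ballI allI impI)
  fix x e :: real assume x: "x \<in> {a..b}" and e: "e > 0"
  obtain \<delta> where \<delta>: "\<delta> > 0" and ac\<delta>: "\<And>\<D>. \<D> division_of (\<Union>\<D>) \<Longrightarrow> \<Union>\<D> \<subseteq> {a..b} \<Longrightarrow>
        (\<Sum>K\<in>\<D>. Sup K - Inf K) < \<delta> \<Longrightarrow> (\<Sum>K\<in>\<D>. cmod (F (Sup K) - F (Inf K))) < e"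
    using assms e unfolding abs_continuous_on_def by meson
  have "dist (F y) (F x) < e" if y: "y \<in> {a..b}" "dist y x < \<delta>" for y
  proof -
    have "{{min x y..max x y}} division_of \<Union>{{min x y..max x y}}"
      using division_of_self[of "min x y" "max x y"] by simp
    then have "cmod (F (max x y) - F (min x y)) < e"
      using ac\<delta>[of "{{min x y..max x y}}"] x y by (simp add: dist_real_def abs_if split: if_splits)
    then show ?thesis by (cases "x \<le> y") (auto simp: dist_norm norm_minus_commute max_def min_def)
  qed
  then show "\<exists>d>0. \<forall>y\<in>{a..b}. dist y x < d \<longrightarrow> dist (F y) (F x) < e" using \<delta> by blast
qed

lemma continuous_on_interval_bounded:
  fixes f :: "real \<Rightarrow> complex"
  assumes "continuous_on {a..b} f"
  obtains B where "B > 0" "\<And>x. x \<in> {a..b} \<Longrightarrow> cmod (f x) \<le> B"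
proof -
  have "bounded (f ` {a..b})"
    by (intro compact_imp_bounded compact_continuous_image assms) auto
  then show ?thesis using that unfolding bounded_pos by auto
qed

text \<open>Used for a primitive times a smooth test function in the integration by parts below.\<close>

lemma abs_continuous_on_mult_Lipschitz:
  assumes F: "abs_continuous_on {a..b} F"
    and lip: "\<And>x y. x \<in> {a..b} \<Longrightarrow> y \<in> {a..b} \<Longrightarrow> cmod (\<phi> x - \<phi> y) \<le> L * \<bar>x - y\<bar>"
  shows "abs_continuous_on {a..b} (\<lambda>x. F x * \<phi> x)"
  unfolding abs_continuous_on_def
proof (intro allI impI)
  fix e :: real assume e: "e > 0"
  obtain B where B: "B > 0" "\<And>x. x \<in> {a..b} \<Longrightarrow> cmod (F x) \<le> B"
    using continuous_on_interval_bounded[OF abs_continuous_on_imp_continuous_on[OF F]] by blast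
  have "continuous_on {a..b} \<phi>"
    by (rule lipschitz_on_continuous_on[of "max L 0"])
       (auto simp: lipschitz_on_def dist_norm intro!: order_trans[OF lip] mult_right_mono)
  then obtain B' where B': "B' > 0" "\<And>x. x \<in> {a..b} \<Longrightarrow> cmod (\<phi> x) \<le> B'"
    using continuous_on_interval_bounded by blast
  define M where "M = max L 1"
  have lip': "cmod (\<phi> x - \<phi> y) \<le> M * \<bar>x - y\<bar>" if "x \<in> {a..b}" "y \<in> {a..b}" for x y
    using lip[OF that] by (rule order_trans) (auto simp: M_def intro!: mult_right_mono)
  have M: "M > 0" by (simp add: M_def)
  obtain \<delta> where \<delta>: "\<delta> > 0" and ac\<delta>: "\<And>\<D>. \<D> division_of (\<Union>\<D>) \<Longrightarrow> \<Union>\<D> \<subseteq> {a..b} \<Longrightarrow>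
        (\<Sum>K\<in>\<D>. Sup K - Inf K) < \<delta> \<Longrightarrow> (\<Sum>K\<in>\<D>. cmod (F (Sup K) - F (Inf K))) < e / (2 * B')"
  proof -
    have "e / (2 * B') > 0" using e B' by simp
    then show ?thesis using F that unfolding abs_continuous_on_def by meson
  qed
  show "\<exists>\<delta>>0. \<forall>D. D division_of \<Union>D \<and> \<Union>D \<subseteq> {a..b} \<and> (\<Sum>K\<in>D. Sup K - Inf K) < \<delta> \<longrightarrow>
      (\<Sum>K\<in>D. cmod (F (Sup K) * \<phi> (Sup K) - F (Inf K) * \<phi> (Inf K))) < e"
  proof (intro exI[of _ "min \<delta> (e / (2 * (B * M)))"] conjI allI impI; (elim conjE)?)
    show "min \<delta> (e / (2 * (B * M))) > 0" using \<delta> e B M by auto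
    fix D assume D: "D division_of \<Union>D" "\<Union>D \<subseteq> {a..b}" and len: "(\<Sum>K\<in>D. Sup K - Inf K) < min \<delta> (e / (2 * (B * M)))"
    have K: "cmod (F (Sup K) * \<phi> (Sup K) - F (Inf K) * \<phi> (Inf K)) \<le>
        B' * cmod (F (Sup K) - F (Inf K)) + B * M * (Sup K - Inf K)" if KD: "K \<in> D" for K
    proof -
      obtain u w where "K = cbox u w" "K \<noteq> {}" using division_ofD(3,4)[OF D(1) KD] by metis
      then have uw: "K = {u..w}" "u \<le> w" by auto
      have sub: "{u..w} \<subseteq> {a..b}" using D KD uw by (metis Sup_upper order_trans)
      then have uab: "u \<in> {a..b}" "w \<in> {a..b}" using uw by auto
      have "F w * \<phi> w - F u * \<phi> u = (F w - F u) * \<phi> w + F u * (\<phi> w - \<phi> u)" by (simp add: algebra_simps)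
      also have "cmod \<dots> \<le> cmod (F w - F u) * B' + B * (M * \<bar>w - u\<bar>)"
        by (rule order_trans[OF norm_triangle_ineq])
           (use B B' uab lip'[OF uab(2,1)] M in \<open>auto simp: norm_mult intro!: add_mono mult_mono\<close>)
      finally show ?thesis using uw by (simp add: ac_simps)
    qed
    have "(\<Sum>K\<in>D. cmod (F (Sup K) * \<phi> (Sup K) - F (Inf K) * \<phi> (Inf K))) \<le>
        B' * (\<Sum>K\<in>D. cmod (F (Sup K) - F (Inf K))) + B * M * (\<Sum>K\<in>D. Sup K - Inf K)"
      unfolding sum_distrib_left sum.distrib[symmetric] by (rule sum_mono) (rule K)
    also have "\<dots> < B' * (e / (2 * B')) + B * M * (e / (2 * (B * M)))"
      using len B M B' by (intro add_strict_mono mult_strict_left_mono ac\<delta>[OF D]) auto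
    also have "\<dots> = e" using B B' M by (simp add: field_simps)
    finally show "(\<Sum>K\<in>D. cmod (F (Sup K) * \<phi> (Sup K) - F (Inf K) * \<phi> (Inf K))) < e" .
  qed
qed

text \<open>The product \<open>H \<phi>\<close> is absolutely continuous, and by Lebesgue's theorem its derivative is
\<open>h \<phi> + H \<phi>'\<close> almost everywhere.\<close>

theorem integration_by_parts_absolutely_integrable:
  fixes h H \<phi> \<phi>' :: "real \<Rightarrow> complex"
  assumes h: "h absolutely_integrable_on {a..b}" and ab: "a \<le> b"
    and H: "\<And>x. x \<in> {a..b} \<Longrightarrow> H x = c + integral {a..x} h"
    and \<phi>: "\<And>x. x \<in> {a..b} \<Longrightarrow> (\<phi> has_vector_derivative \<phi>' x) (at x within {a..b})"
    and c\<phi>': "continuous_on {a..b} \<phi>'"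
  shows "((\<lambda>x. h x * \<phi> x + H x * \<phi>' x) has_integral (H b * \<phi> b - H a * \<phi> a)) {a..b}"
proof -
  obtain L where L: "L > 0" "\<And>x. x \<in> {a..b} \<Longrightarrow> cmod (\<phi>' x) \<le> L"
    using continuous_on_interval_bounded[OF c\<phi>'] by blast
  have lip: "cmod (\<phi> x - \<phi> y) \<le> L * \<bar>x - y\<bar>" if "x \<in> {a..b}" "y \<in> {a..b}" for x y
  proof -
    have "norm (\<phi> x - \<phi> y) \<le> L * norm (x - y)"
      by (rule differentiable_bound[of "{a..b}" \<phi> "\<lambda>x h. h *\<^sub>R \<phi>' x"])
         (use \<phi> L that in \<open>auto simp: has_vector_derivative_def mult.commute[of L] intro!: onorm_le mult_left_mono\<close>)
    then show ?thesis by simp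
  qed
  have ac: "abs_continuous_on {a..b} (\<lambda>x. H x * \<phi> x)"
    by (rule abs_continuous_on_mult_Lipschitz[OF abs_continuous_on_indefinite_integral[OF h H] lip])
  obtain E where E: "negligible E"
    "\<And>x. x \<in> {a..b} - E \<Longrightarrow> ((\<lambda>x. integral {a..x} h) has_vector_derivative h x) (at x within {a..b})"
    using lebesgue_differentiation[of h a b] h set_lebesgue_integral_eq_integral(1) by blast
  show ?thesis
  proof (rule abs_continuous_on_has_integral_derivative[OF ac E(1) ab])
    fix x assume x: "x \<in> {a..b} - E"
    have "((\<lambda>x. c + integral {a..x} h) has_vector_derivative h x) (at x within {a..b})"
      using has_vector_derivative_add[OF has_vector_derivative_const[of c] E(2)[OF x]] by simp
    then have "(H has_vector_derivative h x) (at x within {a..b})"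
      by (rule has_vector_derivative_transform_within[of _ _ _ _ 1]) (use x H in auto)
    from has_vector_derivative_mult[OF this \<phi>[of x]]
    show "((\<lambda>x. H x * \<phi> x) has_vector_derivative h x * \<phi> x + H x * \<phi>' x) (at x within {a..b})"
      using x by (simp add: add.commute)
  qed
qed

section \<open>Initial value problems with integrable coefficients\<close>

lemma L1_integrable: "f \<in> L1 \<Longrightarrow> f integrable_on {0..pi}"
  unfolding L1_def using set_lebesgue_integral_eq_integral(1) by auto

lemma L1_cmod_integrable: "f \<in> L1 \<Longrightarrow> (\<lambda>x. cmod (f x)) integrable_on {0..pi}"
  unfolding L1_def mem_Collect_eq by (rule absolutely_integrable_on_def[THEN iffD1, THEN conjunct2])

lemma L1_add: "f \<in> L1 \<Longrightarrow> g \<in> L1 \<Longrightarrow> (\<lambda>x. f x + g x) \<in> L1"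
  by (simp add: L1_def set_integral_add)

lemma L1_diff: "f \<in> L1 \<Longrightarrow> g \<in> L1 \<Longrightarrow> (\<lambda>x. f x - g x) \<in> L1"
  by (simp add: L1_def set_integral_diff)

lemma L1_cmult: "f \<in> L1 \<Longrightarrow> (\<lambda>x. c * f x) \<in> L1"
  by (simp add: L1_def)

lemma L1_continuous: "continuous_on {0..pi} f \<Longrightarrow> f \<in> L1"
  by (simp add: L1_def absolutely_integrable_continuous_real)

lemma L1_mult_continuous:
  assumes q: "q \<in> L1" and y: "continuous_on {0..pi} y"
  shows "(\<lambda>x. q x * y x) \<in> L1"
proof -
  have "(\<lambda>x. y x * q x) absolutely_integrable_on {0..pi}"
  proof (rule absolutely_integrable_bounded_measurable_product[OF bilinear_times])
    show "y \<in> borel_measurable (lebesgue_on {0..pi})"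
      by (rule continuous_imp_measurable_on_sets_lebesgue[OF y]) auto
    show "bounded (y ` {0..pi})"
      by (intro compact_imp_bounded compact_continuous_image y) auto
  qed (use q in \<open>auto simp: L1_def\<close>)
  then show ?thesis by (simp add: L1_def mult.commute)
qed

lemma norm_L1_nonneg: "norm_L1 f \<ge> 0"
proof -
  have "0 \<le> integral {0..pi} (\<lambda>x. cmod (f x))"
    by (cases "(\<lambda>x. cmod (f x)) integrable_on {0..pi}")
       (auto intro!: Henstock_Kurzweil_Integration.integral_nonneg simp: not_integrable_integral)
  then show ?thesis by (simp add: norm_L1_def)
qed

lemma norm_L1_0 [simp]: "norm_L1 (\<lambda>_. 0) = 0" by (simp add: norm_L1_def)

lemma norm_L1_cmult: "norm_L1 (\<lambda>x. c * f x) = cmod c * norm_L1 f"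
  by (simp add: norm_L1_def norm_mult)

lemma norm_L1_mult_le:
  assumes q: "q \<in> L1" and y: "continuous_on {0..pi} y" "\<And>x. x \<in> {0..pi} \<Longrightarrow> cmod (y x) \<le> B"
  shows "norm_L1 (\<lambda>x. q x * y x) \<le> norm_L1 q * B"
proof -
  have "integral {0..pi} (\<lambda>x. cmod (q x * y x)) \<le> integral {0..pi} (\<lambda>x. cmod (q x) * B)"
    by (intro integral_le L1_cmod_integrable L1_mult_continuous q y integrable_on_mult_left)
       (simp add: norm_mult mult_left_mono y)
  then show ?thesis by (simp add: norm_L1_def divide_right_mono)
qed

lemma norm_L1_le_bound:
  assumes y: "continuous_on {0..pi} y" "\<And>x. x \<in> {0..pi} \<Longrightarrow> cmod (y x) \<le> B"
  shows "norm_L1 y \<le> B"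
proof -
  have "integral {0..pi} (\<lambda>x. cmod (y x)) \<le> integral {0..pi} (\<lambda>x. B)"
    by (intro integral_le L1_cmod_integrable L1_continuous y) auto
  then show ?thesis by (simp add: norm_L1_def field_simps)
qed

lemma cmod_integral_le_norm_L1:
  assumes f: "f \<in> L1" and x: "x \<in> {0..pi}"
  shows "cmod (integral {0..x} f) \<le> pi * norm_L1 f"
proof -
  have sub: "{0..x} \<subseteq> {0..pi}" using x by auto
  have "cmod (integral {0..x} f) \<le> integral {0..x} (\<lambda>t. cmod (f t))"
    by (rule integral_norm_bound_integral)
       (use integrable_subinterval_real[OF _ sub] L1_integrable[OF f] L1_cmod_integrable[OF f] in auto)
  also have "\<dots> \<le> integral {0..pi} (\<lambda>t. cmod (f t))"
    by (rule integral_subset_le) (use sub integrable_subinterval_real[OF _ sub] L1_cmod_integrable[OF f] in auto)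
  finally show ?thesis by (simp add: norm_L1_def)
qed

lemma continuous_indefinite_integral:
  "f \<in> L1 \<Longrightarrow> continuous_on {0..pi} (\<lambda>x. integral {0..x} f)"
  by (intro indefinite_integral_continuous_1 L1_integrable)

text \<open>The equation \<open>y'' = q y + f\<close> in integral form, with \<open>y1\<close> in the role of \<open>y'\<close>. This form is
meaningful for integrable \<open>q\<close> and \<open>f\<close>, and it never mentions a second derivative.\<close>

definition ode_sol :: "(real \<Rightarrow> complex) \<Rightarrow> (real \<Rightarrow> complex) \<Rightarrow> (real \<Rightarrow> complex) \<Rightarrow> (real \<Rightarrow> complex) \<Rightarrow> bool" where
  "ode_sol q f y y1 \<longleftrightarrow> continuous_on {0..pi} y1 \<and>
     (\<forall>x\<in>{0..pi}. y x = y 0 + integral {0..x} y1) \<and>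
     (\<forall>x\<in>{0..pi}. y1 x = y1 0 + integral {0..x} (\<lambda>t. q t * y t + f t))"

lemma ode_solD:
  assumes "ode_sol q f y y1" "x \<in> {0..pi}"
  shows "y x = y 0 + integral {0..x} y1" "y1 x = y1 0 + integral {0..x} (\<lambda>t. q t * y t + f t)"
  using assms unfolding ode_sol_def by blast+

lemma ode_sol_continuous:
  assumes "ode_sol q f y y1"
  shows "continuous_on {0..pi} y" "continuous_on {0..pi} y1"
proof -
  show c: "continuous_on {0..pi} y1" using assms by (simp add: ode_sol_def)
  have "continuous_on {0..pi} (\<lambda>x. y 0 + integral {0..x} y1)"
    by (intro continuous_intros continuous_indefinite_integral L1_continuous c)
  then show "continuous_on {0..pi} y"
    by (rule continuous_on_eq) (rule ode_solD(1)[OF assms, symmetric])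
qed

lemma ode_sol_has_derivative:
  assumes "ode_sol q f y y1" "x \<in> {0..pi}"
  shows "(y has_vector_derivative y1 x) (at x within {0..pi})"
proof -
  have "((\<lambda>x. integral {0..x} y1) has_vector_derivative y1 x) (at x within {0..pi})"
    using integral_has_vector_derivative[OF ode_sol_continuous(2)[OF assms(1)] assms(2)] .
  from has_vector_derivative_add[OF has_vector_derivative_const[of "y 0"] this]
  have "((\<lambda>x. y 0 + integral {0..x} y1) has_vector_derivative y1 x) (at x within {0..pi})" by simp
  then show ?thesis
    by (rule has_vector_derivative_transform_within[of _ _ _ _ 1])
       (use assms(2) ode_solD(1)[OF assms(1), symmetric] in auto)
qed

lemma ode_sol_add_cmult:
  assumes q: "q \<in> L1" and f: "f \<in> L1" and g: "g \<in> L1"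
    and y: "ode_sol q f y y1" and w: "ode_sol q g w w1"
  shows "ode_sol q (\<lambda>x. f x + c * g x) (\<lambda>x. y x + c * w x) (\<lambda>x. y1 x + c * w1 x)"
  unfolding ode_sol_def
proof (intro conjI ballI)
  note cy = ode_sol_continuous[OF y] and cw = ode_sol_continuous[OF w]
  show "continuous_on {0..pi} (\<lambda>x. y1 x + c * w1 x)" by (intro continuous_intros cy cw)
  fix x assume x: "x \<in> {0..pi}"
  have int: "u integrable_on {0..x}" if "u \<in> L1" for u
    by (rule integrable_subinterval_real[OF L1_integrable[OF that]]) (use x in auto)
  have "integral {0..x} (\<lambda>x. y1 x + c * w1 x) = integral {0..x} y1 + c * integral {0..x} w1"
    by (subst Henstock_Kurzweil_Integration.integral_add) (auto intro!: int L1_continuous integrable_on_mult_right cy cw)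
  then show "y x + c * w x = y 0 + c * w 0 + integral {0..x} (\<lambda>x. y1 x + c * w1 x)"
    using ode_solD(1)[OF y x] ode_solD(1)[OF w x] by (simp add: algebra_simps)
  have "integral {0..x} (\<lambda>t. q t * (y t + c * w t) + (f t + c * g t)) =
     integral {0..x} (\<lambda>t. (q t * y t + f t) + c * (q t * w t + g t))"
    by (rule integral_cong) (simp add: algebra_simps)
  also have "\<dots> = integral {0..x} (\<lambda>t. q t * y t + f t) + c * integral {0..x} (\<lambda>t. q t * w t + g t)"
    by (subst Henstock_Kurzweil_Integration.integral_add)
       (auto intro!: int L1_add L1_mult_continuous integrable_on_mult_right cy cw q f g)
  finally show "y1 x + c * w1 x = y1 0 + c * w1 0 + integral {0..x} (\<lambda>t. q t * (y t + c * w t) + (f t + c * g t))"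
    using ode_solD(2)[OF y x] ode_solD(2)[OF w x] by (simp add: algebra_simps)
qed

lemma integral_exp_le:
  fixes M x :: real
  assumes "M > 0" "0 \<le> x"
  shows "integral {0..x} (\<lambda>s. exp (M * s)) \<le> exp (M * x) / M"
proof -
  have "((\<lambda>s. exp (M * s)) has_integral (exp (M * x) / M - exp (M * 0) / M)) {0..x}"
    by (rule fundamental_theorem_of_calculus[where f="\<lambda>s. exp (M * s) / M"])
       (use assms in \<open>auto intro!: derivative_eq_intros simp: has_real_derivative_iff_has_vector_derivative[symmetric]\<close>)
  then show ?thesis using assms by (simp add: integral_unique)
qed

text \<open>In the norm \<open>sup |w t| exp (- M t)\<close> the twofold integration of \<open>q w\<close> has norm at most
\<open>\<pi> \<parallel>q\<parallel> / M\<close>, because the outer integration of \<open>exp (M s)\<close> gains a factor \<open>1/M\<close>. Large \<open>M\<close>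
therefore makes the Volterra operator a contraction on the whole interval at once.\<close>

lemma weighted_volterra_bound:
  assumes q: "q \<in> L1" and w: "continuous_on {0..pi} w"
    and M: "M > 0" and D: "D \<ge> 0" and wD: "\<And>t. t \<in> {0..pi} \<Longrightarrow> cmod (w t) \<le> D * exp (M * t)" and x: "x \<in> {0..pi}"
  shows "cmod (integral {0..x} (\<lambda>s. integral {0..s} (\<lambda>t. q t * w t))) \<le> pi * norm_L1 q * D / M * exp (M * x)"
proof -
  have qw: "(\<lambda>t. q t * w t) \<in> L1" by (rule L1_mult_continuous[OF q w])
  have 1: "cmod (integral {0..s} (\<lambda>t. q t * w t)) \<le> (pi * norm_L1 q * D) * exp (M * s)" if s: "s \<in> {0..pi}" for s
  proof -
    have sub: "{0..s} \<subseteq> {0..pi}" using s by auto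
    have nq: "(\<lambda>t. cmod (q t)) integrable_on {0..s}"
      using integrable_subinterval_real[OF L1_cmod_integrable[OF q] sub] .
    have "cmod (integral {0..s} (\<lambda>t. q t * w t)) \<le> integral {0..s} (\<lambda>t. cmod (q t) * (D * exp (M * s)))"
    proof (rule integral_norm_bound_integral)
      show "(\<lambda>t. q t * w t) integrable_on {0..s}" using integrable_subinterval_real[OF L1_integrable[OF qw] sub] .
      show "(\<lambda>t. cmod (q t) * (D * exp (M * s))) integrable_on {0..s}" by (rule integrable_on_mult_left[OF nq])
      fix t assume t: "t \<in> {0..s}"
      have "cmod (w t) \<le> D * exp (M * t)" using wD t s by auto
      also have "\<dots> \<le> D * exp (M * s)" using D M t by (intro mult_left_mono) auto
      finally show "norm (q t * w t) \<le> cmod (q t) * (D * exp (M * s))"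
        by (simp add: norm_mult mult_left_mono)
    qed
    also have "\<dots> = integral {0..s} (\<lambda>t. cmod (q t)) * (D * exp (M * s))" by simp
    also have "\<dots> \<le> integral {0..pi} (\<lambda>t. cmod (q t)) * (D * exp (M * s))"
      by (intro mult_right_mono integral_subset_le) (use sub nq L1_cmod_integrable[OF q] D in auto)
    finally show ?thesis by (simp add: norm_L1_def mult.assoc)
  qed
  have sub: "{0..x} \<subseteq> {0..pi}" using x by auto
  have "cmod (integral {0..x} (\<lambda>s. integral {0..s} (\<lambda>t. q t * w t))) \<le> integral {0..x} (\<lambda>s. (pi * norm_L1 q * D) * exp (M * s))"
  proof (rule integral_norm_bound_integral)
    show "(\<lambda>s. integral {0..s} (\<lambda>t. q t * w t)) integrable_on {0..x}"
      by (intro integrable_continuous_real continuous_on_subset[OF continuous_indefinite_integral[OF qw] sub])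
    show "(\<lambda>s. (pi * norm_L1 q * D) * exp (M * s)) integrable_on {0..x}"
      by (intro integrable_continuous_real continuous_intros)
    show "norm (integral {0..s} (\<lambda>t. q t * w t)) \<le> (pi * norm_L1 q * D) * exp (M * s)" if "s \<in> {0..x}" for s
      using 1 that sub by auto
  qed
  also have "\<dots> = (pi * norm_L1 q * D) * integral {0..x} (\<lambda>s. exp (M * s))" by simp
  also have "\<dots> \<le> (pi * norm_L1 q * D) * (exp (M * x) / M)"
    using integral_exp_le[OF M, of x] x D norm_L1_nonneg[of q] by (intro mult_left_mono) auto
  finally show ?thesis by (simp add: ac_simps)
qed

text \<open>At the point \<open>x0\<close> where \<open>|y t| exp (- M t)\<close> is largest, the Volterra term takes up at most half of
that maximum \<open>D\<close>, so the other half is bounded by the data.\<close>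

lemma ode_sol_bound:
  assumes q: "q \<in> L1"
  obtains K where "K \<ge> 0" "\<And>f y y1 x. f \<in> L1 \<Longrightarrow> ode_sol q f y y1 \<Longrightarrow> x \<in> {0..pi} \<Longrightarrow>
     cmod (y x) \<le> K * (cmod (y 0) + cmod (y1 0) + norm_L1 f) \<and>
     cmod (y1 x) \<le> K * (cmod (y 0) + cmod (y1 0) + norm_L1 f)"
proof -
  define M where "M = 2 * pi * norm_L1 q + 1"
  have M: "M > 0" "M \<ge> 2 * pi * norm_L1 q" using norm_L1_nonneg[of q] by (auto simp: M_def intro!: add_nonneg_pos)
  \<comment> \<open>For this \<open>M\<close> the Volterra term has weighted norm at most one half, and \<open>K0\<close> is what then remains.\<close>
  define K0 where "K0 = exp (M * pi) * (2 * (1 + pi + pi * pi))"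
  have K0: "K0 \<ge> 0" by (simp add: K0_def)
  define K where "K = K0 + (1 + pi * norm_L1 q * K0 + pi)"
  have main: "cmod (y x) \<le> K0 * (cmod (y 0) + cmod (y1 0) + norm_L1 f) \<and>
     cmod (y1 x) \<le> (1 + pi * norm_L1 q * K0 + pi) * (cmod (y 0) + cmod (y1 0) + norm_L1 f)"
    if f: "f \<in> L1" and y: "ode_sol q f y y1" and x: "x \<in> {0..pi}" for f y y1 x
  proof -
    note cy = ode_sol_continuous[OF y]
    define A where "A = cmod (y 0) + cmod (y1 0) + norm_L1 f"
    have A: "A \<ge> 0" "cmod (y 0) \<le> A" "cmod (y1 0) \<le> A" "norm_L1 f \<le> A" using norm_L1_nonneg[of f] by (auto simp: A_def)
    have "\<exists>x\<in>{0..pi}. \<forall>t\<in>{0..pi}. cmod (y t) * exp (- M * t) \<le> cmod (y x) * exp (- M * x)"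
      by (rule continuous_attains_sup) (auto intro!: continuous_intros cy)
    then obtain x0 where x0: "x0 \<in> {0..pi}" "\<And>t. t \<in> {0..pi} \<Longrightarrow> cmod (y t) * exp (- M * t) \<le> cmod (y x0) * exp (- M * x0)" by blast
    define D where "D = cmod (y x0) * exp (- M * x0)"
    have D: "D \<ge> 0" by (simp add: D_def)
    have yD: "cmod (y t) \<le> D * exp (M * t)" if "t \<in> {0..pi}" for t
      using x0(2)[OF that] by (simp add: D_def exp_minus field_simps)
    have qy: "(\<lambda>t. q t * y t) \<in> L1" by (rule L1_mult_continuous[OF q cy(1)])
    have int: "u integrable_on {0..s}" if "u \<in> L1" "s \<in> {0..pi}" for u s
      by (rule integrable_subinterval_real[OF L1_integrable[OF that(1)]]) (use that in auto)
    have y1: "y1 s = y1 0 + integral {0..s} f + integral {0..s} (\<lambda>t. q t * y t)" if "s \<in> {0..pi}" for s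
    proof -
      have "integral {0..s} (\<lambda>t. q t * y t + f t) = integral {0..s} (\<lambda>t. q t * y t) + integral {0..s} f"
        by (rule Henstock_Kurzweil_Integration.integral_add) (rule int[OF _ that], rule qy f)+
      then show ?thesis using ode_solD(2)[OF y that] by simp
    qed
    have "y x0 = y 0 + integral {0..x0} y1" by (rule ode_solD(1)[OF y x0(1)])
    also have "integral {0..x0} y1 = integral {0..x0} (\<lambda>s. (y1 0 + integral {0..s} f) + integral {0..s} (\<lambda>t. q t * y t))"
      by (rule integral_cong, rule y1) (use x0 in auto)
    also have "\<dots> = integral {0..x0} (\<lambda>s. y1 0 + integral {0..s} f) + integral {0..x0} (\<lambda>s. integral {0..s} (\<lambda>t. q t * y t))"
      by (rule Henstock_Kurzweil_Integration.integral_add)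
         (auto intro!: int x0 L1_continuous continuous_intros continuous_indefinite_integral f qy)
    finally have yx: "y x0 = y 0 + (integral {0..x0} (\<lambda>s. y1 0 + integral {0..s} f) + integral {0..x0} (\<lambda>s. integral {0..s} (\<lambda>t. q t * y t)))" .
    have "cmod (integral {0..x0} (\<lambda>s. y1 0 + integral {0..s} f)) \<le> pi * norm_L1 (\<lambda>s. y1 0 + integral {0..s} f)"
      by (intro cmod_integral_le_norm_L1 x0 L1_continuous continuous_intros continuous_indefinite_integral f)
    also have "norm_L1 (\<lambda>s. y1 0 + integral {0..s} f) \<le> cmod (y1 0) + pi * norm_L1 f"
      by (rule norm_L1_le_bound)
         (auto intro!: continuous_intros continuous_indefinite_integral f order_trans[OF norm_triangle_ineq] cmod_integral_le_norm_L1)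
    finally have b1: "cmod (integral {0..x0} (\<lambda>s. y1 0 + integral {0..s} f)) \<le> pi * (cmod (y1 0) + pi * norm_L1 f)" by simp
    have b2: "cmod (integral {0..x0} (\<lambda>s. integral {0..s} (\<lambda>t. q t * y t))) \<le> pi * norm_L1 q * D / M * exp (M * x0)"
      by (rule weighted_volterra_bound[OF q cy(1) M(1) D yD x0(1)])
    also have "\<dots> \<le> D / 2 * exp (M * x0)"
    proof (rule mult_right_mono)
      have "pi * norm_L1 q * D \<le> M / 2 * D" using M(2) D by (intro mult_right_mono) auto
      then show "pi * norm_L1 q * D / M \<le> D / 2" using M by (simp add: field_simps)
    qed simp
    finally have b2: "cmod (integral {0..x0} (\<lambda>s. integral {0..s} (\<lambda>t. q t * y t))) \<le> D / 2 * exp (M * x0)" .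
    have "cmod (y x0) \<le> cmod (y 0) + (pi * (cmod (y1 0) + pi * norm_L1 f) + D / 2 * exp (M * x0))"
      unfolding yx by (intro order_trans[OF norm_triangle_ineq] add_mono b1 b2 order_refl)
    also have "\<dots> \<le> A + pi * (A + pi * A) + D / 2 * exp (M * x0)"
      using A by (auto intro!: add_mono mult_left_mono)
    also have "A + pi * (A + pi * A) \<le> (A + pi * (A + pi * A)) * exp (M * x0)"
      using A x0 M mult_left_mono[of 1 "exp (M * x0)" "A + pi * (A + pi * A)"] by auto
    finally have "cmod (y x0) \<le> ((A + pi * (A + pi * A)) + D / 2) * exp (M * x0)" by (simp add: algebra_simps)
    moreover have "cmod (y x0) = D * exp (M * x0)" by (simp add: D_def exp_minus)
    ultimately have "D * exp (M * x0) \<le> ((A + pi * (A + pi * A)) + D / 2) * exp (M * x0)" by simp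
    then have "D \<le> (A + pi * (A + pi * A)) + D / 2" by (rule mult_right_le_imp_le) simp
    \<comment> \<open>Half of \<open>D\<close> moves to the left-hand side.\<close>
    then have D2: "D \<le> 2 * (1 + pi + pi * pi) * A" by (simp add: algebra_simps)
    have yb: "cmod (y t) \<le> K0 * A" if "t \<in> {0..pi}" for t
    proof -
      have "cmod (y t) \<le> D * exp (M * t)" using yD that by blast
      also have "\<dots> \<le> (2 * (1 + pi + pi * pi) * A) * exp (M * pi)"
        using D2 M that D A by (intro mult_mono) auto
      finally show ?thesis by (simp add: K0_def ac_simps)
    qed
    have "cmod (y1 x) \<le> cmod (y1 0) + cmod (integral {0..x} f) + cmod (integral {0..x} (\<lambda>t. q t * y t))"
      unfolding y1[OF x] by (intro order_trans[OF norm_triangle_ineq] add_mono norm_triangle_ineq) auto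
    also have "\<dots> \<le> A + pi * A + pi * (norm_L1 q * (K0 * A))"
    proof (intro add_mono)
      show "cmod (integral {0..x} f) \<le> pi * A"
        by (rule order_trans[OF cmod_integral_le_norm_L1[OF f x]]) (use A in auto)
      show "cmod (integral {0..x} (\<lambda>t. q t * y t)) \<le> pi * (norm_L1 q * (K0 * A))"
        by (rule order_trans[OF cmod_integral_le_norm_L1[OF qy x]]) (use norm_L1_mult_le[OF q cy(1) yb] in auto)
    qed (use A in auto)
    also have "\<dots> = (1 + pi * norm_L1 q * K0 + pi) * A" by (simp add: algebra_simps)
    finally show ?thesis using yb[OF x] by (simp add: A_def)
  qed
  show ?thesis
  proof (rule that[of K])
    show "K \<ge> 0" using K0 norm_L1_nonneg[of q] by (simp add: K_def)
    fix f y y1 x assume *: "f \<in> L1" "ode_sol q f y y1" "x \<in> {0..pi}"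
    have A: "cmod (y 0) + cmod (y1 0) + norm_L1 f \<ge> 0" using norm_L1_nonneg[of f] by simp
    have "K0 \<le> K" "1 + pi * norm_L1 q * K0 + pi \<le> K" using K0 norm_L1_nonneg[of q] by (auto simp: K_def)
    then show "cmod (y x) \<le> K * (cmod (y 0) + cmod (y1 0) + norm_L1 f) \<and>
     cmod (y1 x) \<le> K * (cmod (y 0) + cmod (y1 0) + norm_L1 f)"
      using main[OF *] A by (meson mult_right_mono order_trans)
  qed
qed

text \<open>Banach's fixed point theorem for the Volterra equation. The unknown is \<open>u t = exp (- M t) y t\<close>, so
that the weighted norm becomes the supremum norm; functions on the interval are extended to the line
by clamping the argument.\<close>

lemma ivp_exists:
  assumes q: "q \<in> L1" and g: "g \<in> L1"
  shows "\<exists>y y1. ode_sol q g y y1 \<and> y 0 = a \<and> y1 0 = b"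
proof -
  define M where "M = 2 * pi * norm_L1 q + 1"
  have M: "M > 0" "M \<ge> 2 * pi * norm_L1 q" using norm_L1_nonneg[of q] by (auto simp: M_def intro!: add_nonneg_pos)
  define E where "E u t = complex_of_real (exp (M * t)) * u t" for u :: "real \<Rightarrow> complex" and t
  define Y1 where "Y1 y x = b + integral {0..x} (\<lambda>t. q t * y t + g t)" for y :: "real \<Rightarrow> complex" and x
  define Y where "Y y x = a + integral {0..x} (Y1 y)" for y :: "real \<Rightarrow> complex" and x
  define P where "P u x = complex_of_real (exp (- M * x)) * Y (E u) x" for u x
  define \<Phi> where "\<Phi> u = Bcontfun (ext_cont (P (apply_bcontfun u)) 0 pi)" for u :: "real \<Rightarrow>\<^sub>C complex"
  have cE: "continuous_on {0..pi} (E (apply_bcontfun u))" for u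
    unfolding E_def by (intro continuous_intros continuous_on_subset[OF continuous_on_apply_bcontfun]) auto
  have cY1: "continuous_on {0..pi} (Y1 y)" if "continuous_on {0..pi} y" for y
    unfolding Y1_def by (intro continuous_intros continuous_indefinite_integral L1_add L1_mult_continuous q g that)
  have cY: "continuous_on {0..pi} (Y y)" if "continuous_on {0..pi} y" for y
    unfolding Y_def by (intro continuous_intros continuous_indefinite_integral L1_continuous cY1 that)
  have cP: "continuous_on (cbox 0 pi) (P (apply_bcontfun u))" for u
    unfolding P_def box_real by (intro continuous_intros cY cE)
  have \<Phi>: "apply_bcontfun (\<Phi> u) x = P (apply_bcontfun u) (clamp 0 pi x)" for u x
  proof -
    have "ext_cont (P (apply_bcontfun u)) 0 pi \<in> bcontfun"
      unfolding bcontfun_def mem_Collect_eq ext_cont_def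
      by (intro conjI clamp_continuous_on clamp_bounded compact_imp_bounded compact_continuous_image cP compact_cbox)
    then show ?thesis unfolding \<Phi>_def by (simp add: Bcontfun_inverse ext_cont_def)
  qed
  have "dist (\<Phi> u) (\<Phi> w) \<le> (1/2) * dist u w" for u w
  proof (rule dist_bound)
    fix x
    define s where "s = clamp 0 pi x"
    have s: "s \<in> {0..pi}" using clamp_in_interval[of 0 pi x] by (simp add: s_def)
    define d where "d t = E (apply_bcontfun u) t - E (apply_bcontfun w) t" for t
    have cd: "continuous_on {0..pi} d" unfolding d_def by (intro continuous_intros cE)
    have dD: "cmod (d t) \<le> dist u w * exp (M * t)" for t
    proof -
      have "cmod (d t) = exp (M * t) * dist (apply_bcontfun u t) (apply_bcontfun w t)"
        unfolding d_def E_def right_diff_distrib[symmetric] norm_mult by (simp add: dist_norm)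
      also have "\<dots> \<le> exp (M * t) * dist u w" by (intro mult_left_mono dist_bounded) auto
      finally show ?thesis by (simp add: mult.commute)
    qed
    have int: "f integrable_on {0..r}" if "f \<in> L1" "r \<in> {0..pi}" for f r
      by (rule integrable_subinterval_real[OF L1_integrable[OF that(1)]]) (use that in auto)
    have Y1d: "Y1 (E (apply_bcontfun u)) r - Y1 (E (apply_bcontfun w)) r = integral {0..r} (\<lambda>t. q t * d t)" if "r \<in> {0..pi}" for r
    proof -
      have "Y1 (E (apply_bcontfun u)) r - Y1 (E (apply_bcontfun w)) r =
          integral {0..r} (\<lambda>t. q t * E (apply_bcontfun u) t + g t) - integral {0..r} (\<lambda>t. q t * E (apply_bcontfun w) t + g t)"
        by (simp add: Y1_def)
      also have "\<dots> = integral {0..r} (\<lambda>t. (q t * E (apply_bcontfun u) t + g t) - (q t * E (apply_bcontfun w) t + g t))"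
        by (rule Henstock_Kurzweil_Integration.integral_diff[symmetric])
           (intro int L1_add L1_mult_continuous q g cE that)+
      finally show ?thesis by (simp add: d_def algebra_simps)
    qed
    have "Y (E (apply_bcontfun u)) s - Y (E (apply_bcontfun w)) s = integral {0..s} (\<lambda>r. Y1 (E (apply_bcontfun u)) r - Y1 (E (apply_bcontfun w)) r)"
      unfolding Y_def add_diff_cancel_left
      by (rule Henstock_Kurzweil_Integration.integral_diff[symmetric]) (intro int L1_continuous cY1 cE s)+
    also have "\<dots> = integral {0..s} (\<lambda>r. integral {0..r} (\<lambda>t. q t * d t))"
      by (rule integral_cong) (use s Y1d in auto)
    finally have Yd: "Y (E (apply_bcontfun u)) s - Y (E (apply_bcontfun w)) s = integral {0..s} (\<lambda>r. integral {0..r} (\<lambda>t. q t * d t))" .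
    have "dist (apply_bcontfun (\<Phi> u) x) (apply_bcontfun (\<Phi> w) x) = exp (- M * s) * cmod (integral {0..s} (\<lambda>r. integral {0..r} (\<lambda>t. q t * d t)))"
      unfolding \<Phi> s_def[symmetric] P_def dist_norm right_diff_distrib[symmetric] Yd norm_mult by simp
    also have "\<dots> \<le> exp (- M * s) * (pi * norm_L1 q * dist u w / M * exp (M * s))"
      by (intro mult_left_mono weighted_volterra_bound q cd M dD s) auto
    also have "\<dots> = pi * norm_L1 q * dist u w / M" by (simp add: exp_minus)
    also have "\<dots> \<le> (1/2) * dist u w"
    proof -
      have "pi * norm_L1 q * dist u w \<le> M / 2 * dist u w" using M(2) by (intro mult_right_mono) auto
      then show ?thesis using M by (simp add: field_simps)
    qed
    finally show "dist (apply_bcontfun (\<Phi> u) x) (apply_bcontfun (\<Phi> w) x) \<le> (1/2) * dist u w" .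
  qed
  then have "\<exists>!u\<in>UNIV. \<Phi> u = u"
    by (intro Banach_fix[of UNIV "1/2"]) (auto simp: complete_UNIV)
  then obtain u where u: "\<Phi> u = u" by blast
  define y where "y = E (apply_bcontfun u)"
  have yx: "y x = Y y x" if "x \<in> {0..pi}" for x
  proof -
    have "apply_bcontfun u x = complex_of_real (exp (- M * x)) * Y y x"
      using \<Phi>[of u x] u that by (simp add: P_def y_def clamp_cancel_cbox)
    then have "y x = complex_of_real (exp (M * x)) * (complex_of_real (exp (- M * x)) * Y y x)" by (simp add: y_def E_def)
    also have "\<dots> = Y y x" by (simp add: mult.assoc[symmetric] of_real_mult[symmetric] exp_add[symmetric] del: of_real_mult)
    finally show ?thesis .
  qed
  have "Y y 0 = a" "Y1 y 0 = b" by (auto simp: Y_def Y1_def)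
  then have "ode_sol q g y (Y1 y)"
    unfolding ode_sol_def using yx cY1[of y] cE[of u] by (auto simp: y_def[symmetric] Y_def Y1_def)
  moreover have "y 0 = a" using yx[of 0] by (simp add: Y_def)
  ultimately show ?thesis using \<open>Y1 y 0 = b\<close> by blast
qed

section \<open>Boundary value problems and the Hill operator\<close>

lemma AE_lebesgue_on_iff_negligible:
  "(AE x in lebesgue_on {0..pi}. P x) \<longleftrightarrow> negligible {x\<in>{0..pi}. \<not> P x}"
proof -
  have "(AE x in lebesgue_on {0..pi}. P x) \<longleftrightarrow> (AE x in lebesgue. x \<in> {0..pi} \<longrightarrow> P x)"
    by (rule AE_restrict_space_iff) auto
  also have "\<dots> \<longleftrightarrow> (\<exists>N\<in>null_sets lebesgue. {x\<in>{0..pi}. \<not> P x} \<subseteq> N)"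
    by (auto simp: eventually_ae_filter)
  also have "\<dots> \<longleftrightarrow> negligible {x\<in>{0..pi}. \<not> P x}"
    unfolding negligible_iff_null_sets[symmetric]
    by (meson negligible_iff_null_sets negligible_subset order_refl)
  finally show ?thesis .
qed

text \<open>Lebesgue measure is complete, so changing a function on a null set keeps it measurable.\<close>

lemma L2_AE_cong:
  assumes f: "f \<in> L2" and ae: "AE x in lebesgue_on {0..pi}. f x = g x"
  shows "g \<in> L2"
proof -
  define N where "N = {x\<in>{0..pi}. f x \<noteq> g x}"
  have "negligible N" using ae by (simp add: AE_lebesgue_on_iff_negligible N_def)
  then have N: "N \<in> null_sets (lebesgue_on {0..pi})"
    by (subst null_sets_restrict_space) (auto simp: negligible_iff_null_sets N_def)
  have "f \<in> borel_measurable (lebesgue_on ({0..pi} - N))"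
    using f borel_measurable_diff_null[OF N, of f] by (simp add: L2_def)
  then have "g \<in> borel_measurable (lebesgue_on ({0..pi} - N))"
    by (subst measurable_lebesgue_cong[of _ _ f]) (auto simp: N_def)
  then have g: "g \<in> borel_measurable (lebesgue_on {0..pi})"
    using borel_measurable_diff_null[OF N, of g] by simp
  have "integrable (lebesgue_on {0..pi}) (\<lambda>x. (cmod (f x))\<^sup>2)" using f by (simp add: L2_def)
  then have "integrable (lebesgue_on {0..pi}) (\<lambda>x. (cmod (g x))\<^sup>2)"
  proof (rule integrable_cong_AE_imp)
    show "(\<lambda>x. (cmod (g x))\<^sup>2) \<in> borel_measurable (lebesgue_on {0..pi})"
      using g by measurable
    show "AE x in lebesgue_on {0..pi}. (cmod (f x))\<^sup>2 = (cmod (g x))\<^sup>2"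
      using ae by eventually_elim simp
  qed
  then show ?thesis using g by (simp add: L2_def)
qed

lemma L2_continuous:
  assumes "continuous_on {0..pi} y" shows "y \<in> L2"
proof -
  have m: "y \<in> borel_measurable (lebesgue_on {0..pi})"
    by (rule continuous_imp_measurable_on_sets_lebesgue[OF assms]) auto
  have "(\<lambda>x. (cmod (y x))\<^sup>2) absolutely_integrable_on {0..pi}"
    by (intro absolutely_integrable_continuous_real continuous_intros assms)
  then have "integrable (lebesgue_on {0..pi}) (\<lambda>x. (cmod (y x))\<^sup>2)"
    by (rule absolutely_integrable_imp_integrable) auto
  then show ?thesis using m by (simp add: L2_def)
qed

lemma L2_diff:
  assumes f: "f \<in> L2" and g: "g \<in> L2" shows "(\<lambda>x. f x - g x) \<in> L2"
proof -
  have m: "(\<lambda>x. f x - g x) \<in> borel_measurable (lebesgue_on {0..pi})"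
    using f g by (auto simp: L2_def intro: borel_measurable_diff)
  have "integrable (lebesgue_on {0..pi}) (\<lambda>x. (cmod (f x - g x))\<^sup>2)"
  proof (rule Bochner_Integration.integrable_bound)
    show "integrable (lebesgue_on {0..pi}) (\<lambda>x. 2 * (cmod (f x))\<^sup>2 + 2 * (cmod (g x))\<^sup>2)"
      using f g by (auto simp: L2_def)
    show "(\<lambda>x. (cmod (f x - g x))\<^sup>2) \<in> borel_measurable (lebesgue_on {0..pi})"
      using m by measurable
    have "(cmod (f x - g x))\<^sup>2 \<le> 2 * (cmod (f x))\<^sup>2 + 2 * (cmod (g x))\<^sup>2" for x
    proof -
      have "(cmod (f x - g x))\<^sup>2 \<le> (cmod (f x) + cmod (g x))\<^sup>2"
        by (intro power_mono norm_triangle_ineq4) auto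
      also have "\<dots> \<le> 2 * (cmod (f x))\<^sup>2 + 2 * (cmod (g x))\<^sup>2"
        using sum_squares_bound[of "cmod (f x)" "cmod (g x)"] by (simp add: power2_sum)
      finally show ?thesis .
    qed
    then show "AE x in lebesgue_on {0..pi}. norm ((cmod (f x - g x))\<^sup>2) \<le> norm (2 * (cmod (f x))\<^sup>2 + 2 * (cmod (g x))\<^sup>2)"
      by auto
  qed
  then show ?thesis using m by (simp add: L2_def)
qed

lemma L2_subset_L1: "L2 \<subseteq> L1"
proof
  fix f assume f: "f \<in> L2"
  have "integrable (lebesgue_on {0..pi}) (norm \<circ> f)"
  proof (rule Bochner_Integration.integrable_bound)
    have "(\<lambda>x. 1::real) absolutely_integrable_on {0..pi}"
      by (rule absolutely_integrable_continuous_real) auto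
    then have "integrable (lebesgue_on {0..pi}) (\<lambda>x. 1::real)"
      by (rule absolutely_integrable_imp_integrable) auto
    then show "integrable (lebesgue_on {0..pi}) (\<lambda>x. 1 + (cmod (f x))\<^sup>2)"
      using f unfolding L2_def by (intro Bochner_Integration.integrable_add) auto
    show "norm \<circ> f \<in> borel_measurable (lebesgue_on {0..pi})" using f by (auto simp: L2_def)
    have "cmod (f x) \<le> 1 + (cmod (f x))\<^sup>2" for x
      using sum_squares_bound[of "cmod (f x)" 1] norm_ge_zero[of "f x"]
      unfolding power2_eq_square by linarith
    then show "AE x in lebesgue_on {0..pi}. norm ((norm \<circ> f) x) \<le> norm (1 + (cmod (f x))\<^sup>2)"
      by auto
  qed
  then show "f \<in> L1"
    using f by (simp add: L1_def L2_def absolutely_integrable_measurable)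
qed

text \<open>The boundary conditions as a pair of linear forms in the four boundary values
\<open>y 0\<close>, \<open>y \<pi>\<close>, \<open>y' 0\<close>, \<open>y' \<pi>\<close>; the conditions hold when both forms vanish.\<close>

fun bc_form :: "bcond \<Rightarrow> complex \<Rightarrow> complex \<Rightarrow> complex \<Rightarrow> complex \<Rightarrow> complex \<times> complex" where
  "bc_form Per_plus a b a' b' = (b - a, b' - a')"
| "bc_form Per_minus a b a' b' = (b + a, b' + a')"
| "bc_form Dir a b a' b' = (a, b)"

text \<open>The boundary value problem \<open>(z - L) y = f\<close> in the integral form of \<open>ode_sol\<close>. It defines the
resolvent for all integrable \<open>f\<close>, and so gives the extension from \<open>L\<^sup>2\<close> to \<open>L\<^sup>1\<close> without a limit.\<close>

definition bvp :: "bcond \<Rightarrow> (real \<Rightarrow> complex) \<Rightarrow> complex \<Rightarrow> (real \<Rightarrow> complex) \<Rightarrow> (real \<Rightarrow> complex) \<Rightarrow> bool" where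
  "bvp bc v z f y \<longleftrightarrow> (\<exists>y1. ode_sol (\<lambda>t. v t - z) f y y1 \<and> bc_form bc (y 0) (y pi) (y1 0) (y1 pi) = (0, 0))"

lemma satisfies_bc_iff:
  "satisfies_bc bc y \<longleftrightarrow> bc_form bc (y 0) (y pi) (deriv_on y 0) (deriv_on y pi) = (0, 0)"
  by (cases bc) (auto simp: add_eq_0_iff2)

text \<open>Since \<open>y'\<close> is absolutely continuous, it is the integral of its almost everywhere derivative, and
that derivative is determined by the differential equation.\<close>

lemma hill_dom_imp_bvp:
  assumes y: "y \<in> hill_dom bc v" and ae: "AE x in lebesgue_on {0..pi}. z * y x - hill_op v y x = f x"
  shows "bvp bc v z f y"
proof -
  define y1 where "y1 = deriv_on y"
  have dy: "(y has_vector_derivative y1 x) (at x within {0..pi})" if "x \<in> {0..pi}" for x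
    using y that unfolding hill_dom_def y1_def deriv_on_def by (auto simp: vector_derivative_works)
  have ac: "abs_continuous_on {0..pi} y1" using y by (simp add: hill_dom_def y1_def)
  define E where "E = {x\<in>{0..pi}. \<not> (y1 differentiable (at x within {0..pi}) \<and> z * y x - hill_op v y x = f x)}"
  have "AE x in lebesgue_on {0..pi}. y1 differentiable (at x within {0..pi})"
    using y by (simp add: hill_dom_def y1_def)
  with ae have "AE x in lebesgue_on {0..pi}. y1 differentiable (at x within {0..pi}) \<and> z * y x - hill_op v y x = f x"
    by eventually_elim simp
  then have E: "negligible E" unfolding AE_lebesgue_on_iff_negligible E_def .
  have dy1: "(y1 has_vector_derivative (v x - z) * y x + f x) (at x within {0..pi})" if "x \<in> {0..pi} - E" for x
  proof -
    have "y1 differentiable (at x within {0..pi})" and eq: "z * y x - hill_op v y x = f x"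
      using that by (auto simp: E_def)
    then have "(y1 has_vector_derivative deriv_on y1 x) (at x within {0..pi})"
      by (simp add: deriv_on_def vector_derivative_works)
    moreover have "deriv_on y1 x = (v x - z) * y x + f x"
      using eq[symmetric] by (simp add: hill_op_def y1_def algebra_simps)
    ultimately show ?thesis by simp
  qed
  have "ode_sol (\<lambda>t. v t - z) f y y1"
    unfolding ode_sol_def
  proof (intro conjI ballI)
    show "continuous_on {0..pi} y1" by (rule abs_continuous_on_imp_continuous_on[OF ac])
    fix x assume x: "x \<in> {0..pi}"
    have sub: "{0..x} \<subseteq> {0..pi}" and x0: "0 \<le> x" using x by auto
    have "(y1 has_integral (y x - y 0)) {0..x}"
      by (rule fundamental_theorem_of_calculus[OF x0]) (use sub in \<open>auto intro: has_vector_derivative_within_subset[OF dy sub]\<close>)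
    then show "y x = y 0 + integral {0..x} y1" by (simp add: integral_unique)
    have acx: "abs_continuous_on {0..x} y1"
      using ac sub unfolding abs_continuous_on_def by (meson order_trans)
    have "((\<lambda>x. (v x - z) * y x + f x) has_integral (y1 x - y1 0)) {0..x}"
      by (rule abs_continuous_on_has_integral_derivative[OF acx E x0])
         (rule has_vector_derivative_within_subset[OF dy1 sub], use sub in auto)
    then show "y1 x = y1 0 + integral {0..x} (\<lambda>t. (v t - z) * y t + f t)" by (simp add: integral_unique)
  qed
  then show ?thesis
    unfolding bvp_def using y by (intro exI[of _ y1]) (auto simp: hill_dom_def satisfies_bc_iff y1_def)
qed

lemma L1_const: "(\<lambda>_. c) \<in> L1"
  by (rule L1_continuous) auto

text \<open>The converse needs Lebesgue's differentiation theorem, since the domain of the operator asks for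
\<open>y''\<close> almost everywhere and \<open>y'\<close> is only known to be an indefinite integral.\<close>

lemma bvp_imp_hill_dom:
  assumes v: "v \<in> L1" and f: "f \<in> L2" and b: "bvp bc v z f y"
  shows "y \<in> hill_dom bc v" "AE x in lebesgue_on {0..pi}. z * y x - hill_op v y x = f x"
proof -
  obtain y1 where y1: "ode_sol (\<lambda>t. v t - z) f y y1" and bc: "bc_form bc (y 0) (y pi) (y1 0) (y1 pi) = (0, 0)"
    using b by (auto simp: bvp_def)
  note cy = ode_sol_continuous[OF y1]
  define h where "h t = (v t - z) * y t + f t" for t
  have h: "h \<in> L1" unfolding h_def using f L2_subset_L1
    by (intro L1_add L1_mult_continuous L1_diff v cy L1_const) auto
  have dy: "(y has_vector_derivative y1 x) (at x within {0..pi})" if "x \<in> {0..pi}" for x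
    by (rule ode_sol_has_derivative[OF y1 that])
  have der: "deriv_on y x = y1 x" if "x \<in> {0..pi}" for x
    unfolding deriv_on_def using vector_derivative_within_cbox[of 0 pi x y "y1 x"] dy[OF that] that by auto
  have ac: "abs_continuous_on {0..pi} y"
    by (rule abs_continuous_on_indefinite_integral[where f=y1 and c="y 0"])
       (use L1_continuous[OF cy(2)] in \<open>simp add: L1_def\<close>, rule ode_solD(1)[OF y1])
  have eq: "deriv_on y x = y1 0 + integral {0..x} h" if "x \<in> {0..pi}" for x
    using der[OF that] ode_solD(2)[OF y1 that] by (simp add: h_def[abs_def])
  have ac1: "abs_continuous_on {0..pi} (deriv_on y)"
    by (rule abs_continuous_on_indefinite_integral[where f=h and c="y1 0"]) (use h eq in \<open>auto simp: L1_def\<close>)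
  obtain E where E: "negligible E"
    "\<And>x. x \<in> {0..pi} - E \<Longrightarrow> ((\<lambda>x. integral {0..x} h) has_vector_derivative h x) (at x within {0..pi})"
    using lebesgue_differentiation[OF L1_integrable[OF h]] by blast
  have d2: "(deriv_on y has_vector_derivative h x) (at x within {0..pi})" if x: "x \<in> {0..pi} - E" for x
  proof -
    have "((\<lambda>x. y1 0 + integral {0..x} h) has_vector_derivative h x) (at x within {0..pi})"
      using has_vector_derivative_add[OF has_vector_derivative_const[of "y1 0"] E(2)[OF x]] by simp
    then show ?thesis
      by (rule has_vector_derivative_transform_within[of _ _ _ _ 1]) (use x eq[symmetric] in auto)
  qed
  have op: "hill_op v y x = z * y x - f x" if x: "x \<in> {0..pi} - E" for x
  proof -
    have "deriv_on (deriv_on y) x = h x"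
      unfolding deriv_on_def[of "deriv_on y"]
      using vector_derivative_within_cbox[of 0 pi x "deriv_on y" "h x"] d2[OF x] x by auto
    then show ?thesis by (simp add: hill_op_def h_def algebra_simps)
  qed
  have aeE: "AE x in lebesgue_on {0..pi}. x \<in> {0..pi} - E"
    unfolding AE_lebesgue_on_iff_negligible by (rule negligible_subset[OF E(1)]) auto
  have "AE x in lebesgue_on {0..pi}. deriv_on y differentiable (at x within {0..pi})"
    using aeE by eventually_elim (use d2 in \<open>auto intro: differentiableI_vector\<close>)
  moreover have "hill_op v y \<in> L2"
  proof (rule L2_AE_cong)
    show "(\<lambda>x. z * y x - f x) \<in> L2"
      by (intro L2_diff f L2_continuous continuous_intros cy)
    show "AE x in lebesgue_on {0..pi}. z * y x - f x = hill_op v y x"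
      using aeE by eventually_elim (use op in auto)
  qed
  moreover have "y differentiable (at x within {0..pi})" if "x \<in> {0..pi}" for x
    using dy[OF that] by (rule differentiableI_vector)
  moreover have "satisfies_bc bc y" using bc by (simp add: satisfies_bc_iff der)
  ultimately show "y \<in> hill_dom bc v" using ac ac1 by (simp add: hill_dom_def)
  show "AE x in lebesgue_on {0..pi}. z * y x - hill_op v y x = f x"
    using aeE by eventually_elim (use op in auto)
qed

lemma is_eigenvalue_iff_bvp:
  assumes v: "v \<in> L1"
  shows "is_eigenvalue bc v z \<longleftrightarrow> (\<exists>y. bvp bc v z (\<lambda>_. 0) y \<and> (\<exists>x\<in>{0..pi}. y x \<noteq> 0))"
proof
  assume "is_eigenvalue bc v z"
  then obtain y where y: "y \<in> hill_dom bc v" "\<exists>x\<in>{0..pi}. y x \<noteq> 0" "AE x in lebesgue_on {0..pi}. hill_op v y x = z * y x"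
    by (auto simp: is_eigenvalue_def)
  have "AE x in lebesgue_on {0..pi}. z * y x - hill_op v y x = 0" using y(3) by eventually_elim simp
  from hill_dom_imp_bvp[OF y(1) this] y(2) show "\<exists>y. bvp bc v z (\<lambda>_. 0) y \<and> (\<exists>x\<in>{0..pi}. y x \<noteq> 0)" by blast
next
  assume "\<exists>y. bvp bc v z (\<lambda>_. 0) y \<and> (\<exists>x\<in>{0..pi}. y x \<noteq> 0)"
  then obtain y where y: "bvp bc v z (\<lambda>_. 0) y" "\<exists>x\<in>{0..pi}. y x \<noteq> 0" by blast
  have 0: "(\<lambda>_. 0) \<in> L2" by (rule L2_continuous) auto
  note h = bvp_imp_hill_dom[OF v 0 y(1)]
  have "AE x in lebesgue_on {0..pi}. hill_op v y x = z * y x" using h(2) by eventually_elim simp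
  then show "is_eigenvalue bc v z" unfolding is_eigenvalue_def using h(1) y(2) by blast
qed

lemma bvp_continuous: "bvp bc v z f y \<Longrightarrow> continuous_on {0..pi} y"
  unfolding bvp_def using ode_sol_continuous(1) by blast

lemma bvp_cong:
  assumes "bvp bc v z f y" "\<And>x. x \<in> {0..pi} \<Longrightarrow> y x = w x"
  shows "bvp bc v z f w"
proof -
  obtain y1 where y1: "ode_sol (\<lambda>t. v t - z) f y y1" and bc: "bc_form bc (y 0) (y pi) (y1 0) (y1 pi) = (0, 0)"
    using assms(1) by (auto simp: bvp_def)
  have "integral {0..x} (\<lambda>t. (v t - z) * y t + f t) = integral {0..x} (\<lambda>t. (v t - z) * w t + f t)" if "x \<in> {0..pi}" for x
    by (rule integral_cong) (use that assms(2) in auto)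
  note int = this
  have "ode_sol (\<lambda>t. v t - z) f w y1"
    unfolding ode_sol_def
  proof (intro conjI ballI)
    fix x assume x: "x \<in> {0..pi}"
    show "w x = w 0 + integral {0..x} y1" using ode_solD(1)[OF y1 x] assms(2)[OF x] assms(2)[of 0] by simp
    show "y1 x = y1 0 + integral {0..x} (\<lambda>t. (v t - z) * w t + f t)" using ode_solD(2)[OF y1 x] int[OF x] by simp
  qed (rule ode_sol_continuous[OF y1])
  then show ?thesis unfolding bvp_def using bc assms(2)[of 0] assms(2)[of pi] by auto
qed

text \<open>A change of the potential and of the spectral parameter can be moved to the right-hand side. Both
the resolvent identity and the perturbation identity are instances.\<close>

lemma bvp_shift:
  assumes "bvp bc v z f y"
  shows "bvp bc w z' (\<lambda>x. f x + (v x - z - w x + z') * y x) y"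
proof -
  have "(\<lambda>t. (v t - z) * y t + f t) = (\<lambda>t. (w t - z') * y t + (f t + (v t - z - w t + z') * y t))"
    by (auto simp: algebra_simps)
  then have "ode_sol (\<lambda>t. w t - z') (\<lambda>x. f x + (v x - z - w x + z') * y x) y y1 \<longleftrightarrow> ode_sol (\<lambda>t. v t - z) f y y1" for y1
    unfolding ode_sol_def by simp
  then show ?thesis using assms unfolding bvp_def by auto
qed

lemma bc_form_add_cmult:
  "bc_form bc (a + c * p) (b + c * q) (a' + c * p') (b' + c * q') =
     (fst (bc_form bc a b a' b') + c * fst (bc_form bc p q p' q'), snd (bc_form bc a b a' b') + c * snd (bc_form bc p q p' q'))"
  by (cases bc) (auto simp: algebra_simps)

lemma bvp_add_cmult:
  assumes v: "v \<in> L1" and f: "f \<in> L1" and g: "g \<in> L1"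
    and y: "bvp bc v z f y" and w: "bvp bc v z g w"
  shows "bvp bc v z (\<lambda>x. f x + c * g x) (\<lambda>x. y x + c * w x)"
proof -
  obtain y1 where y1: "ode_sol (\<lambda>t. v t - z) f y y1" "bc_form bc (y 0) (y pi) (y1 0) (y1 pi) = (0, 0)"
    using y by (auto simp: bvp_def)
  obtain w1 where w1: "ode_sol (\<lambda>t. v t - z) g w w1" "bc_form bc (w 0) (w pi) (w1 0) (w1 pi) = (0, 0)"
    using w by (auto simp: bvp_def)
  have "(\<lambda>t. v t - z) \<in> L1" by (intro L1_diff v L1_const)
  from ode_sol_add_cmult[OF this f g y1(1) w1(1), of c] show ?thesis
    unfolding bvp_def by (intro exI[of _ "\<lambda>x. y1 x + c * w1 x"]) (simp add: bc_form_add_cmult y1 w1)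
qed

lemma bvp_unique:
  assumes v: "v \<in> L1" and f: "f \<in> L1" and ne: "\<not> is_eigenvalue bc v z"
    and y: "bvp bc v z f y" and w: "bvp bc v z f w" and x: "x \<in> {0..pi}"
  shows "y x = w x"
proof -
  have "bvp bc v z (\<lambda>x. f x + (-1) * f x) (\<lambda>x. y x + (-1) * w x)"
    by (rule bvp_add_cmult[OF v f f y w])
  then have "bvp bc v z (\<lambda>_. 0) (\<lambda>x. y x - w x)" by simp
  then show ?thesis using ne x unfolding is_eigenvalue_iff_bvp[OF v] by auto
qed

lemma cmod_bc_form_le:
  assumes "cmod a \<le> B" "cmod b \<le> B" "cmod a' \<le> B" "cmod b' \<le> B"
  shows "cmod (fst (bc_form bc a b a' b')) \<le> 2 * B" "cmod (snd (bc_form bc a b a' b')) \<le> 2 * B"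
proof -
  have "0 \<le> B" using assms(1) norm_ge_zero order_trans by blast
  then show "cmod (fst (bc_form bc a b a' b')) \<le> 2 * B" "cmod (snd (bc_form bc a b a' b')) \<le> 2 * B"
    using assms norm_triangle_ineq[of b a] norm_triangle_ineq4[of b a] norm_triangle_ineq[of b' a'] norm_triangle_ineq4[of b' a']
    by (cases bc; simp)+
qed

text \<open>The Fredholm alternative by linear algebra. Every solution is a particular one plus a combination of
two fundamental solutions \<open>u\<close> and \<open>w\<close>, and the boundary conditions are two linear equations for the
coefficients. A vanishing determinant would give a nonzero solution of the homogeneous problem, hence
an eigenfunction; otherwise Cramer's rule gives the solution and its bound.\<close>

theorem bvp_solvable:
  assumes v: "v \<in> L1" and ne: "\<not> is_eigenvalue bc v z"
  obtains K where "K \<ge> 0" "\<And>f. f \<in> L1 \<Longrightarrow> \<exists>y. bvp bc v z f y \<and> (\<forall>x\<in>{0..pi}. cmod (y x) \<le> K * norm_L1 f)"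
proof -
  define q where "q t = v t - z" for t
  have q: "q \<in> L1" unfolding q_def by (intro L1_diff v L1_const)
  have 0: "(\<lambda>_. 0) \<in> L1" by (rule L1_const)
  obtain u u1 where u: "ode_sol q (\<lambda>_. 0) u u1" "u 0 = 1" "u1 0 = 0" using ivp_exists[OF q 0] by blast
  obtain w w1 where w: "ode_sol q (\<lambda>_. 0) w w1" "w 0 = 0" "w1 0 = 1" using ivp_exists[OF q 0] by blast
  obtain K where K: "K \<ge> 0" "\<And>f y y1 x. f \<in> L1 \<Longrightarrow> ode_sol q f y y1 \<Longrightarrow> x \<in> {0..pi} \<Longrightarrow>
     cmod (y x) \<le> K * (cmod (y 0) + cmod (y1 0) + norm_L1 f) \<and>
     cmod (y1 x) \<le> K * (cmod (y 0) + cmod (y1 0) + norm_L1 f)"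
    using ode_sol_bound[OF q] by blast
  define bu where "bu = bc_form bc (u 0) (u pi) (u1 0) (u1 pi)"
  define bw where "bw = bc_form bc (w 0) (w pi) (w1 0) (w1 pi)"
  define d where "d = fst bu * snd bw - fst bw * snd bu"
  have comb: "ode_sol q (\<lambda>x. f x) (\<lambda>x. (p x + \<alpha> * u x) + \<beta> * w x) (\<lambda>x. (p1 x + \<alpha> * u1 x) + \<beta> * w1 x)"
    if f: "f \<in> L1" and p: "ode_sol q f p p1" for f p p1 \<alpha> \<beta>
  proof -
    have 1: "ode_sol q (\<lambda>x. f x) (\<lambda>x. p x + \<alpha> * u x) (\<lambda>x. p1 x + \<alpha> * u1 x)"
      using ode_sol_add_cmult[OF q f 0 p u(1), of \<alpha>] by simp
    show ?thesis using ode_sol_add_cmult[OF q _ 0 1 w(1), of \<beta>] f by simp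
  qed
  have "d \<noteq> 0"
  proof
    assume d0: "d = 0"
    have "\<exists>\<alpha> \<beta>. (\<alpha> \<noteq> 0 \<or> \<beta> \<noteq> 0) \<and> \<alpha> * fst bu + \<beta> * fst bw = 0 \<and> \<alpha> * snd bu + \<beta> * snd bw = 0"
    proof (cases "fst bw = 0 \<and> fst bu = 0")
      case False
      then show ?thesis using d0 by (intro exI[of _ "fst bw"] exI[of _ "- fst bu"]) (auto simp: d_def)
    next
      case True
      show ?thesis
      proof (cases "snd bw = 0 \<and> snd bu = 0")
        case False
        then show ?thesis using True by (intro exI[of _ "snd bw"] exI[of _ "- snd bu"]) (auto simp: )
      next
        case True': True
        then show ?thesis using True by (intro exI[of _ 1] exI[of _ 0]) auto
      qed
    qed
    then obtain \<alpha> \<beta> where ab: "\<alpha> \<noteq> 0 \<or> \<beta> \<noteq> 0" "\<alpha> * fst bu + \<beta> * fst bw = 0" "\<alpha> * snd bu + \<beta> * snd bw = 0" by blast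
    define y where "y x = \<alpha> * u x + \<beta> * w x" for x
    define y1 where "y1 x = \<alpha> * u1 x + \<beta> * w1 x" for x
    have "ode_sol q (\<lambda>_. 0) (\<lambda>_. 0) (\<lambda>_. 0)" by (simp add: ode_sol_def)
    from comb[OF 0 this, of \<alpha> \<beta>] have sol: "ode_sol q (\<lambda>_. 0) y y1" by (simp add: y_def[abs_def] y1_def[abs_def])
    have "bc_form bc (y 0) (y pi) (y1 0) (y1 pi) = bc_form bc (0 + \<alpha> * u 0 + \<beta> * w 0) (0 + \<alpha> * u pi + \<beta> * w pi) (0 + \<alpha> * u1 0 + \<beta> * w1 0) (0 + \<alpha> * u1 pi + \<beta> * w1 pi)"
      by (simp add: y_def y1_def)
    also have "\<dots> = (0, 0)" unfolding bc_form_add_cmult bu_def[symmetric] bw_def[symmetric] using ab by (cases bc) auto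
    finally have "bvp bc v z (\<lambda>_. 0) y" using sol unfolding bvp_def q_def by blast
    then have y0: "y x = 0" if "x \<in> {0..pi}" for x using ne that unfolding is_eigenvalue_iff_bvp[OF v] by blast
    have "(y has_vector_derivative y1 0) (at 0 within {0..pi})" by (rule ode_sol_has_derivative[OF sol]) auto
    moreover have "(y has_vector_derivative 0) (at 0 within {0..pi})"
      by (rule has_vector_derivative_transform_within[of "\<lambda>_. 0" _ _ _ 1]) (use y0 in auto)
    ultimately have "y1 0 = 0"
      using vector_derivative_within_cbox[of 0 pi 0 y "y1 0"] vector_derivative_within_cbox[of 0 pi 0 y 0] by auto
    moreover have "y 0 = 0" using y0[of 0] by simp
    ultimately show False using ab(1) u w by (simp add: y_def y1_def)
  qed
  define c where "c = (2 * K * cmod (snd bw) + 2 * K * cmod (fst bw)) / cmod d + (2 * K * cmod (fst bu) + 2 * K * cmod (snd bu)) / cmod d + 1"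
  have c: "c \<ge> 0" using K(1) by (auto simp: c_def)
  show ?thesis
  proof (rule that[of "K * c"])
    show "K * c \<ge> 0" using K c by simp
    fix f assume f: "f \<in> L1"
    obtain p p1 where p: "ode_sol q f p p1" "p 0 = 0" "p1 0 = 0" using ivp_exists[OF q f] by blast
    define bp where "bp = bc_form bc (p 0) (p pi) (p1 0) (p1 pi)"
    have pb: "cmod (p x) \<le> K * norm_L1 f" "cmod (p1 x) \<le> K * norm_L1 f" if "x \<in> {0..pi}" for x
      using K(2)[OF f p(1) that] p by auto
    have bp: "cmod (fst bp) \<le> 2 * (K * norm_L1 f)" "cmod (snd bp) \<le> 2 * (K * norm_L1 f)"
      unfolding bp_def by (intro cmod_bc_form_le pb; simp)+
    \<comment> \<open>Cramer's rule for the coefficients of \<open>u\<close> and \<open>w\<close>.\<close>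
    define \<alpha> where "\<alpha> = (- fst bp * snd bw + snd bp * fst bw) / d"
    define \<beta> where "\<beta> = (- fst bu * snd bp + snd bu * fst bp) / d"
    define y where "y x = (p x + \<alpha> * u x) + \<beta> * w x" for x
    define y1 where "y1 x = (p1 x + \<alpha> * u1 x) + \<beta> * w1 x" for x
    have sol: "ode_sol q f y y1" using comb[OF f p(1)] by (simp add: y_def[abs_def] y1_def[abs_def])
    have "fst bp + \<alpha> * fst bu + \<beta> * fst bw = 0" "snd bp + \<alpha> * snd bu + \<beta> * snd bw = 0"
      using \<open>d \<noteq> 0\<close> unfolding \<alpha>_def \<beta>_def d_def by (simp_all add: field_simps)
    then have "bc_form bc (y 0) (y pi) (y1 0) (y1 pi) = (0, 0)"
      unfolding y_def y1_def bc_form_add_cmult bp_def[symmetric] bu_def[symmetric] bw_def[symmetric] by simp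
    then have b: "bvp bc v z f y" using sol unfolding bvp_def q_def by blast
    have "cmod (- fst bp * snd bw + snd bp * fst bw) \<le> 2 * (K * norm_L1 f) * cmod (snd bw) + 2 * (K * norm_L1 f) * cmod (fst bw)"
      by (rule order_trans[OF norm_triangle_ineq]) (auto simp: norm_mult intro!: add_mono mult_right_mono bp)
    then have a: "cmod \<alpha> \<le> (2 * K * cmod (snd bw) + 2 * K * cmod (fst bw)) / cmod d * norm_L1 f"
      unfolding \<alpha>_def norm_divide using \<open>d \<noteq> 0\<close> by (simp add: field_simps)
    have "cmod (- fst bu * snd bp + snd bu * fst bp) \<le> cmod (fst bu) * (2 * (K * norm_L1 f)) + cmod (snd bu) * (2 * (K * norm_L1 f))"
      by (rule order_trans[OF norm_triangle_ineq]) (auto simp: norm_mult intro!: add_mono mult_left_mono bp)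
    then have b': "cmod \<beta> \<le> (2 * K * cmod (fst bu) + 2 * K * cmod (snd bu)) / cmod d * norm_L1 f"
      unfolding \<beta>_def norm_divide using \<open>d \<noteq> 0\<close> by (simp add: field_simps)
    have "cmod (y x) \<le> K * c * norm_L1 f" if x: "x \<in> {0..pi}" for x
    proof -
      have "y 0 = \<alpha>" "y1 0 = \<beta>" using p u w by (auto simp: y_def y1_def)
      then have "cmod (y x) \<le> K * (cmod \<alpha> + cmod \<beta> + norm_L1 f)" using K(2)[OF f sol x] by simp
      also have "\<dots> \<le> K * (c * norm_L1 f)"
        using K(1) a b' by (intro mult_left_mono) (auto simp: c_def algebra_simps)
      finally show ?thesis by simp
    qed
    then show "\<exists>y. bvp bc v z f y \<and> (\<forall>x\<in>{0..pi}. cmod (y x) \<le> K * c * norm_L1 f)" using b by blast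
  qed
qed

section \<open>Uniqueness of trigonometric coefficients\<close>

text \<open>By the Weierstrass theorem \<open>h x\<close>, as a function of \<open>cos x\<close>, is a uniform limit of polynomials, all
orthogonal to \<open>h\<close>; so \<open>h\<close> is orthogonal to itself.\<close>

lemma real_cos_moments_zero:
  fixes h :: "real \<Rightarrow> real"
  assumes h: "continuous_on {0..pi} h" and m: "\<And>m. integral {0..pi} (\<lambda>x. h x * cos x ^ m) = 0"
    and x: "x \<in> {0..pi}"
  shows "h x = 0"
proof -
  define B where "B = integral {0..pi} (\<lambda>x. \<bar>h x\<bar>)"
  have cg: "continuous_on {-1..1} (\<lambda>s. h (arccos s))"
    by (rule continuous_on_compose2[OF h continuous_on_arccos']) (auto intro: arccos_lbound arccos_ubound)
  have bound: "integral {0..pi} (\<lambda>x. h x ^ 2) \<le> e * B" if e: "e > 0" for e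
  proof -
    obtain p where p: "real_polynomial_function p" "\<And>s. s \<in> {-1..1} \<Longrightarrow> \<bar>h (arccos s) - p s\<bar> < e"
      using Stone_Weierstrass_real_polynomial_function[OF compact_Icc cg e] by auto
    obtain a n where a: "p = (\<lambda>x. \<Sum>i\<le>n. a i * x ^ i)" using p(1) unfolding real_polynomial_function_iff_sum by blast
    have int: "u integrable_on {0..pi}" if "continuous_on {0..pi} u" for u :: "real \<Rightarrow> real"
      using integrable_continuous_real[OF that] .
    have "integral {0..pi} (\<lambda>x. h x * p (cos x)) = integral {0..pi} (\<lambda>x. \<Sum>i\<le>n. a i * (h x * cos x ^ i))"
      unfolding a by (rule integral_cong) (simp add: sum_distrib_left ac_simps)
    also have "\<dots> = (\<Sum>i\<le>n. integral {0..pi} (\<lambda>x. a i * (h x * cos x ^ i)))"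
      by (rule integral_sum) (auto intro!: int continuous_intros h)
    also have "\<dots> = 0" by (simp add: m)
    finally have z: "integral {0..pi} (\<lambda>x. h x * p (cos x)) = 0" .
    have pc: "continuous_on {0..pi} (\<lambda>x. p (cos x))" unfolding a by (intro continuous_intros)
    have "integral {0..pi} (\<lambda>x. h x ^ 2) = integral {0..pi} (\<lambda>x. h x ^ 2) - integral {0..pi} (\<lambda>x. h x * p (cos x))"
      by (simp add: z)
    also have "\<dots> = integral {0..pi} (\<lambda>x. h x ^ 2 - h x * p (cos x))"
      by (rule Henstock_Kurzweil_Integration.integral_diff[symmetric]) (intro int continuous_intros h pc)+
    also have "\<dots> \<le> integral {0..pi} (\<lambda>x. e * \<bar>h x\<bar>)"
    proof (rule integral_le)
      show "(\<lambda>x. h x ^ 2 - h x * p (cos x)) integrable_on {0..pi}" by (intro int continuous_intros h pc)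
      show "(\<lambda>x. e * \<bar>h x\<bar>) integrable_on {0..pi}" by (intro int continuous_intros h)
      fix x assume x: "x \<in> {0..pi}"
      have "\<bar>h (arccos (cos x)) - p (cos x)\<bar> < e" by (rule p(2)) auto
      then have "\<bar>h x - p (cos x)\<bar> \<le> e" using x by (simp add: arccos_cos)
      then have "\<bar>h x\<bar> * \<bar>h x - p (cos x)\<bar> \<le> \<bar>h x\<bar> * e" by (intro mult_left_mono) auto
      then have "\<bar>h x * (h x - p (cos x))\<bar> \<le> e * \<bar>h x\<bar>" by (simp add: abs_mult mult.commute)
      then show "h x ^ 2 - h x * p (cos x) \<le> e * \<bar>h x\<bar>" by (simp add: power2_eq_square algebra_simps)
    qed
    finally show ?thesis by (simp add: B_def)
  qed
  have B: "B \<ge> 0" unfolding B_def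
    by (rule Henstock_Kurzweil_Integration.integral_nonneg) (auto intro!: integrable_continuous_real continuous_intros h)
  have "integral {0..pi} (\<lambda>x. h x ^ 2) \<le> 0"
  proof (rule field_le_epsilon)
    fix e :: real assume "e > 0"
    then have "integral {0..pi} (\<lambda>x. h x ^ 2) \<le> e / (B + 1) * B" using B by (intro bound) auto
    also have "\<dots> \<le> e" using B \<open>e > 0\<close> by (simp add: field_simps)
    finally show "integral {0..pi} (\<lambda>x. h x ^ 2) \<le> 0 + e" by simp
  qed
  moreover have "integral {0..pi} (\<lambda>x. h x ^ 2) \<ge> 0"
    by (rule Henstock_Kurzweil_Integration.integral_nonneg) (auto intro!: integrable_continuous_real continuous_intros h)
  ultimately have "integral {0..pi} (\<lambda>x. h x ^ 2) = 0" by simp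
  moreover have "continuous_on {0..pi} (\<lambda>x. h x ^ 2)" by (intro continuous_intros h)
  ultimately have "\<forall>x\<in>{0..pi}. h x ^ 2 = 0"
    using integral_eq_0_iff[of 0 pi "\<lambda>x. h x ^ 2"] by simp
  then show ?thesis using x by auto
qed

lemma cos_moments_zero:
  fixes h :: "real \<Rightarrow> complex"
  assumes h: "continuous_on {0..pi} h" and m: "\<And>m. integral {0..pi} (\<lambda>x. h x * of_real (cos x ^ m)) = 0"
    and x: "x \<in> {0..pi}"
  shows "h x = 0"
proof -
  have hi: "((\<lambda>x. h x * of_real (cos x ^ m)) has_integral 0) {0..pi}" for m
  proof -
    have "(\<lambda>x. h x * of_real (cos x ^ m)) integrable_on {0..pi}"
      by (intro integrable_continuous_real continuous_intros h)
    from integrable_integral[OF this] show ?thesis by (simp only: m)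
  qed
  have "((\<lambda>x. Re (h x) * cos x ^ m) has_integral 0) {0..pi}" "((\<lambda>x. Im (h x) * cos x ^ m) has_integral 0) {0..pi}" for m
    using has_integral_Re[OF hi[of m]] has_integral_Im[OF hi[of m]] by auto
  note parts = this[THEN integral_unique]
  have "Re (h x) = 0"
    by (rule real_cos_moments_zero[of "\<lambda>x. Re (h x)", OF _ parts(1) x]) (intro continuous_intros h)
  moreover have "Im (h x) = 0"
    by (rule real_cos_moments_zero[of "\<lambda>x. Im (h x)", OF _ parts(2) x]) (intro continuous_intros h)
  ultimately show ?thesis by (simp add: complex_eq_iff)
qed

lemma zero_on_Icc_from_interior:
  fixes y :: "real \<Rightarrow> complex"
  assumes "continuous_on {0..pi} y" "\<And>x. x \<in> {0<..<pi} \<Longrightarrow> y x = 0" "x \<in> {0..pi}"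
  shows "y x = 0"
  using continuous_constant_on_closure[of "{0<..<pi}" y 0 x] assms by auto

text \<open>The product formula for \<open>cos x sin k x\<close> shows by induction that \<open>y\<close> is orthogonal to
\<open>cos\<^sup>m x sin k x\<close> for all \<open>m\<close>. For \<open>k = 1\<close> these are the cosine moments of \<open>y sin\<close>.\<close>

lemma sine_uniqueness:
  assumes y: "continuous_on {0..pi} y" and c: "\<And>k::int. k \<ge> 1 \<Longrightarrow> integral {0..pi} (\<lambda>x. y x * of_real (sin (of_int k * x))) = 0"
    and x: "x \<in> {0..pi}"
  shows "y x = (0::complex)"
proof (rule zero_on_Icc_from_interior[OF y _ x])
  fix x assume x: "x \<in> {0<..<pi}"
  have c': "integral {0..pi} (\<lambda>x. y x * of_real (sin (of_int k * x))) = 0" for k :: int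
  proof (cases "k \<ge> 1")
    case False
    show ?thesis
    proof (cases "k = 0")
      case False
      then have "integral {0..pi} (\<lambda>x. y x * of_real (sin (of_int (-k) * x))) = 0" using \<open>\<not> k \<ge> 1\<close> by (intro c) simp
      then show ?thesis by simp
    qed simp
  qed (rule c)
  have "integral {0..pi} (\<lambda>x. y x * of_real (cos x ^ m * sin (of_int k * x))) = 0" for m :: nat and k :: int
  proof (induction m arbitrary: k)
    case (Suc m)
    have "integral {0..pi} (\<lambda>x. y x * of_real (cos x ^ Suc m * sin (of_int k * x))) =
       integral {0..pi} (\<lambda>x. (1/2) * (y x * of_real (cos x ^ m * sin (of_int (k+1) * x)) + y x * of_real (cos x ^ m * sin (of_int (k-1) * x))))"
    proof (rule integral_cong)
      fix x :: real
      have "sin (of_int (k+1) * x) + sin (of_int (k-1) * x) = 2 * (cos x * sin (of_int k * x))"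
        by (simp add: algebra_simps sin_add sin_diff)
      then have "cos x ^ Suc m * sin (of_int k * x) = (1/2) * (cos x ^ m * sin (of_int (k+1) * x) + cos x ^ m * sin (of_int (k-1) * x))"
        by (simp add: distrib_left[symmetric] del: of_int_add of_int_diff)
      then show "y x * of_real (cos x ^ Suc m * sin (of_int k * x)) =
        (1/2) * (y x * of_real (cos x ^ m * sin (of_int (k+1) * x)) + y x * of_real (cos x ^ m * sin (of_int (k-1) * x)))"
        by (simp add: algebra_simps del: of_int_add of_int_diff power_Suc)
    qed
    also have "\<dots> = (1/2) * (integral {0..pi} (\<lambda>x. y x * of_real (cos x ^ m * sin (of_int (k+1) * x))) + integral {0..pi} (\<lambda>x. y x * of_real (cos x ^ m * sin (of_int (k-1) * x))))"
      unfolding integral_mult_right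
      by (subst Henstock_Kurzweil_Integration.integral_add) (auto intro!: integrable_continuous_real continuous_intros y)
    also have "\<dots> = 0" unfolding Suc.IH by simp
    finally show ?case .
  qed (use c' in simp)
  from this[of _ 1] have "integral {0..pi} (\<lambda>x. (y x * of_real (sin x)) * of_real (cos x ^ m)) = 0" for m
    by (simp add: ac_simps)
  then have "y x * of_real (sin x) = 0"
    by (intro cos_moments_zero[of "\<lambda>x. y x * of_real (sin x)" x]) (use x in \<open>auto intro!: continuous_intros y\<close>)
  then show "y x = 0" using x sin_gt_zero[of x] by auto
qed

text \<open>The two halves of the interval are mapped to the whole interval by \<open>t/2\<close> and \<open>\<pi> - t/2\<close>. These maps
turn \<open>cos 2x\<close> into \<open>cos t\<close> on both halves, and \<open>sin 2x\<close> into \<open>sin t\<close> and \<open>- sin t\<close>.\<close>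

lemma integral_fold_half:
  fixes F :: "real \<Rightarrow> complex"
  assumes F: "continuous_on {0..pi} F"
  shows "integral {0..pi} F = (1/2) * integral {0..pi} (\<lambda>t. F (t/2) + F (pi - t/2))"
proof -
  define G where "G x = integral {0..x} F" for x
  have G: "(G has_vector_derivative F x) (at x within {0..pi})" if "x \<in> {0..pi}" for x
    unfolding G_def by (rule integral_has_vector_derivative[OF F that])
  have "((\<lambda>t. (1/2) *\<^sub>R F (t/2) - (-(1/2)) *\<^sub>R F (pi - t/2)) has_integral ((G (pi/2) - G (pi - pi/2)) - (G (0/2) - G (pi - 0/2)))) {0..pi}"
  proof (rule fundamental_theorem_of_calculus)
    fix t :: real assume t: "t \<in> {0..pi}"
    have "((\<lambda>t. t/2) has_vector_derivative (1/2)) (at t within {0..pi})"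
      "((\<lambda>t. pi - t/2) has_vector_derivative (-(1/2))) (at t within {0..pi})"
      by (auto intro!: derivative_eq_intros simp: has_real_derivative_iff_has_vector_derivative[symmetric])
    note d = this
    have "(G \<circ> (\<lambda>t. t/2) has_vector_derivative (1/2) *\<^sub>R F (t/2)) (at t within {0..pi})"
      by (rule vector_diff_chain_within[OF d(1)])
         (rule has_vector_derivative_within_subset[OF G], use t in auto)
    moreover have "(G \<circ> (\<lambda>t. pi - t/2) has_vector_derivative (-(1/2)) *\<^sub>R F (pi - t/2)) (at t within {0..pi})"
      by (rule vector_diff_chain_within[OF d(2)])
         (rule has_vector_derivative_within_subset[OF G], use t in auto)
    ultimately show "((\<lambda>t. G (t/2) - G (pi - t/2)) has_vector_derivative (1/2) *\<^sub>R F (t/2) - (-(1/2)) *\<^sub>R F (pi - t/2)) (at t within {0..pi})"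
      unfolding o_def by (rule has_vector_derivative_diff)
  qed auto
  then have "((\<lambda>t. (1/2) * (F (t/2) + F (pi - t/2))) has_integral G pi) {0..pi}"
    by (simp add: G_def scaleR_conv_of_real algebra_simps)
  then have "integral {0..pi} (\<lambda>t. (1/2) * (F (t/2) + F (pi - t/2))) = G pi" by (rule integral_unique)
  then show ?thesis unfolding integral_mult_right G_def by (rule sym)
qed

text \<open>The function \<open>cos 2x\<close> does not separate \<open>x\<close> from \<open>\<pi> - x\<close>. So the cosine moments are applied to
the symmetric part of \<open>y\<close>, and to the antisymmetric part multiplied by the sine. The points
where the sine vanishes follow by continuity.\<close>

lemma cis_even_uniqueness:
  assumes y: "continuous_on {0..pi} y" and c: "\<And>j::int. integral {0..pi} (\<lambda>x. y x * cis (2 * of_int j * x)) = 0"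
    and x: "x \<in> {0..pi}"
  shows "y x = (0::complex)"
proof -
  have c': "integral {0..pi} (\<lambda>x. y x * of_real (cos (2 * x) ^ m) * cis (2 * of_int j * x)) = 0" for m :: nat and j :: int
  proof (induction m arbitrary: j)
    case (Suc m)
    have "integral {0..pi} (\<lambda>x. y x * of_real (cos (2 * x) ^ Suc m) * cis (2 * of_int j * x)) =
       integral {0..pi} (\<lambda>x. (1/2) * (y x * of_real (cos (2 * x) ^ m) * cis (2 * of_int (j+1) * x) + y x * of_real (cos (2 * x) ^ m) * cis (2 * of_int (j-1) * x)))"
    proof (rule integral_cong)
      fix x :: real
      have 1: "2 * of_int (j+1) * x = 2 * of_int j * x + 2 * x" "2 * of_int (j-1) * x = 2 * of_int j * x + (- (2 * x))"
        by (simp_all add: algebra_simps)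
      have "cis (2 * of_int (j+1) * x) + cis (2 * of_int (j-1) * x) = cis (2 * of_int j * x) * (cis (2 * x) + cis (- (2 * x)))"
        unfolding 1 cis_mult[symmetric] by (simp add: algebra_simps)
      also have "cis (2 * x) + cis (- (2 * x)) = 2 * of_real (cos (2 * x))" by (simp add: complex_eq_iff)
      finally have "of_real (cos (2 * x)) * cis (2 * of_int j * x) = (1/2) * (cis (2 * of_int (j+1) * x) + cis (2 * of_int (j-1) * x))" by simp
      then show "y x * of_real (cos (2 * x) ^ Suc m) * cis (2 * of_int j * x) =
         (1/2) * (y x * of_real (cos (2 * x) ^ m) * cis (2 * of_int (j+1) * x) + y x * of_real (cos (2 * x) ^ m) * cis (2 * of_int (j-1) * x))"
        by (simp add: mult.assoc distrib_left[symmetric] del: of_int_add of_int_diff)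
    qed
    also have "\<dots> = (1/2) * (integral {0..pi} (\<lambda>x. y x * of_real (cos (2 * x) ^ m) * cis (2 * of_int (j+1) * x)) + integral {0..pi} (\<lambda>x. y x * of_real (cos (2 * x) ^ m) * cis (2 * of_int (j-1) * x)))"
      unfolding integral_mult_right
      by (subst Henstock_Kurzweil_Integration.integral_add) (auto intro!: integrable_continuous_real continuous_intros y)
    also have "\<dots> = 0" unfolding Suc.IH by simp
    finally show ?case .
  qed (use c in simp)
  have cy1: "continuous_on {0..pi} (\<lambda>t. y (t/2))" by (rule continuous_on_compose2[OF y]) (auto intro!: continuous_intros)
  have cy2: "continuous_on {0..pi} (\<lambda>t. y (pi - t/2))" by (rule continuous_on_compose2[OF y]) (auto intro!: continuous_intros)
  have 1: "y (t/2) + y (pi - t/2) = 0" if t: "t \<in> {0..pi}" for t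
  proof (rule cos_moments_zero[of "\<lambda>t. y (t/2) + y (pi - t/2)" t])
    fix m
    have "integral {0..pi} (\<lambda>x. y x * of_real (cos (2 * x) ^ m)) = 0" using c'[of m 0] by simp
    moreover have "integral {0..pi} (\<lambda>x. y x * of_real (cos (2 * x) ^ m)) =
      (1/2) * integral {0..pi} (\<lambda>t. y (t/2) * of_real (cos (2 * (t/2)) ^ m) + y (pi - t/2) * of_real (cos (2 * (pi - t/2)) ^ m))"
      by (rule integral_fold_half) (intro continuous_intros y)
    ultimately show "integral {0..pi} (\<lambda>t. (y (t/2) + y (pi - t/2)) * of_real (cos t ^ m)) = 0"
      by (simp add: right_diff_distrib cos_diff algebra_simps)
  qed (use t in \<open>auto intro!: continuous_intros cy1 cy2\<close>)
  have 2: "(y (t/2) - y (pi - t/2)) * of_real (sin t) = 0" if t: "t \<in> {0..pi}" for t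
  proof (rule cos_moments_zero[of "\<lambda>t. (y (t/2) - y (pi - t/2)) * of_real (sin t)" t])
    fix m
    have "integral {0..pi} (\<lambda>x. y x * of_real (cos (2 * x) ^ m) * cis (2 * of_int 1 * x)) -
       integral {0..pi} (\<lambda>x. y x * of_real (cos (2 * x) ^ m) * cis (2 * of_int (-1) * x)) = 0" by (simp only: c') simp
    also have "integral {0..pi} (\<lambda>x. y x * of_real (cos (2 * x) ^ m) * cis (2 * of_int 1 * x)) -
       integral {0..pi} (\<lambda>x. y x * of_real (cos (2 * x) ^ m) * cis (2 * of_int (-1) * x)) =
       integral {0..pi} (\<lambda>x. y x * of_real (cos (2 * x) ^ m) * cis (2 * of_int 1 * x) - y x * of_real (cos (2 * x) ^ m) * cis (2 * of_int (-1) * x))"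
      by (rule Henstock_Kurzweil_Integration.integral_diff[symmetric]) (auto intro!: integrable_continuous_real continuous_intros y)
    also have "\<dots> = integral {0..pi} (\<lambda>x. (2 * \<i>) * (y x * of_real (cos (2 * x) ^ m * sin (2 * x))))"
    proof (rule integral_cong)
      fix x :: real
      have "cis (2 * of_int 1 * x) - cis (2 * of_int (-1) * x) = 2 * \<i> * of_real (sin (2 * x))"
        by (simp add: complex_eq_iff)
      then show "y x * of_real (cos (2 * x) ^ m) * cis (2 * of_int 1 * x) - y x * of_real (cos (2 * x) ^ m) * cis (2 * of_int (-1) * x) =
        (2 * \<i>) * (y x * of_real (cos (2 * x) ^ m * sin (2 * x)))"
        by (simp only: right_diff_distrib[symmetric]) (simp add: ac_simps)
    qed
    finally have "integral {0..pi} (\<lambda>x. y x * of_real (cos (2 * x) ^ m * sin (2 * x))) = 0" by simp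
    moreover have "integral {0..pi} (\<lambda>x. y x * of_real (cos (2 * x) ^ m * sin (2 * x))) =
      (1/2) * integral {0..pi} (\<lambda>t. y (t/2) * of_real (cos (2 * (t/2)) ^ m * sin (2 * (t/2))) + y (pi - t/2) * of_real (cos (2 * (pi - t/2)) ^ m * sin (2 * (pi - t/2))))"
      by (rule integral_fold_half) (intro continuous_intros y)
    ultimately show "integral {0..pi} (\<lambda>t. (y (t/2) - y (pi - t/2)) * of_real (sin t) * of_real (cos t ^ m)) = 0"
      by (simp add: right_diff_distrib cos_diff sin_diff algebra_simps)
  qed (use t in \<open>auto intro!: continuous_intros cy1 cy2\<close>)
  have half: "y (t/2) = 0 \<and> y (pi - t/2) = 0" if t: "t \<in> {0<..pi}" for t
  proof (cases "t = pi")
    case True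
    then show ?thesis using 1[of pi] by simp
  next
    case False
    then have "sin t > 0" using t by (intro sin_gt_zero) auto
    then have "y (t/2) - y (pi - t/2) = 0" using 2[of t] t by auto
    moreover have "y (t/2) + y (pi - t/2) = 0" using 1 t by auto
    ultimately show ?thesis by (auto simp: add_eq_0_iff)
  qed
  show ?thesis
  proof (rule zero_on_Icc_from_interior[OF y _ x])
    fix x assume x: "x \<in> {0<..<pi}"
    show "y x = 0"
    proof (cases "x \<le> pi/2")
      case True
      then show ?thesis using half[of "2*x"] x by auto
    next
      case False
      then have "2 * (pi - x) \<in> {0<..pi}" using x by auto
      from half[OF this] have "y (pi - 2 * (pi - x) / 2) = 0" by blast
      moreover have "pi - 2 * (pi - x) / 2 = x" by (simp add: field_simps)
      ultimately show ?thesis by metis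
    qed
  qed
qed

section \<open>Eigenfunctions of the free operator\<close>

text \<open>The free eigenvalues are the squares of these integers. For the periodic and the antiperiodic
conditions both signs occur, which accounts for the double eigenvalues.\<close>

fun idx :: "bcond \<Rightarrow> int set" where
  "idx Per_plus = {k. even k}"
| "idx Per_minus = {k. odd k}"
| "idx Dir = {k. k \<ge> 1}"

fun eig :: "bcond \<Rightarrow> int \<Rightarrow> real \<Rightarrow> complex" where
  "eig Dir k x = of_real (sqrt 2 * sin (of_int k * x))"
| "eig Per_plus k x = cis (of_int k * x)"
| "eig Per_minus k x = cis (of_int k * x)"

text \<open>Kept as explicit formulas because the boundary terms in integrations by parts need the values at the
end points.\<close>

fun eig_deriv :: "bcond \<Rightarrow> int \<Rightarrow> real \<Rightarrow> complex" where
  "eig_deriv Dir k x = of_real (sqrt 2 * (of_int k * cos (of_int k * x)))"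
| "eig_deriv Per_plus k x = \<i> * of_int k * cis (of_int k * x)"
| "eig_deriv Per_minus k x = \<i> * of_int k * cis (of_int k * x)"

definition fcoeff :: "bcond \<Rightarrow> (real \<Rightarrow> complex) \<Rightarrow> int \<Rightarrow> complex" where
  "fcoeff bc f k = 1 / of_real pi * integral {0..pi} (\<lambda>x. f x * cnj (eig bc k x))"

lemma eig_eq:
  "eig Dir k = (\<lambda>x. of_real (sqrt 2 * sin (of_int k * x)))"
  "eig Per_plus k = (\<lambda>x. cis (of_int k * x))"
  "eig Per_minus k = (\<lambda>x. cis (of_int k * x))"
  "eig_deriv Dir k = (\<lambda>x. of_real (sqrt 2 * (of_int k * cos (of_int k * x))))"
  "eig_deriv Per_plus k = (\<lambda>x. \<i> * of_int k * cis (of_int k * x))"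
  "eig_deriv Per_minus k = (\<lambda>x. \<i> * of_int k * cis (of_int k * x))"
  by (rule ext, simp)+

lemma continuous_on_eig [continuous_intros]: "continuous_on A (eig bc k)"
  by (cases bc) (auto intro!: continuous_intros simp only: eig_eq)

lemma cmod_eig_le: "cmod (eig bc k x) \<le> sqrt 2"
  by (cases bc) (auto simp: norm_mult)

lemma cnj_eig_has_derivative:
  "((\<lambda>x. cnj (eig bc k x)) has_vector_derivative cnj (eig_deriv bc k x)) (at x within A)"
  "((\<lambda>x. cnj (eig_deriv bc k x)) has_vector_derivative (- (of_int k ^ 2) * cnj (eig bc k x))) (at x within A)"
proof -
  have cis: "((\<lambda>x. cis (of_int k * x)) has_vector_derivative (\<i> * of_int k * cis (of_int k * x))) (at x within A)"
  proof -
    have "((\<lambda>x. complex_of_real (cos (of_int k * x))) has_vector_derivative of_real (- (of_int k * sin (of_int k * x)))) (at x within A)"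
      "((\<lambda>x. complex_of_real (sin (of_int k * x))) has_vector_derivative of_real (of_int k * cos (of_int k * x))) (at x within A)"
      by (intro has_vector_derivative_of_real; auto intro!: derivative_eq_intros simp: has_real_derivative_iff_has_vector_derivative[symmetric])+
    from has_vector_derivative_add[OF this(1) has_vector_derivative_mult_right[OF this(2), of \<i>]]
    have "((\<lambda>x. of_real (cos (of_int k * x)) + \<i> * of_real (sin (of_int k * x))) has_vector_derivative
        (of_real (- (of_int k * sin (of_int k * x))) + \<i> * of_real (of_int k * cos (of_int k * x)))) (at x within A)" .
    moreover have "cis t = of_real (cos t) + \<i> * of_real (sin t)" for t by (simp add: complex_eq_iff)
    ultimately show ?thesis by (simp add: algebra_simps)
  qed
  have cis2: "((\<lambda>x. \<i> * of_int k * cis (of_int k * x)) has_vector_derivative (- (of_int k ^ 2) * cis (of_int k * x))) (at x within A)"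
    using has_vector_derivative_mult_right[OF cis, of "\<i> * of_int k"] by (simp add: power2_eq_square algebra_simps)
  have sin: "((\<lambda>x. complex_of_real (sqrt 2 * sin (of_int k * x))) has_vector_derivative of_real (sqrt 2 * (of_int k * cos (of_int k * x)))) (at x within A)"
    by (intro has_vector_derivative_of_real) (auto intro!: derivative_eq_intros simp: has_real_derivative_iff_has_vector_derivative[symmetric])
  have cos: "((\<lambda>x. complex_of_real (sqrt 2 * (of_int k * cos (of_int k * x)))) has_vector_derivative of_real (- (sqrt 2 * (of_int k * (of_int k * sin (of_int k * x)))))) (at x within A)"
    by (intro has_vector_derivative_of_real) (auto intro!: derivative_eq_intros simp: has_real_derivative_iff_has_vector_derivative[symmetric])
  have 1: "(eig bc k has_vector_derivative eig_deriv bc k x) (at x within A)"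
    using cis sin by (cases bc) (simp_all only: eig_eq)
  have 2: "(eig_deriv bc k has_vector_derivative (- (of_int k ^ 2) * eig bc k x)) (at x within A)"
    using cis2 cos by (cases bc) (simp_all add: eig_eq power2_eq_square ac_simps)
  show "((\<lambda>x. cnj (eig bc k x)) has_vector_derivative cnj (eig_deriv bc k x)) (at x within A)"
    using 1 by (rule has_vector_derivative_cnj)
  show "((\<lambda>x. cnj (eig_deriv bc k x)) has_vector_derivative (- (of_int k ^ 2) * cnj (eig bc k x))) (at x within A)"
    using has_vector_derivative_cnj[OF 2] by simp
qed

section \<open>The eigenfunction expansion of the free resolvent\<close>

lemma fcoeff_bound:
  assumes "f \<in> L1"
  shows "cmod (fcoeff bc f k) \<le> sqrt 2 * norm_L1 f"
proof -
  have c: "continuous_on {0..pi} (\<lambda>x. cnj (eig bc k x))" by (intro continuous_intros)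
  have "cmod (integral {0..pi} (\<lambda>x. f x * cnj (eig bc k x))) \<le> pi * norm_L1 (\<lambda>x. f x * cnj (eig bc k x))"
    by (rule cmod_integral_le_norm_L1[OF L1_mult_continuous[OF assms c]]) auto
  also have "norm_L1 (\<lambda>x. f x * cnj (eig bc k x)) \<le> norm_L1 f * sqrt 2"
    by (rule norm_L1_mult_le[OF assms c]) (simp add: cmod_eig_le)
  finally show ?thesis by (simp add: fcoeff_def norm_mult norm_divide field_simps)
qed

lemma cmod_fcoeff_mult_eig_le:
  assumes "f \<in> L1"
  shows "cmod (fcoeff bc f k) * cmod (eig bc k x) \<le> 2 * norm_L1 f"
proof -
  have "cmod (fcoeff bc f k) * cmod (eig bc k x) \<le> (sqrt 2 * norm_L1 f) * sqrt 2"
    by (intro mult_mono fcoeff_bound assms cmod_eig_le) (auto simp: norm_L1_nonneg)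
  also have "\<dots> = 2 * norm_L1 f" using real_sqrt_mult_self[of 2] by simp
  finally show ?thesis .
qed

lemma cis_int_pi: "cis (of_int k * pi) = (if even k then 1 else -1)"
  by (simp add: complex_eq_iff mult.commute[of _ pi])

lemma sin_int_pi: "sin (of_int k * pi) = 0"
  by (simp add: mult.commute[of _ pi])

lemma boundary_terms_agree:
  assumes "bc_form bc a b a' b' = (0, 0)" "k \<in> idx bc"
  shows "b' * cnj (eig bc k pi) - b * cnj (eig_deriv bc k pi) = a' * cnj (eig bc k 0) - a * cnj (eig_deriv bc k 0)"
  using assms by (cases bc) (auto simp: cis_int_pi cis_int_pi[unfolded mult.commute[of _ pi]] sin_int_pi algebra_simps eq_neg_iff_add_eq_0[symmetric] add_eq_0_iff2)

text \<open>Two integrations by parts move the operator onto the eigenfunction; the boundary terms cancel since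
both functions satisfy the boundary conditions.\<close>

lemma bvp_fcoeff:
  assumes f: "f \<in> L1" and y: "bvp bc (\<lambda>_. 0) z f y" and k: "k \<in> idx bc"
  shows "(z - of_int k ^ 2) * fcoeff bc y k = fcoeff bc f k"
proof -
  obtain y1 where y1: "ode_sol (\<lambda>t. 0 - z) f y y1" and bc: "bc_form bc (y 0) (y pi) (y1 0) (y1 pi) = (0, 0)"
    using y by (auto simp: bvp_def)
  note cy = ode_sol_continuous[OF y1]
  define h where "h t = (0 - z) * y t + f t" for t
  have h: "h \<in> L1" unfolding h_def by (intro L1_add L1_cmult L1_continuous cy f)
  define \<phi> where "\<phi> x = cnj (eig bc k x)" for x
  define \<phi>1 where "\<phi>1 x = cnj (eig_deriv bc k x)" for x
  have d: "(\<phi> has_vector_derivative \<phi>1 x) (at x within A)" "(\<phi>1 has_vector_derivative (- (of_int k ^ 2) * \<phi> x)) (at x within A)" for x A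
    unfolding \<phi>_def \<phi>1_def by (rule cnj_eig_has_derivative)+
  have c\<phi>: "continuous_on {0..pi} \<phi>" "continuous_on {0..pi} \<phi>1"
    using d by (meson continuous_on_eq_continuous_within has_vector_derivative_continuous)+
  have "((\<lambda>x. h x * \<phi> x + y1 x * \<phi>1 x) has_integral (y1 pi * \<phi> pi - y1 0 * \<phi> 0)) {0..pi}"
    by (rule integration_by_parts_absolutely_integrable[where c="y1 0"])
       (use h ode_solD(2)[OF y1, folded h_def] d c\<phi> in \<open>simp_all only: L1_def mem_Collect_eq pi_ge_zero\<close>)
  moreover have "((\<lambda>x. y1 x * \<phi>1 x + y x * (- (of_int k ^ 2) * \<phi> x)) has_integral (y pi * \<phi>1 pi - y 0 * \<phi>1 0)) {0..pi}"
  proof (rule integration_by_parts_absolutely_integrable[where c="y 0"])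
    show "y1 absolutely_integrable_on {0..pi}" using L1_continuous[OF cy(2)] by (simp add: L1_def)
    show "continuous_on {0..pi} (\<lambda>x. - (of_int k ^ 2) * \<phi> x)" by (intro continuous_intros c\<phi>)
  qed (rule ode_solD(1)[OF y1] d pi_ge_zero | assumption)+
  ultimately have "((\<lambda>x. (h x * \<phi> x + y1 x * \<phi>1 x) - (y1 x * \<phi>1 x + y x * (- (of_int k ^ 2) * \<phi> x))) has_integral
     ((y1 pi * \<phi> pi - y1 0 * \<phi> 0) - (y pi * \<phi>1 pi - y 0 * \<phi>1 0))) {0..pi}"
    by (rule has_integral_diff)
  moreover have "(y1 pi * \<phi> pi - y1 0 * \<phi> 0) - (y pi * \<phi>1 pi - y 0 * \<phi>1 0) = 0"
    using boundary_terms_agree[OF bc k] by (simp add: \<phi>_def \<phi>1_def algebra_simps)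
  moreover have "(h x * \<phi> x + y1 x * \<phi>1 x) - (y1 x * \<phi>1 x + y x * (- (of_int k ^ 2) * \<phi> x)) = f x * \<phi> x - (z - of_int k ^ 2) * (y x * \<phi> x)" for x
    by (simp add: h_def algebra_simps)
  ultimately have 0: "((\<lambda>x. f x * \<phi> x - (z - of_int k ^ 2) * (y x * \<phi> x)) has_integral 0) {0..pi}" by simp
  have "((\<lambda>x. f x * \<phi> x) has_integral integral {0..pi} (\<lambda>x. f x * \<phi> x)) {0..pi}"
    by (intro integrable_integral L1_integrable L1_mult_continuous f c\<phi>)
  moreover have "((\<lambda>x. y x * \<phi> x) has_integral integral {0..pi} (\<lambda>x. y x * \<phi> x)) {0..pi}"
    by (intro integrable_integral L1_integrable L1_mult_continuous L1_continuous cy c\<phi>)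
  ultimately have "((\<lambda>x. f x * \<phi> x - (z - of_int k ^ 2) * (y x * \<phi> x)) has_integral
     (integral {0..pi} (\<lambda>x. f x * \<phi> x) - (z - of_int k ^ 2) * integral {0..pi} (\<lambda>x. y x * \<phi> x))) {0..pi}"
    by (intro has_integral_diff has_integral_mult_right)
  from has_integral_unique[OF this 0]
  have "integral {0..pi} (\<lambda>x. f x * \<phi> x) = (z - of_int k ^ 2) * integral {0..pi} (\<lambda>x. y x * \<phi> x)" by simp
  then show ?thesis by (simp add: fcoeff_def \<phi>_def[symmetric])
qed

lemma integral_cos_int:
  fixes m :: int
  assumes "m \<noteq> 0" shows "((\<lambda>x. cos (of_int m * x)) has_integral 0) {0..pi}"
proof -
  have "((\<lambda>x. cos (of_int m * x)) has_integral (sin (of_int m * pi) / of_int m - sin (of_int m * 0) / of_int m)) {0..pi}"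
    by (rule fundamental_theorem_of_calculus[where f="\<lambda>x. sin (of_int m * x) / of_int m"])
       (use assms in \<open>auto intro!: derivative_eq_intros simp: has_real_derivative_iff_has_vector_derivative[symmetric]\<close>)
  then show ?thesis by (simp add: sin_int_pi)
qed

lemma integral_sin_even:
  fixes m :: int
  assumes "m \<noteq> 0" "even m" shows "((\<lambda>x. sin (of_int m * x)) has_integral 0) {0..pi}"
proof -
  have "((\<lambda>x. sin (of_int m * x)) has_integral (- cos (of_int m * pi) / of_int m - (- cos (of_int m * 0) / of_int m))) {0..pi}"
    by (rule fundamental_theorem_of_calculus[where f="\<lambda>x. - cos (of_int m * x) / of_int m"])
       (use assms in \<open>auto intro!: derivative_eq_intros simp: has_real_derivative_iff_has_vector_derivative[symmetric]\<close>)
  then show ?thesis using assms by (simp add: mult.commute[of _ pi])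
qed

lemma integral_cis_even:
  fixes m :: int
  assumes "even m" shows "integral {0..pi} (\<lambda>x. cis (of_int m * x)) = (if m = 0 then of_real pi else 0)"
proof (cases "m = 0")
  case False
  have "((\<lambda>x. complex_of_real (cos (of_int m * x)) + \<i> * of_real (sin (of_int m * x))) has_integral (of_real 0 + \<i> * of_real 0)) {0..pi}"
    by (intro has_integral_add has_integral_mult_right has_integral_of_real integral_cos_int integral_sin_even False assms)
  moreover have "complex_of_real (cos t) + \<i> * of_real (sin t) = cis t" for t by (simp add: complex_eq_iff)
  ultimately show ?thesis using False by (simp add: integral_unique)
qed (simp add: scaleR_conv_of_real)

lemma fcoeff_eig:
  assumes j: "j \<in> idx bc" and k: "k \<in> idx bc"
  shows "fcoeff bc (eig bc j) k = (if j = k then 1 else 0)"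
proof (cases "bc = Dir")
  case True
  have jk: "j \<ge> 1" "k \<ge> 1" using j k True by auto
  have 0: "((\<lambda>x. cos (of_int (j - k) * x)) has_integral (if j = k then pi else 0)) {0..pi}"
    using integral_cos_int[of "j - k"] has_integral_const_real[of "1::real" 0 pi] by auto
  have "((\<lambda>x. cos (of_int (j + k) * x)) has_integral 0) {0..pi}"
    using integral_cos_int[of "j + k"] jk by auto
  from has_integral_of_real[OF has_integral_diff[OF 0 this]]
  have "((\<lambda>x. complex_of_real (cos (of_int (j - k) * x) - cos (of_int (j + k) * x))) has_integral (if j = k then of_real pi else 0)) {0..pi}"
    by (auto split: if_splits)
  moreover have "complex_of_real (cos (of_int (j - k) * x) - cos (of_int (j + k) * x)) = eig bc j x * cnj (eig bc k x)" for x
  proof -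
    have "cos (of_int (j - k) * x) - cos (of_int (j + k) * x) = 2 * sin (of_int j * x) * sin (of_int k * x)"
      by (simp add: algebra_simps cos_add cos_diff)
    also have "\<dots> = (sqrt 2 * sin (of_int j * x)) * (sqrt 2 * sin (of_int k * x))" by simp
    finally show ?thesis using True by (simp only: eig.simps complex_cnj_complex_of_real of_real_mult[symmetric])
  qed
  ultimately show ?thesis by (simp add: fcoeff_def integral_unique)
next
  case False
  then have "eig bc j x * cnj (eig bc k x) = cis (of_int (j - k) * x)" for x
    by (cases bc) (auto simp: cis_cnj cis_mult algebra_simps)
  moreover have "even (j - k)" using j k False by (cases bc) auto
  ultimately show ?thesis using integral_cis_even[of "j - k"] by (simp add: fcoeff_def)
qed

text \<open>The antiperiodic case reduces to the periodic one by the factor \<open>exp (- i x)\<close>, which shifts the odd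
frequencies to the even ones.\<close>

lemma eig_uniqueness:
  assumes y: "continuous_on {0..pi} y" and c: "\<And>k. k \<in> idx bc \<Longrightarrow> fcoeff bc y k = 0" and x: "x \<in> {0..pi}"
  shows "y x = 0"
proof (cases bc)
  case Dir
  show ?thesis
  proof (rule sine_uniqueness[OF y _ x])
    fix k :: int assume "k \<ge> 1"
    then have "integral {0..pi} (\<lambda>x. y x * of_real (sqrt 2 * sin (of_int k * x))) = 0" using c[of k] Dir by (simp add: fcoeff_def)
    moreover have "(\<lambda>x. y x * of_real (sqrt 2 * sin (of_int k * x))) = (\<lambda>x. of_real (sqrt 2) * (y x * of_real (sin (of_int k * x))))" by (auto simp: ac_simps)
    ultimately show "integral {0..pi} (\<lambda>x. y x * of_real (sin (of_int k * x))) = 0" by simp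
  qed
next
  case Per_plus
  show ?thesis
  proof (rule cis_even_uniqueness[OF y _ x])
    fix j :: int
    show "integral {0..pi} (\<lambda>x. y x * cis (2 * of_int j * x)) = 0"
      using c[of "- 2 * j"] Per_plus by (simp add: fcoeff_def cis_cnj)
  qed
next
  case Per_minus
  have "y x * cis (- x) = 0"
  proof (rule cis_even_uniqueness[OF _ _ x])
    show "continuous_on {0..pi} (\<lambda>x. y x * cis (- x))" by (intro continuous_intros y)
    fix j :: int
    have "integral {0..pi} (\<lambda>x. y x * cnj (eig bc (1 - 2 * j) x)) = 0"
      using c[of "1 - 2 * j"] Per_minus by (simp add: fcoeff_def)
    moreover have "cnj (eig bc (1 - 2 * j) x) = cis (- x) * cis (2 * of_int j * x)" for x
      using Per_minus by (simp add: cis_cnj cis_mult algebra_simps)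
    ultimately show "integral {0..pi} (\<lambda>x. y x * cis (- x) * cis (2 * of_int j * x)) = 0" by (simp add: mult.assoc)
  qed
  then show ?thesis by simp
qed

lemma summable_on_int_abs:
  fixes g :: "nat \<Rightarrow> real"
  assumes g0: "\<And>n. g n \<ge> 0" and g: "g summable_on UNIV"
  shows "(\<lambda>k::int. g (nat \<bar>k\<bar>)) summable_on UNIV" "(\<Sum>\<^sub>\<infinity>k::int. g (nat \<bar>k\<bar>)) \<le> 2 * infsum g UNIV"
proof -
  have s1: "(\<lambda>k::int. g (nat \<bar>k\<bar>)) summable_on range int" and i1: "(\<Sum>\<^sub>\<infinity>k\<in>range int. g (nat \<bar>k\<bar>)) = infsum g UNIV"
    using g by (auto simp: summable_on_reindex infsum_reindex inj_on_def o_def)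
  have inj: "inj_on (\<lambda>n. - int n) UNIV" by (auto simp: inj_on_def)
  have s2: "(\<lambda>k::int. g (nat \<bar>k\<bar>)) summable_on range (\<lambda>n. - int n)" and i2: "(\<Sum>\<^sub>\<infinity>k\<in>range (\<lambda>n. - int n). g (nat \<bar>k\<bar>)) = infsum g UNIV"
    using g by (auto simp: summable_on_reindex[OF inj] infsum_reindex[OF inj] o_def)
  have U: "UNIV = range int \<union> (range (\<lambda>n. - int n) - {0})"
  proof -
    have "k \<in> range int \<union> (range (\<lambda>n. - int n) - {0})" for k :: int
      by (cases "k \<ge> 0") (auto intro: rev_image_eqI[of "nat k"] rev_image_eqI[of "nat (-k)"])
    then show ?thesis by auto
  qed
  have s3: "(\<lambda>k::int. g (nat \<bar>k\<bar>)) summable_on (range (\<lambda>n. - int n) - {0})"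
    by (rule summable_on_subset_banach[OF s2]) auto
  have disj: "range int \<inter> (range (\<lambda>n. - int n) - {0}) = {}" by auto
  show "(\<lambda>k::int. g (nat \<bar>k\<bar>)) summable_on UNIV"
    unfolding U by (rule summable_on_Un_disjoint[OF s1 s3 disj])
  have "(\<Sum>\<^sub>\<infinity>k::int. g (nat \<bar>k\<bar>)) = (\<Sum>\<^sub>\<infinity>k\<in>range int. g (nat \<bar>k\<bar>)) + (\<Sum>\<^sub>\<infinity>k\<in>(range (\<lambda>n. - int n) - {0}). g (nat \<bar>k\<bar>))"
    unfolding U by (rule infsum_Un_disjoint[OF s1 s3 disj])
  also have "(\<Sum>\<^sub>\<infinity>k\<in>(range (\<lambda>n. - int n) - {0}). g (nat \<bar>k\<bar>)) \<le> (\<Sum>\<^sub>\<infinity>k\<in>range (\<lambda>n. - int n). g (nat \<bar>k\<bar>))"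
    by (rule infsum_mono2[OF s3 s2]) (auto simp: g0)
  finally show "(\<Sum>\<^sub>\<infinity>k::int. g (nat \<bar>k\<bar>)) \<le> 2 * infsum g UNIV" using i1 i2 by simp
qed

lemma summable_on_inverse_squares: "(\<lambda>k::int. 1 / (1 + (real_of_int k)\<^sup>2)) summable_on A"
proof -
  have "summable (\<lambda>n. 1 / (1 + (real n)\<^sup>2))"
  proof (rule summable_comparison_test_ev[OF _ inverse_power_summable[of 2, where 'a=real]])
    show "eventually (\<lambda>n. norm (1 / (1 + (real n)\<^sup>2)) \<le> inverse (of_nat n ^ 2)) sequentially"
      using eventually_gt_at_top[of 0]
    proof eventually_elim
      fix n :: nat assume "n > 0"
      then have "1 / (1 + (real n)\<^sup>2) \<le> 1 / (real n)\<^sup>2" by (intro divide_left_mono) (auto intro!: mult_pos_pos add_pos_nonneg)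
      then show "norm (1 / (1 + (real n)\<^sup>2)) \<le> inverse (of_nat n ^ 2)" by (simp add: inverse_eq_divide)
    qed
  qed simp
  then have "(\<lambda>n. 1 / (1 + (real n)\<^sup>2)) summable_on UNIV"
    by (subst summable_on_UNIV_nonneg_real_iff) auto
  from summable_on_int_abs(1)[OF _ this]
  have "(\<lambda>k::int. 1 / (1 + (real (nat \<bar>k\<bar>))\<^sup>2)) summable_on UNIV" by simp
  then have "(\<lambda>k::int. 1 / (1 + (real_of_int k)\<^sup>2)) summable_on UNIV" by (simp add: of_nat_nat)
  then show ?thesis by (rule summable_on_subset_banach) auto
qed

text \<open>Beyond \<open>|k| \<ge> 2 |z| + 1\<close> the terms are at most \<open>2 / (1 + k\<^sup>2)\<close>; the finitely many others only affect
the constant.\<close>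

lemma summable_inverse_distance:
  assumes z: "\<And>k. k \<in> A \<Longrightarrow> z \<noteq> of_int k ^ 2"
  shows "(\<lambda>k::int. 1 / cmod (z - of_int k ^ 2)) summable_on A"
proof -
  define m where "m = nat \<lceil>2 * cmod z + 1\<rceil>"
  define F where "F = {- int m..int m} \<inter> A"
  have fin: "finite F" by (simp add: F_def)
  define C where "C = 2 + (\<Sum>k\<in>F. (1 + (real_of_int k)\<^sup>2) / cmod (z - of_int k ^ 2))"
  have "1 / cmod (z - of_int k ^ 2) \<le> C * (1 / (1 + (real_of_int k)\<^sup>2))" if k: "k \<in> A" for k
  proof -
    have pos: "1 + (real_of_int k)\<^sup>2 > 0" by (auto intro: add_pos_nonneg)
    have zk: "cmod (z - of_int k ^ 2) > 0" using z[OF k] by simp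
    have "(1 + (real_of_int k)\<^sup>2) / cmod (z - of_int k ^ 2) \<le> C"
    proof (cases "k \<in> F")
      case True
      then have "(1 + (real_of_int k)\<^sup>2) / cmod (z - of_int k ^ 2) \<le> (\<Sum>k\<in>F. (1 + (real_of_int k)\<^sup>2) / cmod (z - of_int k ^ 2))"
        by (intro member_le_sum) (auto simp: fin)
      then show ?thesis by (simp add: C_def)
    next
      case False
      then have "\<bar>k\<bar> > int m" using k by (auto simp: F_def)
      then have km: "\<bar>real_of_int k\<bar> > real m" by linarith
      have mz: "real m \<ge> 2 * cmod z + 1" unfolding m_def using norm_ge_zero[of z] by linarith
      have "real m * 1 \<le> \<bar>real_of_int k\<bar> * \<bar>real_of_int k\<bar>"
      proof -
        have "1 \<le> \<bar>real_of_int k\<bar>" using km mz norm_ge_zero[of z] by linarith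
        then show ?thesis using km by (intro mult_mono) auto
      qed
      then have "2 * cmod z + 1 \<le> (real_of_int k)\<^sup>2" using mz by (simp add: power2_eq_square abs_mult_self_eq)
      moreover have "cmod (z - of_int k ^ 2) \<ge> (real_of_int k)\<^sup>2 - cmod z"
        using norm_triangle_ineq2[of "of_int k ^ 2" z] by (simp add: norm_minus_commute norm_power)
      ultimately have "1 + (real_of_int k)\<^sup>2 \<le> 2 * cmod (z - of_int k ^ 2)" by linarith
      then have "(1 + (real_of_int k)\<^sup>2) / cmod (z - of_int k ^ 2) \<le> 2" using zk by (simp add: divide_le_eq)
      moreover have "C \<ge> 2" unfolding C_def by (auto intro!: sum_nonneg)
      ultimately show ?thesis by simp
    qed
    then show ?thesis using pos zk by (simp add: field_simps)
  qed
  then show ?thesis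
    by (intro summable_on_comparison_test[OF summable_on_cmult_right[OF summable_on_inverse_squares, of C]]) auto
qed

text \<open>The series converges uniformly, so its sum is continuous with the coefficients that \<open>bvp_fcoeff\<close>
gives for \<open>y\<close>. A continuous function is determined by its coefficients.\<close>

theorem bvp_series:
  assumes f: "f \<in> L1" and y: "bvp bc (\<lambda>_. 0) z f y" and z: "\<And>k. k \<in> idx bc \<Longrightarrow> z \<noteq> of_int k ^ 2"
    and x: "x \<in> {0..pi}"
  shows "((\<lambda>k. fcoeff bc f k / (z - of_int k ^ 2) * eig bc k x) has_sum y x) (idx bc)"
proof -
  define t where "t k x = fcoeff bc f k / (z - of_int k ^ 2) * eig bc k x" for k x
  define M where "M k = 2 * norm_L1 f * (1 / cmod (z - of_int k ^ 2))" for k :: int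
  have M: "M summable_on idx bc" unfolding M_def
    by (intro summable_on_cmult_right summable_inverse_distance z)
  have tM: "norm (t k x) \<le> M k" for k x
  proof -
    have "cmod (fcoeff bc f k) * cmod (eig bc k x) / cmod (z - of_int k ^ 2) \<le> (2 * norm_L1 f) / cmod (z - of_int k ^ 2)"
      by (intro divide_right_mono cmod_fcoeff_mult_eig_le f) auto
    then show ?thesis by (simp add: t_def M_def norm_mult norm_divide)
  qed
  have abs: "(\<lambda>k. norm (t k x)) summable_on idx bc" for x
    by (rule Infinite_Sum.abs_summable_on_comparison_test'[OF M tM])
  define S where "S x = (\<Sum>\<^sub>\<infinity>k\<in>idx bc. t k x)" for x
  have S: "((\<lambda>k. t k x) has_sum S x) (idx bc)" for x
    unfolding S_def by (rule has_sum_infsum[OF abs_summable_summable[OF abs]])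
  have ul: "uniform_limit {0..pi} (\<lambda>X x. \<Sum>k\<in>X. t k x) S (finite_subsets_at_top (idx bc))"
    unfolding S_def by (rule Weierstrass_m_test_general[OF tM M])
  have ct: "continuous_on {0..pi} (t k)" for k unfolding t_def by (intro continuous_intros)
  have cS: "continuous_on {0..pi} S"
    by (rule uniform_limit_theorem[OF _ ul]) (auto intro!: always_eventually continuous_on_sum ct)
  have "fcoeff bc (\<lambda>x. y x - S x) k = 0" if k: "k \<in> idx bc" for k
  proof -
    define e where "e x = cnj (eig bc k x)" for x
    have ce: "continuous_on {0..pi} e" unfolding e_def by (intro continuous_intros)
    have int: "u integrable_on {0..pi}" if "continuous_on {0..pi} u" for u :: "real \<Rightarrow> complex"
      using integrable_continuous_real[OF that] .
    have ul2: "uniform_limit {0..pi} (\<lambda>X x. (\<Sum>k\<in>X. t k x) * e x) (\<lambda>x. S x * e x) (finite_subsets_at_top (idx bc))"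
      by (rule uniform_lim_mult[OF ul uniform_limit_const])
         (auto intro!: compact_imp_bounded compact_continuous_image cS ce)
    obtain I J where IJ: "\<And>X. ((\<lambda>x. (\<Sum>k\<in>X. t k x) * e x) has_integral I X) {0..pi}"
        "((\<lambda>x. S x * e x) has_integral J) {0..pi}" "(I \<longlongrightarrow> J) (finite_subsets_at_top (idx bc))"
      by (rule uniform_limit_integral[OF ul2]) (auto intro!: continuous_intros ct ce)
    have ek: "integral {0..pi} (\<lambda>x. eig bc j x * e x) = of_real pi * (if j = k then 1 else 0)" if "j \<in> idx bc" for j
      using fcoeff_eig[OF that k] by (simp add: fcoeff_def e_def field_simps split: if_splits)
    have I: "I X = of_real pi * (fcoeff bc f k / (z - of_int k ^ 2))" if X: "finite X" "X \<subseteq> idx bc" "k \<in> X" for X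
    proof -
      have "I X = integral {0..pi} (\<lambda>x. (\<Sum>k\<in>X. t k x) * e x)" by (rule integral_unique[OF IJ(1), symmetric])
      also have "\<dots> = integral {0..pi} (\<lambda>x. \<Sum>j\<in>X. fcoeff bc f j / (z - of_int j ^ 2) * (eig bc j x * e x))"
        by (simp add: t_def sum_distrib_right mult.assoc)
      also have "\<dots> = (\<Sum>j\<in>X. integral {0..pi} (\<lambda>x. fcoeff bc f j / (z - of_int j ^ 2) * (eig bc j x * e x)))"
        by (rule integral_sum[OF X(1)]) (intro int continuous_intros ce)
      also have "\<dots> = (\<Sum>j\<in>X. if j = k then of_real pi * (fcoeff bc f j / (z - of_int j ^ 2)) else 0)"
        by (rule sum.cong) (use X ek in \<open>auto simp: subset_iff\<close>)
      also have "\<dots> = of_real pi * (fcoeff bc f k / (z - of_int k ^ 2))" using X by simp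
      finally show ?thesis .
    qed
    have "eventually (\<lambda>X. I X = of_real pi * (fcoeff bc f k / (z - of_int k ^ 2))) (finite_subsets_at_top (idx bc))"
      unfolding eventually_finite_subsets_at_top
      by (intro exI[of _ "{k}"]) (use k I in auto)
    then have "J = of_real pi * (fcoeff bc f k / (z - of_int k ^ 2))"
      using tendsto_unique[OF _ IJ(3) tendsto_eventually] by simp
    then have FS: "((\<lambda>x. S x * e x) has_integral (of_real pi * (fcoeff bc f k / (z - of_int k ^ 2)))) {0..pi}" using IJ(2) by simp
    have "integral {0..pi} (\<lambda>x. y x * e x) = of_real pi * fcoeff bc y k" by (simp add: fcoeff_def e_def)
    also have "fcoeff bc y k = fcoeff bc f k / (z - of_int k ^ 2)"
      using bvp_fcoeff[OF f y k] z[OF k] by (simp add: field_simps)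
    finally have "((\<lambda>x. y x * e x) has_integral (of_real pi * (fcoeff bc f k / (z - of_int k ^ 2)))) {0..pi}"
      using integrable_integral[OF int[of "\<lambda>x. y x * e x"]] bvp_continuous[OF y] ce by (simp add: continuous_on_mult)
    from has_integral_diff[OF this FS] have "((\<lambda>x. (y x - S x) * e x) has_integral 0) {0..pi}"
      by (simp add: algebra_simps)
    then show ?thesis by (simp add: fcoeff_def e_def integral_unique)
  qed
  from eig_uniqueness[OF _ this x] have "y x = S x"
    using bvp_continuous[OF y] cS by (simp add: continuous_on_diff)
  then show ?thesis using S[of x] by (simp add: t_def)
qed

text \<open>Up to the factor \<open>2\<close>, which bounds \<open>|e\<^sub>k x| |e\<^sub>k t|\<close>, this dominates the norm of the free resolvent
from \<open>L\<^sup>1\<close> to \<open>C\<close>.\<close>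

definition rho :: "bcond \<Rightarrow> complex \<Rightarrow> real" where
  "rho bc z = (\<Sum>\<^sub>\<infinity>k\<in>idx bc. 1 / cmod (z - of_int k ^ 2))"

lemma bvp_free_bound:
  assumes f: "f \<in> L1" and y: "bvp bc (\<lambda>_. 0) z f y" and z: "\<And>k. k \<in> idx bc \<Longrightarrow> z \<noteq> of_int k ^ 2"
    and x: "x \<in> {0..pi}"
  shows "cmod (y x) \<le> 2 * rho bc z * norm_L1 f"
proof -
  note s = bvp_series[OF f y z x]
  have M: "(\<lambda>k. 2 * norm_L1 f * (1 / cmod (z - of_int k ^ 2))) summable_on idx bc"
    by (intro summable_on_cmult_right summable_inverse_distance z)
  have "cmod (y x) \<le> (\<Sum>\<^sub>\<infinity>k\<in>idx bc. 2 * norm_L1 f * (1 / cmod (z - of_int k ^ 2)))"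
  proof (rule norm_infsum_le[OF s has_sum_infsum[OF M]])
    fix k
    have "cmod (fcoeff bc f k) * cmod (eig bc k x) / cmod (z - of_int k ^ 2) \<le> (2 * norm_L1 f) / cmod (z - of_int k ^ 2)"
      by (intro divide_right_mono cmod_fcoeff_mult_eig_le f) auto
    then show "norm (fcoeff bc f k / (z - of_int k ^ 2) * eig bc k x) \<le> 2 * norm_L1 f * (1 / cmod (z - of_int k ^ 2))"
      by (simp add: norm_mult norm_divide)
  qed
  also have "\<dots> = 2 * norm_L1 f * rho bc z" unfolding rho_def by (rule infsum_cmult_right') 
  finally show ?thesis by (simp add: ac_simps)
qed

section \<open>The resolvent as an analytic function of the spectral parameter\<close>

text \<open>The resolvent applied to \<open>f\<close>, for integrable \<open>f\<close>. The solution is cut off outside the interval,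
where the boundary value problem leaves it undetermined.\<close>

definition green :: "bcond \<Rightarrow> (real \<Rightarrow> complex) \<Rightarrow> complex \<Rightarrow> (real \<Rightarrow> complex) \<Rightarrow> real \<Rightarrow> complex" where
  "green bc v z f x = (if x \<in> {0..pi} then (SOME y. bvp bc v z f y) x else 0)"

definition res_set :: "bcond \<Rightarrow> (real \<Rightarrow> complex) \<Rightarrow> complex set" where
  "res_set bc v = {z. \<not> is_eigenvalue bc v z}"

lemma green_bvp:
  assumes "v \<in> L1" "z \<in> res_set bc v" "f \<in> L1"
  shows "bvp bc v z f (green bc v z f)"
proof -
  have ne: "\<not> is_eigenvalue bc v z" using assms(2) by (simp add: res_set_def)
  obtain K where "\<And>f. f \<in> L1 \<Longrightarrow> \<exists>y. bvp bc v z f y \<and> (\<forall>x\<in>{0..pi}. cmod (y x) \<le> K * norm_L1 f)"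
    using bvp_solvable[OF assms(1) ne] by blast
  then have "\<exists>y. bvp bc v z f y" using assms(3) by blast
  then have "bvp bc v z f (SOME y. bvp bc v z f y)" by (rule someI_ex)
  then show ?thesis by (rule bvp_cong) (simp add: green_def)
qed

lemma green_eqI:
  assumes "v \<in> L1" "z \<in> res_set bc v" "f \<in> L1" "bvp bc v z f y" "x \<in> {0..pi}"
  shows "green bc v z f x = y x"
  using bvp_unique[OF assms(1,3) _ green_bvp[OF assms(1-3)] assms(4,5)] assms(2) by (simp add: res_set_def)

lemma green_continuous:
  "v \<in> L1 \<Longrightarrow> z \<in> res_set bc v \<Longrightarrow> f \<in> L1 \<Longrightarrow> continuous_on {0..pi} (green bc v z f)"
  by (rule bvp_continuous[OF green_bvp])

lemma green_L1:
  "v \<in> L1 \<Longrightarrow> z \<in> res_set bc v \<Longrightarrow> f \<in> L1 \<Longrightarrow> green bc v z f \<in> L1"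
  by (rule L1_continuous[OF green_continuous])

lemma green_bounded:
  assumes "v \<in> L1" "z \<in> res_set bc v"
  obtains K where "K \<ge> 0" "\<And>f x. f \<in> L1 \<Longrightarrow> x \<in> {0..pi} \<Longrightarrow> cmod (green bc v z f x) \<le> K * norm_L1 f"
proof -
  have ne: "\<not> is_eigenvalue bc v z" using assms(2) by (simp add: res_set_def)
  obtain K where K: "K \<ge> 0" "\<And>f. f \<in> L1 \<Longrightarrow> \<exists>y. bvp bc v z f y \<and> (\<forall>x\<in>{0..pi}. cmod (y x) \<le> K * norm_L1 f)"
    using bvp_solvable[OF assms(1) ne] by blast
  have "cmod (green bc v z f x) \<le> K * norm_L1 f" if f: "f \<in> L1" and x: "x \<in> {0..pi}" for f x
  proof -
    obtain y where y: "bvp bc v z f y" "\<forall>x\<in>{0..pi}. cmod (y x) \<le> K * norm_L1 f" using K(2)[OF f] by blast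
    show ?thesis using green_eqI[OF assms f y(1) x] y(2) x by simp
  qed
  with K(1) that show ?thesis by blast
qed

lemma resolvent_eq_green:
  assumes v: "v \<in> L1" and z: "z \<in> res_set bc v" and f: "f \<in> L2" and x: "x \<in> {0..pi}"
  shows "resolvent bc v z f x = green bc v z f x"
proof -
  have f1: "f \<in> L1" using f L2_subset_L1 by blast
  define P where "P y \<longleftrightarrow> y \<in> hill_dom bc v \<and> (AE x in lebesgue_on {0..pi}. z * y x - hill_op v y x = f x)" for y
  have "P (green bc v z f)"
    unfolding P_def using bvp_imp_hill_dom[OF v f green_bvp[OF v z f1]] by blast
  then have "P (SOME y. P y)" by (rule someI[of P])
  then have "bvp bc v z f (SOME y. P y)" using hill_dom_imp_bvp unfolding P_def by blast
  then have "green bc v z f x = (SOME y. P y) x" by (rule green_eqI[OF v z f1 _ x])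
  then show ?thesis by (simp add: resolvent_def P_def)
qed

lemma green_add_cmult:
  assumes v: "v \<in> L1" and z: "z \<in> res_set bc v" and f: "f \<in> L1" and g: "g \<in> L1" and x: "x \<in> {0..pi}"
  shows "green bc v z (\<lambda>x. f x + c * g x) x = green bc v z f x + c * green bc v z g x"
  by (rule green_eqI[OF v z _ bvp_add_cmult[OF v f g green_bvp[OF v z f] green_bvp[OF v z g]] x])
     (intro L1_add L1_cmult f g)

lemma green_diff:
  assumes v: "v \<in> L1" and z: "z \<in> res_set bc v" and f: "f \<in> L1" and g: "g \<in> L1" and x: "x \<in> {0..pi}"
  shows "green bc v z (\<lambda>x. f x - g x) x = green bc v z f x - green bc v z g x"
  using green_add_cmult[OF assms, of "-1"] by simp

lemma bvp_as_green:
  assumes v: "v \<in> L1" and w: "w \<in> L1" and z': "z' \<in> res_set bc w" and f: "f \<in> L1"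
    and y: "bvp bc v z f y" and x: "x \<in> {0..pi}"
  shows "y x = green bc w z' f x + green bc w z' (\<lambda>x. (v x - z - w x + z') * y x) x"
proof -
  have g: "(\<lambda>x. (v x - z - w x + z') * y x) \<in> L1"
    by (intro L1_mult_continuous L1_add L1_diff v w L1_const bvp_continuous[OF y])
  have "y x = green bc w z' (\<lambda>x. f x + (v x - z - w x + z') * y x) x"
    by (rule green_eqI[symmetric, OF w z' L1_add[OF f g] bvp_shift[OF y] x])
  also have "\<dots> = green bc w z' f x + 1 * green bc w z' (\<lambda>x. (v x - z - w x + z') * y x) x"
    using green_add_cmult[OF w z' f g x, of 1] by simp
  finally show ?thesis by simp
qed

lemma resolvent_identity:
  assumes v: "v \<in> L1" and z: "z \<in> res_set bc v" and z0: "z0 \<in> res_set bc v" and f: "f \<in> L1" and x: "x \<in> {0..pi}"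
  shows "green bc v z f x = green bc v z0 f x + (z0 - z) * green bc v z0 (green bc v z f) x"
proof -
  have "green bc v z f x = green bc v z0 f x + green bc v z0 (\<lambda>x. (v x - z - v x + z0) * green bc v z f x) x"
    by (rule bvp_as_green[OF v v z0 f green_bvp[OF v z f] x])
  also have "(\<lambda>x. (v x - z - v x + z0) * green bc v z f x) = (\<lambda>x. 0 + (z0 - z) * green bc v z f x)" by (simp add: algebra_simps)
  also have "green bc v z0 (\<lambda>x. 0 + (z0 - z) * green bc v z f x) x = green bc v z0 (\<lambda>_. 0) x + (z0 - z) * green bc v z0 (green bc v z f) x"
    by (rule green_add_cmult[OF v z0 L1_const green_L1[OF v z f] x])
  also have "green bc v z0 (\<lambda>_. 0) x = 0"
    using green_diff[OF v z0 L1_const[of 0] L1_const[of 0] x] by simp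
  finally show ?thesis by simp
qed

lemma perturbation_identity:
  assumes v: "v \<in> L1" and z: "z \<in> res_set bc v" and z0: "z \<in> res_set bc (\<lambda>_. 0)" and f: "f \<in> L1" and x: "x \<in> {0..pi}"
  shows "green bc v z f x = green bc (\<lambda>_. 0) z f x + green bc (\<lambda>_. 0) z (\<lambda>x. v x * green bc v z f x) x"
  using bvp_as_green[OF v L1_const z0 f green_bvp[OF v z f] x] by simp

text \<open>Apply the hypothesis at a maximum of \<open>|y|\<close> with \<open>B\<close> equal to that maximum. Every Neumann series
argument below takes this form, as an a priori estimate for a solution known to exist.\<close>

lemma self_bound_contraction:
  assumes y: "continuous_on {0..pi} y" and b: "\<And>B x. (\<And>t. t \<in> {0..pi} \<Longrightarrow> cmod (y t) \<le> B) \<Longrightarrow> x \<in> {0..pi} \<Longrightarrow> cmod (y x) \<le> c + q * B"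
    and q: "q \<le> 1/2" and x: "x \<in> {0..pi}"
  shows "cmod (y x) \<le> 2 * c"
proof -
  have "\<exists>x\<in>{0..pi}. \<forall>t\<in>{0..pi}. cmod (y t) \<le> cmod (y x)"
    by (rule continuous_attains_sup) (auto intro!: continuous_intros y)
  then obtain x0 where x0: "x0 \<in> {0..pi}" "\<And>t. t \<in> {0..pi} \<Longrightarrow> cmod (y t) \<le> cmod (y x0)" by blast
  have "cmod (y x0) \<le> c + q * cmod (y x0)" by (rule b[OF x0(2) x0(1)])
  also have "q * cmod (y x0) \<le> 1/2 * cmod (y x0)" using q by (intro mult_right_mono) auto
  finally have "cmod (y x0) \<le> 2 * c" by simp
  then show ?thesis using x0(2)[OF x] by simp
qed

text \<open>For \<open>z\<close> near \<open>z0\<close> a solution at \<open>z\<close> is a solution at \<open>z0\<close> with the small extra right-hand side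
\<open>(z0 - z) y\<close>. This excludes eigenvalues and bounds the resolvent uniformly.\<close>

lemma res_set_local:
  assumes v: "v \<in> L1" and z0: "z0 \<in> res_set bc v"
  obtains K d where "K \<ge> 0" "d > 0" "ball z0 d \<subseteq> res_set bc v"
    "\<And>z f x. z \<in> ball z0 d \<Longrightarrow> f \<in> L1 \<Longrightarrow> x \<in> {0..pi} \<Longrightarrow> cmod (green bc v z f x) \<le> K * norm_L1 f"
proof -
  obtain K where K: "K \<ge> 0" "\<And>f x. f \<in> L1 \<Longrightarrow> x \<in> {0..pi} \<Longrightarrow> cmod (green bc v z0 f x) \<le> K * norm_L1 f"
    using green_bounded[OF v z0] by blast
  define d where "d = 1 / (2 * (K + 1))"
  have d: "d > 0" using K by (simp add: d_def)
  have Kd: "K * cmod (z0 - z) \<le> 1/2" if "z \<in> ball z0 d" for z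
  proof -
    have "K * cmod (z0 - z) \<le> (K + 1) * d" using that K d by (intro mult_mono) (auto simp: dist_norm)
    also have "\<dots> = 1/2" using K by (simp add: d_def field_simps)
    finally show ?thesis .
  qed
  have main: "cmod (y x) \<le> 2 * (K * norm_L1 f)"
    if z: "z \<in> ball z0 d" and f: "f \<in> L1" and y: "bvp bc v z f y" and x: "x \<in> {0..pi}" for z f y x
  proof (rule self_bound_contraction[OF bvp_continuous[OF y] _ Kd[OF z] x])
    fix B x assume B: "\<And>t. t \<in> {0..pi} \<Longrightarrow> cmod (y t) \<le> B" and x: "x \<in> {0..pi}"
    note cy = bvp_continuous[OF y]
    have g: "(\<lambda>x. (v x - z - v x + z0) * y x) \<in> L1"
      by (intro L1_mult_continuous L1_add L1_diff v L1_const cy)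
    have "norm_L1 (\<lambda>x. (v x - z - v x + z0) * y x) = cmod (z0 - z) * norm_L1 y"
      using norm_L1_cmult[of "z0 - z" y] by (simp add: algebra_simps)
    also have "\<dots> \<le> cmod (z0 - z) * B" by (intro mult_left_mono norm_L1_le_bound cy B) auto
    finally have "K * norm_L1 (\<lambda>x. (v x - z - v x + z0) * y x) \<le> K * (cmod (z0 - z) * B)" using K by (intro mult_left_mono)
    moreover have "cmod (y x) \<le> cmod (green bc v z0 f x) + cmod (green bc v z0 (\<lambda>x. (v x - z - v x + z0) * y x) x)"
      unfolding bvp_as_green[OF v v z0 f y x] by (rule norm_triangle_ineq)
    ultimately show "cmod (y x) \<le> K * norm_L1 f + K * cmod (z0 - z) * B"
      using K(2)[OF f x] K(2)[OF g x] by simp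
  qed
  have sub: "ball z0 d \<subseteq> res_set bc v"
  proof
    fix z assume z: "z \<in> ball z0 d"
    show "z \<in> res_set bc v"
      unfolding res_set_def is_eigenvalue_iff_bvp[OF v]
      using main[OF z L1_const[of 0]] by auto
  qed
  show ?thesis
  proof (rule that[OF _ d sub])
    show "2 * K \<ge> 0" using K by simp
    fix z f x assume z: "z \<in> ball z0 d" and f: "f \<in> L1" and x: "x \<in> {0..pi}"
    show "cmod (green bc v z f x) \<le> 2 * K * norm_L1 f"
      using main[OF z f green_bvp[OF v _ f] x] sub z by auto
  qed
qed

lemma open_res_set: "v \<in> L1 \<Longrightarrow> open (res_set bc v)"
  unfolding open_contains_ball using res_set_local by metis

lemma green_uniform_tendsto:
  assumes v: "v \<in> L1" and z0: "z0 \<in> res_set bc v" and f: "f \<in> L1" and e: "e > 0"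
  shows "eventually (\<lambda>z. z \<in> res_set bc v \<and> (\<forall>x\<in>{0..pi}. cmod (green bc v z f x - green bc v z0 f x) < e)) (nhds z0)"
proof -
  obtain K d where K: "K \<ge> 0" "d > 0" "ball z0 d \<subseteq> res_set bc v"
    "\<And>z f x. z \<in> ball z0 d \<Longrightarrow> f \<in> L1 \<Longrightarrow> x \<in> {0..pi} \<Longrightarrow> cmod (green bc v z f x) \<le> K * norm_L1 f"
    using res_set_local[OF v z0] by blast
  define L where "L = K * (K * norm_L1 f) + 1"
  have L: "L > 0" using K norm_L1_nonneg[of f] by (auto simp: L_def intro!: add_nonneg_pos)
  have "cmod (green bc v z f x - green bc v z0 f x) < e"
    if z: "z \<in> ball z0 (min d (e / L))" and x: "x \<in> {0..pi}" for z x
  proof -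
    have zd: "z \<in> ball z0 d" and zr: "z \<in> res_set bc v" using z K by auto
    have "norm_L1 (green bc v z f) \<le> K * norm_L1 f"
      by (rule norm_L1_le_bound[OF green_continuous[OF v zr f]]) (rule K(4)[OF zd f])
    then have "K * norm_L1 (green bc v z f) \<le> K * (K * norm_L1 f)" using K by (intro mult_left_mono)
    then have b: "cmod (green bc v z0 (green bc v z f) x) \<le> L"
      using K(4)[OF _ green_L1[OF v zr f] x, of z0] K(2) by (simp add: L_def)
    have "cmod (green bc v z f x - green bc v z0 f x) = cmod (z0 - z) * cmod (green bc v z0 (green bc v z f) x)"
      using resolvent_identity[OF v zr z0 f x] by (simp add: norm_mult)
    also have "\<dots> \<le> cmod (z0 - z) * L" by (intro mult_left_mono b) auto
    also have "\<dots> < e / L * L" using z L by (intro mult_strict_right_mono) (auto simp: dist_norm)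
    finally show ?thesis using L by simp
  qed
  then show ?thesis
    unfolding eventually_nhds_metric using K L e
    by (intro exI[of _ "min d (e / L)"]) (auto simp: dist_commute)
qed

lemma green_jointly_continuous:
  assumes v: "v \<in> L1" and f: "f \<in> L1"
  shows "continuous_on (res_set bc v \<times> {0..pi}) (\<lambda>(z, x). green bc v z f x)"
  unfolding continuous_on_def
proof (intro ballI)
  fix p assume "p \<in> res_set bc v \<times> {0..pi}"
  then obtain z0 x0 where p: "p = (z0, x0)" and z0: "z0 \<in> res_set bc v" and x0: "x0 \<in> {0..pi}" by auto
  show "((\<lambda>(z, x). green bc v z f x) \<longlongrightarrow> (case p of (z, x) \<Rightarrow> green bc v z f x)) (at p within res_set bc v \<times> {0..pi})"
    unfolding p prod.case tendsto_iff
  proof (intro allI impI)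
    fix e :: real assume e: "e > 0"
    have "eventually (\<lambda>z. z \<in> res_set bc v \<and> (\<forall>x\<in>{0..pi}. cmod (green bc v z f x - green bc v z0 f x) < e/2)) (nhds z0)"
      using green_uniform_tendsto[OF v z0 f, of "e/2"] e by simp
    then obtain d1 where d1: "d1 > 0" "\<And>z x. dist z z0 < d1 \<Longrightarrow> x \<in> {0..pi} \<Longrightarrow> cmod (green bc v z f x - green bc v z0 f x) < e/2"
      unfolding eventually_nhds_metric by blast
    obtain d2 where d2: "d2 > 0" "\<And>x. x \<in> {0..pi} \<Longrightarrow> dist x x0 < d2 \<Longrightarrow> dist (green bc v z0 f x) (green bc v z0 f x0) < e/2"
      using green_continuous[OF v z0 f] x0 e unfolding continuous_on_iff by (meson half_gt_zero)
    have "dist (green bc v z f x) (green bc v z0 f x0) < e"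
      if zx: "x \<in> {0..pi}" "dist (z, x) (z0, x0) < min d1 d2" for z x
    proof -
      have "dist z z0 < d1" "dist x x0 < d2"
        using zx(2) dist_fst_le[of "(z,x)" "(z0,x0)"] dist_snd_le[of "(z,x)" "(z0,x0)"] by auto
      then have "dist (green bc v z f x) (green bc v z0 f x) < e/2" "dist (green bc v z0 f x) (green bc v z0 f x0) < e/2"
        using d1(2) d2(2) zx(1) by (auto simp: dist_norm)
      then show ?thesis using dist_triangle_half_l[of "green bc v z f x"] by (metis dist_commute dist_triangle_half_l)
    qed
    then show "eventually (\<lambda>q. dist (case q of (z, x) \<Rightarrow> green bc v z f x) (green bc v z0 f x0) < e) (at (z0, x0) within res_set bc v \<times> {0..pi})"
      unfolding eventually_at using d1(1) d2(1) by (intro exI[of _ "min d1 d2"]) auto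
  qed
qed

text \<open>By the resolvent identity the difference quotient is \<open>- G\<^sub>z\<^sub>0 G\<^sub>z f\<close>, which tends to \<open>- G\<^sub>z\<^sub>0 G\<^sub>z\<^sub>0 f\<close>.\<close>

lemma green_holomorphic:
  assumes v: "v \<in> L1" and f: "f \<in> L1" and x: "x \<in> {0..pi}"
  shows "(\<lambda>z. green bc v z f x) holomorphic_on res_set bc v"
  unfolding holomorphic_on_def
proof
  fix z0 assume z0: "z0 \<in> res_set bc v"
  obtain K where K: "K \<ge> 0" "\<And>f x. f \<in> L1 \<Longrightarrow> x \<in> {0..pi} \<Longrightarrow> cmod (green bc v z0 f x) \<le> K * norm_L1 f"
    using green_bounded[OF v z0] by blast
  have "((\<lambda>z. green bc v z f x) has_field_derivative (- green bc v z0 (green bc v z0 f) x)) (at z0)"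
    unfolding has_field_derivative_iff
  proof (rule tendstoI)
    fix e :: real assume e: "e > 0"
    have e': "e / (K + 1) > 0" using e K by simp
    have "eventually (\<lambda>z. z \<in> res_set bc v \<and> (\<forall>x\<in>{0..pi}. cmod (green bc v z f x - green bc v z0 f x) < e / (K + 1))) (at z0)"
      using green_uniform_tendsto[OF v z0 f e'] by (simp add: eventually_at_filter eventually_mono)
    moreover have "eventually (\<lambda>z. z \<noteq> z0) (at z0)" by (simp add: eventually_at_filter)
    ultimately show "eventually (\<lambda>z. dist ((green bc v z f x - green bc v z0 f x) / (z - z0)) (- green bc v z0 (green bc v z0 f) x) < e) (at z0)"
    proof eventually_elim
      case (elim z)
      then have z: "z \<in> res_set bc v" and near: "\<And>x. x \<in> {0..pi} \<Longrightarrow> cmod (green bc v z f x - green bc v z0 f x) \<le> e / (K + 1)" and ne: "z \<noteq> z0"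
        by (auto intro: less_imp_le)
      have "(green bc v z f x - green bc v z0 f x) / (z - z0) = - green bc v z0 (green bc v z f) x"
        using resolvent_identity[OF v z z0 f x] ne by (simp add: field_simps)
      then have "dist ((green bc v z f x - green bc v z0 f x) / (z - z0)) (- green bc v z0 (green bc v z0 f) x) =
         cmod (green bc v z0 (green bc v z f) x - green bc v z0 (green bc v z0 f) x)"
        by (simp add: dist_norm norm_minus_commute)
      also have "\<dots> = cmod (green bc v z0 (\<lambda>x. green bc v z f x - green bc v z0 f x) x)"
        using green_diff[OF v z0 green_L1[OF v z f] green_L1[OF v z0 f] x] by simp
      also have "\<dots> \<le> K * norm_L1 (\<lambda>x. green bc v z f x - green bc v z0 f x)"
        by (rule K(2)[OF L1_diff[OF green_L1[OF v z f] green_L1[OF v z0 f]] x])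
      also have "\<dots> \<le> K * (e / (K + 1))"
        using K by (intro mult_left_mono norm_L1_le_bound continuous_intros green_continuous v z z0 f near)
      also have "\<dots> < e" using K e by (simp add: field_simps)
      finally show ?case .
    qed
  qed
  then show "(\<lambda>z. green bc v z f x) field_differentiable at z0 within res_set bc v"
    using field_differentiable_at_within field_differentiable_def by blast
qed

text \<open>If \<open>k\<^sup>2\<close> were in the resolvent set, solving with right-hand side \<open>e\<^sub>k\<close> would give the contradiction
\<open>0 = 1\<close> for the coefficient of index \<open>k\<close>. Outside the squares the bound of the free resolvent forces
homogeneous solutions to vanish.\<close>

lemma res_set_free: "res_set bc (\<lambda>_. 0) = {z. \<forall>k\<in>idx bc. z \<noteq> of_int k ^ 2}"
proof (intro set_eqI iffI)
  fix z assume z: "z \<in> res_set bc (\<lambda>_. 0)"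
  have "z \<noteq> of_int k ^ 2" if k: "k \<in> idx bc" for k
  proof
    assume eq: "z = of_int k ^ 2"
    have e: "eig bc k \<in> L1" by (intro L1_continuous continuous_intros)
    show False
      using bvp_fcoeff[OF e green_bvp[OF L1_const z e] k] fcoeff_eig[OF k k] eq by simp
  qed
  then show "z \<in> {z. \<forall>k\<in>idx bc. z \<noteq> of_int k ^ 2}" by blast
next
  fix z :: complex assume "z \<in> {z. \<forall>k\<in>idx bc. z \<noteq> of_int k ^ 2}"
  then have z: "z \<noteq> of_int k ^ 2" if "k \<in> idx bc" for k using that by blast
  show "z \<in> res_set bc (\<lambda>_. 0)"
    unfolding res_set_def is_eigenvalue_iff_bvp[OF L1_const]
    using bvp_free_bound[OF L1_const[of 0] _ z] by fastforce
qed

lemma green_free_bound: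
  assumes "z \<in> res_set bc (\<lambda>_. 0)" "f \<in> L1" "x \<in> {0..pi}"
  shows "cmod (green bc (\<lambda>_. 0) z f x) \<le> 2 * rho bc z * norm_L1 f"
  by (rule bvp_free_bound[OF assms(2) green_bvp[OF L1_const assms(1,2)] _ assms(3)])
     (use assms(1) in \<open>auto simp: res_set_free\<close>)

lemma rho_nonneg: "rho bc z \<ge> 0"
  unfolding rho_def by (rule infsum_nonneg) auto

lemma bvp_small_rho_bound:
  assumes v: "v \<in> L1" and z: "z \<in> res_set bc (\<lambda>_. 0)" and small: "2 * rho bc z * norm_L1 v \<le> 1/2"
    and f: "f \<in> L1" and y: "bvp bc v z f y" and x: "x \<in> {0..pi}"
  shows "cmod (y x) \<le> 4 * rho bc z * norm_L1 f"
proof -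
  have "cmod (y x) \<le> 2 * (2 * rho bc z * norm_L1 f)"
  proof (rule self_bound_contraction[OF bvp_continuous[OF y] _ small x])
    fix B x assume B: "\<And>t. t \<in> {0..pi} \<Longrightarrow> cmod (y t) \<le> B" and x: "x \<in> {0..pi}"
    note cy = bvp_continuous[OF y]
    have g: "(\<lambda>x. v x * y x) \<in> L1" by (rule L1_mult_continuous[OF v cy])
    have "2 * rho bc z * norm_L1 (\<lambda>x. v x * y x) \<le> 2 * rho bc z * (norm_L1 v * B)"
      by (intro mult_left_mono norm_L1_mult_le[OF v cy] B) (auto simp: rho_nonneg)
    moreover have "y x = green bc (\<lambda>_. 0) z f x + green bc (\<lambda>_. 0) z (\<lambda>x. v x * y x) x"
      using bvp_as_green[OF v L1_const z f y x] by simp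
    ultimately show "cmod (y x) \<le> 2 * rho bc z * norm_L1 f + 2 * rho bc z * norm_L1 v * B"
      using green_free_bound[OF z f x] green_free_bound[OF z g x]
        norm_triangle_ineq[of "green bc (\<lambda>_. 0) z f x" "green bc (\<lambda>_. 0) z (\<lambda>x. v x * y x) x"]
      by (simp add: mult.assoc)
  qed
  then show ?thesis by simp
qed

lemma res_set_small_rho:
  assumes v: "v \<in> L1" and z: "z \<in> res_set bc (\<lambda>_. 0)" and small: "2 * rho bc z * norm_L1 v \<le> 1/2"
  shows "z \<in> res_set bc v"
  unfolding res_set_def is_eigenvalue_iff_bvp[OF v]
  using bvp_small_rho_bound[OF v z small L1_const[of 0]] by fastforce

text \<open>The perturbation identity, used twice, writes the remainder as \<open>G\<^sup>0\<^sub>z v G\<^sup>0\<^sub>z v G\<^sub>z f\<close>. Each free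
resolvent costs \<open>2 \<rho>(z)\<close>, and the perturbed one \<open>4 \<rho>(z)\<close>.\<close>

theorem second_order_remainder_bound:
  assumes v: "v \<in> L1" and z: "z \<in> res_set bc (\<lambda>_. 0)" and small: "2 * rho bc z * norm_L1 v \<le> 1/2"
    and f: "f \<in> L1" and x: "x \<in> {0..pi}"
  shows "cmod (green bc v z f x - green bc (\<lambda>_. 0) z f x - green bc (\<lambda>_. 0) z (\<lambda>x. v x * green bc (\<lambda>_. 0) z f x) x)
     \<le> 16 * (norm_L1 v)\<^sup>2 * rho bc z ^ 3 * norm_L1 f"
proof -
  let ?G = "green bc (\<lambda>_. 0) z" and ?y = "green bc v z f"
  have zv: "z \<in> res_set bc v" by (rule res_set_small_rho[OF v z small])
  have cy: "continuous_on {0..pi} ?y" by (rule green_continuous[OF v zv f])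
  have cG: "continuous_on {0..pi} (?G g)" if "g \<in> L1" for g by (rule green_continuous[OF L1_const z that])
  have vy: "(\<lambda>x. v x * ?y x) \<in> L1" by (rule L1_mult_continuous[OF v cy])
  have vf: "(\<lambda>x. v x * ?G f x) \<in> L1" by (rule L1_mult_continuous[OF v cG[OF f]])
  have vvy: "(\<lambda>x. v x * ?G (\<lambda>x. v x * ?y x) x) \<in> L1" by (rule L1_mult_continuous[OF v cG[OF vy]])
  have "?y x - ?G f x = ?G (\<lambda>x. v x * ?y x) x" using perturbation_identity[OF v zv z f x] by simp
  then have "?y x - ?G f x - ?G (\<lambda>x. v x * ?G f x) x = ?G (\<lambda>x. v x * ?y x - v x * ?G f x) x"
    using green_diff[OF L1_const z vy vf x] by simp
  also have "cmod \<dots> \<le> 2 * rho bc z * norm_L1 (\<lambda>x. v x * ?y x - v x * ?G f x)"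
    by (rule green_free_bound[OF z L1_diff[OF vy vf] x])
  also have "norm_L1 (\<lambda>x. v x * ?y x - v x * ?G f x) = norm_L1 (\<lambda>x. v x * (?y x - ?G f x))"
    by (simp add: right_diff_distrib)
  also have "\<dots> \<le> norm_L1 v * (2 * rho bc z * (norm_L1 v * (4 * rho bc z * norm_L1 f)))"
  proof (rule norm_L1_mult_le[OF v continuous_on_diff[OF cy cG[OF f]]])
    fix t assume t: "t \<in> {0..pi}"
    have "cmod (?y t - ?G f t) = cmod (?G (\<lambda>x. v x * ?y x) t)" using perturbation_identity[OF v zv z f t] by simp
    also have "\<dots> \<le> 2 * rho bc z * norm_L1 (\<lambda>x. v x * ?y x)" by (rule green_free_bound[OF z vy t])
    also have "\<dots> \<le> 2 * rho bc z * (norm_L1 v * (4 * rho bc z * norm_L1 f))"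
      by (intro mult_left_mono norm_L1_mult_le[OF v cy] bvp_small_rho_bound[OF v z small f green_bvp[OF v zv f]]) (auto simp: rho_nonneg)
    finally show "cmod (?y t - ?G f t) \<le> 2 * rho bc z * (norm_L1 v * (4 * rho bc z * norm_L1 f))" .
  qed
  finally have "cmod (?y x - ?G f x - ?G (\<lambda>x. v x * ?G f x) x) \<le> 2 * rho bc z * (norm_L1 v * (2 * rho bc z * (norm_L1 v * (4 * rho bc z * norm_L1 f))))"
    by (simp add: mult_left_mono rho_nonneg)
  also have "\<dots> = 16 * (norm_L1 v)\<^sup>2 * rho bc z ^ 3 * norm_L1 f"
    by (simp add: power2_eq_square power3_eq_cube)
  finally show ?thesis .
qed

section \<open>Sums over the free spectrum\<close>

lemma summable_on_nat_bounded:
  fixes g :: "nat \<Rightarrow> real"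
  assumes g: "\<And>n. g n \<ge> 0" and B: "\<And>K. (\<Sum>n<K. g n) \<le> B"
  shows "g summable_on UNIV" "infsum g UNIV \<le> B"
proof -
  have s: "summable g" by (rule summableI_nonneg_bounded[OF g B])
  then show u: "g summable_on UNIV" using g by (subst summable_on_UNIV_nonneg_real_iff) auto
  have "infsum g UNIV = suminf g"
    by (rule sums_unique[OF has_sum_imp_sums[OF has_sum_infsum[OF u]]])
  also have "\<dots> \<le> B" by (rule suminf_le_const[OF s B])
  finally show "infsum g UNIV \<le> B" .
qed

lemma summable_on_int_bounded:
  fixes g :: "nat \<Rightarrow> real"
  assumes g: "\<And>n. g n \<ge> 0" and B: "\<And>K. (\<Sum>n<K. g n) \<le> B"
  shows "(\<lambda>k::int. g (nat \<bar>k\<bar>)) summable_on A" "(\<Sum>\<^sub>\<infinity>k\<in>A. g (nat \<bar>k\<bar>)) \<le> 2 * B"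
proof -
  note s = summable_on_nat_bounded[OF g B]
  note i = summable_on_int_abs[OF g s(1)]
  show A: "(\<lambda>k::int. g (nat \<bar>k\<bar>)) summable_on A" by (rule summable_on_subset_banach[OF i(1)]) auto
  have "(\<Sum>\<^sub>\<infinity>k\<in>A. g (nat \<bar>k\<bar>)) \<le> (\<Sum>\<^sub>\<infinity>k::int. g (nat \<bar>k\<bar>))"
    by (rule infsum_mono2[OF A i(1)]) (auto simp: g)
  also have "\<dots> \<le> 2 * B" using i(2) s(2) by simp
  finally show "(\<Sum>\<^sub>\<infinity>k\<in>A. g (nat \<bar>k\<bar>)) \<le> 2 * B" .
qed

text \<open>Both inequalities compare a term with an integral. With \<open>u\<close> and \<open>w\<close> the cube roots of \<open>n + 1\<close> and
\<open>n\<close> they follow from \<open>u - w = 1 / (u\<^sup>2 + u w + w\<^sup>2)\<close>, and sums over \<open>n\<close> then telescope.\<close>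

lemma cube_root_step:
  fixes n :: nat
  assumes "n \<ge> 1"
  shows "1 / root 3 (real (Suc n)) ^ 2 \<le> 3 * (root 3 (real (Suc n)) - root 3 (real n))"
    "1 / root 3 (real (Suc n)) ^ 4 \<le> 3 * (1 / root 3 (real n) - 1 / root 3 (real (Suc n)))"
proof -
  define u where "u = root 3 (real (Suc n))"
  define w where "w = root 3 (real n)"
  have uw: "w > 0" "w \<le> u" "u > 0" using assms by (auto simp: u_def w_def)
  have "u ^ 3 = real n + 1" "w ^ 3 = real n" by (simp_all add: u_def w_def)
  then have "(u - w) * (u^2 + u * w + w^2) = 1" by (simp add: algebra_simps power2_eq_square power3_eq_cube)
  then have d: "u - w = 1 / (u^2 + u * w + w^2)" using uw
    by (metis nonzero_mult_div_cancel_right mult_zero_right zero_neq_one)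
  have "u * w \<le> u * u" "w * w \<le> u * u" using uw by (auto intro: mult_mono)
  then have le: "u^2 + u * w + w^2 \<le> 3 * u^2" unfolding power2_eq_square by linarith
  have pos: "u^2 + u * w + w^2 > 0" using uw by (intro add_pos_pos mult_pos_pos zero_less_power) auto
  have "1 / (3 * u^2) \<le> u - w" unfolding d using le pos uw by (intro divide_left_mono) auto
  then show 1: "1 / root 3 (real (Suc n)) ^ 2 \<le> 3 * (root 3 (real (Suc n)) - root 3 (real n))"
    unfolding u_def[symmetric] w_def[symmetric] using uw by (simp add: field_simps)
  have "1 / u^4 = (1 / u^2) * (1 / (u * u))" by (simp add: power2_eq_square power4_eq_xxxx)
  also have "\<dots> \<le> (3 * (u - w)) * (1 / (u * w))"
    using 1 uw by (intro mult_mono divide_left_mono) (auto simp: u_def w_def)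
  also have "\<dots> = 3 * (1 / w - 1 / u)" using uw by (simp add: field_simps)
  finally show "1 / root 3 (real (Suc n)) ^ 4 \<le> 3 * (1 / root 3 (real n) - 1 / root 3 (real (Suc n)))"
    by (simp add: u_def w_def)
qed

lemma sum_inverse_cube_root_square: "(\<Sum>m=1..M. 1 / root 3 (real m) ^ 2) \<le> 3 * root 3 (real M)"
proof (induction M)
  case (Suc M)
  show ?case
  proof (cases "M \<ge> 1")
    case True
    then show ?thesis using Suc cube_root_step(1)[OF True] by (simp add: algebra_simps)
  next
    case False
    then have "M = 0" by simp
    then show ?thesis by simp
  qed
qed simp

lemma sum_inverse_cube_root_fourth:
  assumes "N \<ge> 1"
  shows "(\<Sum>p=Suc N..N+K. 1 / root 3 (real p) ^ 4) \<le> 3 / root 3 (real N) - 3 / root 3 (real (N + K))"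
proof (induction K)
  case (Suc K)
  have "1 / root 3 (real (Suc (N + K))) ^ 4 \<le> 3 * (1 / root 3 (real (N + K)) - 1 / root 3 (real (Suc (N + K))))"
    by (rule cube_root_step(2)) (use assms in simp)
  then show ?case using Suc by (simp add: algebra_simps)
qed simp

text \<open>A lower bound for the distance from \<open>N\<^sup>2 + N\<close> to \<open>n\<^sup>2\<close> that factors conveniently: near the line it
is \<open>N\<close> times the distance of \<open>n\<close> to the nearest index on the other side, far to the right it is
quadratic.\<close>

definition gap :: "nat \<Rightarrow> nat \<Rightarrow> real" where
  "gap N n = (if n \<le> N then real N * real (N + 1 - n) else real N * real (n - N) + (real (n - N))\<^sup>2)"

lemma gap_ge_1: "N \<ge> 1 \<Longrightarrow> gap N n \<ge> 1"
proof -
  assume N: "N \<ge> 1"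
  show ?thesis
  proof (cases "n \<le> N")
    case True
    then have "1 * 1 \<le> real N * real (N + 1 - n)" using N by (intro mult_mono) auto
    then show ?thesis using True by (simp add: gap_def)
  next
    case False
    then have "1 * 1 \<le> real N * real (n - N)" using N by (intro mult_mono) auto
    then show ?thesis using False by (simp add: gap_def add_increasing2)
  qed
qed

lemma gap_le:
  fixes k :: int
  shows "gap N (nat \<bar>k\<bar>) \<le> \<bar>(real N)\<^sup>2 + real N - (of_int k)\<^sup>2\<bar>"
proof -
  define n where "n = nat \<bar>k\<bar>"
  have k2: "(real_of_int k)\<^sup>2 = (real n)\<^sup>2" by (simp add: n_def of_nat_nat)
  show ?thesis
  proof (cases "n \<le> N")
    case True
    have "(real n)\<^sup>2 \<le> real N * real n" using True by (simp add: power2_eq_square mult_right_mono)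
    moreover have "real N * real (N + 1 - n) = (real N)\<^sup>2 + real N - real N * real n"
      using True by (simp add: of_nat_diff algebra_simps power2_eq_square)
    ultimately have "real N * real (N + 1 - n) \<le> (real N)\<^sup>2 + real N - (real n)\<^sup>2" by linarith
    then show ?thesis using True unfolding n_def[symmetric] k2 by (simp add: gap_def)
  next
    case False
    define p where "p = n - N"
    have n: "real n = real N + real p" using False by (simp add: p_def)
    have p: "real p \<ge> 1" using False by (simp add: p_def)
    have "real N * 1 \<le> real N * real p" using p by (intro mult_left_mono) auto
    then have "real N * real p + (real p)\<^sup>2 \<le> (real n)\<^sup>2 - ((real N)\<^sup>2 + real N)"
      unfolding n by (simp add: power2_eq_square algebra_simps)
    then show ?thesis using False unfolding n_def[symmetric] k2 by (simp add: gap_def p_def)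
  qed
qed

text \<open>The weight \<open>gap\<^sup>-\<^sup>2\<^sup>/\<^sup>3\<close>. The exponent is dictated by the estimate of the integral of \<open>\<rho>\<^sup>3\<close>, where the
integral of \<open>|gap + i t|\<^sup>-\<^sup>3\<close> over \<open>t\<close> produces \<open>gap\<^sup>-\<^sup>2\<close>, the cube of the weight.\<close>

definition gap_weight :: "nat \<Rightarrow> nat \<Rightarrow> real" where
  "gap_weight N n = 1 / root 3 (gap N n) ^ 2"

lemma gap_weight_pos: "N \<ge> 1 \<Longrightarrow> gap_weight N n > 0"
  using gap_ge_1[of N n] by (simp add: gap_weight_def)

lemma gap_weight_cube: "N \<ge> 1 \<Longrightarrow> gap_weight N n ^ 3 = 1 / gap N n ^ 2"
proof -
  assume "N \<ge> 1"
  have "root 3 (gap N n) ^ 3 = gap N n" by (simp add: odd_real_root_pow)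
  then have "(root 3 (gap N n) ^ 2) ^ 3 = gap N n ^ 2"
    by (metis power_mult mult.commute)
  then show ?thesis by (simp add: gap_weight_def power_divide)
qed

text \<open>Three ranges: up to \<open>N\<close> and from there to \<open>2 N\<close> the gap is at least \<open>N\<close> times a distance, which
gives a sum of \<open>m\<^sup>-\<^sup>2\<^sup>/\<^sup>3\<close> over at most \<open>N + 1\<close> terms; beyond \<open>2 N\<close> it is at least the square of the
distance, which gives a convergent tail.\<close>

lemma sum_gap_weight_le:
  assumes N: "N \<ge> 1"
  shows "(\<Sum>n<K. gap_weight N n) \<le> 12 / root 3 (real N)"
proof -
  define r where "r = root 3 (real N)"
  have r: "r > 0" using N by (simp add: r_def)
  have pos: "gap_weight N n \<ge> 0" for n using gap_weight_pos[OF N, of n] by simp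
  have near: "(\<Sum>n\<le>N. gap_weight N n) \<le> 6 / r"
  proof -
    have "(\<Sum>n\<le>N. gap_weight N n) = (\<Sum>n\<le>N. 1 / r^2 * (1 / root 3 (real (Suc (N - n))) ^ 2))"
      by (rule sum.cong) (auto simp: gap_weight_def gap_def r_def real_root_mult power_mult_distrib Suc_diff_le)
    also have "\<dots> = 1 / r^2 * (\<Sum>n\<le>N. 1 / root 3 (real (Suc n)) ^ 2)"
      unfolding sum_distrib_left[symmetric]
      by (rule arg_cong[of _ _ "\<lambda>s. 1 / r^2 * s"], rule sum.reindex_bij_witness[of _ "\<lambda>i. N - i" "\<lambda>i. N - i"]) auto
    also have "(\<Sum>n\<le>N. 1 / root 3 (real (Suc n)) ^ 2) = (\<Sum>m=1..Suc N. 1 / root 3 (real m) ^ 2)"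
      by (simp only: atMost_atLeast0 One_nat_def sum.shift_bounds_cl_Suc_ivl)
    also have "\<dots> \<le> 3 * root 3 (real (Suc N))" by (rule sum_inverse_cube_root_square)
    \<comment> \<open>The 8 is a cube, so that its root leaves the factor 2.\<close>
    also have "root 3 (real (Suc N)) \<le> root 3 (8 * real N)" using N by simp
    also have "root 3 (8 * real N) = 2 * r"
      using real_root_pos2[of 3 2] by (simp add: real_root_mult r_def)
    finally show ?thesis using r by (simp add: mult_left_mono power2_eq_square field_simps)
  qed
  have mid: "(\<Sum>n=Suc N..N+N. gap_weight N n) \<le> 3 / r"
  proof -
    have "(\<Sum>n=Suc N..N+N. gap_weight N n) \<le> (\<Sum>n=Suc N..N+N. 1 / r^2 * (1 / root 3 (real (n - N)) ^ 2))"
    proof (rule sum_mono)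
      fix n assume n: "n \<in> {Suc N..N+N}"
      have "root 3 (real N * real (n - N)) \<le> root 3 (gap N n)" using n by (simp add: gap_def)
      then have "root 3 (real N * real (n - N)) ^ 2 \<le> root 3 (gap N n) ^ 2" by (intro power_mono) auto
      then have "gap_weight N n \<le> 1 / root 3 (real N * real (n - N)) ^ 2"
        unfolding gap_weight_def using n N gap_ge_1[OF N, of n] by (intro divide_left_mono) auto
      then show "gap_weight N n \<le> 1 / r^2 * (1 / root 3 (real (n - N)) ^ 2)"
        by (simp add: r_def real_root_mult power_mult_distrib)
    qed
    also have "\<dots> = 1 / r^2 * (\<Sum>m=1..N. 1 / root 3 (real m) ^ 2)"
      unfolding sum_distrib_left[symmetric]
      using sum.shift_bounds_cl_nat_ivl[of "\<lambda>n. 1 / root 3 (real (n - N)) ^ 2" 1 N N] by (simp add: add.commute)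
    also have "\<dots> \<le> 1 / r^2 * (3 * r)"
      unfolding r_def by (intro mult_left_mono sum_inverse_cube_root_square) auto
    finally show ?thesis using r by (simp add: power2_eq_square)
  qed
  have far: "(\<Sum>n=Suc (N+N)..N+N+K. gap_weight N n) \<le> 3 / r"
  proof -
    have "(\<Sum>n=Suc (N+N)..N+N+K. gap_weight N n) \<le> (\<Sum>n=Suc (N+N)..N+N+K. 1 / root 3 (real (n - N)) ^ 4)"
    proof (rule sum_mono)
      fix n assume n: "n \<in> {Suc (N+N)..N+N+K}"
      have "root 3 (real (n - N) * real (n - N)) \<le> root 3 (gap N n)" using n by (simp add: gap_def power2_eq_square)
      then have "root 3 (real (n - N) * real (n - N)) ^ 2 \<le> root 3 (gap N n) ^ 2" by (intro power_mono) auto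
      then have "gap_weight N n \<le> 1 / root 3 (real (n - N) * real (n - N)) ^ 2"
        unfolding gap_weight_def using n N gap_ge_1[OF N, of n] by (intro divide_left_mono) auto
      then show "gap_weight N n \<le> 1 / root 3 (real (n - N)) ^ 4"
        by (simp add: real_root_mult power_mult_distrib power2_eq_square power4_eq_xxxx)
    qed
    also have "\<dots> = (\<Sum>p=Suc N..N+K. 1 / root 3 (real p) ^ 4)"
      using sum.shift_bounds_cl_nat_ivl[of "\<lambda>n. 1 / root 3 (real (n - N)) ^ 4" "Suc N" N "N+K"] by (simp add: ac_simps)
    also have "\<dots> \<le> 3 / r - 3 / root 3 (real (N + K))" unfolding r_def by (rule sum_inverse_cube_root_fourth[OF N])
    also have "\<dots> \<le> 3 / r" by simp
    finally show ?thesis .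
  qed
  have "{..<K} \<subseteq> {..N} \<union> {Suc N..N+N} \<union> {Suc (N+N)..N+N+K}" by auto
  then have "(\<Sum>n<K. gap_weight N n) \<le> (\<Sum>n\<in>{..N} \<union> {Suc N..N+N} \<union> {Suc (N+N)..N+N+K}. gap_weight N n)"
    by (intro sum_mono2) (auto simp: pos)
  also have "\<dots> = (\<Sum>n\<le>N. gap_weight N n) + (\<Sum>n=Suc N..N+N. gap_weight N n) + (\<Sum>n=Suc (N+N)..N+N+K. gap_weight N n)"
    by (subst sum.union_disjoint; (subst sum.union_disjoint)?; auto)
  also have "\<dots> \<le> 6 / r + 3 / r + 3 / r" using near mid far by linarith
  finally show ?thesis by (simp add: r_def field_simps)
qed

text \<open>Convexity of the cube: its graph lies above the tangent at the weighted mean \<open>s\<close> of the ratios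
\<open>u k / w k\<close>, and the linear terms cancel in the sum.\<close>

lemma cube_sum_le_weighted:
  fixes u w :: "'a \<Rightarrow> real"
  assumes X: "finite X" and w: "\<And>k. k \<in> X \<Longrightarrow> w k > 0" and u: "\<And>k. k \<in> X \<Longrightarrow> u k \<ge> 0"
  shows "(\<Sum>k\<in>X. u k) ^ 3 \<le> (\<Sum>k\<in>X. w k)\<^sup>2 * (\<Sum>k\<in>X. u k ^ 3 / (w k)\<^sup>2)"
proof (cases "X = {}")
  case False
  define W where "W = (\<Sum>k\<in>X. w k)"
  define U where "U = (\<Sum>k\<in>X. u k)"
  have W: "W > 0" unfolding W_def using X False w by (intro sum_pos) auto
  define s where "s = U / W"
  have s: "s \<ge> 0" unfolding s_def U_def using W u by (intro divide_nonneg_pos sum_nonneg) auto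
  have tangent: "w k * s ^ 3 + 3 * s\<^sup>2 * (u k - w k * s) \<le> u k ^ 3 / (w k)\<^sup>2" if k: "k \<in> X" for k
  proof -
    define t where "t = u k / w k"
    have t: "t \<ge> 0" "u k = w k * t" using w[OF k] u[OF k] by (auto simp: t_def)
    have "0 \<le> (t - s)\<^sup>2 * (t + 2 * s)" using t s by auto
    then have "s ^ 3 + 3 * s\<^sup>2 * (t - s) \<le> t ^ 3" by (simp add: power2_eq_square power3_eq_cube algebra_simps)
    then have "w k * (s ^ 3 + 3 * s\<^sup>2 * (t - s)) \<le> w k * t ^ 3" using w[OF k] by (intro mult_left_mono) auto
    moreover have "u k ^ 3 / (w k)\<^sup>2 = w k * t ^ 3"
      using w[OF k] by (simp add: t_def power_divide power2_eq_square power3_eq_cube)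
    moreover have "w k * (s ^ 3 + 3 * s\<^sup>2 * (t - s)) = w k * s ^ 3 + 3 * s\<^sup>2 * (u k - w k * s)"
      unfolding t(2) by (simp add: algebra_simps)
    ultimately show ?thesis by simp
  qed
  have "W * s ^ 3 + 3 * s\<^sup>2 * (U - W * s) = (\<Sum>k\<in>X. w k * s ^ 3 + 3 * s\<^sup>2 * (u k - w k * s))"
    by (simp add: sum.distrib sum_subtractf sum_distrib_left sum_distrib_right W_def U_def algebra_simps)
  also have "\<dots> \<le> (\<Sum>k\<in>X. u k ^ 3 / (w k)\<^sup>2)" by (rule sum_mono) (rule tangent)
  finally have "W * s ^ 3 \<le> (\<Sum>k\<in>X. u k ^ 3 / (w k)\<^sup>2)" using W by (simp add: s_def)
  then have "W\<^sup>2 * (W * s ^ 3) \<le> W\<^sup>2 * (\<Sum>k\<in>X. u k ^ 3 / (w k)\<^sup>2)" by (intro mult_left_mono) auto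
  moreover have "W\<^sup>2 * (W * s ^ 3) = U ^ 3" using W by (simp add: s_def power_divide power2_eq_square power3_eq_cube)
  ultimately show ?thesis by (simp add: W_def U_def)
qed simp

text \<open>The function \<open>t / (A\<^sup>2 sqrt (A\<^sup>2 + t\<^sup>2))\<close> is a primitive, and it stays between \<open>- 1 / A\<^sup>2\<close> and \<open>1 / A\<^sup>2\<close>.\<close>

lemma integral_inverse_cube_le:
  assumes A: "A > 0" and L: "L \<ge> 0"
  shows "(\<lambda>t. 1 / sqrt (A\<^sup>2 + t\<^sup>2) ^ 3) integrable_on {-L..L}"
    "integral {-L..L} (\<lambda>t. 1 / sqrt (A\<^sup>2 + t\<^sup>2) ^ 3) \<le> 2 / A\<^sup>2"
proof -
  define F where "F t = t / (A\<^sup>2 * sqrt (A\<^sup>2 + t\<^sup>2))" for t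
  have pos: "A\<^sup>2 + t\<^sup>2 > 0" for t using A by (intro add_pos_nonneg) auto
  have "(F has_real_derivative 1 / sqrt (A\<^sup>2 + t\<^sup>2) ^ 3) (at t within S)" for t S
  proof -
    define s where "s = sqrt (A\<^sup>2 + t\<^sup>2)"
    have s: "s > 0" "s * s = A\<^sup>2 + t\<^sup>2" using pos[of t] by (auto simp: s_def)
    have "(F has_real_derivative (1 * (A\<^sup>2 * s) - t * (A\<^sup>2 * (t / s))) / (A\<^sup>2 * s * (A\<^sup>2 * s))) (at t within S)"
      unfolding F_def s_def using pos[of t] A
      by (auto intro!: derivative_eq_intros simp: field_simps power2_eq_square)
    also have "(1 * (A\<^sup>2 * s) - t * (A\<^sup>2 * (t / s))) = A\<^sup>2 * ((s * s - t\<^sup>2) / s)"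
      using s(1) by (simp add: field_simps power2_eq_square)
    also have "\<dots> = A\<^sup>2 * (A\<^sup>2 / s)" using s(2) by simp
    also have "A\<^sup>2 * (A\<^sup>2 / s) / (A\<^sup>2 * s * (A\<^sup>2 * s)) = 1 / s ^ 3" using s(1) A by (simp add: field_simps power3_eq_cube)
    finally show ?thesis by (simp add: s_def)
  qed
  then have I: "((\<lambda>t. 1 / sqrt (A\<^sup>2 + t\<^sup>2) ^ 3) has_integral (F L - F (-L))) {-L..L}"
    using L by (intro fundamental_theorem_of_calculus) (auto simp: has_real_derivative_iff_has_vector_derivative[symmetric])
  then show "(\<lambda>t. 1 / sqrt (A\<^sup>2 + t\<^sup>2) ^ 3) integrable_on {-L..L}" by blast
  have "L \<le> sqrt (A\<^sup>2 + L\<^sup>2)" using L by (intro real_le_rsqrt) auto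
  then have "L / sqrt (A\<^sup>2 + L\<^sup>2) \<le> 1" using pos[of L] by simp
  then have "2 * (L / sqrt (A\<^sup>2 + L\<^sup>2)) / A\<^sup>2 \<le> 2 * 1 / A\<^sup>2" by (intro divide_right_mono) auto
  moreover have "F L - F (-L) = 2 * (L / sqrt (A\<^sup>2 + L\<^sup>2)) / A\<^sup>2" by (simp add: F_def)
  ultimately show "integral {-L..L} (\<lambda>t. 1 / sqrt (A\<^sup>2 + t\<^sup>2) ^ 3) \<le> 2 / A\<^sup>2"
    using integral_unique[OF I] by simp
qed

text \<open>From \<open>(M + n)\<^sup>2 \<le> 2 (M\<^sup>2 + n\<^sup>2)\<close> the terms are dominated by a telescoping sum.\<close>

lemma sum_inverse_sum_squares_le:
  assumes M: "M \<ge> 2"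
  shows "(\<Sum>n<K. 1 / ((real M)\<^sup>2 + (real n)\<^sup>2)) \<le> 2 / (real M - 1)"
proof -
  have "(\<Sum>n<K. 1 / ((real M)\<^sup>2 + (real n)\<^sup>2)) \<le> 2 / (real M - 1) - 2 / (real M + real K - 1)"
  proof (induction K)
    case (Suc K)
    define a where "a = real M + real K"
    have a: "a \<ge> 2" using M by (simp add: a_def)
    have "0 \<le> (real M - real K)\<^sup>2" by simp
    then have "a * (a - 1) \<le> 2 * ((real M)\<^sup>2 + (real K)\<^sup>2)"
      unfolding a_def using M by (simp add: power2_eq_square algebra_simps)
    moreover have "a * (a - 1) > 0" using a by (intro mult_pos_pos) auto
    ultimately have "1 / ((real M)\<^sup>2 + (real K)\<^sup>2) \<le> 2 / (a * (a - 1))"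
      by (simp add: field_simps)
    also have "\<dots> = 2 / (a - 1) - 2 / a" using a by (simp add: field_simps)
    finally have "1 / ((real M)\<^sup>2 + (real K)\<^sup>2) \<le> 2 / (real M + real K - 1) - 2 / (real M + real (Suc K) - 1)"
      by (simp add: a_def)
    then show ?case using Suc by simp
  qed simp
  also have "\<dots> \<le> 2 / (real M - 1)" using M by simp
  finally show ?thesis .
qed

lemma sqrt_step:
  assumes "n \<ge> 1"
  shows "1 / sqrt (real (Suc n)) \<le> 2 * (sqrt (real (Suc n)) - sqrt (real n))"
    "1 / (real (Suc n) * sqrt (real (Suc n))) \<le> 2 * (1 / sqrt (real n) - 1 / sqrt (real (Suc n)))"
proof -
  define u where "u = sqrt (real (Suc n))"
  define w where "w = sqrt (real n)"
  have uw: "w > 0" "w \<le> u" "u > 0" using assms by (auto simp: u_def w_def)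
  have u2: "u * u = real (Suc n)" "w * w = real n" by (simp_all add: u_def w_def)
  then have "(u - w) * (u + w) = 1" by (simp add: algebra_simps)
  then have d: "u - w = 1 / (u + w)" using uw by (simp add: field_simps)
  have "1 / (2 * u) \<le> u - w" unfolding d using uw by (intro divide_left_mono) auto
  then show 1: "1 / sqrt (real (Suc n)) \<le> 2 * (sqrt (real (Suc n)) - sqrt (real n))"
    unfolding u_def[symmetric] w_def[symmetric] using uw by (simp add: field_simps)
  have "1 / (u * u * u) = (1 / u) * (1 / (u * u))" by simp
  also have "\<dots> \<le> (2 * (u - w)) * (1 / (u * w))"
    using 1 uw by (intro mult_mono divide_left_mono) (auto simp: u_def w_def)
  also have "\<dots> = 2 * (1 / w - 1 / u)" using uw by (simp add: field_simps)
  finally show "1 / (real (Suc n) * sqrt (real (Suc n))) \<le> 2 * (1 / sqrt (real n) - 1 / sqrt (real (Suc n)))"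
    using u2 by (simp add: u_def w_def)
qed

lemma sum_inverse_sqrt: "(\<Sum>m=1..M. 1 / sqrt (real m)) \<le> 2 * sqrt (real M)"
proof (induction M)
  case (Suc M)
  show ?case
  proof (cases "M \<ge> 1")
    case True
    then show ?thesis using Suc sqrt_step(1)[OF True] by (simp add: algebra_simps)
  next
    case False
    then have "M = 0" by simp
    then show ?thesis by simp
  qed
qed simp

lemma sum_inverse_sqrt_cubed:
  assumes "N \<ge> 1"
  shows "(\<Sum>p=Suc N..N+K. 1 / (real p * sqrt (real p))) \<le> 2 / sqrt (real N) - 2 / sqrt (real (N + K))"
proof (induction K)
  case (Suc K)
  have "1 / (real (Suc (N + K)) * sqrt (real (Suc (N + K)))) \<le> 2 * (1 / sqrt (real (N + K)) - 1 / sqrt (real (Suc (N + K))))"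
    by (rule sqrt_step(2)) (use assms in simp)
  then show ?case using Suc by (simp add: algebra_simps)
qed simp

text \<open>Here \<open>n = N + p\<close> is outside and \<open>N - m\<close> inside, so \<open>p + m\<close> is their distance. The inequality
\<open>(p + m)\<^sup>2 \<ge> p (m + 1)\<close> separates the variables, and the two remaining sums are of order \<open>sqrt N\<close> and
\<open>1 / sqrt N\<close>.\<close>

lemma double_sum_far:
  assumes N: "N \<ge> 1"
  shows "(\<Sum>m\<le>N. \<Sum>p=1..P. 1 / (real (p + m) * real (N + p))) \<le> 12"
proof -
  have "(\<Sum>m\<le>N. \<Sum>p=1..P. 1 / (real (p + m) * real (N + p))) \<le>
      (\<Sum>m\<le>N. \<Sum>p=1..P. (1 / sqrt (real (Suc m))) * (1 / (sqrt (real p) * real (N + p))))"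
  proof (intro sum_mono)
    fix m p assume "p \<in> {1..P}"
    then have p: "p \<ge> 1" by simp
    have sq: "real p * 1 \<le> real p * real p" "0 \<le> real p * real m" "0 \<le> real m * real m" using p by (auto intro!: mult_mono)
    have "(real (p + m))\<^sup>2 = real p * real p + 2 * (real p * real m) + real m * real m"
      "real p * real (Suc m) = real p * 1 + real p * real m" by (simp_all add: power2_eq_square algebra_simps)
    then have "real p * real (Suc m) \<le> (real (p + m))\<^sup>2" using sq by linarith
    then have "sqrt (real p * real (Suc m)) \<le> real (p + m)" by (intro real_le_lsqrt) auto
    then have "sqrt (real (Suc m)) * sqrt (real p) \<le> real (p + m)" by (simp add: real_sqrt_mult mult.commute)
    then have "sqrt (real (Suc m)) * sqrt (real p) * real (N + p) \<le> real (p + m) * real (N + p)" by (intro mult_right_mono) auto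
    moreover have "0 < sqrt (real (Suc m)) * sqrt (real p) * real (N + p)" using p by simp
    ultimately have "1 / (real (p + m) * real (N + p)) \<le> 1 / (sqrt (real (Suc m)) * sqrt (real p) * real (N + p))"
      by (intro divide_left_mono mult_pos_pos) (use p in auto)
    then show "1 / (real (p + m) * real (N + p)) \<le> (1 / sqrt (real (Suc m))) * (1 / (sqrt (real p) * real (N + p)))"
      by (simp add: mult.assoc)
  qed
  also have "\<dots> = (\<Sum>m\<le>N. 1 / sqrt (real (Suc m))) * (\<Sum>p=1..P. 1 / (sqrt (real p) * real (N + p)))"
    by (simp add: sum_product)
  also have "\<dots> \<le> (2 * sqrt (real (Suc N))) * (4 / sqrt (real N))"
  proof (rule mult_mono)
    have "(\<Sum>m\<le>N. 1 / sqrt (real (Suc m))) = (\<Sum>m=1..Suc N. 1 / sqrt (real m))"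
      by (simp only: atMost_atLeast0 One_nat_def sum.shift_bounds_cl_Suc_ivl)
    then show "(\<Sum>m\<le>N. 1 / sqrt (real (Suc m))) \<le> 2 * sqrt (real (Suc N))" using sum_inverse_sqrt[of "Suc N"] by simp
    have "(\<Sum>p=1..P. 1 / (sqrt (real p) * real (N + p))) \<le> (\<Sum>p\<in>{1..N} \<union> {Suc N..N+P}. 1 / (sqrt (real p) * real (N + p)))"
      by (intro sum_mono2) auto
    also have "\<dots> = (\<Sum>p=1..N. 1 / (sqrt (real p) * real (N + p))) + (\<Sum>p=Suc N..N+P. 1 / (sqrt (real p) * real (N + p)))"
      by (rule sum.union_disjoint) auto
    also have "(\<Sum>p=1..N. 1 / (sqrt (real p) * real (N + p))) \<le> (\<Sum>p=1..N. (1 / real N) * (1 / sqrt (real p)))"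
    proof (rule sum_mono)
      fix p assume p: "p \<in> {1..N}"
      have "sqrt (real p) * real N \<le> sqrt (real p) * real (N + p)" by (intro mult_left_mono) auto
      then have "1 / (sqrt (real p) * real (N + p)) \<le> 1 / (sqrt (real p) * real N)"
        using N p by (intro divide_left_mono mult_pos_pos) auto
      then show "1 / (sqrt (real p) * real (N + p)) \<le> (1 / real N) * (1 / sqrt (real p))" by (simp add: mult.commute)
    qed
    also have "\<dots> \<le> (1 / real N) * (2 * sqrt (real N))"
      unfolding sum_distrib_left[symmetric] by (intro mult_left_mono sum_inverse_sqrt) auto
    also have "\<dots> = 2 / sqrt (real N)" using N by (simp add: field_simps)
    also have "(\<Sum>p=Suc N..N+P. 1 / (sqrt (real p) * real (N + p))) \<le> (\<Sum>p=Suc N..N+P. 1 / (real p * sqrt (real p)))"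
      using N by (intro sum_mono divide_left_mono) (auto simp: mult.commute)
    also have "\<dots> \<le> 2 / sqrt (real N) - 2 / sqrt (real (N + P))" by (rule sum_inverse_sqrt_cubed[OF N])
    also have "\<dots> \<le> 2 / sqrt (real N)" by simp
    finally show "(\<Sum>p=1..P. 1 / (sqrt (real p) * real (N + p))) \<le> 4 / sqrt (real N)" by simp
  qed (auto intro!: sum_nonneg)
  also have "\<dots> \<le> 12"
  proof -
    have "sqrt (real (Suc N)) \<le> sqrt ((3/2)\<^sup>2 * real N)" using N by (intro real_sqrt_le_mono) (simp add: power2_eq_square)
    also have "\<dots> = 3/2 * sqrt (real N)" by (simp add: real_sqrt_mult)
    finally show ?thesis using N by (simp add: field_simps)
  qed
  finally show ?thesis .
qed

text \<open>At most \<open>d\<close> pairs \<open>(p, m)\<close> with \<open>p \<ge> 1\<close> have distance \<open>d = p + m\<close>, and each has weight at most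
\<open>1 / (d N)\<close>; so every distance \<open>d < H\<close> contributes at most \<open>1 / N\<close>.\<close>

lemma double_sum_near:
  assumes N: "N \<ge> 1" and H: "H > 0"
  shows "(\<Sum>m\<le>N. \<Sum>p=1..P. of_bool (real (p + m) < H) / (real (p + m) * real (N + p))) \<le> H / real N"
proof -
  define Q where "Q = nat \<lceil>H\<rceil> - 1"
  have Q: "real d < H \<longleftrightarrow> d \<le> Q" for d :: nat
  proof -
    have "real d < H \<longleftrightarrow> int d < \<lceil>H\<rceil>" by (simp add: less_ceiling_iff)
    also have "\<dots> \<longleftrightarrow> d \<le> Q"
    proof -
      have "\<lceil>H\<rceil> \<ge> 1" using H by simp
      then show ?thesis unfolding Q_def by linarith
    qed
    finally show ?thesis .
  qed
  have "(\<Sum>m\<le>N. \<Sum>p=1..P. of_bool (real (p + m) < H) / (real (p + m) * real (N + p))) \<le>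
     (\<Sum>m\<le>N. \<Sum>d=1..Q. of_bool (m < d) / (real d * real N))"
  proof (rule sum_mono)
    fix m
    have "(\<Sum>p=1..P. of_bool (real (p + m) < H) / (real (p + m) * real (N + p))) \<le>
       (\<Sum>p=1..P. of_bool (p + m \<le> Q) / (real (p + m) * real N))"
      using N unfolding Q by (intro sum_mono divide_left_mono mult_left_mono) auto
    also have "\<dots> = (\<Sum>d=1+m..P+m. of_bool (d \<le> Q) / (real d * real N))"
      by (rule sum.shift_bounds_cl_nat_ivl[of "\<lambda>d. of_bool (d \<le> Q) / (real d * real N)" 1 m P, symmetric])
    also have "\<dots> = (\<Sum>d\<in>{1+m..P+m} \<inter> {1..Q}. 1 / (real d * real N))"
      by (rule sum.mono_neutral_cong_right) auto
    also have "\<dots> \<le> (\<Sum>d=1..Q. of_bool (m < d) / (real d * real N))"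
    proof -
      have "(\<Sum>d\<in>{1+m..P+m} \<inter> {1..Q}. 1 / (real d * real N)) = (\<Sum>d\<in>{1+m..P+m} \<inter> {1..Q}. of_bool (m < d) / (real d * real N))"
        by (rule sum.cong) auto
      also have "\<dots> \<le> (\<Sum>d=1..Q. of_bool (m < d) / (real d * real N))" by (rule sum_mono2) auto
      finally show ?thesis .
    qed
    finally show "(\<Sum>p=1..P. of_bool (real (p + m) < H) / (real (p + m) * real (N + p))) \<le> (\<Sum>d=1..Q. of_bool (m < d) / (real d * real N))" .
  qed
  also have "\<dots> = (\<Sum>d=1..Q. \<Sum>m\<le>N. of_bool (m < d) / (real d * real N))" by (rule sum.swap)
  also have "\<dots> \<le> (\<Sum>d=1..Q. 1 / real N)"
  proof (rule sum_mono)
    fix d assume d: "d \<in> {1..Q}"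
    have "(\<Sum>m\<le>N. of_bool (m < d) / (real d * real N)) = (\<Sum>m\<in>{..N} \<inter> {..<d}. 1 / (real d * real N))"
      by (rule sum.mono_neutral_cong_right) auto
    also have "\<dots> = real (card ({..N} \<inter> {..<d})) * (1 / (real d * real N))" by simp
    also have "\<dots> \<le> real d * (1 / (real d * real N))"
      using card_mono[of "{..<d}" "{..N} \<inter> {..<d}"] by (intro mult_right_mono) auto
    also have "\<dots> = 1 / real N" using d by simp
    finally show "(\<Sum>m\<le>N. of_bool (m < d) / (real d * real N)) \<le> 1 / real N" .
  qed
  also have "\<dots> = real Q / real N" by simp
  also have "\<dots> \<le> H / real N" using Q[of Q] by (intro divide_right_mono) auto
  finally show ?thesis .
qed

section \<open>Contour integrals over rectangles\<close>

lemma contour_integral_rectpath: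
  assumes ab: "Re a \<le> Re b" "Im a \<le> Im b" and F: "continuous_on (path_image (rectpath a b)) F"
  defines "c \<equiv> Complex (Re b) (Im a)" and "d \<equiv> Complex (Re a) (Im b)"
  shows "F contour_integrable_on rectpath a b"
    "contour_integral (rectpath a b) F = contour_integral (linepath a c) F + contour_integral (linepath c b) F +
       contour_integral (linepath b d) F + contour_integral (linepath d a) F"
    "closed_segment a c \<union> closed_segment c b \<union> closed_segment b d \<union> closed_segment d a = path_image (rectpath a b)"
proof -
  show sub: "closed_segment a c \<union> closed_segment c b \<union> closed_segment b d \<union> closed_segment d a = path_image (rectpath a b)"
    by (simp add: rectpath_def Let_def path_image_join c_def d_def Un_assoc)
  have int: "F contour_integrable_on linepath p q" if "closed_segment p q \<subseteq> path_image (rectpath a b)" for p q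
    by (rule contour_integrable_continuous_linepath[OF continuous_on_subset[OF F that]])
  have i: "F contour_integrable_on linepath a c" "F contour_integrable_on linepath c b"
    "F contour_integrable_on linepath b d" "F contour_integrable_on linepath d a"
    using sub by (auto intro!: int)
  have "(F has_contour_integral (contour_integral (linepath a c) F + (contour_integral (linepath c b) F +
       (contour_integral (linepath b d) F + contour_integral (linepath d a) F)))) (rectpath a b)"
    unfolding rectpath_def Let_def c_def[symmetric] d_def[symmetric]
    by (intro has_contour_integral_join has_contour_integral_integral i) auto
  then show "F contour_integrable_on rectpath a b"
    "contour_integral (rectpath a b) F = contour_integral (linepath a c) F + contour_integral (linepath c b) F +
       contour_integral (linepath b d) F + contour_integral (linepath d a) F"
    by (auto simp: has_contour_integral_integrable contour_integral_unique add.assoc)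
qed

text \<open>The Weierstrass test gives uniform convergence on the segment, and contour integration is continuous
under uniform convergence.\<close>

lemma contour_integral_linepath_has_sum:
  fixes F :: "'a \<Rightarrow> complex \<Rightarrow> complex"
  assumes c: "\<And>k. k \<in> A \<Longrightarrow> continuous_on (closed_segment p q) (F k)"
    and M: "M summable_on A" "\<And>k z. k \<in> A \<Longrightarrow> z \<in> closed_segment p q \<Longrightarrow> norm (F k z) \<le> M k"
    and S: "\<And>z. z \<in> closed_segment p q \<Longrightarrow> ((\<lambda>k. F k z) has_sum S z) A"
  shows "((\<lambda>k. contour_integral (linepath p q) (F k)) has_sum contour_integral (linepath p q) S) A"
proof -
  have ul: "uniform_limit (closed_segment p q) (\<lambda>X z. \<Sum>k\<in>X. F k z) S (finite_subsets_at_top A)"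
    by (rule Weierstrass_m_test_general'[OF M(2) S M(1)])
  have cs: "continuous_on (closed_segment p q) (\<lambda>z. \<Sum>k\<in>X. F k z)" if "X \<subseteq> A" for X
    using that by (intro continuous_on_sum c) auto
  have ev: "eventually (\<lambda>X. finite X \<and> X \<subseteq> A) (finite_subsets_at_top A)"
    by (simp add: eventually_finite_subsets_at_top_weakI)
  have "((\<lambda>X. contour_integral (linepath p q) (\<lambda>z. \<Sum>k\<in>X. F k z)) \<longlongrightarrow> contour_integral (linepath p q) S) (finite_subsets_at_top A)"
  proof (rule contour_integral_uniform_limit(2))
    show "eventually (\<lambda>X. (\<lambda>z. \<Sum>k\<in>X. F k z) contour_integrable_on linepath p q) (finite_subsets_at_top A)"
      using ev by eventually_elim (auto intro!: contour_integrable_continuous_linepath cs)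
    show "uniform_limit (path_image (linepath p q)) (\<lambda>X z. \<Sum>k\<in>X. F k z) S (finite_subsets_at_top A)"
      using ul by simp
    show "norm (vector_derivative (linepath p q) (at t)) \<le> norm (q - p)" for t by simp
  qed auto
  moreover have "eventually (\<lambda>X. contour_integral (linepath p q) (\<lambda>z. \<Sum>k\<in>X. F k z) = (\<Sum>k\<in>X. contour_integral (linepath p q) (F k))) (finite_subsets_at_top A)"
    using ev by eventually_elim (auto intro!: contour_integral_sum contour_integrable_continuous_linepath c)
  ultimately show "((\<lambda>k. contour_integral (linepath p q) (F k)) has_sum contour_integral (linepath p q) S) A"
    unfolding has_sum_def by (rule Lim_transform_eventually)
qed

lemma contour_integral_rectpath_has_sum:
  fixes F :: "'a \<Rightarrow> complex \<Rightarrow> complex"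
  assumes ab: "Re a \<le> Re b" "Im a \<le> Im b"
    and c: "\<And>k. k \<in> A \<Longrightarrow> continuous_on (path_image (rectpath a b)) (F k)"
    and M: "M summable_on A" "\<And>k z. k \<in> A \<Longrightarrow> z \<in> path_image (rectpath a b) \<Longrightarrow> norm (F k z) \<le> M k"
    and S: "\<And>z. z \<in> path_image (rectpath a b) \<Longrightarrow> ((\<lambda>k. F k z) has_sum S z) A"
  shows "((\<lambda>k. contour_integral (rectpath a b) (F k)) has_sum contour_integral (rectpath a b) S) A"
    and "continuous_on (path_image (rectpath a b)) S"
proof -
  have ul: "uniform_limit (path_image (rectpath a b)) (\<lambda>X z. \<Sum>k\<in>X. F k z) S (finite_subsets_at_top A)"
    by (rule Weierstrass_m_test_general'[OF M(2) S M(1)])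
  have ev: "eventually (\<lambda>X. finite X \<and> X \<subseteq> A) (finite_subsets_at_top A)"
    by (simp add: eventually_finite_subsets_at_top_weakI)
  show cS: "continuous_on (path_image (rectpath a b)) S"
    by (rule uniform_limit_theorem[OF eventually_mono[OF ev] ul]) (auto intro!: continuous_on_sum c)
  define p where "p = Complex (Re b) (Im a)"
  define q where "q = Complex (Re a) (Im b)"
  note R = contour_integral_rectpath[OF ab, folded p_def q_def]
  have seg: "((\<lambda>k. contour_integral (linepath s t) (F k)) has_sum contour_integral (linepath s t) S) A"
    if "closed_segment s t \<subseteq> path_image (rectpath a b)" for s t
    by (rule contour_integral_linepath_has_sum[OF continuous_on_subset[OF c that] M(1) M(2) S])
       (use that in auto)
  have segs: "closed_segment a p \<subseteq> path_image (rectpath a b)" "closed_segment p b \<subseteq> path_image (rectpath a b)"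
    "closed_segment b q \<subseteq> path_image (rectpath a b)" "closed_segment q a \<subseteq> path_image (rectpath a b)"
    using R(3)[OF cS] by auto
  have "((\<lambda>k. contour_integral (linepath a p) (F k) + contour_integral (linepath p b) (F k) +
       contour_integral (linepath b q) (F k) + contour_integral (linepath q a) (F k)) has_sum contour_integral (rectpath a b) S) A"
    unfolding R(2)[OF cS] by (intro has_sum_add seg segs)
  then show "((\<lambda>k. contour_integral (rectpath a b) (F k)) has_sum contour_integral (rectpath a b) S) A"
    by (rule has_sum_cong[THEN iffD1, rotated]) (simp add: R(2)[OF c])
qed

lemma contour_integral_inverse_rectpath:
  assumes ab: "Re a \<le> Re b" "Im a \<le> Im b" and w: "w \<notin> path_image (rectpath a b)"
  shows "contour_integral (rectpath a b) (\<lambda>z. 1 / (z - w)) = 2 * of_real pi * \<i> * of_bool (w \<in> box a b)"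
    "(\<lambda>z. 1 / (z - w)) contour_integrable_on rectpath a b"
proof -
  have "winding_number (rectpath a b) w = of_bool (w \<in> box a b)"
  proof (cases "w \<in> box a b")
    case False
    then have "w \<notin> cbox a b" using w ab by (auto simp: path_image_rectpath_cbox_minus_box)
    then show ?thesis using winding_number_rectpath_outside[OF ab] False by simp
  qed (simp add: winding_number_rectpath)
  then show "contour_integral (rectpath a b) (\<lambda>z. 1 / (z - w)) = 2 * of_real pi * \<i> * of_bool (w \<in> box a b)"
    using winding_number_valid_path[OF valid_path_rectpath w] by (simp add: field_simps)
  show "(\<lambda>z. 1 / (z - w)) contour_integrable_on rectpath a b"
    using w by (intro contour_integral_rectpath(1)[OF ab] continuous_intros) auto
qed

text \<open>Partial fractions reduce the integral to winding numbers, which cancel when both poles lie on the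
same side. A double pole has a primitive.\<close>

lemma contour_integral_two_poles_rectpath:
  assumes ab: "Re a \<le> Re b" "Im a \<le> Im b" and u: "u \<notin> path_image (rectpath a b)" and w: "w \<notin> path_image (rectpath a b)"
  shows "norm (1 / (2 * of_real pi * \<i>) * contour_integral (rectpath a b) (\<lambda>z. 1 / ((z - u) * (z - w)))) =
     of_bool ((u \<in> box a b) \<noteq> (w \<in> box a b)) / cmod (u - w)"
proof (cases "u = w")
  case True
  have "((\<lambda>z. 1 / ((z - u) * (z - u))) has_contour_integral 0) (rectpath a b)"
  proof (rule Cauchy_theorem_primitive[where f="\<lambda>z. - 1 / (z - u)" and S="- {u}"])
    fix z assume "z \<in> - {u}"
    then show "((\<lambda>z. - 1 / (z - u)) has_field_derivative 1 / ((z - u) * (z - u))) (at z within - {u})"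
      by (auto intro!: derivative_eq_intros)
  qed (use u in auto)
  then show ?thesis using True by (simp add: contour_integral_unique)
next
  case False
  have "contour_integral (rectpath a b) (\<lambda>z. 1 / ((z - u) * (z - w))) =
     contour_integral (rectpath a b) (\<lambda>z. (1 / (u - w)) * (1 / (z - u) - 1 / (z - w)))"
  proof (rule contour_integral_cong)
    fix z assume "z \<in> path_image (rectpath a b)"
    then have "z - u \<noteq> 0" "z - w \<noteq> 0" "u - w \<noteq> 0" using u w False by auto
    then show "1 / ((z - u) * (z - w)) = (1 / (u - w)) * (1 / (z - u) - 1 / (z - w))"
      by (simp add: divide_simps)
  qed simp
  also have "\<dots> = (1 / (u - w)) * (contour_integral (rectpath a b) (\<lambda>z. 1 / (z - u)) - contour_integral (rectpath a b) (\<lambda>z. 1 / (z - w)))"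
    by (subst contour_integral_lmul, intro contour_integrable_diff contour_integral_inverse_rectpath(2) ab u w,
        subst contour_integral_diff, intro contour_integral_inverse_rectpath(2) ab u w, intro contour_integral_inverse_rectpath(2) ab u w, rule refl)
  also have "\<dots> = (2 * of_real pi * \<i>) * ((of_bool (u \<in> box a b) - of_bool (w \<in> box a b)) / (u - w))"
    unfolding contour_integral_inverse_rectpath(1)[OF ab u] contour_integral_inverse_rectpath(1)[OF ab w]
    by (simp add: field_simps)
  finally have "1 / (2 * of_real pi * \<i>) * contour_integral (rectpath a b) (\<lambda>z. 1 / ((z - u) * (z - w))) = (of_bool (u \<in> box a b) - of_bool (w \<in> box a b)) / (u - w)"
    by simp
  then show ?thesis by (simp add: norm_divide)
qed

section \<open>The size of the free resolvent\<close>

lemma dist_square_on_line: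
  fixes k :: int
  assumes "Re z = (real N)\<^sup>2 + real N"
  shows "sqrt ((gap N (nat \<bar>k\<bar>))\<^sup>2 + (Im z)\<^sup>2) \<le> cmod (z - of_int k ^ 2)"
proof -
  have g: "0 \<le> gap N (nat \<bar>k\<bar>)" by (simp add: gap_def)
  have "(gap N (nat \<bar>k\<bar>))\<^sup>2 \<le> ((real N)\<^sup>2 + real N - (of_int k)\<^sup>2)\<^sup>2"
    using gap_le[of N k] g by (metis abs_le_square_iff abs_of_nonneg)
  moreover have "Re (z - of_int k ^ 2) = (real N)\<^sup>2 + real N - (of_int k)\<^sup>2" "Im (z - of_int k ^ 2) = Im z"
    using assms by (simp_all add: of_int_power[symmetric] del: of_int_power)
  ultimately show ?thesis by (simp add: cmod_def)
qed

lemma gap_le_dist_square: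
  fixes k :: int
  assumes "Re z = (real N)\<^sup>2 + real N"
  shows "gap N (nat \<bar>k\<bar>) \<le> cmod (z - of_int k ^ 2)"
proof -
  have "gap N (nat \<bar>k\<bar>) \<le> sqrt ((gap N (nat \<bar>k\<bar>))\<^sup>2 + (Im z)\<^sup>2)" by (intro real_le_rsqrt) simp
  then show ?thesis using dist_square_on_line[OF assms, of k] by (rule order_trans)
qed

text \<open>The part of the half plane \<open>Re z \<le> L\<close> outside the strip around the positive axis; for large \<open>L\<close> it
contains the left, upper and lower sides of the contour.\<close>

definition far_from_spectrum :: "real \<Rightarrow> complex \<Rightarrow> bool" where
  "far_from_spectrum L z \<longleftrightarrow> Re z \<le> L \<and> (Re z \<le> - L \<or> \<bar>Im z\<bar> \<ge> L)"

lemma far_arithmetic: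
  fixes L q x y c :: real
  assumes "0 \<le> L" "q - x \<le> c" "y \<le> c" "0 \<le> q" "x \<le> - L \<or> (L \<le> y \<and> x \<le> L)"
  shows "(L + q) / 3 \<le> c"
  using assms by auto

lemma dist_square_far:
  fixes k :: int
  assumes "far_from_spectrum L z" "L \<ge> 0"
  shows "(L + (of_int k)\<^sup>2) / 3 \<le> cmod (z - of_int k ^ 2)"
proof -
  have Re: "Re (z - of_int k ^ 2) = Re z - (of_int k)\<^sup>2" "Im (z - of_int k ^ 2) = Im z"
    by (simp_all add: of_int_power[symmetric] del: of_int_power)
  have 1: "(of_int k)\<^sup>2 - Re z \<le> cmod (z - of_int k ^ 2)" "\<bar>Im z\<bar> \<le> cmod (z - of_int k ^ 2)"
    using abs_Re_le_cmod[of "z - of_int k ^ 2"] abs_Im_le_cmod[of "z - of_int k ^ 2"] unfolding Re by auto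
  define q where "q = (real_of_int k)\<^sup>2"
  have q: "q \<ge> 0" by (simp add: q_def)
  have "Re z \<le> - L \<or> (L \<le> \<bar>Im z\<bar> \<and> Re z \<le> L)" "L \<ge> 0"
    using assms unfolding far_from_spectrum_def by blast+
  then show ?thesis using 1 q unfolding q_def[symmetric]
    by (intro far_arithmetic[of L q "Re z" _ "\<bar>Im z\<bar>"]) blast+
qed

lemma inverse_gap_le_gap_weight: "N \<ge> 1 \<Longrightarrow> 1 / gap N n \<le> gap_weight N n"
proof -
  assume N: "N \<ge> 1"
  define r where "r = root 3 (gap N n)"
  have r: "r \<ge> 1" using gap_ge_1[OF N, of n] by (simp add: r_def)
  have "r ^ 2 \<le> r ^ 3" using r by (intro power_increasing) auto
  moreover have "r ^ 3 = gap N n" by (simp add: r_def odd_real_root_pow)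
  ultimately have "1 / gap N n \<le> 1 / r ^ 2" using r gap_ge_1[OF N, of n] by (intro divide_left_mono mult_pos_pos) auto
  then show ?thesis by (simp add: gap_weight_def r_def)
qed

lemma line_in_free_res_set:
  assumes "Re z = (real N)\<^sup>2 + real N" "N \<ge> 1"
  shows "z \<in> res_set bc (\<lambda>_. 0)"
  unfolding res_set_free
proof (intro CollectI ballI notI)
  fix k assume "z = of_int k ^ 2"
  then have "cmod (z - of_int k ^ 2) = 0" by simp
  then show False using gap_le_dist_square[OF assms(1), of k] gap_ge_1[OF assms(2), of "nat \<bar>k\<bar>"] by linarith
qed

lemma far_in_free_res_set:
  assumes "far_from_spectrum L z" "L > 0"
  shows "z \<in> res_set bc (\<lambda>_. 0)"
  unfolding res_set_free
proof (intro CollectI ballI notI)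
  fix k assume "z = of_int k ^ 2"
  then have 0: "cmod (z - of_int k ^ 2) = 0" by simp
  have "0 < L + (of_int k)\<^sup>2" using assms(2) by (intro add_pos_nonneg) auto
  then have "0 < (L + (of_int k)\<^sup>2) / 3" by simp
  then show False using dist_square_far[OF assms(1) less_imp_le[OF assms(2)], of k] unfolding 0 by simp
qed

lemma rho_le_infsum:
  assumes z: "z \<in> res_set bc (\<lambda>_. 0)" and g: "\<And>n. g n \<ge> 0" and B: "\<And>K. (\<Sum>n<K. g n) \<le> B"
    and le: "\<And>k::int. 1 / cmod (z - of_int k ^ 2) \<le> g (nat \<bar>k\<bar>)"
  shows "rho bc z \<le> 2 * B"
proof -
  note s = summable_on_int_bounded[OF g B, of "idx bc"]
  have "rho bc z \<le> (\<Sum>\<^sub>\<infinity>k\<in>idx bc. g (nat \<bar>k\<bar>))"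
    unfolding rho_def
    by (rule infsum_mono[OF summable_inverse_distance s(1) le]) (use z in \<open>auto simp: res_set_free\<close>)
  then show ?thesis using s(2) by simp
qed

lemma rho_line_le:
  assumes z: "Re z = (real N)\<^sup>2 + real N" and N: "N \<ge> 1"
  shows "rho bc z \<le> 24 / root 3 (real N)"
proof -
  have "rho bc z \<le> 2 * (12 / root 3 (real N))"
  proof (rule rho_le_infsum[OF line_in_free_res_set[OF z N] _ sum_gap_weight_le[OF N]])
    show "0 \<le> gap_weight N n" for n using gap_weight_pos[OF N, of n] by simp
    fix k :: int
    have "1 / cmod (z - of_int k ^ 2) \<le> 1 / gap N (nat \<bar>k\<bar>)"
      using gap_le_dist_square[OF z, of k] gap_ge_1[OF N, of "nat \<bar>k\<bar>"] by (intro divide_left_mono mult_pos_pos) auto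
    then show "1 / cmod (z - of_int k ^ 2) \<le> gap_weight N (nat \<bar>k\<bar>)" using inverse_gap_le_gap_weight[OF N] order_trans by blast
  qed
  then show ?thesis by simp
qed

lemma inverse_dist_far:
  fixes k :: int
  assumes z: "far_from_spectrum ((real M)\<^sup>2) z" and M: "M \<ge> 2"
  shows "1 / cmod (z - of_int k ^ 2) \<le> 3 * (1 / ((real M)\<^sup>2 + (real (nat \<bar>k\<bar>))\<^sup>2))"
proof -
  have k: "(real (nat \<bar>k\<bar>))\<^sup>2 = (of_int k)\<^sup>2" by (simp add: of_nat_nat)
  have pos: "(real M)\<^sup>2 + (of_int k)\<^sup>2 > 0" using M by (intro add_pos_nonneg) auto
  have "((real M)\<^sup>2 + (of_int k)\<^sup>2) / 3 \<le> cmod (z - of_int k ^ 2)" by (rule dist_square_far[OF z]) simp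
  then have "1 / cmod (z - of_int k ^ 2) \<le> 1 / (((real M)\<^sup>2 + (of_int k)\<^sup>2) / 3)"
    using pos by (intro divide_left_mono mult_pos_pos) auto
  then show ?thesis unfolding k by simp
qed

lemma rho_far_le:
  assumes z: "far_from_spectrum ((real M)\<^sup>2) z" and M: "M \<ge> 2"
  shows "rho bc z \<le> 12 / (real M - 1)"
proof -
  have "rho bc z \<le> 2 * (3 * (2 / (real M - 1)))"
  proof (rule rho_le_infsum[OF far_in_free_res_set[OF z]])
    show "0 < (real M)\<^sup>2" using M by simp
    show "0 \<le> 3 * (1 / ((real M)\<^sup>2 + (real n)\<^sup>2))" for n by simp
    show "(\<Sum>n<K. 3 * (1 / ((real M)\<^sup>2 + (real n)\<^sup>2))) \<le> 3 * (2 / (real M - 1))" for K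
      unfolding sum_distrib_left[symmetric] by (intro mult_left_mono sum_inverse_sum_squares_le M) auto
    show "1 / cmod (z - of_int k ^ 2) \<le> 3 * (1 / ((real M)\<^sup>2 + (real (nat \<bar>k\<bar>))\<^sup>2))" for k
      by (rule inverse_dist_far[OF z M])
  qed
  then show ?thesis by simp
qed

lemma finite_int_sum_gap_weight_le:
  assumes N: "N \<ge> 1" and X: "finite X"
  shows "(\<Sum>k\<in>X. gap_weight N (nat \<bar>k\<bar>)) \<le> 24 / root 3 (real N)"
proof -
  have g: "0 \<le> gap_weight N n" for n using gap_weight_pos[OF N, of n] by simp
  note s = summable_on_int_bounded[OF g sum_gap_weight_le[OF N], of UNIV]
  have "(\<Sum>k\<in>X. gap_weight N (nat \<bar>k\<bar>)) \<le> (\<Sum>\<^sub>\<infinity>k. gap_weight N (nat \<bar>k\<bar>))"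
    by (rule finite_sum_le_infsum[OF s(1) X]) (auto simp: g)
  then show ?thesis using s(2) by simp
qed

text \<open>The pointwise size of \<open>\<rho>\<close> on the line carries a logarithm, which the integral does not see.
For finite sums the weighted convexity inequality bounds the cube by
\<open>W\<^sup>2 \<Sum> u\<^sub>k\<^sup>3 / w\<^sub>k\<^sup>2\<close>, whose integral is at most \<open>W\<^sup>2 \<Sum> 2 w\<^sub>k \<le> 2 W\<^sup>3\<close>, with \<open>W = 24 N\<^sup>-\<^sup>1\<^sup>/\<^sup>3\<close> a bound for
the total weight. The partial sums converge uniformly to \<open>\<rho>\<close>.\<close>

theorem integral_rho_cube_le:
  assumes N: "N \<ge> 1" and L: "L \<ge> 0"
  defines "R \<equiv> (real N)\<^sup>2 + real N"
  shows "continuous_on {-L..L} (\<lambda>t. rho bc (Complex R t))"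
    "integral {-L..L} (\<lambda>t. rho bc (Complex R t) ^ 3) \<le> 27648 / real N"
proof -
  define W where "W = 24 / root 3 (real N)"
  have W: "W \<ge> 0" by (simp add: W_def)
  define u where "u k t = 1 / cmod (Complex R t - of_int k ^ 2)" for k :: int and t
  define w where "w k = gap_weight N (nat \<bar>k\<bar>)" for k :: int
  have w: "w k > 0" for k using gap_weight_pos[OF N] by (simp add: w_def)
  have dpos: "cmod (Complex R t - of_int k ^ 2) \<ge> 1" for k :: int and t
    using gap_le_dist_square[of "Complex R t" N k] gap_ge_1[OF N, of "nat \<bar>k\<bar>"] by (simp add: R_def)
  have dne: "Complex R t - of_int k ^ 2 \<noteq> 0" for k :: int and t
    using dpos[of t k] by auto
  have uw: "u k t \<le> w k" for k t
  proof -
    have "u k t \<le> 1 / gap N (nat \<bar>k\<bar>)" unfolding u_def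
      using gap_le_dist_square[of "Complex R t" N k] gap_ge_1[OF N, of "nat \<bar>k\<bar>"]
      by (intro divide_left_mono mult_pos_pos) (auto simp: R_def)
    then show ?thesis unfolding w_def using inverse_gap_le_gap_weight[OF N] order_trans by blast
  qed
  have u0: "u k t \<ge> 0" for k t by (simp add: u_def)
  have cu: "continuous_on {-L..L} (u k)" for k
  proof -
    have "continuous_on {-L..L} (\<lambda>t. 1 / cmod ((of_real R + \<i> * of_real t) - of_int k ^ 2))"
      using dne by (intro continuous_intros) (auto simp: complex_eq_iff Complex_eq)
    then show ?thesis by (simp add: u_def[abs_def] Complex_eq)
  qed
  have ws: "w summable_on idx bc"
    unfolding w_def by (rule summable_on_int_bounded(1)[OF _ sum_gap_weight_le[OF N]]) (use gap_weight_pos[OF N] in \<open>auto intro: less_imp_le\<close>)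
  have usum: "((\<lambda>k. u k t) has_sum rho bc (Complex R t)) (idx bc)" for t
    unfolding rho_def u_def
    by (intro has_sum_infsum summable_inverse_distance) (use dne in auto)
  have ul: "uniform_limit {-L..L} (\<lambda>X t. \<Sum>k\<in>X. u k t) (\<lambda>t. rho bc (Complex R t)) (finite_subsets_at_top (idx bc))"
    by (rule Weierstrass_m_test_general'[OF _ usum ws]) (use uw u0 in auto)
  show crho: "continuous_on {-L..L} (\<lambda>t. rho bc (Complex R t))"
    by (rule uniform_limit_theorem[OF _ ul]) (auto intro!: always_eventually continuous_on_sum cu)
  have b: "bounded ((\<lambda>t. rho bc (Complex R t)) ` {-L..L})"
    by (intro compact_imp_bounded compact_continuous_image crho) auto
  have b2: "bounded ((\<lambda>t. rho bc (Complex R t) * rho bc (Complex R t)) ` {-L..L})"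
    by (intro compact_imp_bounded compact_continuous_image continuous_intros crho) auto
  have ul3: "uniform_limit {-L..L} (\<lambda>X t. (\<Sum>k\<in>X. u k t) ^ 3) (\<lambda>t. rho bc (Complex R t) ^ 3) (finite_subsets_at_top (idx bc))"
    unfolding power3_eq_cube by (rule uniform_lim_mult[OF uniform_lim_mult[OF ul ul b b] ul b2 b])
  obtain I J where IJ: "\<And>X. ((\<lambda>t. (\<Sum>k\<in>X. u k t) ^ 3) has_integral I X) {-L..L}"
      "((\<lambda>t. rho bc (Complex R t) ^ 3) has_integral J) {-L..L}" "(I \<longlongrightarrow> J) (finite_subsets_at_top (idx bc))"
    by (rule uniform_limit_integral[OF ul3]) (auto intro!: continuous_intros cu)
  have I: "I X \<le> 2 * W ^ 3" if X: "finite X" for X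
  proof -
    define K where "K k t = 1 / sqrt ((gap N (nat \<bar>k\<bar>))\<^sup>2 + t\<^sup>2) ^ 3" for k :: int and t
    have gp: "gap N n > 0" for n using gap_ge_1[OF N, of n] by simp
    have Kint: "K k integrable_on {-L..L}" "integral {-L..L} (K k) \<le> 2 / (gap N (nat \<bar>k\<bar>))\<^sup>2" for k
      unfolding K_def using integral_inverse_cube_le[OF gp L] by auto
    have uK: "u k t ^ 3 \<le> K k t" for k t
    proof -
      have "sqrt ((gap N (nat \<bar>k\<bar>))\<^sup>2 + t\<^sup>2) \<le> cmod (Complex R t - of_int k ^ 2)"
        using dist_square_on_line[of "Complex R t" N k] by (simp add: R_def)
      moreover have "sqrt ((gap N (nat \<bar>k\<bar>))\<^sup>2 + t\<^sup>2) > 0"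
        using gp[of "nat \<bar>k\<bar>"] by (simp add: add_pos_nonneg)
      ultimately have "u k t \<le> 1 / sqrt ((gap N (nat \<bar>k\<bar>))\<^sup>2 + t\<^sup>2)"
        unfolding u_def by (intro divide_left_mono mult_pos_pos) auto
      from power_mono[OF this u0, of 3] show ?thesis by (simp add: K_def power_divide)
    qed
    define Wx where "Wx = (\<Sum>k\<in>X. w k)"
    have Wx: "0 \<le> Wx" "Wx \<le> W" unfolding Wx_def W_def w_def using finite_int_sum_gap_weight_le[OF N X] gap_weight_pos[OF N]
      by (auto intro!: sum_nonneg intro: less_imp_le)
    have "I X = integral {-L..L} (\<lambda>t. (\<Sum>k\<in>X. u k t) ^ 3)" by (rule integral_unique[OF IJ(1), symmetric])
    also have "\<dots> \<le> integral {-L..L} (\<lambda>t. Wx\<^sup>2 * (\<Sum>k\<in>X. K k t / (w k)\<^sup>2))"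
    proof (rule integral_le)
      show "(\<lambda>t. (\<Sum>k\<in>X. u k t) ^ 3) integrable_on {-L..L}" using IJ(1) by blast
      show "(\<lambda>t. Wx\<^sup>2 * (\<Sum>k\<in>X. K k t / (w k)\<^sup>2)) integrable_on {-L..L}"
        by (intro integrable_on_mult_right integrable_sum X integrable_on_divide Kint)
      fix t
      have "(\<Sum>k\<in>X. u k t) ^ 3 \<le> Wx\<^sup>2 * (\<Sum>k\<in>X. u k t ^ 3 / (w k)\<^sup>2)"
        unfolding Wx_def by (rule cube_sum_le_weighted[OF X w u0])
      also have "\<dots> \<le> Wx\<^sup>2 * (\<Sum>k\<in>X. K k t / (w k)\<^sup>2)"
        by (intro mult_left_mono sum_mono divide_right_mono uK) auto
      finally show "(\<Sum>k\<in>X. u k t) ^ 3 \<le> Wx\<^sup>2 * (\<Sum>k\<in>X. K k t / (w k)\<^sup>2)" .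
    qed
    also have "\<dots> = Wx\<^sup>2 * (\<Sum>k\<in>X. integral {-L..L} (K k) / (w k)\<^sup>2)"
      by (simp add: integral_sum[OF X] Kint integrable_on_divide)
    also have "\<dots> \<le> Wx\<^sup>2 * (\<Sum>k\<in>X. 2 * w k)"
    proof (intro mult_left_mono sum_mono)
      fix k
      have "integral {-L..L} (K k) / (w k)\<^sup>2 \<le> 2 * w k ^ 3 / (w k)\<^sup>2"
        using Kint(2)[of k] gap_weight_cube[OF N, of "nat \<bar>k\<bar>"] by (intro divide_right_mono) (auto simp: w_def)
      also have "\<dots> = 2 * w k" using w[of k] by (simp add: power2_eq_square power3_eq_cube)
      finally show "integral {-L..L} (K k) / (w k)\<^sup>2 \<le> 2 * w k" .
    qed simp
    also have "\<dots> = 2 * Wx ^ 3" by (simp add: Wx_def sum_distrib_left[symmetric] power2_eq_square power3_eq_cube)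
    also have "\<dots> \<le> 2 * W ^ 3" using Wx by (intro mult_left_mono power_mono) auto
    finally show ?thesis .
  qed
  have "J \<le> 2 * W ^ 3"
    by (rule tendsto_upperbound[OF IJ(3)])
       (auto intro!: eventually_finite_subsets_at_top_weakI I)
  moreover have "W ^ 3 = 13824 / real N"
  proof -
    have "root 3 (real N) ^ 3 = real N" by (simp add: odd_real_root_pow)
    then show ?thesis by (simp add: W_def power_divide)
  qed
  ultimately show "integral {-L..L} (\<lambda>t. rho bc (Complex R t) ^ 3) \<le> 27648 / real N"
    using integral_unique[OF IJ(2)] by simp
qed

section \<open>Matrix elements of the potential\<close>

lemma exp_eq_cis: "exp (- \<i> * of_int k * of_real x) = cis (- (of_int k * x))"
  by (simp add: cis_conv_exp mult.assoc)

lemma cmod_V_coeff_le: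
  assumes "v \<in> L1" shows "cmod (V_coeff v k) \<le> norm_L1 v"
proof -
  have c: "continuous_on {0..pi} (\<lambda>x. cis (- (of_int k * x)))" by (intro continuous_intros)
  have "cmod (integral {0..pi} (\<lambda>x. v x * cis (- (of_int k * x)))) \<le> pi * norm_L1 (\<lambda>x. v x * cis (- (of_int k * x)))"
    by (rule cmod_integral_le_norm_L1[OF L1_mult_continuous[OF assms c]]) auto
  also have "norm_L1 (\<lambda>x. v x * cis (- (of_int k * x))) \<le> norm_L1 v * 1"
    by (rule norm_L1_mult_le[OF assms c]) simp
  finally show ?thesis unfolding V_coeff_def exp_eq_cis by (simp add: norm_mult norm_divide field_simps)
qed

lemma cmod_V_tilde_le:
  assumes "v \<in> L1" shows "cmod (V_tilde v k) \<le> sqrt 2 * norm_L1 v"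
proof -
  have c: "continuous_on {0..pi} (\<lambda>x. complex_of_real (sqrt 2 * cos (real k * x)))" by (intro continuous_intros)
  have "cmod (integral {0..pi} (\<lambda>x. v x * of_real (sqrt 2 * cos (real k * x)))) \<le> pi * norm_L1 (\<lambda>x. v x * of_real (sqrt 2 * cos (real k * x)))"
    by (rule cmod_integral_le_norm_L1[OF L1_mult_continuous[OF assms c]]) auto
  also have "norm_L1 (\<lambda>x. v x * of_real (sqrt 2 * cos (real k * x))) \<le> norm_L1 v * sqrt 2"
    by (rule norm_L1_mult_le[OF assms c]) (simp add: norm_mult)
  finally show ?thesis unfolding V_tilde_def by (simp add: norm_mult norm_divide field_simps)
qed

lemma cmod_V_coeff_le_vstar:
  assumes v: "v \<in> L1" and k: "even k" "H \<le> \<bar>real_of_int k\<bar>" and bc: "bc = Per_plus \<or> bc = Per_minus"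
  shows "cmod (V_coeff v k) \<le> vstar bc v H"
proof -
  have "cmod (V_coeff v k) \<le> (SUP k\<in>{k::int. even k \<and> \<bar>real_of_int k\<bar> \<ge> H}. cmod (V_coeff v k))"
    by (rule cSUP_upper) (use k cmod_V_coeff_le[OF v] in \<open>auto intro!: bdd_aboveI2\<close>)
  then show ?thesis using bc by auto
qed

lemma cmod_V_tilde_le_vstar:
  assumes v: "v \<in> L1" and k: "H \<le> real k"
  shows "cmod (V_tilde v k) \<le> vstar Dir v H"
  unfolding vstar.simps
  by (rule cSUP_upper) (use k cmod_V_tilde_le[OF v] in \<open>auto intro!: bdd_aboveI2\<close>)

lemma vstar_nonneg:
  assumes v: "v \<in> L1" shows "vstar bc v H \<ge> 0"
proof (cases bc)
  case Dir
  have "H \<le> real (nat \<lceil>H\<rceil>)" by linarith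
  from cmod_V_tilde_le_vstar[OF v this] show ?thesis unfolding Dir using norm_ge_zero order_trans by blast
next
  case Per_plus
  have "even (2 * \<lceil>\<bar>H\<bar>\<rceil>)" "H \<le> \<bar>real_of_int (2 * \<lceil>\<bar>H\<bar>\<rceil>)\<bar>" by (simp, linarith)
  from cmod_V_coeff_le_vstar[OF v this, of bc] show ?thesis unfolding Per_plus using norm_ge_zero order_trans by blast
next
  case Per_minus
  have "even (2 * \<lceil>\<bar>H\<bar>\<rceil>)" "H \<le> \<bar>real_of_int (2 * \<lceil>\<bar>H\<bar>\<rceil>)\<bar>" by (simp, linarith)
  from cmod_V_coeff_le_vstar[OF v this, of bc] show ?thesis unfolding Per_minus using norm_ge_zero order_trans by blast
qed

lemma vstar_antimono:
  assumes v: "v \<in> L1" and le: "H \<le> H'"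
  shows "vstar bc v H' \<le> vstar bc v H"
proof (cases bc)
  case Dir
  have "{k::nat. real k \<ge> H'} \<noteq> {}" using real_arch_simple by auto
  then show ?thesis unfolding Dir vstar.simps
    using le cmod_V_tilde_le[OF v] by (intro cSUP_subset_mono) (auto intro!: bdd_aboveI2)
next
  case Per_plus
  have "2 * \<lceil>\<bar>H'\<bar>\<rceil> \<in> {k::int. even k \<and> \<bar>real_of_int k\<bar> \<ge> H'}" by (simp, linarith)
  then have "{k::int. even k \<and> \<bar>real_of_int k\<bar> \<ge> H'} \<noteq> {}" by blast
  then show ?thesis unfolding Per_plus vstar.simps
    using le cmod_V_coeff_le[OF v] by (intro cSUP_subset_mono) (auto intro!: bdd_aboveI2)
next
  case Per_minus
  have "2 * \<lceil>\<bar>H'\<bar>\<rceil> \<in> {k::int. even k \<and> \<bar>real_of_int k\<bar> \<ge> H'}" by (simp, linarith)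
  then have "{k::int. even k \<and> \<bar>real_of_int k\<bar> \<ge> H'} \<noteq> {}" by blast
  then show ?thesis unfolding Per_minus vstar.simps
    using le cmod_V_coeff_le[OF v] by (intro cSUP_subset_mono) (auto intro!: bdd_aboveI2)
qed

text \<open>The matrix of multiplication by \<open>v\<close> in the basis of eigenfunctions.\<close>

definition v_matrix :: "bcond \<Rightarrow> (real \<Rightarrow> complex) \<Rightarrow> int \<Rightarrow> int \<Rightarrow> complex" where
  "v_matrix bc v j k = fcoeff bc (\<lambda>x. v x * eig bc k x) j"

lemma cmod_v_matrix_le:
  assumes v: "v \<in> L1" shows "cmod (v_matrix bc v j k) \<le> 2 * norm_L1 v"
proof -
  have ce: "continuous_on {0..pi} (eig bc k)" by (intro continuous_intros)
  have "cmod (v_matrix bc v j k) \<le> sqrt 2 * norm_L1 (\<lambda>x. v x * eig bc k x)"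
    unfolding v_matrix_def by (rule fcoeff_bound[OF L1_mult_continuous[OF v ce]])
  also have "\<dots> \<le> sqrt 2 * (norm_L1 v * sqrt 2)"
    by (intro mult_left_mono norm_L1_mult_le[OF v ce] cmod_eig_le) auto
  finally show ?thesis by (simp add: mult.commute mult.left_commute)
qed

lemma v_matrix_Per:
  assumes "bc \<noteq> Dir" shows "v_matrix bc v j k = V_coeff v (j - k)"
proof -
  have "eig bc k x * cnj (eig bc j x) = exp (- \<i> * of_int (j - k) * of_real x)" for x
    unfolding exp_eq_cis using assms by (cases bc) (auto simp: cis_cnj cis_mult algebra_simps)
  then show ?thesis by (simp add: v_matrix_def fcoeff_def V_coeff_def mult.assoc)
qed

text \<open>For Dirichlet conditions the product of two sines is a difference of two cosines, whose frequencies
\<open>|j - k|\<close> and \<open>j + k\<close> are both at least \<open>| |j| - |k| |\<close>.\<close>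

lemma v_matrix_Dir:
  assumes v: "v \<in> L1" and j: "j \<ge> 1" and k: "k \<ge> 1"
  shows "v_matrix Dir v j k = (V_tilde v (nat \<bar>j - k\<bar>) - V_tilde v (nat (j + k))) / sqrt 2"
proof -
  define c where "c m x = complex_of_real (sqrt 2 * cos (real m * x))" for m :: nat and x
  have c: "continuous_on {0..pi} (c m)" for m unfolding c_def by (intro continuous_intros)
  have int: "(\<lambda>x. v x * c m x) integrable_on {0..pi}" for m by (rule L1_integrable[OF L1_mult_continuous[OF v c]])
  have eq: "v x * eig Dir k x * cnj (eig Dir j x) = (1 / complex_of_real (sqrt 2)) * (v x * c (nat \<bar>j - k\<bar>) x - v x * c (nat (j + k)) x)" for x
  proof -
    have "real (nat \<bar>j - k\<bar>) * x = of_int \<bar>j - k\<bar> * x" by (simp add: of_nat_nat)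
    then have a: "cos (real (nat \<bar>j - k\<bar>) * x) = cos (of_int j * x - of_int k * x)"
      by (cases "j \<ge> k") (auto simp: algebra_simps cos_diff)
    have b: "cos (real (nat (j + k)) * x) = cos (of_int j * x + of_int k * x)"
      using j k by (simp add: of_nat_nat algebra_simps)
    have "c (nat \<bar>j - k\<bar>) x - c (nat (j + k)) x = of_real (sqrt 2 * (2 * (sin (of_int j * x) * sin (of_int k * x))))"
      unfolding c_def a b cos_add cos_diff of_real_diff[symmetric] by (rule arg_cong[of _ _ of_real]) (simp add: algebra_simps)
    also have "\<dots> = of_real (sqrt 2) * (eig Dir k x * cnj (eig Dir j x))"
    proof -
      have "sqrt 2 * (2 * (sin (of_int j * x) * sin (of_int k * x))) = sqrt 2 * ((sqrt 2 * sin (of_int k * x)) * (sqrt 2 * sin (of_int j * x)))"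
        by simp
      then show ?thesis by (simp only: eig.simps complex_cnj_complex_of_real of_real_mult[symmetric])
    qed
    finally have "eig Dir k x * cnj (eig Dir j x) = (1 / complex_of_real (sqrt 2)) * (c (nat \<bar>j - k\<bar>) x - c (nat (j + k)) x)" by simp
    then have "v x * (eig Dir k x * cnj (eig Dir j x)) = v x * ((1 / complex_of_real (sqrt 2)) * (c (nat \<bar>j - k\<bar>) x - c (nat (j + k)) x))" by (rule arg_cong)
    then show ?thesis by (simp only: mult.assoc mult.left_commute[of "v x"] right_diff_distrib)
  qed
  have "integral {0..pi} (\<lambda>x. v x * eig Dir k x * cnj (eig Dir j x)) =
    (1 / complex_of_real (sqrt 2)) * (integral {0..pi} (\<lambda>x. v x * c (nat \<bar>j - k\<bar>) x) - integral {0..pi} (\<lambda>x. v x * c (nat (j + k)) x))"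
    unfolding eq integral_mult_right by (subst Henstock_Kurzweil_Integration.integral_diff[OF int int]) (rule refl)
  then show ?thesis unfolding v_matrix_def fcoeff_def V_tilde_def c_def by (simp add: field_simps)
qed

text \<open>All Fourier coefficients of \<open>v\<close> that enter have index at least \<open>| |j| - |k| |\<close>. Below \<open>H\<close> only the
trivial bound is available.\<close>

lemma cmod_v_matrix_le_vstar:
  assumes v: "v \<in> L1" and j: "j \<in> idx bc" and k: "k \<in> idx bc"
  shows "cmod (v_matrix bc v j k) \<le> 2 * (vstar bc v H + norm_L1 v * of_bool (\<bar>real_of_int \<bar>j\<bar> - real_of_int \<bar>k\<bar>\<bar> < H))"
proof (cases "\<bar>real_of_int \<bar>j\<bar> - real_of_int \<bar>k\<bar>\<bar> < H")
  case True
  then show ?thesis using cmod_v_matrix_le[OF v, of bc j k] vstar_nonneg[OF v, of bc H] by simp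
next
  case False
  have "cmod (v_matrix bc v j k) \<le> 2 * vstar bc v H"
  proof (cases "bc = Dir")
    case True
    have jk: "j \<ge> 1" "k \<ge> 1" using j k True by auto
    have d: "H \<le> real (nat \<bar>j - k\<bar>)" "H \<le> real (nat (j + k))" using False jk by auto
    have "cmod (v_matrix bc v j k) \<le> (vstar Dir v H + vstar Dir v H) / sqrt 2"
      unfolding True v_matrix_Dir[OF v jk] norm_divide
      using order_trans[OF norm_triangle_ineq4 add_mono[OF cmod_V_tilde_le_vstar[OF v d(1)] cmod_V_tilde_le_vstar[OF v d(2)]]]
      by (simp add: divide_right_mono)
    also have "\<dots> \<le> (vstar Dir v H + vstar Dir v H) / 1"
      using vstar_nonneg[OF v, of Dir H] by (intro divide_left_mono) auto
    finally show ?thesis using True by simp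
  next
    case bc: False
    have ev: "even (j - k)" using j k bc by (cases bc) auto
    have "H \<le> \<bar>real_of_int (j - k)\<bar>" using False by linarith
    from cmod_V_coeff_le_vstar[OF v ev this, of bc] have "cmod (v_matrix bc v j k) \<le> vstar bc v H"
      unfolding v_matrix_Per[OF bc] using bc by (cases bc) auto
    then show ?thesis using vstar_nonneg[OF v, of bc H] by simp
  qed
  then show ?thesis using False by simp
qed

text \<open>The map \<open>y \<mapsto> fcoeff (v y)\<close> is continuous for the supremum norm, and the eigenfunction
expansion converges uniformly.\<close>

lemma fcoeff_green_free_has_sum:
  assumes v: "v \<in> L1" and f: "f \<in> L1" and z: "z \<in> res_set bc (\<lambda>_. 0)"
  shows "((\<lambda>k. fcoeff bc f k / (z - of_int k ^ 2) * v_matrix bc v j k) has_sum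
     fcoeff bc (\<lambda>x. v x * green bc (\<lambda>_. 0) z f x) j) (idx bc)"
proof -
  have zk: "z \<noteq> of_int k ^ 2" if "k \<in> idx bc" for k using z that by (simp add: res_set_free)
  define y where "y = green bc (\<lambda>_. 0) z f"
  have b: "bvp bc (\<lambda>_. 0) z f y" unfolding y_def by (rule green_bvp[OF L1_const z f])
  have cy: "continuous_on {0..pi} y" by (rule bvp_continuous[OF b])
  define a where "a k = fcoeff bc f k / (z - of_int k ^ 2)" for k
  define M where "M k = 2 * norm_L1 f * (1 / cmod (z - of_int k ^ 2))" for k :: int
  have M: "M summable_on idx bc" unfolding M_def
    by (intro summable_on_cmult_right summable_inverse_distance zk)
  have aM: "norm (a k * eig bc k x) \<le> M k" for k x
  proof -
    have "cmod (fcoeff bc f k) * cmod (eig bc k x) / cmod (z - of_int k ^ 2) \<le> (2 * norm_L1 f) / cmod (z - of_int k ^ 2)"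
      by (intro divide_right_mono cmod_fcoeff_mult_eig_le f) auto
    then show ?thesis by (simp add: a_def M_def norm_mult norm_divide)
  qed
  have ul: "uniform_limit {0..pi} (\<lambda>X x. \<Sum>k\<in>X. a k * eig bc k x) y (finite_subsets_at_top (idx bc))"
    by (rule Weierstrass_m_test_general'[OF aM _ M]) (use bvp_series[OF f b zk] in \<open>simp add: a_def\<close>)
  define p where "p X x = (\<Sum>k\<in>X. a k * eig bc k x)" for X x
  have cp: "continuous_on {0..pi} (p X)" for X unfolding p_def by (intro continuous_intros)
  have pX: "fcoeff bc (\<lambda>x. v x * p X x) j = (\<Sum>k\<in>X. a k * v_matrix bc v j k)" if "finite X" for X
  proof -
    have "integral {0..pi} (\<lambda>x. v x * p X x * cnj (eig bc j x)) = integral {0..pi} (\<lambda>x. \<Sum>k\<in>X. a k * (v x * eig bc k x * cnj (eig bc j x)))"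
      by (simp add: p_def sum_distrib_left sum_distrib_right ac_simps)
    also have "\<dots> = (\<Sum>k\<in>X. a k * integral {0..pi} (\<lambda>x. v x * eig bc k x * cnj (eig bc j x)))"
    proof (subst integral_sum[OF that])
      have ce: "continuous_on {0..pi} (eig bc k)" "continuous_on {0..pi} (\<lambda>x. cnj (eig bc k x))" for k
        by (intro continuous_intros)+
      show "(\<lambda>x. a k * (v x * eig bc k x * cnj (eig bc j x))) integrable_on {0..pi}" for k
        by (rule integrable_on_mult_right, rule L1_integrable, rule L1_mult_continuous[OF L1_mult_continuous[OF v ce(1)] ce(2)])
    qed simp
    finally show ?thesis by (simp add: fcoeff_def v_matrix_def sum_distrib_left ac_simps)
  qed
  have "((\<lambda>X. fcoeff bc (\<lambda>x. v x * p X x) j) \<longlongrightarrow> fcoeff bc (\<lambda>x. v x * y x) j) (finite_subsets_at_top (idx bc))"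
  proof (rule tendstoI)
    fix e :: real assume e: "e > 0"
    define e' where "e' = e / (sqrt 2 * norm_L1 v + 1)"
    have pos: "sqrt 2 * norm_L1 v + 1 > 0" using norm_L1_nonneg[of v] by (intro add_nonneg_pos) auto
    then have e': "e' > 0" using e by (simp add: e'_def)
    have "eventually (\<lambda>X. \<forall>x\<in>{0..pi}. dist (p X x) (y x) < e') (finite_subsets_at_top (idx bc))"
      using uniform_limitD[OF ul e'] by (simp add: p_def)
    then show "eventually (\<lambda>X. dist (fcoeff bc (\<lambda>x. v x * p X x) j) (fcoeff bc (\<lambda>x. v x * y x) j) < e) (finite_subsets_at_top (idx bc))"
    proof eventually_elim
      case (elim X)
      have l: "(\<lambda>x. v x * p X x) \<in> L1" "(\<lambda>x. v x * y x) \<in> L1" by (intro L1_mult_continuous v cp cy)+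
      have ce: "continuous_on {0..pi} (\<lambda>x. cnj (eig bc j x))" by (intro continuous_intros)
      have "integral {0..pi} (\<lambda>x. v x * p X x * cnj (eig bc j x)) - integral {0..pi} (\<lambda>x. v x * y x * cnj (eig bc j x)) =
         integral {0..pi} (\<lambda>x. v x * p X x * cnj (eig bc j x) - v x * y x * cnj (eig bc j x))"
        by (rule Henstock_Kurzweil_Integration.integral_diff[symmetric]) (intro L1_integrable L1_mult_continuous l ce)+
      also have "\<dots> = integral {0..pi} (\<lambda>x. v x * (p X x - y x) * cnj (eig bc j x))" by (simp add: algebra_simps)
      finally have "fcoeff bc (\<lambda>x. v x * p X x) j - fcoeff bc (\<lambda>x. v x * y x) j = fcoeff bc (\<lambda>x. v x * (p X x - y x)) j"
        unfolding fcoeff_def by (simp only: right_diff_distrib[symmetric])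
      also have "cmod \<dots> \<le> sqrt 2 * norm_L1 (\<lambda>x. v x * (p X x - y x))"
        by (intro fcoeff_bound L1_mult_continuous v continuous_intros cp cy)
      also have "\<dots> \<le> sqrt 2 * (norm_L1 v * e')"
        by (intro mult_left_mono norm_L1_mult_le v continuous_intros cp cy) (use elim in \<open>auto simp: dist_norm intro: less_imp_le\<close>)
      also have "\<dots> < (sqrt 2 * norm_L1 v + 1) * e'" using e' by (simp add: algebra_simps)
      also have "\<dots> = e" using pos by (simp add: e'_def)
      finally show ?case by (simp add: dist_norm)
    qed
  qed
  moreover have "eventually (\<lambda>X. fcoeff bc (\<lambda>x. v x * p X x) j = (\<Sum>k\<in>X. a k * v_matrix bc v j k)) (finite_subsets_at_top (idx bc))"
    by (rule eventually_finite_subsets_at_top_weakI) (rule pX)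
  ultimately show ?thesis
    unfolding has_sum_def y_def[symmetric] a_def[symmetric] by (rule Lim_transform_eventually)
qed

section \<open>A large rectangle\<close>

definition bigbox_lo :: "nat \<Rightarrow> complex" where "bigbox_lo M = Complex (- (real M)\<^sup>2) (- (real M)\<^sup>2)"
definition bigbox_hi :: "nat \<Rightarrow> nat \<Rightarrow> complex" where "bigbox_hi N M = Complex ((real N)\<^sup>2 + real N) ((real M)\<^sup>2)"

text \<open>The condition \<open>N + 1 \<le> M\<close> makes \<open>M\<^sup>2\<close> larger than \<open>N\<^sup>2 + N\<close>, so the three sides other than the right
one are far from the spectrum.\<close>

locale big_box =
  fixes N M :: nat
  assumes N1: "N \<ge> 1" and MN: "M \<ge> N + 1"
begin

abbreviation "lo \<equiv> bigbox_lo M"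
abbreviation "hi \<equiv> bigbox_hi N M"
abbreviation "\<Gamma> \<equiv> rectpath lo hi"

lemma RL: "(real N)\<^sup>2 + real N \<le> (real M)\<^sup>2"
proof -
  have "(real N + 1)\<^sup>2 \<le> (real M)\<^sup>2" using MN by (intro power_mono) auto
  then show ?thesis by (simp add: power2_eq_square algebra_simps)
qed

lemma M2: "M \<ge> 2" using N1 MN by simp

lemma lohi: "Re lo \<le> Re hi" "Im lo \<le> Im hi"
  by (auto simp: bigbox_lo_def bigbox_hi_def intro: order_trans[of _ 0])

lemma path_cases:
  assumes "z \<in> path_image \<Gamma>"
  shows "Re z = (real N)\<^sup>2 + real N \<or> far_from_spectrum ((real M)\<^sup>2) z"
  using assms RL unfolding path_image_rectpath[OF lohi] far_from_spectrum_def
  by (auto simp: bigbox_lo_def bigbox_hi_def)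

lemma path_in_res: "z \<in> path_image \<Gamma> \<Longrightarrow> z \<in> res_set bc (\<lambda>_. 0)"
  using path_cases[of z] line_in_free_res_set[of z N bc] far_in_free_res_set[of "(real M)\<^sup>2" z bc] N1 M2 by auto

lemma square_in_box:
  fixes k :: int
  shows "(of_int k ^ 2 \<in> box lo hi) \<longleftrightarrow> \<bar>k\<bar> \<le> int N"
proof -
  have M0: "(real M)\<^sup>2 > 0" using M2 by simp
  have "(of_int k ^ 2 \<in> box lo hi) \<longleftrightarrow> (real_of_int k)\<^sup>2 < (real N)\<^sup>2 + real N"
  proof -
    have "Re (of_int k ^ 2) = (real_of_int k)\<^sup>2" "Im (of_int k ^ 2 :: complex) = 0"
      by (simp_all add: of_int_power[symmetric] del: of_int_power)
    moreover have "- (real M)\<^sup>2 < (real_of_int k)\<^sup>2" by (rule less_le_trans[of _ 0]) (use M0 in auto)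
    ultimately show ?thesis using M0 by (auto simp: in_box_complex_iff bigbox_lo_def bigbox_hi_def)
  qed
  also have "\<dots> \<longleftrightarrow> \<bar>k\<bar> \<le> int N"
  proof
    assume "\<bar>k\<bar> \<le> int N"
    then have "\<bar>real_of_int k\<bar> \<le> real N" by linarith
    then have "(real_of_int k)\<^sup>2 \<le> (real N)\<^sup>2" by (metis abs_le_square_iff abs_of_nat)
    then show "(real_of_int k)\<^sup>2 < (real N)\<^sup>2 + real N" using N1 by simp
  next
    assume *: "(real_of_int k)\<^sup>2 < (real N)\<^sup>2 + real N"
    show "\<bar>k\<bar> \<le> int N"
    proof (rule ccontr)
      assume "\<not> \<bar>k\<bar> \<le> int N"
      then have "real N + 1 \<le> \<bar>real_of_int k\<bar>" by linarith
      then have "(real N + 1)\<^sup>2 \<le> \<bar>real_of_int k\<bar>\<^sup>2" by (intro power_mono) auto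
      then show False using * by (simp add: power2_eq_square algebra_simps)
    qed
  qed
  finally show ?thesis .
qed

text \<open>A summable majorant of \<open>1 / |z - k\<^sup>2|\<close> that is valid on the whole contour; the first summand serves
the right side, the second the others.\<close>

definition \<mu> :: "int \<Rightarrow> real" where
  "\<mu> k = gap_weight N (nat \<bar>k\<bar>) + 3 * (1 / ((real M)\<^sup>2 + (real (nat \<bar>k\<bar>))\<^sup>2))"

lemma mu_nonneg: "\<mu> k \<ge> 0"
  unfolding \<mu>_def using gap_weight_pos[OF N1, of "nat \<bar>k\<bar>"] by (intro add_nonneg_nonneg) auto

lemma mu_summable: "\<mu> summable_on A"
  unfolding \<mu>_def
proof (rule summable_on_add)
  show "(\<lambda>k. gap_weight N (nat \<bar>k\<bar>)) summable_on A"
    by (rule summable_on_int_bounded(1)[OF _ sum_gap_weight_le[OF N1]]) (use gap_weight_pos[OF N1] in \<open>auto intro: less_imp_le\<close>)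
  have "(\<lambda>k. 1 / ((real M)\<^sup>2 + (real (nat \<bar>k\<bar>))\<^sup>2)) summable_on A"
    by (rule summable_on_int_bounded(1)[OF _ sum_inverse_sum_squares_le[OF M2]]) auto
  then show "(\<lambda>k. 3 * (1 / ((real M)\<^sup>2 + (real (nat \<bar>k\<bar>))\<^sup>2))) summable_on A" by (rule summable_on_cmult_right)
qed

lemma inverse_dist_le_mu:
  assumes z: "z \<in> path_image \<Gamma>"
  shows "1 / cmod (z - of_int k ^ 2) \<le> \<mu> k"
  using path_cases[OF z]
proof
  assume r: "Re z = (real N)\<^sup>2 + real N"
  have "1 / cmod (z - of_int k ^ 2) \<le> 1 / gap N (nat \<bar>k\<bar>)"
    using gap_le_dist_square[OF r, of k] gap_ge_1[OF N1, of "nat \<bar>k\<bar>"] by (intro divide_left_mono mult_pos_pos) auto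
  then have "1 / cmod (z - of_int k ^ 2) \<le> gap_weight N (nat \<bar>k\<bar>)" using inverse_gap_le_gap_weight[OF N1] order_trans by blast
  then show ?thesis unfolding \<mu>_def by (rule add_increasing2[rotated]) simp
next
  assume "far_from_spectrum ((real M)\<^sup>2) z"
  from inverse_dist_far[OF this M2, of k] show ?thesis
    unfolding \<mu>_def using gap_weight_pos[OF N1, of "nat \<bar>k\<bar>"] by linarith
qed

lemma square_not_on_path:
  fixes k :: int shows "of_int k ^ 2 \<notin> path_image \<Gamma>"
proof
  assume "of_int k ^ 2 \<in> path_image \<Gamma>"
  from path_cases[OF this] show False
  proof
    assume r: "Re (of_int k ^ 2) = (real N)\<^sup>2 + real N"
    show False using gap_le_dist_square[OF r, of k] gap_ge_1[OF N1, of "nat \<bar>k\<bar>"] by simp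
  next
    assume "far_from_spectrum ((real M)\<^sup>2) (of_int k ^ 2)"
    from dist_square_far[OF this, of k] have "((real M)\<^sup>2 + (of_int k)\<^sup>2) / 3 \<le> 0" by simp
    moreover have "(real M)\<^sup>2 + (of_int k)\<^sup>2 > 0" using M2 by (intro add_pos_nonneg) auto
    ultimately show False by simp
  qed
qed

end

section \<open>The first-order term of the perturbation series\<close>

lemma has_sum_norm_le_finite:
  fixes f :: "'a \<Rightarrow> 'b::real_normed_vector"
  assumes "(f has_sum S) A" "\<And>X. finite X \<Longrightarrow> X \<subseteq> A \<Longrightarrow> norm (sum f X) \<le> B"
  shows "norm S \<le> B"
  by (rule tendsto_upperbound[OF tendsto_norm[OF assms(1)[unfolded has_sum_def]]])
     (auto intro!: eventually_finite_subsets_at_top_weakI assms(2))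

lemma has_sum_finite_sum:
  fixes f :: "'i \<Rightarrow> 'a \<Rightarrow> complex"
  assumes "\<And>i. ((\<lambda>k. f i k) has_sum S i) A"
  shows "((\<lambda>k. \<Sum>i\<in>J. f i k) has_sum (\<Sum>i\<in>J. S i)) A"
  by (induction J rule: infinite_finite_induct) (auto intro: has_sum_add assms)

text \<open>The contribution of a pair of indices, \<open>m\<close> inside and \<open>n\<close> outside, to the first-order term. The
denominator \<open>(n - m) n\<close> is a simpler lower bound for \<open>n\<^sup>2 - m\<^sup>2\<close>. The parameters \<open>A\<close> and \<open>B\<close> stand
for \<open>v\<^sup>*(H)\<close> and the norm of \<open>v\<close>.\<close>

definition pair_bound :: "nat \<Rightarrow> real \<Rightarrow> real \<Rightarrow> real \<Rightarrow> nat \<Rightarrow> nat \<Rightarrow> real" where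
  "pair_bound N A B H m n = (if m \<le> N \<and> N < n then (A + B * of_bool (real n - real m < H)) / ((real n - real m) * real n) else 0)"

lemma pair_bound_nonneg: "A \<ge> 0 \<Longrightarrow> B \<ge> 0 \<Longrightarrow> pair_bound N A B H m n \<ge> 0"
  by (auto simp: pair_bound_def intro!: divide_nonneg_nonneg mult_nonneg_nonneg)

lemma sum_int_abs_le:
  fixes \<phi> :: "nat \<Rightarrow> real"
  assumes "\<And>m. \<phi> m \<ge> 0"
  shows "(\<Sum>i\<in>{- int N..int N}. \<phi> (nat \<bar>i\<bar>)) \<le> 2 * (\<Sum>m\<le>N. \<phi> m)"
proof -
  have "{- int N..int N} \<subseteq> int ` {..N} \<union> (\<lambda>m. - int m) ` {..N}"
  proof
    fix i assume i: "i \<in> {- int N..int N}"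
    show "i \<in> int ` {..N} \<union> (\<lambda>m. - int m) ` {..N}"
      by (cases "i \<ge> 0") (use i in \<open>auto intro: rev_image_eqI[of "nat i"] rev_image_eqI[of "nat (-i)"]\<close>)
  qed
  then have "(\<Sum>i\<in>{- int N..int N}. \<phi> (nat \<bar>i\<bar>)) \<le> (\<Sum>i\<in>int ` {..N} \<union> (\<lambda>m. - int m) ` {..N}. \<phi> (nat \<bar>i\<bar>))"
    by (intro sum_mono2) (auto simp: assms)
  also have "\<dots> \<le> (\<Sum>i\<in>int ` {..N}. \<phi> (nat \<bar>i\<bar>)) + (\<Sum>i\<in>(\<lambda>m. - int m) ` {..N}. \<phi> (nat \<bar>i\<bar>))"
    by (subst sum.union_inter[symmetric]) (auto intro!: sum_nonneg assms)
  also have "\<dots> = 2 * (\<Sum>m\<le>N. \<phi> m)"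
    by (simp add: sum.reindex inj_on_def)
  finally show ?thesis .
qed

lemma sum_pair_bound_le:
  assumes N: "N \<ge> 1" and A: "A \<ge> 0" and B: "B \<ge> 0" and H: "H > 0"
  shows "(\<Sum>n<K. \<Sum>i\<in>{- int N..int N}. pair_bound N A B H (nat \<bar>i\<bar>) n) \<le> 2 * (12 * A + B * (H / real N))"
proof -
  have "(\<Sum>n<K. \<Sum>i\<in>{- int N..int N}. pair_bound N A B H (nat \<bar>i\<bar>) n) \<le> (\<Sum>n<K. 2 * (\<Sum>m\<le>N. pair_bound N A B H m n))"
    by (intro sum_mono sum_int_abs_le pair_bound_nonneg A B)
  also have "\<dots> = 2 * (\<Sum>m\<le>N. \<Sum>n<K. pair_bound N A B H m n)"
    unfolding sum_distrib_left[symmetric] by (subst sum.swap) (rule refl)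
  also have "(\<Sum>m\<le>N. \<Sum>n<K. pair_bound N A B H m n) = (\<Sum>m\<le>N. \<Sum>n<K. pair_bound N A B H (N - m) n)"
    by (rule sum.reindex_bij_witness[of _ "\<lambda>i. N - i" "\<lambda>i. N - i"]) auto
  also have "\<dots> \<le> (\<Sum>m\<le>N. \<Sum>p=1..K. pair_bound N A B H (N - m) (N + p))"
  proof (rule sum_mono)
    fix m
    have "(\<Sum>n<K. pair_bound N A B H (N - m) n) \<le> (\<Sum>n\<in>{..N} \<union> {1+N..K+N}. pair_bound N A B H (N - m) n)"
      by (intro sum_mono2) (auto simp: pair_bound_nonneg A B)
    also have "\<dots> = (\<Sum>n\<le>N. pair_bound N A B H (N - m) n) + (\<Sum>n=1+N..K+N. pair_bound N A B H (N - m) n)"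
      by (rule sum.union_disjoint) auto
    also have "(\<Sum>n\<le>N. pair_bound N A B H (N - m) n) = 0" by (intro sum.neutral) (auto simp: pair_bound_def)
    also have "(\<Sum>n=1+N..K+N. pair_bound N A B H (N - m) n) = (\<Sum>p=1..K. pair_bound N A B H (N - m) (p + N))"
      by (rule sum.shift_bounds_cl_nat_ivl)
    finally show "(\<Sum>n<K. pair_bound N A B H (N - m) n) \<le> (\<Sum>p=1..K. pair_bound N A B H (N - m) (N + p))" by (simp add: add.commute)
  qed
  also have "\<dots> = (\<Sum>m\<le>N. \<Sum>p=1..K. A * (1 / (real (p + m) * real (N + p))) + B * (of_bool (real (p + m) < H) / (real (p + m) * real (N + p))))"
  proof (intro sum.cong refl)
    fix m p assume "m \<in> {..N}" "p \<in> {1..K}"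
    then have e: "real (N + p) - real (N - m) = real (p + m)" "N - m \<le> N" "N < N + p" by auto
    show "pair_bound N A B H (N - m) (N + p) = A * (1 / (real (p + m) * real (N + p))) + B * (of_bool (real (p + m) < H) / (real (p + m) * real (N + p)))"
      unfolding pair_bound_def e(1) using e(2,3) by (simp add: add_divide_distrib)
  qed
  also have "\<dots> = A * (\<Sum>m\<le>N. \<Sum>p=1..K. 1 / (real (p + m) * real (N + p))) + B * (\<Sum>m\<le>N. \<Sum>p=1..K. of_bool (real (p + m) < H) / (real (p + m) * real (N + p)))"
    by (simp add: sum.distrib sum_distrib_left)
  also have "\<dots> \<le> A * 12 + B * (H / real N)"
    by (intro add_mono mult_left_mono double_sum_far double_sum_near N H A B)
  finally show ?thesis by simp
qed

text \<open>For a fixed outer index, the sum over the inner one runs effectively over \<open>- N .. N\<close>; this sum is a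
function of the outer index whose total is bounded. The factor doubles once for the sign of each
index and once for the two orders of the pair.\<close>

lemma finite_double_sum_pair_bound_le:
  assumes N: "N \<ge> 1" and A: "A \<ge> 0" and B: "B \<ge> 0" and H: "H > 0"
    and J: "finite J" and K: "finite K"
  shows "(\<Sum>j\<in>J. \<Sum>k\<in>K. pair_bound N A B H (nat \<bar>j\<bar>) (nat \<bar>k\<bar>) + pair_bound N A B H (nat \<bar>k\<bar>) (nat \<bar>j\<bar>)) \<le> 8 * (12 * A + B * (H / real N))"
proof -
  define q where "q n = (\<Sum>i\<in>{- int N..int N}. pair_bound N A B H (nat \<bar>i\<bar>) n)" for n
  have q0: "q n \<ge> 0" for n unfolding q_def by (intro sum_nonneg pair_bound_nonneg A B)
  have qK: "(\<Sum>k\<in>X. q (nat \<bar>k\<bar>)) \<le> 4 * (12 * A + B * (H / real N))" if "finite X" for X :: "int set"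
  proof -
    have qs: "(\<Sum>n<K. q n) \<le> 2 * (12 * A + B * (H / real N))" for K unfolding q_def by (rule sum_pair_bound_le[OF N A B H])
    note s = summable_on_int_bounded[OF q0 qs, of UNIV]
    have "(\<Sum>k\<in>X. q (nat \<bar>k\<bar>)) \<le> (\<Sum>\<^sub>\<infinity>k. q (nat \<bar>k\<bar>))"
      by (rule finite_sum_le_infsum[OF s(1) that]) (auto simp: q0)
    then show ?thesis using s(2) by simp
  qed
  have part: "(\<Sum>k\<in>X. \<Sum>j\<in>Y. pair_bound N A B H (nat \<bar>j\<bar>) (nat \<bar>k\<bar>)) \<le> 4 * (12 * A + B * (H / real N))" if "finite X" "finite Y" for X Y :: "int set"
  proof -
    have "(\<Sum>k\<in>X. \<Sum>j\<in>Y. pair_bound N A B H (nat \<bar>j\<bar>) (nat \<bar>k\<bar>)) \<le> (\<Sum>k\<in>X. q (nat \<bar>k\<bar>))"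
    proof (rule sum_mono)
      fix k
      have "(\<Sum>j\<in>Y. pair_bound N A B H (nat \<bar>j\<bar>) (nat \<bar>k\<bar>)) = (\<Sum>j\<in>Y \<inter> {- int N..int N}. pair_bound N A B H (nat \<bar>j\<bar>) (nat \<bar>k\<bar>))"
        by (rule sum.mono_neutral_right) (use that in \<open>auto simp: pair_bound_def\<close>)
      also have "\<dots> \<le> q (nat \<bar>k\<bar>)" unfolding q_def by (intro sum_mono2) (auto simp: pair_bound_nonneg A B)
      finally show "(\<Sum>j\<in>Y. pair_bound N A B H (nat \<bar>j\<bar>) (nat \<bar>k\<bar>)) \<le> q (nat \<bar>k\<bar>)" .
    qed
    then show ?thesis using qK[OF that(1)] by simp
  qed
  have "(\<Sum>j\<in>J. \<Sum>k\<in>K. pair_bound N A B H (nat \<bar>j\<bar>) (nat \<bar>k\<bar>) + pair_bound N A B H (nat \<bar>k\<bar>) (nat \<bar>j\<bar>)) =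
     (\<Sum>k\<in>K. \<Sum>j\<in>J. pair_bound N A B H (nat \<bar>j\<bar>) (nat \<bar>k\<bar>)) + (\<Sum>j\<in>J. \<Sum>k\<in>K. pair_bound N A B H (nat \<bar>k\<bar>) (nat \<bar>j\<bar>))"
    unfolding sum.distrib by (subst sum.swap) (rule refl)
  then show ?thesis using part[OF K J] part[OF J K] by linarith
qed

context big_box begin

text \<open>Exactly one of the two poles must be inside, and then the residue is \<open>1 / |j\<^sup>2 - k\<^sup>2|\<close>.\<close>

lemma two_poles_le_pair_bound:
  assumes v: "v \<in> L1" and j: "j \<in> idx bc" and k: "k \<in> idx bc"
  defines "c \<equiv> 1 / (2 * of_real pi * \<i>) * contour_integral \<Gamma> (\<lambda>z. 1 / ((z - of_int j ^ 2) * (z - of_int k ^ 2)))"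
  shows "cmod (v_matrix bc v j k) * cmod c \<le>
     2 * (pair_bound N (vstar bc v H) (norm_L1 v) H (nat \<bar>j\<bar>) (nat \<bar>k\<bar>) + pair_bound N (vstar bc v H) (norm_L1 v) H (nat \<bar>k\<bar>) (nat \<bar>j\<bar>))"
proof -
  define A where "A = vstar bc v H"
  define B where "B = norm_L1 v"
  have A: "A \<ge> 0" and B: "B \<ge> 0" using vstar_nonneg[OF v] norm_L1_nonneg by (auto simp: A_def B_def)
  define m where "m = nat \<bar>j\<bar>"
  define n where "n = nat \<bar>k\<bar>"
  have c: "cmod c = of_bool ((m \<le> N) \<noteq> (n \<le> N)) / \<bar>(real m)\<^sup>2 - (real n)\<^sup>2\<bar>"
  proof -
    have "cmod c = of_bool ((of_int j ^ 2 \<in> box lo hi) \<noteq> (of_int k ^ 2 \<in> box lo hi)) / cmod (of_int j ^ 2 - of_int k ^ 2)"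
      unfolding c_def by (rule contour_integral_two_poles_rectpath[OF lohi square_not_on_path square_not_on_path])
    moreover have "cmod (of_int j ^ 2 - of_int k ^ 2) = \<bar>(real m)\<^sup>2 - (real n)\<^sup>2\<bar>"
    proof -
      have "(of_int j ^ 2 - of_int k ^ 2 :: complex) = of_real ((real m)\<^sup>2 - (real n)\<^sup>2)"
        by (simp add: m_def n_def of_nat_nat)
      then show ?thesis by (simp only: norm_of_real)
    qed
    moreover have "\<bar>j\<bar> \<le> int N \<longleftrightarrow> m \<le> N" "\<bar>k\<bar> \<le> int N \<longleftrightarrow> n \<le> N" by (auto simp: m_def n_def)
    ultimately show ?thesis unfolding square_in_box by simp
  qed
  have V: "cmod (v_matrix bc v j k) \<le> 2 * (A + B * of_bool (\<bar>real m - real n\<bar> < H))"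
    using cmod_v_matrix_le_vstar[OF v j k, of H] by (simp add: A_def B_def m_def n_def of_nat_nat)
  have main: "2 * (A + B * of_bool (\<bar>real m - real n\<bar> < H)) * (1 / \<bar>(real m)\<^sup>2 - (real n)\<^sup>2\<bar>) \<le> 2 * pair_bound N A B H m n"
    if "m \<le> N" "N < n" for m n
  proof -
    have mn: "real m < real n" using that by simp
    have "\<bar>(real m)\<^sup>2 - (real n)\<^sup>2\<bar> = (real n - real m) * (real n + real m)"
    proof -
      have "(real m)\<^sup>2 \<le> (real n)\<^sup>2" using mn by (intro power_mono) auto
      then have "\<bar>(real m)\<^sup>2 - (real n)\<^sup>2\<bar> = (real n)\<^sup>2 - (real m)\<^sup>2" by simp
      then show ?thesis by (simp add: power2_eq_square algebra_simps)
    qed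
    moreover have "(real n - real m) * real n \<le> (real n - real m) * (real n + real m)" "(real n - real m) * real n > 0"
      using mn by (auto intro!: mult_left_mono mult_pos_pos)
    ultimately have "1 / \<bar>(real m)\<^sup>2 - (real n)\<^sup>2\<bar> \<le> 1 / ((real n - real m) * real n)"
      using mn by (intro divide_left_mono mult_pos_pos) auto
    then have "2 * (A + B * of_bool (\<bar>real m - real n\<bar> < H)) * (1 / \<bar>(real m)\<^sup>2 - (real n)\<^sup>2\<bar>) \<le>
       2 * (A + B * of_bool (\<bar>real m - real n\<bar> < H)) * (1 / ((real n - real m) * real n))"
      using A B by (intro mult_left_mono) auto
    moreover have "\<bar>real m - real n\<bar> = real n - real m" using mn by simp
    ultimately show ?thesis using that by (simp add: pair_bound_def)
  qed
  have "cmod (v_matrix bc v j k) * cmod c \<le> 2 * (pair_bound N A B H m n + pair_bound N A B H n m)"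
  proof (cases "(m \<le> N) = (n \<le> N)")
    case True
    then show ?thesis using pair_bound_nonneg[OF A B, of N H m n] pair_bound_nonneg[OF A B, of N H n m] by (simp add: c)
  next
    case False
    have "cmod (v_matrix bc v j k) * cmod c \<le> 2 * (A + B * of_bool (\<bar>real m - real n\<bar> < H)) * (1 / \<bar>(real m)\<^sup>2 - (real n)\<^sup>2\<bar>)"
      unfolding c using False by (intro mult_mono V) (auto simp: A B)
    also have "\<dots> \<le> 2 * (pair_bound N A B H m n + pair_bound N A B H n m)"
    proof (cases "m \<le> N")
      case True
      then show ?thesis using main[of m n] False pair_bound_nonneg[OF A B, of N H n m] by simp
    next
      case mN: False
      then show ?thesis using main[of n m] False pair_bound_nonneg[OF A B, of N H m n]
        by (simp add: abs_minus_commute)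
    qed
    finally show ?thesis .
  qed
  then show ?thesis by (simp add: A_def B_def m_def n_def)
qed

lemma rho_on_path_le: "z \<in> path_image \<Gamma> \<Longrightarrow> rho bc z \<le> infsum \<mu> (idx bc)"
  unfolding rho_def
  by (intro infsum_mono summable_inverse_distance mu_summable inverse_dist_le_mu)
     (use path_in_res[of z bc] in \<open>auto simp: res_set_free\<close>)

definition first_order :: "bcond \<Rightarrow> (real \<Rightarrow> complex) \<Rightarrow> (real \<Rightarrow> complex) \<Rightarrow> real \<Rightarrow> complex \<Rightarrow> complex" where
  "first_order bc v f x z = green bc (\<lambda>_. 0) z (\<lambda>x. v x * green bc (\<lambda>_. 0) z f x) x"

text \<open>Integration term by term turns the double expansion into a double sum of residues. It is carried out
for one index after the other, so that only single series occur. The resulting iterated sum is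
estimated through its finite rectangular partial sums.\<close>

theorem first_order_contour_bound:
  assumes v: "v \<in> L1" and f: "f \<in> L1" and x: "x \<in> {0..pi}" and H: "H > 0"
  shows "continuous_on (path_image \<Gamma>) (first_order bc v f x)"
    "cmod (1 / (2 * of_real pi * \<i>) * contour_integral \<Gamma> (first_order bc v f x))
       \<le> 32 * norm_L1 f * (12 * vstar bc v H + norm_L1 v * (H / real N))"
proof -
  define I where "I = idx bc"
  define b where "b j z = fcoeff bc (\<lambda>x. v x * green bc (\<lambda>_. 0) z f x) j" for j z
  define P where "P j k z = 1 / ((z - of_int j ^ 2) * (z - of_int k ^ 2))" for j k :: int and z :: complex
  have dist0: "z - of_int k ^ 2 \<noteq> 0" if "z \<in> path_image \<Gamma>" for k :: int and z
    using square_not_on_path[of k] that by auto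
  have cP: "continuous_on (path_image \<Gamma>) (P j k)" for j k
    unfolding P_def using dist0 by (intro continuous_intros) auto
  have res: "z \<in> res_set bc (\<lambda>_. 0)" if "z \<in> path_image \<Gamma>" for z using path_in_res[OF that] .
  have inv: "norm (1 / (z - of_int k ^ 2)) \<le> \<mu> k" if "z \<in> path_image \<Gamma>" for z k
    using inverse_dist_le_mu[OF that, of k] by (simp add: norm_divide)
  have PM: "norm (P j k z) \<le> \<mu> j * \<mu> k" if "z \<in> path_image \<Gamma>" for j k z
  proof -
    have "norm (1 / (z - of_int j ^ 2)) * norm (1 / (z - of_int k ^ 2)) \<le> \<mu> j * \<mu> k"
      by (intro mult_mono inv that mu_nonneg) auto
    then show ?thesis by (simp add: P_def norm_divide norm_mult)
  qed
  define F where "F j k z = fcoeff bc f k * v_matrix bc v j k * P j k z" for j k z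
  have cF: "continuous_on (path_image \<Gamma>) (F j k)" for j k unfolding F_def by (intro continuous_intros cP)
  have inner: "((\<lambda>k. contour_integral \<Gamma> (F j k)) has_sum contour_integral \<Gamma> (\<lambda>z. b j z / (z - of_int j ^ 2))) I"
    "continuous_on (path_image \<Gamma>) (\<lambda>z. b j z / (z - of_int j ^ 2))" for j
  proof -
    have M: "(\<lambda>k. (sqrt 2 * norm_L1 f) * (2 * norm_L1 v) * \<mu> j * \<mu> k) summable_on I"
      by (intro summable_on_cmult_right mu_summable)
    have le: "norm (F j k z) \<le> (sqrt 2 * norm_L1 f) * (2 * norm_L1 v) * \<mu> j * \<mu> k" if "z \<in> path_image \<Gamma>" for k z
    proof -
      have "norm (F j k z) \<le> ((sqrt 2 * norm_L1 f) * (2 * norm_L1 v)) * (\<mu> j * \<mu> k)"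
        unfolding F_def norm_mult[of _ "P j k z"] norm_mult[of "fcoeff bc f k"]
        by (intro mult_mono fcoeff_bound f cmod_v_matrix_le v PM that mult_nonneg_nonneg mu_nonneg) (auto simp: norm_L1_nonneg)
      then show ?thesis by (simp add: mult.assoc)
    qed
    have S: "((\<lambda>k. F j k z) has_sum b j z / (z - of_int j ^ 2)) I" if z: "z \<in> path_image \<Gamma>" for z
    proof -
      have "((\<lambda>k. fcoeff bc f k / (z - of_int k ^ 2) * v_matrix bc v j k * (1 / (z - of_int j ^ 2))) has_sum b j z * (1 / (z - of_int j ^ 2))) I"
        unfolding b_def I_def by (intro has_sum_cmult_left fcoeff_green_free_has_sum v f res z)
      moreover have "fcoeff bc f k / (z - of_int k ^ 2) * v_matrix bc v j k * (1 / (z - of_int j ^ 2)) = F j k z" for k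
        by (simp add: F_def P_def)
      ultimately show ?thesis by simp
    qed
    show "((\<lambda>k. contour_integral \<Gamma> (F j k)) has_sum contour_integral \<Gamma> (\<lambda>z. b j z / (z - of_int j ^ 2))) I"
      "continuous_on (path_image \<Gamma>) (\<lambda>z. b j z / (z - of_int j ^ 2))"
      by (rule contour_integral_rectpath_has_sum[OF lohi cF M le S]; assumption)+
  qed
  define G where "G j z = eig bc j x * (b j z / (z - of_int j ^ 2))" for j z
  have cG: "continuous_on (path_image \<Gamma>) (G j)" for j unfolding G_def by (intro continuous_intros inner(2))
  define \<beta> where "\<beta> = sqrt 2 * (norm_L1 v * (2 * infsum \<mu> I * norm_L1 f))"
  have M: "(\<lambda>j. sqrt 2 * \<beta> * \<mu> j) summable_on I" by (intro summable_on_cmult_right mu_summable)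
  have GM: "norm (G j z) \<le> sqrt 2 * \<beta> * \<mu> j" if z: "z \<in> path_image \<Gamma>" for j z
  proof -
    have cg: "continuous_on {0..pi} (green bc (\<lambda>_. 0) z f)" by (rule green_continuous[OF L1_const res[OF z] f])
    have "cmod (b j z) \<le> sqrt 2 * norm_L1 (\<lambda>x. v x * green bc (\<lambda>_. 0) z f x)"
      unfolding b_def by (rule fcoeff_bound[OF L1_mult_continuous[OF v cg]])
    also have "\<dots> \<le> \<beta>" unfolding \<beta>_def
    proof (intro mult_left_mono norm_L1_mult_le[OF v cg])
      fix t assume t: "t \<in> {0..pi}"
      have "cmod (green bc (\<lambda>_. 0) z f t) \<le> 2 * rho bc z * norm_L1 f" by (rule green_free_bound[OF res[OF z] f t])
      also have "\<dots> \<le> 2 * infsum \<mu> I * norm_L1 f"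
        unfolding I_def by (intro mult_right_mono mult_left_mono rho_on_path_le z norm_L1_nonneg) auto
      finally show "cmod (green bc (\<lambda>_. 0) z f t) \<le> 2 * infsum \<mu> I * norm_L1 f" .
    qed simp
    finally have b: "cmod (b j z) \<le> \<beta>" .
    have "norm (G j z) = cmod (eig bc j x) * (cmod (b j z) * norm (1 / (z - of_int j ^ 2)))"
      by (simp add: G_def norm_mult norm_divide)
    also have "\<dots> \<le> sqrt 2 * (\<beta> * \<mu> j)"
      using b order_trans[OF norm_ge_zero b] by (intro mult_mono cmod_eig_le inv z mult_nonneg_nonneg) auto
    finally show ?thesis by simp
  qed
  have S: "((\<lambda>j. G j z) has_sum first_order bc v f x z) I" if z: "z \<in> path_image \<Gamma>" for z
  proof -
    have cg: "continuous_on {0..pi} (green bc (\<lambda>_. 0) z f)" by (rule green_continuous[OF L1_const res[OF z] f])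
    have l: "(\<lambda>x. v x * green bc (\<lambda>_. 0) z f x) \<in> L1" by (rule L1_mult_continuous[OF v cg])
    have zk: "z \<noteq> of_int k ^ 2" for k using dist0[OF z, of k] by auto
    have "((\<lambda>j. b j z / (z - of_int j ^ 2) * eig bc j x) has_sum first_order bc v f x z) I"
      unfolding b_def first_order_def I_def
      by (rule bvp_series[OF l green_bvp[OF L1_const res[OF z] l] zk x])
    then show ?thesis by (simp add: G_def mult.commute)
  qed
  show "continuous_on (path_image \<Gamma>) (first_order bc v f x)"
    by (rule contour_integral_rectpath_has_sum(2)[OF lohi cG M GM S])
  have outer: "((\<lambda>j. contour_integral \<Gamma> (G j)) has_sum contour_integral \<Gamma> (first_order bc v f x)) I"
    by (rule contour_integral_rectpath_has_sum(1)[OF lohi cG M GM S])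
  define w where "w = 1 / (2 * of_real pi * \<i>)"
  define Q where "Q = 32 * norm_L1 f * (12 * vstar bc v H + norm_L1 v * (H / real N))"
  have "((\<lambda>j. w * contour_integral \<Gamma> (G j)) has_sum w * contour_integral \<Gamma> (first_order bc v f x)) I"
    by (rule has_sum_cmult_right[OF outer])
  then have "cmod (w * contour_integral \<Gamma> (first_order bc v f x)) \<le> Q"
  proof (rule has_sum_norm_le_finite)
    fix J assume J: "finite J" "J \<subseteq> I"
    have "w * contour_integral \<Gamma> (G j) = eig bc j x * (w * contour_integral \<Gamma> (\<lambda>z. b j z / (z - of_int j ^ 2)))" for j
      unfolding G_def by (subst contour_integral_lmul) (use contour_integral_rectpath(1)[OF lohi inner(2)] in auto)
    then have "((\<lambda>k. \<Sum>j\<in>J. eig bc j x * (w * contour_integral \<Gamma> (F j k))) has_sum (\<Sum>j\<in>J. w * contour_integral \<Gamma> (G j))) I"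
      by (simp only:) (intro has_sum_finite_sum has_sum_cmult_right inner(1))
    then show "cmod (\<Sum>j\<in>J. w * contour_integral \<Gamma> (G j)) \<le> Q"
    proof (rule has_sum_norm_le_finite)
      fix K assume K: "finite K" "K \<subseteq> I"
      define h where "h j k = pair_bound N (vstar bc v H) (norm_L1 v) H (nat \<bar>j\<bar>) (nat \<bar>k\<bar>) + pair_bound N (vstar bc v H) (norm_L1 v) H (nat \<bar>k\<bar>) (nat \<bar>j\<bar>)" for j k :: int
      have each: "cmod (eig bc j x * (w * contour_integral \<Gamma> (F j k))) \<le> 4 * norm_L1 f * h j k" if "j \<in> J" "k \<in> K" for j k
      proof -
        have jk: "j \<in> idx bc" "k \<in> idx bc" using that J K by (auto simp: I_def)
        have "w * contour_integral \<Gamma> (F j k) = fcoeff bc f k * (v_matrix bc v j k * (w * contour_integral \<Gamma> (P j k)))"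
          unfolding F_def by (subst contour_integral_lmul) (use contour_integral_rectpath(1)[OF lohi cP] in auto)
        then have "cmod (eig bc j x * (w * contour_integral \<Gamma> (F j k))) =
           cmod (eig bc j x) * (cmod (fcoeff bc f k) * (cmod (v_matrix bc v j k) * cmod (w * contour_integral \<Gamma> (P j k))))"
          by (simp only: norm_mult)
        also have "\<dots> \<le> sqrt 2 * ((sqrt 2 * norm_L1 f) * (2 * h j k))"
          unfolding h_def w_def P_def
          by (intro mult_mono cmod_eig_le fcoeff_bound f two_poles_le_pair_bound v jk mult_nonneg_nonneg) (auto simp: norm_L1_nonneg)
        also have "\<dots> = 4 * norm_L1 f * h j k" using real_sqrt_mult_self[of 2] by (simp add: mult.assoc[symmetric])
        finally show ?thesis .
      qed
      have "cmod (\<Sum>k\<in>K. \<Sum>j\<in>J. eig bc j x * (w * contour_integral \<Gamma> (F j k))) \<le> (\<Sum>k\<in>K. \<Sum>j\<in>J. 4 * norm_L1 f * h j k)"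
        by (intro order_trans[OF norm_sum] sum_mono each)
      also have "\<dots> = 4 * norm_L1 f * (\<Sum>j\<in>J. \<Sum>k\<in>K. h j k)"
        unfolding sum_distrib_left[symmetric] by (subst sum.swap) (rule refl)
      also have "\<dots> \<le> 4 * norm_L1 f * (8 * (12 * vstar bc v H + norm_L1 v * (H / real N)))"
        unfolding h_def
        by (intro mult_left_mono finite_double_sum_pair_bound_le N1 vstar_nonneg v norm_L1_nonneg H J K) (simp add: norm_L1_nonneg)
      also have "\<dots> = Q" by (simp add: Q_def)
      finally show "cmod (\<Sum>k\<in>K. \<Sum>j\<in>J. eig bc j x * (w * contour_integral \<Gamma> (F j k))) \<le> Q" .
    qed
  qed
  then show "cmod (1 / (2 * of_real pi * \<i>) * contour_integral \<Gamma> (first_order bc v f x))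
       \<le> 32 * norm_L1 f * (12 * vstar bc v H + norm_L1 v * (H / real N))" by (simp add: w_def Q_def)
qed

section \<open>The remainder\<close>

text \<open>On the right side the remainder is dominated by \<open>\<rho>\<^sup>3\<close>, whose integral is \<open>O(1/N)\<close>. On each of the
other sides \<open>\<rho> \<le> 24 / M\<close> and the length is at most \<open>2 M\<^sup>2\<close>. The constant is \<open>2 \<sqdot> 24\<^sup>3 = 27648\<close> for
every side.\<close>

theorem remainder_contour_bound:
  assumes v: "v \<in> L1" and f: "f \<in> L1" and x: "x \<in> {0..pi}"
    and small: "\<And>z. z \<in> path_image \<Gamma> \<Longrightarrow> 2 * rho bc z * norm_L1 v \<le> 1/2"
  defines "E \<equiv> \<lambda>z. green bc v z f x - green bc (\<lambda>_. 0) z f x - first_order bc v f x z"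
  shows "continuous_on (path_image \<Gamma>) E"
    "cmod (contour_integral \<Gamma> E) \<le> 1769472 * (norm_L1 v)\<^sup>2 * norm_L1 f / real N"
proof -
  define c where "c = 16 * (norm_L1 v)\<^sup>2 * norm_L1 f"
  have c: "c \<ge> 0" using norm_L1_nonneg[of f] by (simp add: c_def)
  have cont: "continuous_on (path_image \<Gamma>) (\<lambda>z. green bc w z f x)" if "w \<in> L1" "path_image \<Gamma> \<subseteq> res_set bc w" for w
    by (rule continuous_on_subset[OF holomorphic_on_imp_continuous_on[OF green_holomorphic[OF that(1) f x]] that(2)])
  have rv: "path_image \<Gamma> \<subseteq> res_set bc v" using res_set_small_rho[OF v path_in_res small] by blast
  show cE: "continuous_on (path_image \<Gamma>) E"
    unfolding E_def
    by (intro continuous_intros cont v rv L1_const first_order_contour_bound(1)[where H=1] f x) (auto intro: path_in_res)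
  have Eb: "cmod (E z) \<le> c * rho bc z ^ 3" if "z \<in> path_image \<Gamma>" for z
    using second_order_remainder_bound[OF v path_in_res[OF that] small[OF that] f x]
    unfolding E_def first_order_def c_def by (simp add: ac_simps)
  define R where "R = (real N)\<^sup>2 + real N"
  define L where "L = (real M)\<^sup>2"
  have L: "L > 0" "R \<le> L" using M2 RL by (auto simp: L_def R_def)
  have R0: "R > 0" using N1 by (simp add: R_def add_pos_nonneg)
  define p where "p = Complex (Re hi) (Im lo)"
  define q where "q = Complex (Re lo) (Im hi)"
  note rect = contour_integral_rectpath[OF lohi cE, folded p_def q_def]
  have crd: "Re p = R" "Im p = - L" "Re q = - L" "Im q = L" "Re hi = R" "Im hi = L" "Re lo = - L" "Im lo = - L"
    by (simp_all add: p_def q_def bigbox_lo_def bigbox_hi_def R_def L_def)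
  have side: "cmod (contour_integral (linepath s t) E) \<le> 27648 * c / real N"
    if seg: "closed_segment s t \<subseteq> path_image \<Gamma>" and far: "\<And>z. z \<in> closed_segment s t \<Longrightarrow> far_from_spectrum L z"
      and len: "cmod (t - s) \<le> 2 * L" for s t
  proof -
    have "cmod (contour_integral (linepath s t) E) \<le> (c * (12 / (real M - 1)) ^ 3) * cmod (t - s)"
    proof (rule contour_integral_bound_linepath)
      show "E contour_integrable_on linepath s t"
        by (rule contour_integrable_continuous_linepath[OF continuous_on_subset[OF cE seg]])
      show "0 \<le> c * (12 / (real M - 1)) ^ 3" using c M2 by auto
      fix z assume z: "z \<in> closed_segment s t"
      have "cmod (E z) \<le> c * rho bc z ^ 3" using Eb z seg by auto
      also have "\<dots> \<le> c * (12 / (real M - 1)) ^ 3"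
        using rho_far_le[OF far[OF z, unfolded L_def] M2, of bc] rho_nonneg c by (intro mult_left_mono power_mono) auto
      finally show "cmod (E z) \<le> c * (12 / (real M - 1)) ^ 3" .
    qed
    also have "\<dots> \<le> (c * (24 / real M) ^ 3) * (2 * L)"
    proof (intro mult_mono mult_left_mono power_mono len)
      have "12 / (real M - 1) \<le> 12 / (real M / 2)" using M2 by (intro divide_left_mono mult_pos_pos) auto
      then show "12 / (real M - 1) \<le> 24 / real M" by simp
    qed (use c M2 in auto)
    also have "\<dots> = 27648 * c / real M" using M2 by (simp add: L_def power_divide power2_eq_square power3_eq_cube)
    also have "\<dots> \<le> 27648 * c / real N" using c MN N1 by (intro divide_left_mono) auto
    finally show ?thesis .
  qed
  have segs: "closed_segment lo p \<subseteq> path_image \<Gamma>" "closed_segment p hi \<subseteq> path_image \<Gamma>"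
    "closed_segment hi q \<subseteq> path_image \<Gamma>" "closed_segment q lo \<subseteq> path_image \<Gamma>"
    using rect(3) by auto
  have bottom: "cmod (contour_integral (linepath lo p) E) \<le> 27648 * c / real N"
  proof (rule side[OF segs(1)])
    fix z assume "z \<in> closed_segment lo p"
    then show "far_from_spectrum L z" using L R0 by (auto simp: closed_segment_same_Im crd far_from_spectrum_def closed_segment_eq_real_ivl)
  next
    show "cmod (p - lo) \<le> 2 * L" using L R0 cmod_eq_Re[of "p - lo"] by (simp add: crd)
  qed
  have top: "cmod (contour_integral (linepath hi q) E) \<le> 27648 * c / real N"
  proof (rule side[OF segs(3)])
    fix z assume "z \<in> closed_segment hi q"
    then show "far_from_spectrum L z" using L R0 by (auto simp: closed_segment_same_Im crd far_from_spectrum_def closed_segment_eq_real_ivl)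
  next
    show "cmod (q - hi) \<le> 2 * L" using L R0 cmod_eq_Re[of "q - hi"] by (simp add: crd)
  qed
  have left: "cmod (contour_integral (linepath q lo) E) \<le> 27648 * c / real N"
  proof (rule side[OF segs(4)])
    fix z assume "z \<in> closed_segment q lo"
    then show "far_from_spectrum L z" using L R0 by (auto simp: closed_segment_same_Re crd far_from_spectrum_def closed_segment_eq_real_ivl)
  next
    show "cmod (lo - q) \<le> 2 * L" using L R0 cmod_eq_Im[of "lo - q"] by (simp add: crd)
  qed
  have right: "cmod (contour_integral (linepath p hi) E) \<le> 27648 * c / real N"
  proof -
    have on: "Complex R t \<in> path_image \<Gamma>" if "t \<in> {-L..L}" for t
      using that R0 L unfolding path_image_rectpath[OF lohi] crd by auto
    have "contour_integral (linepath p hi) E = \<i> * integral {Im p..Im hi} (\<lambda>t. E (Complex (Re p) t))"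
      by (rule contour_integral_linepath_same_Re) (use L in \<open>simp_all add: crd\<close>)
    then have "cmod (contour_integral (linepath p hi) E) = cmod (integral {-L..L} (\<lambda>t. E (Complex R t)))"
      by (simp add: crd norm_mult)
    also have "\<dots> \<le> integral {-L..L} (\<lambda>t. c * rho bc (Complex R t) ^ 3)"
    proof (rule integral_norm_bound_integral)
      have "continuous_on {-L..L} (\<lambda>t. E (of_real R + \<i> * of_real t))"
        by (rule continuous_on_compose2[OF cE]) (use on in \<open>auto intro!: continuous_intros simp: Complex_eq\<close>)
      then show "(\<lambda>t. E (Complex R t)) integrable_on {-L..L}" by (simp add: Complex_eq integrable_continuous_real)
      show "(\<lambda>t. c * rho bc (Complex R t) ^ 3) integrable_on {-L..L}"
        unfolding R_def by (intro integrable_continuous_real continuous_intros integral_rho_cube_le(1) N1) (use L in simp)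
      show "cmod (E (Complex R t)) \<le> c * rho bc (Complex R t) ^ 3" if "t \<in> {-L..L}" for t
        by (rule Eb[OF on[OF that]])
    qed
    also have "\<dots> = c * integral {-L..L} (\<lambda>t. rho bc (Complex R t) ^ 3)" by simp
    also have "\<dots> \<le> c * (27648 / real N)"
      unfolding R_def by (intro mult_left_mono integral_rho_cube_le(2) N1 c) (use L in simp)
    finally show ?thesis by (simp add: mult.commute[of c])
  qed
  have "cmod (contour_integral \<Gamma> E) \<le> cmod (contour_integral (linepath lo p) E) + cmod (contour_integral (linepath p hi) E) +
     cmod (contour_integral (linepath hi q) E) + cmod (contour_integral (linepath q lo) E)"
    unfolding rect(2) by (intro order_trans[OF norm_triangle_ineq] add_mono order_refl)
  also have "\<dots> \<le> 4 * (27648 * c / real N)" using bottom top left right by linarith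
  also have "\<dots> = 1769472 * (norm_L1 v)\<^sup>2 * norm_L1 f / real N" by (simp add: c_def)
  finally show "cmod (contour_integral \<Gamma> E) \<le> 1769472 * (norm_L1 v)\<^sup>2 * norm_L1 f / real N" .
qed

theorem difference_contour_bound:
  assumes v: "v \<in> L1" and f: "f \<in> L1" and x: "x \<in> {0..pi}" and H: "H > 0"
    and small: "\<And>z. z \<in> path_image \<Gamma> \<Longrightarrow> 2 * rho bc z * norm_L1 v \<le> 1/2"
  shows "cmod (1 / (2 * of_real pi * \<i>) * contour_integral \<Gamma> (\<lambda>z. green bc v z f x - green bc (\<lambda>_. 0) z f x))
     \<le> norm_L1 f * (384 * vstar bc v H + 32 * norm_L1 v * (H / real N) + 1769472 * (norm_L1 v)\<^sup>2 / real N)"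
proof -
  define E where "E z = green bc v z f x - green bc (\<lambda>_. 0) z f x - first_order bc v f x z" for z
  define w where "w = 1 / (2 * of_real pi * \<i>)"
  note E = remainder_contour_bound[OF v f x small, folded E_def]
  note F = first_order_contour_bound[OF v f x H, of bc, folded w_def]
  have w: "cmod w \<le> 1" using pi_gt3 by (simp add: w_def norm_divide norm_mult)
  have "contour_integral \<Gamma> (\<lambda>z. green bc v z f x - green bc (\<lambda>_. 0) z f x) = contour_integral \<Gamma> (\<lambda>z. E z + first_order bc v f x z)"
    by (simp add: E_def)
  also have "\<dots> = contour_integral \<Gamma> E + contour_integral \<Gamma> (first_order bc v f x)"
    by (intro contour_integral_add contour_integral_rectpath(1)[OF lohi] E(1) F(1))
  finally have "w * contour_integral \<Gamma> (\<lambda>z. green bc v z f x - green bc (\<lambda>_. 0) z f x) = w * contour_integral \<Gamma> E + w * contour_integral \<Gamma> (first_order bc v f x)"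
    by (simp add: distrib_left)
  also have "cmod \<dots> \<le> 1 * (1769472 * (norm_L1 v)\<^sup>2 * norm_L1 f / real N) + 32 * norm_L1 f * (12 * vstar bc v H + norm_L1 v * (H / real N))"
    by (rule order_trans[OF norm_triangle_ineq]) (intro add_mono F(2), unfold norm_mult, intro mult_mono w E(2), auto)
  finally show ?thesis by (simp add: w_def algebra_simps)
qed

end

section \<open>Deformation of the contour\<close>

definition rect_lo :: "real \<Rightarrow> real \<Rightarrow> complex" where "rect_lo \<omega> h = Complex (- \<omega>) (- h)"
definition rect_hi :: "nat \<Rightarrow> real \<Rightarrow> complex" where "rect_hi N h = Complex ((real N)\<^sup>2 + real N) h"

lemma interior_Pi_rect: "interior (Pi_rect N \<omega> h) = box (rect_lo \<omega> h) (rect_hi N h)"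
proof -
  have "Pi_rect N \<omega> h = cbox (rect_lo \<omega> h) (rect_hi N h)"
    by (auto simp: Pi_rect_def in_cbox_complex_iff rect_lo_def rect_hi_def)
  then show ?thesis by (simp add: interior_cbox)
qed

lemma bigbox_eq_rect: "bigbox_lo M = rect_lo ((real M)\<^sup>2) ((real M)\<^sup>2)" "bigbox_hi N M = rect_hi N ((real M)\<^sup>2)"
  by (simp_all add: bigbox_lo_def bigbox_hi_def rect_lo_def rect_hi_def)

lemma rect_order:
  assumes "\<omega> > 0" "h > 0"
  shows "Re (rect_lo \<omega> h) \<le> Re (rect_hi N h)" "Im (rect_lo \<omega> h) \<le> Im (rect_hi N h)"
  using assms by (auto simp: rect_lo_def rect_hi_def intro: order_trans[of _ 0])

lemma outside_box_in_res:
  assumes adm: "admissible bc v N \<omega> h" and z: "Re z \<le> (real N)\<^sup>2 + real N" "z \<notin> box (rect_lo \<omega> h) (rect_hi N h)"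
  shows "z \<in> res_set bc v \<inter> res_set bc (\<lambda>_. 0)"
  using adm z unfolding admissible_def interior_Pi_rect res_set_def by blast

lemma rect_path_in_res:
  assumes adm: "admissible bc v N \<omega> h" and le: "\<omega> \<le> \<omega>'" "h \<le> h'"
  shows "path_image (rectpath (rect_lo \<omega>' h') (rect_hi N h')) \<subseteq> res_set bc v \<inter> res_set bc (\<lambda>_. 0)"
proof
  have pos: "\<omega> > 0" "h > 0" using adm by (auto simp: admissible_def)
  then have pos': "\<omega>' > 0" "h' > 0" using le by auto
  fix z assume "z \<in> path_image (rectpath (rect_lo \<omega>' h') (rect_hi N h'))"
  then have z: "z \<in> cbox (rect_lo \<omega>' h') (rect_hi N h')" "z \<notin> box (rect_lo \<omega>' h') (rect_hi N h')"
    by (auto simp: path_image_rectpath_cbox_minus_box[OF rect_order[OF pos']])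
  have "box (rect_lo \<omega> h) (rect_hi N h) \<subseteq> box (rect_lo \<omega>' h') (rect_hi N h')"
    using le by (auto simp: in_box_complex_iff rect_lo_def rect_hi_def)
  then have "z \<notin> box (rect_lo \<omega> h) (rect_hi N h)" using z(2) by blast
  moreover have "Re z \<le> (real N)\<^sup>2 + real N" using z(1) by (auto simp: in_cbox_complex_iff rect_hi_def)
  ultimately show "z \<in> res_set bc v \<inter> res_set bc (\<lambda>_. 0)" by (intro outside_box_in_res[OF adm])
qed

text \<open>Corners enter the parametrisation of a rectangle linearly, so the straight homotopy between two
rectangles runs through rectangles.\<close>

lemma rectpath_affine:
  "(1 - s) *\<^sub>R rectpath a b t + s *\<^sub>R rectpath a' b' t = rectpath ((1 - s) *\<^sub>R a + s *\<^sub>R a') ((1 - s) *\<^sub>R b + s *\<^sub>R b') t"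
  unfolding rectpath_def Let_def joinpaths_def linepath_def
  by (simp add: complex_eq_iff) (simp add: algebra_simps)

text \<open>Every intermediate rectangle contains the original one and has the same right side, so its boundary
avoids all eigenvalues.\<close>

lemma contour_integral_rect_enlarge:
  assumes v: "v \<in> L1" and adm: "admissible bc v N \<omega> h" and le: "\<omega> \<le> \<omega>'" "h \<le> h'"
    and F: "F holomorphic_on (res_set bc v \<inter> res_set bc (\<lambda>_. 0))"
  shows "contour_integral (rectpath (rect_lo \<omega> h) (rect_hi N h)) F = contour_integral (rectpath (rect_lo \<omega>' h') (rect_hi N h')) F"
proof (rule Cauchy_theorem_homotopic_loops[where S="res_set bc v \<inter> res_set bc (\<lambda>_. 0)"])
  show "open (res_set bc v \<inter> res_set bc (\<lambda>_. 0))" by (intro open_Int open_res_set v L1_const)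
  show "homotopic_loops (res_set bc v \<inter> res_set bc (\<lambda>_. 0)) (rectpath (rect_lo \<omega> h) (rect_hi N h)) (rectpath (rect_lo \<omega>' h') (rect_hi N h'))"
  proof (rule homotopic_loops_linear)
    fix t :: real assume t: "t \<in> {0..1}"
    show "closed_segment (rectpath (rect_lo \<omega> h) (rect_hi N h) t) (rectpath (rect_lo \<omega>' h') (rect_hi N h') t) \<subseteq> res_set bc v \<inter> res_set bc (\<lambda>_. 0)"
    proof
      fix z assume "z \<in> closed_segment (rectpath (rect_lo \<omega> h) (rect_hi N h) t) (rectpath (rect_lo \<omega>' h') (rect_hi N h') t)"
      then obtain s where s: "0 \<le> s" "s \<le> 1"
        "z = (1 - s) *\<^sub>R rectpath (rect_lo \<omega> h) (rect_hi N h) t + s *\<^sub>R rectpath (rect_lo \<omega>' h') (rect_hi N h') t"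
        unfolding closed_segment_def by blast
      define \<omega>2 where "\<omega>2 = (1 - s) * \<omega> + s * \<omega>'"
      define h2 where "h2 = (1 - s) * h + s * h'"
      have "s * \<omega> \<le> s * \<omega>'" "s * h \<le> s * h'" using s le by (auto intro: mult_left_mono)
      then have le2: "\<omega> \<le> \<omega>2" "h \<le> h2" by (auto simp: \<omega>2_def h2_def algebra_simps)
      have "z = rectpath (rect_lo \<omega>2 h2) (rect_hi N h2) t"
        unfolding s(3) rectpath_affine
        by (rule arg_cong2[of _ _ _ _ "\<lambda>a b. rectpath a b t"])
           (auto simp: rect_lo_def rect_hi_def \<omega>2_def h2_def complex_eq_iff algebra_simps)
      then have "z \<in> path_image (rectpath (rect_lo \<omega>2 h2) (rect_hi N h2))" using t by (auto simp: path_image_def)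
      then show "z \<in> res_set bc v \<inter> res_set bc (\<lambda>_. 0)" using rect_path_in_res[OF adm le2] by blast
    qed
  qed auto
qed (use F in auto)

text \<open>The extension of the difference of the spectral operators to \<open>L\<^sup>1\<close>: the contour integral of the
difference of the resolvents, which are defined on \<open>L\<^sup>1\<close>.\<close>

definition diff_op :: "bcond \<Rightarrow> (real \<Rightarrow> complex) \<Rightarrow> nat \<Rightarrow> real \<Rightarrow> real \<Rightarrow> (real \<Rightarrow> complex) \<Rightarrow> real \<Rightarrow> complex" where
  "diff_op bc v N \<omega> h f x = 1 / (2 * of_real pi * \<i>) *
     contour_integral (rectpath (rect_lo \<omega> h) (rect_hi N h)) (\<lambda>z. green bc v z f x - green bc (\<lambda>_. 0) z f x)"

lemma green_difference_holomorphic: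
  assumes v: "v \<in> L1" and f: "f \<in> L1" and x: "x \<in> {0..pi}"
  shows "(\<lambda>z. green bc v z f x - green bc (\<lambda>_. 0) z f x) holomorphic_on (res_set bc v \<inter> res_set bc (\<lambda>_. 0))"
  by (intro holomorphic_on_diff holomorphic_on_subset[OF green_holomorphic[OF v f x]] holomorphic_on_subset[OF green_holomorphic[OF L1_const f x]]) auto

lemma green_continuous_on_rect:
  assumes v: "v \<in> L1" and adm: "admissible bc v N \<omega> h" and f: "f \<in> L1" and x: "x \<in> {0..pi}"
  shows "continuous_on (path_image (rectpath (rect_lo \<omega> h) (rect_hi N h))) (\<lambda>z. green bc v z f x)"
    "continuous_on (path_image (rectpath (rect_lo \<omega> h) (rect_hi N h))) (\<lambda>z. green bc (\<lambda>_. 0) z f x)"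
proof -
  note sub = rect_path_in_res[OF adm order_refl order_refl]
  show "continuous_on (path_image (rectpath (rect_lo \<omega> h) (rect_hi N h))) (\<lambda>z. green bc v z f x)"
    by (rule continuous_on_subset[OF holomorphic_on_imp_continuous_on[OF green_holomorphic[OF v f x]]]) (use sub in auto)
  show "continuous_on (path_image (rectpath (rect_lo \<omega> h) (rect_hi N h))) (\<lambda>z. green bc (\<lambda>_. 0) z f x)"
    by (rule continuous_on_subset[OF holomorphic_on_imp_continuous_on[OF green_holomorphic[OF L1_const f x]]]) (use sub in auto)
qed

lemma admissible_pos: "admissible bc v N \<omega> h \<Longrightarrow> \<omega> > 0 \<and> h > 0"
  by (simp add: admissible_def)

lemma spectral_S_difference:
  assumes v: "v \<in> L1" and adm: "admissible bc v N \<omega> h" and f: "f \<in> L2" and x: "x \<in> {0..pi}"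
  shows "spectral_S bc v N \<omega> h f x - spectral_S bc (\<lambda>_. 0) N \<omega> h f x = diff_op bc v N \<omega> h f x"
proof -
  define \<gamma> where "\<gamma> = rectpath (rect_lo \<omega> h) (rect_hi N h)"
  have f1: "f \<in> L1" using f L2_subset_L1 by blast
  have sub: "path_image \<gamma> \<subseteq> res_set bc v \<inter> res_set bc (\<lambda>_. 0)"
    unfolding \<gamma>_def by (rule rect_path_in_res[OF adm order_refl order_refl])
  note ord = rect_order[OF conjunct1[OF admissible_pos[OF adm]] conjunct2[OF admissible_pos[OF adm]]]
  have eq: "contour_integral \<gamma> (\<lambda>z. resolvent bc w z f x) = contour_integral \<gamma> (\<lambda>z. green bc w z f x)"
    if "w \<in> L1" "path_image \<gamma> \<subseteq> res_set bc w" for w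
    by (rule contour_integral_cong) (use resolvent_eq_green[OF that(1) _ f x] that(2) in auto)
  have "contour_integral \<gamma> (\<lambda>z. green bc v z f x - green bc (\<lambda>_. 0) z f x) = contour_integral \<gamma> (\<lambda>z. green bc v z f x) - contour_integral \<gamma> (\<lambda>z. green bc (\<lambda>_. 0) z f x)"
    unfolding \<gamma>_def by (intro contour_integral_diff contour_integral_rectpath(1)[OF ord] green_continuous_on_rect[OF v adm f1 x])
  then show ?thesis
    unfolding spectral_S_def diff_op_def rect_lo_def[symmetric] rect_hi_def[symmetric] \<gamma>_def[symmetric]
    using eq[OF v] eq[OF L1_const] sub by (simp add: right_diff_distrib)
qed

lemma diff_op_diff:
  assumes v: "v \<in> L1" and adm: "admissible bc v N \<omega> h" and f: "f \<in> L1" and g: "g \<in> L1" and x: "x \<in> {0..pi}"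
  shows "diff_op bc v N \<omega> h (\<lambda>x. f x - g x) x = diff_op bc v N \<omega> h f x - diff_op bc v N \<omega> h g x"
proof -
  define \<gamma> where "\<gamma> = rectpath (rect_lo \<omega> h) (rect_hi N h)"
  have sub: "path_image \<gamma> \<subseteq> res_set bc v \<inter> res_set bc (\<lambda>_. 0)"
    unfolding \<gamma>_def by (rule rect_path_in_res[OF adm order_refl order_refl])
  note ord = rect_order[OF conjunct1[OF admissible_pos[OF adm]] conjunct2[OF admissible_pos[OF adm]]]
  have "contour_integral \<gamma> (\<lambda>z. green bc v z (\<lambda>x. f x - g x) x - green bc (\<lambda>_. 0) z (\<lambda>x. f x - g x) x) =
     contour_integral \<gamma> (\<lambda>z. (green bc v z f x - green bc (\<lambda>_. 0) z f x) - (green bc v z g x - green bc (\<lambda>_. 0) z g x))"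
  proof (rule contour_integral_cong)
    fix z assume "z \<in> path_image \<gamma>"
    then have z: "z \<in> res_set bc v" "z \<in> res_set bc (\<lambda>_. 0)" using sub by auto
    show "green bc v z (\<lambda>x. f x - g x) x - green bc (\<lambda>_. 0) z (\<lambda>x. f x - g x) x =
       (green bc v z f x - green bc (\<lambda>_. 0) z f x) - (green bc v z g x - green bc (\<lambda>_. 0) z g x)"
      unfolding green_diff[OF v z(1) f g x] green_diff[OF L1_const z(2) f g x] by simp
  qed simp
  also have "\<dots> = contour_integral \<gamma> (\<lambda>z. green bc v z f x - green bc (\<lambda>_. 0) z f x) - contour_integral \<gamma> (\<lambda>z. green bc v z g x - green bc (\<lambda>_. 0) z g x)"
    unfolding \<gamma>_def
    by (intro contour_integral_diff contour_integrable_diff contour_integral_rectpath(1)[OF ord]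
        green_continuous_on_rect[OF v adm f x] green_continuous_on_rect[OF v adm g x])
  finally show ?thesis by (simp add: diff_op_def \<gamma>_def right_diff_distrib)
qed

lemma continuous_on_contour_integral_linepath:
  fixes F :: "complex \<Rightarrow> real \<Rightarrow> complex"
  assumes F: "continuous_on (S \<times> U) (\<lambda>(z, x). F z x)" and pq: "closed_segment p q \<subseteq> S"
  shows "continuous_on U (\<lambda>x. contour_integral (linepath p q) (\<lambda>z. F z x))"
proof -
  have "continuous_on (U \<times> cbox 0 1) (\<lambda>(x, t). F (linepath p q t) x * (q - p))"
  proof -
    have "continuous_on (U \<times> cbox 0 1) (\<lambda>y. (\<lambda>(z, x). F z x) (linepath p q (snd y), fst y))"
      by (rule continuous_on_compose2[OF F])
         (use pq linepath_in_path[of _ p q] in \<open>auto simp: linepath_def intro!: continuous_intros\<close>)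
    then show ?thesis by (auto simp: case_prod_unfold intro!: continuous_intros)
  qed
  from integral_continuous_on_param[OF this]
  show ?thesis by (simp add: contour_integral_integral)
qed

text \<open>The resolvents are jointly continuous in \<open>z\<close> and \<open>x\<close>, and the contour is made of four segments.\<close>

lemma diff_op_continuous:
  assumes v: "v \<in> L1" and adm: "admissible bc v N \<omega> h" and f: "f \<in> L1"
  shows "continuous_on {0..pi} (diff_op bc v N \<omega> h f)"
proof -
  define S where "S = res_set bc v \<inter> res_set bc (\<lambda>_. 0)"
  define F where "F z x = green bc v z f x - green bc (\<lambda>_. 0) z f x" for z x
  note ord = rect_order[OF conjunct1[OF admissible_pos[OF adm]] conjunct2[OF admissible_pos[OF adm]]]
  have sub: "path_image (rectpath (rect_lo \<omega> h) (rect_hi N h)) \<subseteq> S"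
    unfolding S_def by (rule rect_path_in_res[OF adm order_refl order_refl])
  have cF: "continuous_on (S \<times> {0..pi}) (\<lambda>(z, x). F z x)"
  proof -
    have "continuous_on (S \<times> {0..pi}) (\<lambda>(z, x). green bc v z f x)"
      by (rule continuous_on_subset[OF green_jointly_continuous[OF v f, of bc]]) (auto simp: S_def)
    moreover have "continuous_on (S \<times> {0..pi}) (\<lambda>(z, x). green bc (\<lambda>_. 0) z f x)"
      by (rule continuous_on_subset[OF green_jointly_continuous[OF L1_const f, of bc]]) (auto simp: S_def)
    ultimately show ?thesis unfolding F_def case_prod_unfold by (intro continuous_intros)
  qed
  define a where "a = rect_lo \<omega> h"
  define b where "b = rect_hi N h"
  define c where "c = Complex (Re b) (Im a)"
  define d where "d = Complex (Re a) (Im b)"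
  have FC: "continuous_on (path_image (rectpath a b)) (\<lambda>z. F z x)" if "x \<in> {0..pi}" for x
    unfolding F_def a_def b_def by (intro continuous_intros green_continuous_on_rect[OF v adm f that])
  have ab: "Re a \<le> Re b" "Im a \<le> Im b" unfolding a_def b_def by (rule ord)+
  note rect = contour_integral_rectpath[OF ab FC, folded c_def d_def]
  have "closed_segment a c \<union> closed_segment c b \<union> closed_segment b d \<union> closed_segment d a \<subseteq> S"
    using rect(3)[of 0] sub by (simp add: a_def b_def)
  then have "continuous_on {0..pi} (\<lambda>x. contour_integral (linepath a c) (\<lambda>z. F z x) + contour_integral (linepath c b) (\<lambda>z. F z x) +
       contour_integral (linepath b d) (\<lambda>z. F z x) + contour_integral (linepath d a) (\<lambda>z. F z x))"
    by (intro continuous_intros continuous_on_contour_integral_linepath[OF cF]) auto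
  then have "continuous_on {0..pi} (\<lambda>x. contour_integral (rectpath a b) (\<lambda>z. F z x))"
    by (rule continuous_on_eq) (simp add: rect(2))
  then show ?thesis
    unfolding diff_op_def[abs_def] F_def[symmetric] a_def[symmetric] b_def[symmetric] by (intro continuous_intros)
qed

lemma rho_small_on_line:
  assumes N: "N \<ge> 1" "96 * norm_L1 v \<le> root 3 (real N)" and z: "Re z = (real N)\<^sup>2 + real N"
  shows "2 * rho bc z * norm_L1 v \<le> 1/2"
proof -
  have r: "root 3 (real N) > 0" using N by simp
  have "2 * rho bc z * norm_L1 v \<le> 2 * (24 / root 3 (real N)) * norm_L1 v"
    by (intro mult_right_mono mult_left_mono rho_line_le z N norm_L1_nonneg) auto
  also have "\<dots> \<le> 1/2" using N r by (simp add: field_simps)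
  finally show ?thesis .
qed

lemma rho_small_far:
  assumes M: "M \<ge> 2" "48 * norm_L1 v \<le> real M - 1" and z: "far_from_spectrum ((real M)\<^sup>2) z"
  shows "2 * rho bc z * norm_L1 v \<le> 1/2"
proof -
  have "2 * rho bc z * norm_L1 v \<le> 2 * (12 / (real M - 1)) * norm_L1 v"
    by (intro mult_right_mono mult_left_mono rho_far_le z M norm_L1_nonneg) auto
  also have "\<dots> \<le> 1/2" using M by (simp add: field_simps)
  finally show ?thesis .
qed

lemma large_nat_exists: "\<exists>M::nat. M \<ge> N + 1 \<and> real M \<ge> r"
  using real_arch_simple[of r] by (metis le_max_iff_disj max.cobounded1 of_nat_mono order_trans max.commute)

text \<open>On the line, and far from the spectrum to its left, \<open>\<rho>\<close> is so small that the contraction excludes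
eigenvalues. The remaining points to the left of the line form the interior of a rectangle.\<close>

lemma admissible_exists:
  assumes v: "v \<in> L1" and N: "N \<ge> 1" "96 * norm_L1 v \<le> root 3 (real N)"
  shows "\<exists>\<omega> h. admissible bc v N \<omega> h"
proof -
  obtain M where M: "M \<ge> N + 1" "real M \<ge> 48 * norm_L1 v + 1" using large_nat_exists by blast
  interpret big_box N M using N M by unfold_locales
  have M': "48 * norm_L1 v \<le> real M - 1" using M by simp
  define L where "L = (real M)\<^sup>2"
  have L: "L > 0" using M2 by (simp add: L_def)
  have "z \<in> interior (Pi_rect N L L)" if e: "is_eigenvalue bc v z \<or> is_eigenvalue bc (\<lambda>_. 0) z" and z: "Re z \<le> (real N)\<^sup>2 + real N" for z
  proof -
    have nr: "\<not> (z \<in> res_set bc v \<and> z \<in> res_set bc (\<lambda>_. 0))" using e by (auto simp: res_set_def)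
    have "Re z \<noteq> (real N)\<^sup>2 + real N"
      using nr line_in_free_res_set[OF _ N(1), of z bc] res_set_small_rho[OF v _ rho_small_on_line[OF N]] by blast
    moreover have "\<not> far_from_spectrum L z"
    proof
      assume far: "far_from_spectrum L z"
      have z0: "z \<in> res_set bc (\<lambda>_. 0)" by (rule far_in_free_res_set[OF far L])
      have "z \<in> res_set bc v"
        by (rule res_set_small_rho[OF v z0 rho_small_far[OF M2 M' far[unfolded L_def]]])
      then show False using nr z0 by blast
    qed
    ultimately show ?thesis
      using z RL unfolding interior_Pi_rect far_from_spectrum_def
      by (auto simp: in_box_complex_iff rect_lo_def rect_hi_def L_def)
  qed
  then have "admissible bc v N L L" using L by (auto simp: admissible_def)
  then show ?thesis by blast
qed

text \<open>The given contour is first enlarged until \<open>\<rho>\<close> is small on all of it; the estimate there is uniform in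
the size of the rectangle.\<close>

theorem diff_op_bound:
  assumes v: "v \<in> L1" and N: "N \<ge> 1" "96 * norm_L1 v \<le> root 3 (real N)" and adm: "admissible bc v N \<omega> h"
    and f: "f \<in> L1" and x: "x \<in> {0..pi}" and H: "H > 0"
  shows "cmod (diff_op bc v N \<omega> h f x)
     \<le> norm_L1 f * (384 * vstar bc v H + 32 * norm_L1 v * (H / real N) + 1769472 * (norm_L1 v)\<^sup>2 / real N)"
proof -
  obtain M where M: "M \<ge> N + 1" "real M \<ge> max (48 * norm_L1 v + 1) (max \<omega> h)" using large_nat_exists by blast
  interpret big_box N M using N M by unfold_locales
  have "real M * 1 \<le> real M * real M" using M2 by (intro mult_left_mono) auto
  then have le: "\<omega> \<le> (real M)\<^sup>2" "h \<le> (real M)\<^sup>2" using M(2) unfolding power2_eq_square by auto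
  have M': "48 * norm_L1 v \<le> real M - 1" using M by simp
  have small: "2 * rho bc z * norm_L1 v \<le> 1/2" if "z \<in> path_image \<Gamma>" for z
    using path_cases[OF that] rho_small_on_line[OF N] rho_small_far[OF M2 M'] by blast
  have "contour_integral (rectpath (rect_lo \<omega> h) (rect_hi N h)) (\<lambda>z. green bc v z f x - green bc (\<lambda>_. 0) z f x) =
     contour_integral \<Gamma> (\<lambda>z. green bc v z f x - green bc (\<lambda>_. 0) z f x)"
    unfolding bigbox_eq_rect
    by (rule contour_integral_rect_enlarge[OF v adm le green_difference_holomorphic[OF v f x]])
  then show ?thesis
    unfolding diff_op_def using difference_contour_bound[OF v f x H small] by simp
qed

text \<open>Boundedness and linearity give convergence along every approximating sequence; on \<open>L\<^sup>2\<close> the operator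
agrees with the given one.\<close>

lemma diff_op_extends:
  assumes v: "v \<in> L1" and N: "N \<ge> 1" "96 * norm_L1 v \<le> root 3 (real N)" and adm: "admissible bc v N \<omega> h"
  shows "extends_to_L1_C (\<lambda>f x. spectral_S bc v N \<omega> h f x - spectral_S bc (\<lambda>_. 0) N \<omega> h f x) (diff_op bc v N \<omega> h)"
  unfolding extends_to_L1_C_def
proof (intro ballI conjI allI impI; (elim conjE)?)
  fix f assume f: "f \<in> L1"
  show "continuous_on {0..pi} (diff_op bc v N \<omega> h f)" by (rule diff_op_continuous[OF v adm f])
  fix F assume F: "\<forall>n. F n \<in> L2" and lim: "(\<lambda>n. norm_L1 (\<lambda>x. F n x - f x)) \<longlonglongrightarrow> 0"
  define K where "K = 384 * vstar bc v 1 + 32 * norm_L1 v * (1 / real N) + 1769472 * (norm_L1 v)\<^sup>2 / real N"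
  have F1: "F n \<in> L1" for n using F L2_subset_L1 by blast
  have b: "cmod (diff_op bc v N \<omega> h (F n) x - diff_op bc v N \<omega> h f x) \<le> norm_L1 (\<lambda>x. F n x - f x) * K" if x: "x \<in> {0..pi}" for n x
    using diff_op_bound[OF v N adm L1_diff[OF F1 f] x zero_less_one] diff_op_diff[OF v adm F1 f x] by (simp add: K_def)
  have lim': "(\<lambda>n. norm_L1 (\<lambda>x. F n x - f x) * K) \<longlonglongrightarrow> 0" using tendsto_mult_right[OF lim, of K] by simp
  show "uniform_limit {0..pi} (\<lambda>n x. spectral_S bc v N \<omega> h (F n) x - spectral_S bc (\<lambda>_. 0) N \<omega> h (F n) x) (diff_op bc v N \<omega> h f) sequentially"
  proof (rule uniform_limitI)
    fix e :: real assume "e > 0"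
    with lim' have "eventually (\<lambda>n. norm_L1 (\<lambda>x. F n x - f x) * K < e) sequentially" by (rule order_tendstoD)
    then show "eventually (\<lambda>n. \<forall>x\<in>{0..pi}. dist (spectral_S bc v N \<omega> h (F n) x - spectral_S bc (\<lambda>_. 0) N \<omega> h (F n) x) (diff_op bc v N \<omega> h f x) < e) sequentially"
    proof eventually_elim
      case (elim n)
      show ?case
      proof
        fix x assume x: "x \<in> {0..pi}"
        show "dist (spectral_S bc v N \<omega> h (F n) x - spectral_S bc (\<lambda>_. 0) N \<omega> h (F n) x) (diff_op bc v N \<omega> h f x) < e"
          using b[OF x, of n] elim spectral_S_difference[OF v adm F[rule_format, of n] x] by (simp add: dist_norm)
      qed
    qed
  qed
qed

lemma opnorm_le:
  assumes "\<And>f x. f \<in> L1 \<Longrightarrow> x \<in> {0..pi} \<Longrightarrow> cmod (T f x) \<le> norm_L1 f * B" "B \<ge> 0"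
  shows "opnorm_L1_C T \<le> ennreal B"
  unfolding opnorm_L1_C_def norm_C_def
proof (intro SUP_least)
  fix f x assume f: "f \<in> {f \<in> L1. norm_L1 f \<le> 1}" and x: "x \<in> {0..pi}"
  have "cmod (T f x) \<le> norm_L1 f * B" using assms f x by auto
  also have "\<dots> \<le> 1 * B" using f assms(2) by (intro mult_right_mono) auto
  finally show "ennreal (cmod (T f x)) \<le> ennreal B" by (intro ennreal_leI) simp
qed

section \<open>Constant potentials\<close>

text \<open>Integration by parts: the coefficients of the primitive of \<open>u\<close> are those of \<open>u\<close> with respect to the
derivatives of the eigenfunctions, divided by \<open>k\<^sup>2\<close>.\<close>

lemma fcoeff_primitive_zero:
  assumes u: "u \<in> L1" and mean: "integral {0..pi} u = 0" and k: "k \<noteq> 0"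
    and c: "integral {0..pi} (\<lambda>x. u x * cnj (eig_deriv bc k x)) = 0"
  shows "fcoeff bc (\<lambda>x. integral {0..x} u) k = 0"
proof -
  define W where "W x = integral {0..x} u" for x
  have cW: "continuous_on {0..pi} W" unfolding W_def by (rule continuous_indefinite_integral[OF u])
  have ce: "continuous_on {0..pi} (\<lambda>x. cnj (eig bc k x))" by (intro continuous_intros)
  have cd: "continuous_on {0..pi} (\<lambda>x. cnj (eig_deriv bc k x))"
    using cnj_eig_has_derivative(2) has_vector_derivative_continuous unfolding continuous_on_eq_continuous_within by blast
  have "((\<lambda>x. u x * cnj (eig_deriv bc k x) + W x * (- (of_int k ^ 2) * cnj (eig bc k x))) has_integral
      (W pi * cnj (eig_deriv bc k pi) - W 0 * cnj (eig_deriv bc k 0))) {0..pi}"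
  proof (rule integration_by_parts_absolutely_integrable[where c=0])
    show "u absolutely_integrable_on {0..pi}" using u by (simp add: L1_def)
    show "continuous_on {0..pi} (\<lambda>x. - (of_int k ^ 2) * cnj (eig bc k x))" by (intro continuous_intros ce)
    show "W x = 0 + integral {0..x} u" for x by (simp add: W_def)
  qed (rule cnj_eig_has_derivative(2) pi_ge_zero)+
  moreover have "W pi = 0" "W 0 = 0" using mean by (auto simp: W_def)
  ultimately have 0: "((\<lambda>x. u x * cnj (eig_deriv bc k x) + W x * (- (of_int k ^ 2) * cnj (eig bc k x))) has_integral 0) {0..pi}" by simp
  have "((\<lambda>x. u x * cnj (eig_deriv bc k x)) has_integral 0) {0..pi}"
    using integrable_integral[OF L1_integrable[OF L1_mult_continuous[OF u cd]]] c by simp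
  from has_integral_diff[OF 0 this]
  have "((\<lambda>x. - (of_int k ^ 2) * (W x * cnj (eig bc k x))) has_integral 0) {0..pi}"
    by (simp add: ac_simps)
  then have "- (of_int k ^ 2) * integral {0..pi} (\<lambda>x. W x * cnj (eig bc k x)) = 0"
    unfolding integral_mult_right[symmetric] by (rule integral_unique)
  then have "integral {0..pi} (\<lambda>x. W x * cnj (eig bc k x)) = 0" using k by simp
  then show ?thesis by (simp add: fcoeff_def W_def)
qed

text \<open>The primitive of \<open>v\<close> minus its mean is continuous and vanishes at both ends. Its sine coefficients,
or its periodic coefficients of nonzero index, are those of \<open>v\<close> up to factors and vanish. By
uniqueness it is constant, hence zero, and so is its derivative almost everywhere. The periodic
basis serves the antiperiodic conditions too, since \<open>v\<^sup>*\<close> is the same for both.\<close>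

lemma vstar_zero_imp_constant:
  assumes v: "v \<in> L1" and z: "vstar bc v 1 = 0"
  obtains c E where "negligible E" "\<And>x. x \<in> {0..pi} - E \<Longrightarrow> v x = c"
proof -
  define c where "c = 1 / of_real pi * integral {0..pi} v"
  define u where "u x = v x - c" for x
  have u: "u \<in> L1" unfolding u_def by (intro L1_diff v L1_const)
  have mean: "integral {0..pi} u = 0"
    unfolding u_def using L1_integrable[OF v] by (subst Henstock_Kurzweil_Integration.integral_diff) (auto simp: c_def scaleR_conv_of_real)
  define W where "W x = integral {0..x} u" for x
  have cW: "continuous_on {0..pi} W" unfolding W_def by (rule continuous_indefinite_integral[OF u])
  have W0: "W 0 = 0" by (simp add: W_def)
  have split: "integral {0..pi} (\<lambda>x. u x * e x) = integral {0..pi} (\<lambda>x. v x * e x) - c * integral {0..pi} e"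
    if ce: "continuous_on {0..pi} e" for e
  proof -
    have "integral {0..pi} (\<lambda>x. u x * e x) = integral {0..pi} (\<lambda>x. v x * e x - c * e x)"
      by (simp add: u_def algebra_simps)
    also have "\<dots> = integral {0..pi} (\<lambda>x. v x * e x) - integral {0..pi} (\<lambda>x. c * e x)"
      by (rule Henstock_Kurzweil_Integration.integral_diff) (intro L1_integrable L1_mult_continuous L1_cmult L1_continuous v ce)+
    finally show ?thesis by simp
  qed
  have Wz: "W x = 0" if x: "x \<in> {0..pi}" for x
  proof (cases "bc = Dir")
    case True
    show ?thesis
    proof (rule eig_uniqueness[OF cW _ x, of Dir])
      fix k assume k: "k \<in> idx Dir"
      then have k1: "k \<ge> 1" by simp
      have kr: "real (nat k) = of_int k" using k1 by simp
      have "cmod (V_tilde v (nat k)) \<le> vstar Dir v 1" by (rule cmod_V_tilde_le_vstar[OF v]) (use k1 in simp)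
      then have Vz: "integral {0..pi} (\<lambda>x. v x * of_real (sqrt 2 * cos (of_int k * x))) = 0"
        using z True by (simp add: V_tilde_def kr del: of_real_mult)
      have ce: "continuous_on {0..pi} (\<lambda>x. complex_of_real (sqrt 2 * cos (of_int k * x)))" by (intro continuous_intros)
      have "((\<lambda>x. complex_of_real (sqrt 2 * cos (of_int k * x))) has_integral of_real (sqrt 2 * 0)) {0..pi}"
        by (intro has_integral_of_real has_integral_mult_right integral_cos_int) (use k1 in simp)
      then have "integral {0..pi} (\<lambda>x. complex_of_real (sqrt 2 * cos (of_int k * x))) = of_real (sqrt 2 * 0)"
        by (rule integral_unique)
      then have uz: "integral {0..pi} (\<lambda>x. u x * of_real (sqrt 2 * cos (of_int k * x))) = 0"
        using split[OF ce] Vz by simp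
      have "integral {0..pi} (\<lambda>x. u x * cnj (eig_deriv Dir k x)) = integral {0..pi} (\<lambda>x. of_int k * (u x * of_real (sqrt 2 * cos (of_int k * x))))"
        by (simp add: ac_simps)
      also have "\<dots> = 0" unfolding integral_mult_right uz by simp
      finally show "fcoeff Dir W k = 0"
        unfolding W_def using fcoeff_primitive_zero[OF u mean, of k Dir] k1 by simp
    qed
  next
    case False
    have V0: "V_coeff v k = 0" if "even k" "k \<noteq> 0" for k
    proof -
      have "1 \<le> \<bar>real_of_int k\<bar>" using that by linarith
      from cmod_V_coeff_le_vstar[OF v that(1) this, of bc] show ?thesis using z False by (cases bc) auto
    qed
    have Wk: "fcoeff Per_plus W k = 0" if k: "even k" "k \<noteq> 0" for k
    proof -
      have ce: "continuous_on {0..pi} (\<lambda>x. cis (- (of_int k * x)))" by (intro continuous_intros)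
      have "integral {0..pi} (\<lambda>x. v x * cis (- (of_int k * x))) = 0"
        using V0[OF k] unfolding V_coeff_def exp_eq_cis by simp
      moreover have "integral {0..pi} (\<lambda>x. cis (- (of_int k * x))) = 0"
        using integral_cis_even[of "- k"] k by simp
      ultimately have uz: "integral {0..pi} (\<lambda>x. u x * cis (- (of_int k * x))) = 0" using split[OF ce] by simp
      have "integral {0..pi} (\<lambda>x. u x * cnj (eig_deriv Per_plus k x)) = integral {0..pi} (\<lambda>x. (- \<i> * of_int k) * (u x * cis (- (of_int k * x))))"
        by (simp add: cis_cnj ac_simps)
      also have "\<dots> = 0" unfolding integral_mult_right uz by simp
      finally show ?thesis
        unfolding W_def using fcoeff_primitive_zero[OF u mean k(2), of Per_plus] by simp
    qed
    define m where "m = fcoeff Per_plus W 0"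
    have "W t - m = 0" if t: "t \<in> {0..pi}" for t
    proof (rule eig_uniqueness[OF _ _ t, of _ Per_plus])
      show "continuous_on {0..pi} (\<lambda>t. W t - m)" by (intro continuous_intros cW)
      fix k assume k: "k \<in> idx Per_plus"
      have ce: "continuous_on {0..pi} (\<lambda>x. cnj (eig Per_plus k x))" by (intro continuous_intros)
      have "integral {0..pi} (\<lambda>x. (W x - m) * cnj (eig Per_plus k x)) =
         integral {0..pi} (\<lambda>x. W x * cnj (eig Per_plus k x) - m * (eig Per_plus 0 x * cnj (eig Per_plus k x)))"
        by (simp add: algebra_simps)
      also have "\<dots> = integral {0..pi} (\<lambda>x. W x * cnj (eig Per_plus k x)) - integral {0..pi} (\<lambda>x. m * (eig Per_plus 0 x * cnj (eig Per_plus k x)))"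
        by (rule Henstock_Kurzweil_Integration.integral_diff)
           (intro integrable_continuous_real continuous_intros cW ce)+
      finally have "fcoeff Per_plus (\<lambda>t. W t - m) k = fcoeff Per_plus W k - m * fcoeff Per_plus (eig Per_plus 0) k"
        unfolding fcoeff_def integral_mult_right by (simp only:) (simp add: right_diff_distrib ac_simps)
      also have "\<dots> = 0"
        using fcoeff_eig[of 0 Per_plus k] k Wk[of k] by (cases "k = 0") (auto simp: m_def)
      finally show "fcoeff Per_plus (\<lambda>t. W t - m) k = 0" .
    qed
    from this[OF x] this[of 0] W0 show ?thesis by simp
  qed
  obtain E where E: "negligible E"
    "\<And>x. x \<in> {0..pi} - E \<Longrightarrow> ((\<lambda>x. integral {0..x} u) has_vector_derivative u x) (at x within {0..pi})"
    using lebesgue_differentiation[OF L1_integrable[OF u]] by blast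
  show ?thesis
  proof (rule that[OF E(1)])
    fix x assume x: "x \<in> {0..pi} - E"
    have "((\<lambda>x. integral {0..x} u) has_vector_derivative 0) (at x within {0..pi})"
      by (rule has_vector_derivative_transform_within[of "\<lambda>_. 0" _ _ _ 1]) (use x Wz in \<open>auto simp: W_def\<close>)
    then have "vector_derivative (\<lambda>x. integral {0..x} u) (at x within cbox 0 pi) = 0"
      by (intro vector_derivative_within_cbox) (use x in auto)
    moreover have "vector_derivative (\<lambda>x. integral {0..x} u) (at x within cbox 0 pi) = u x"
      by (intro vector_derivative_within_cbox) (use x E(2)[OF x] in auto)
    ultimately have "u x = 0" by simp
    then show "v x = c" by (simp add: u_def)
  qed
qed

lemma bvp_constant_potential:
  assumes E: "negligible E" and c: "\<And>x. x \<in> {0..pi} - E \<Longrightarrow> v x = c"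
  shows "bvp bc v z f = bvp bc (\<lambda>_. 0) (z - c) f"
proof -
  have "integral {0..x} (\<lambda>t. (v t - z) * y t + f t) = integral {0..x} (\<lambda>t. (0 - (z - c)) * y t + f t)" if "x \<in> {0..pi}" for x y
    by (rule integral_spike[OF E]) (use that c in auto)
  note int = this
  have "ode_sol (\<lambda>t. v t - z) f y y1 = ode_sol (\<lambda>t. 0 - (z - c)) f y y1" for y y1
    unfolding ode_sol_def by (intro conj_cong ball_cong refl) (simp only: int)
  then show ?thesis unfolding bvp_def[abs_def] by simp
qed

lemma gap_ge: "real N \<le> gap N n"
proof (cases "n \<le> N")
  case True
  then have "real N * 1 \<le> real N * real (N + 1 - n)" by (intro mult_left_mono) auto
  then show ?thesis using True by (simp add: gap_def)
next
  case False
  then have "real N * 1 \<le> real N * real (n - N)" by (intro mult_left_mono) auto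
  moreover have "0 \<le> (real (n - N))\<^sup>2" by simp
  ultimately have "real N \<le> real N * real (n - N) + (real (n - N))\<^sup>2" by linarith
  then show ?thesis using False by (simp add: gap_def)
qed

text \<open>A constant potential \<open>c\<close> shifts the free eigenvalues to \<open>k\<^sup>2 + c\<close>. The gap around the line
\<open>Re z = N\<^sup>2 + N\<close> exceeds \<open>|c|\<close>, so no eigenvalue crosses the contour and the residues of the
two resolvents cancel.\<close>

lemma diff_op_constant_potential:
  assumes v: "v \<in> L1" and E: "negligible E" and c: "\<And>x. x \<in> {0..pi} - E \<Longrightarrow> v x = c"
    and N: "N \<ge> 1" "2 * cmod c + 1 \<le> real N" and adm: "admissible bc v N \<omega> h"
    and f: "f \<in> L1" and x: "x \<in> {0..pi}"
  shows "diff_op bc v N \<omega> h f x = 0"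
proof -
  obtain M where M: "M \<ge> N + 1" "real M \<ge> max (6 * cmod c + 1) (max \<omega> h)" using large_nat_exists by blast
  interpret big_box N M using N M by unfold_locales
  have "real M * 1 \<le> real M * real M" using M2 by (intro mult_left_mono) auto
  then have le: "\<omega> \<le> (real M)\<^sup>2" "h \<le> (real M)\<^sup>2" "6 * cmod c + 1 \<le> (real M)\<^sup>2" using M(2) unfolding power2_eq_square by auto
  have green_eq: "green bc v z f x = green bc (\<lambda>_. 0) (z - c) f x" for z
  proof -
    have "bvp bc v z f = bvp bc (\<lambda>_. 0) (z - c) f" by (rule bvp_constant_potential[OF E c])
    then show ?thesis by (simp only: green_def)
  qed
  have dist: "2 * cmod c < cmod (z - of_int k ^ 2)" if z: "z \<in> path_image \<Gamma>" for z and k :: int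
    using path_cases[OF z]
  proof
    assume r: "Re z = (real N)\<^sup>2 + real N"
    show ?thesis using gap_le_dist_square[OF r, of k] gap_ge[of N "nat \<bar>k\<bar>"] N(2) by linarith
  next
    assume "far_from_spectrum ((real M)\<^sup>2) z"
    from dist_square_far[OF this, of k] have "((real M)\<^sup>2 + (of_int k)\<^sup>2) / 3 \<le> cmod (z - of_int k ^ 2)" by simp
    moreover have "(real M)\<^sup>2 / 3 \<le> ((real M)\<^sup>2 + (of_int k)\<^sup>2) / 3" by (intro divide_right_mono) auto
    moreover have "2 * cmod c < (real M)\<^sup>2 / 3" using le(3) by simp
    ultimately show ?thesis by linarith
  qed
  have dist2: "cmod (z - of_int k ^ 2) \<le> 2 * cmod (z - c - of_int k ^ 2)" if z: "z \<in> path_image \<Gamma>" for z and k :: int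
    using dist[OF z, of k] norm_triangle_ineq2[of "z - of_int k ^ 2" c] by (simp add: algebra_simps)
  have ne: "z - of_int k ^ 2 \<noteq> 0" "z - c - of_int k ^ 2 \<noteq> 0" if z: "z \<in> path_image \<Gamma>" for z and k :: int
    using dist[OF z, of k] dist2[OF z, of k] norm_ge_zero[of c] by auto
  have res: "z \<in> res_set bc (\<lambda>_. 0)" "z - c \<in> res_set bc (\<lambda>_. 0)" if z: "z \<in> path_image \<Gamma>" for z
    using ne[OF z] by (auto simp: res_set_free)
  define F where "F k z = fcoeff bc f k * eig bc k x * (1 / (z - (c + of_int k ^ 2)) - 1 / (z - of_int k ^ 2))" for k z
  have eq: "z - (c + of_int k ^ 2) = z - c - of_int k ^ 2" for z and k :: int by simp
  have cF: "continuous_on (path_image \<Gamma>) (F k)" for k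
    unfolding F_def using ne by (intro continuous_intros) (auto simp: eq)
  define b where "b = sqrt 2 * norm_L1 f * sqrt 2"
  have Msum: "(\<lambda>k. b * 3 * \<mu> k) summable_on idx bc" by (intro summable_on_cmult_right mu_summable)
  have FM: "norm (F k z) \<le> b * 3 * \<mu> k" if z: "z \<in> path_image \<Gamma>" for k z
  proof -
    have p: "cmod (z - c - of_int k ^ 2) > 0" "cmod (z - of_int k ^ 2) > 0" using ne[OF z, of k] by auto
    have "1 / cmod (z - c - of_int k ^ 2) \<le> 2 * (1 / cmod (z - of_int k ^ 2))"
      using dist2[OF z, of k] p by (simp add: field_simps)
    then have "1 / cmod (z - c - of_int k ^ 2) + 1 / cmod (z - of_int k ^ 2) \<le> 3 * \<mu> k"
      using inverse_dist_le_mu[OF z, of k] by linarith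
    moreover have "norm (1 / (z - (c + of_int k ^ 2)) - 1 / (z - of_int k ^ 2)) \<le> 1 / cmod (z - c - of_int k ^ 2) + 1 / cmod (z - of_int k ^ 2)"
      using norm_triangle_ineq4[of "1 / (z - (c + of_int k ^ 2))" "1 / (z - of_int k ^ 2)"] by (simp only: norm_divide norm_one eq)
    ultimately have l: "norm (1 / (z - (c + of_int k ^ 2)) - 1 / (z - of_int k ^ 2)) \<le> 3 * \<mu> k" by linarith
    have "norm (F k z) \<le> b * (3 * \<mu> k)"
      unfolding F_def norm_mult b_def
      by (intro mult_mono fcoeff_bound f cmod_eig_le l) (auto simp: norm_L1_nonneg)
    then show ?thesis by simp
  qed
  have S: "((\<lambda>k. F k z) has_sum (green bc v z f x - green bc (\<lambda>_. 0) z f x)) (idx bc)" if z: "z \<in> path_image \<Gamma>" for z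
  proof -
    have zk: "w \<noteq> of_int k ^ 2" if "w \<in> res_set bc (\<lambda>_. 0)" "k \<in> idx bc" for w k using that by (simp add: res_set_free)
    have "((\<lambda>k. fcoeff bc f k / (z - c - of_int k ^ 2) * eig bc k x + - 1 * (fcoeff bc f k / (z - of_int k ^ 2) * eig bc k x)) has_sum
       (green bc (\<lambda>_. 0) (z - c) f x + - 1 * green bc (\<lambda>_. 0) z f x)) (idx bc)"
      by (intro has_sum_add has_sum_cmult_right bvp_series f green_bvp L1_const res z zk x)
    moreover have "fcoeff bc f k / (z - c - of_int k ^ 2) * eig bc k x + - 1 * (fcoeff bc f k / (z - of_int k ^ 2) * eig bc k x) = F k z" for k
      unfolding F_def eq by (simp add: right_diff_distrib)
    ultimately show ?thesis by (simp add: green_eq)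
  qed
  have "contour_integral \<Gamma> (F k) = 0" for k
  proof -
    have n1: "of_int k ^ 2 \<notin> path_image \<Gamma>" "c + of_int k ^ 2 \<notin> path_image \<Gamma>"
      using ne[of _ k] by (force, force)
    have cc: "\<bar>Re c\<bar> \<le> cmod c" "\<bar>Im c\<bar> \<le> cmod c" by (rule abs_Re_le_cmod, rule abs_Im_le_cmod)
    have box: "(c + of_int k ^ 2 \<in> box lo hi) = (of_int k ^ 2 \<in> box lo hi)"
    proof -
      define s where "s = (real_of_int k)\<^sup>2"
      have s: "s \<ge> 0" by (simp add: s_def)
      have k2: "Re (of_int k ^ 2 :: complex) = s" "Im (of_int k ^ 2 :: complex) = 0"
        by (simp_all add: s_def of_int_power[symmetric] del: of_int_power)
      have L: "6 * cmod c + 1 \<le> (real M)\<^sup>2" by (rule le(3))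
      have "(c + of_int k ^ 2 \<in> box lo hi) \<longleftrightarrow> Re c + s < (real N)\<^sup>2 + real N"
      proof -
        have "- (real M)\<^sup>2 < Re c + s" "- (real M)\<^sup>2 < Im c" "Im c < (real M)\<^sup>2"
          using cc s L norm_ge_zero[of c] by linarith+
        then show ?thesis by (auto simp: in_box_complex_iff bigbox_lo_def bigbox_hi_def k2)
      qed
      also have "\<dots> \<longleftrightarrow> \<bar>k\<bar> \<le> int N"
      proof
        assume "\<bar>k\<bar> \<le> int N"
        then have "\<bar>real_of_int k\<bar> \<le> real N" by linarith
        then have "s \<le> (real N)\<^sup>2" unfolding s_def by (metis abs_le_square_iff abs_of_nat)
        then show "Re c + s < (real N)\<^sup>2 + real N" using cc N(2) norm_ge_zero[of c] by linarith
      next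
        assume *: "Re c + s < (real N)\<^sup>2 + real N"
        show "\<bar>k\<bar> \<le> int N"
        proof (rule ccontr)
          assume "\<not> \<bar>k\<bar> \<le> int N"
          then have "real N + 1 \<le> \<bar>real_of_int k\<bar>" by linarith
          then have "(real N + 1)\<^sup>2 \<le> \<bar>real_of_int k\<bar>\<^sup>2" by (intro power_mono) auto
          then have "(real N)\<^sup>2 + 2 * real N + 1 \<le> s" by (simp add: s_def power2_eq_square algebra_simps)
          then show False using * cc N(2) norm_ge_zero[of c] by linarith
        qed
      qed
      finally show ?thesis unfolding square_in_box .
    qed
    note i1 = contour_integral_inverse_rectpath[OF lohi n1(1)]
    note i2 = contour_integral_inverse_rectpath[OF lohi n1(2)]
    have "contour_integral \<Gamma> (F k) = fcoeff bc f k * eig bc k x * contour_integral \<Gamma> (\<lambda>z. 1 / (z - (c + of_int k ^ 2)) - 1 / (z - of_int k ^ 2))"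
      unfolding F_def by (rule contour_integral_lmul) (intro contour_integrable_diff i1(2) i2(2))
    also have "contour_integral \<Gamma> (\<lambda>z. 1 / (z - (c + of_int k ^ 2)) - 1 / (z - of_int k ^ 2)) = 0"
      by (subst contour_integral_diff[OF i2(2) i1(2)]) (simp only: i1(1) i2(1) box diff_self)
    finally show ?thesis by simp
  qed
  then have "((\<lambda>k. 0) has_sum contour_integral \<Gamma> (\<lambda>z. green bc v z f x - green bc (\<lambda>_. 0) z f x)) (idx bc)"
    using contour_integral_rectpath_has_sum(1)[OF lohi cF Msum FM S] by simp
  then have "contour_integral \<Gamma> (\<lambda>z. green bc v z f x - green bc (\<lambda>_. 0) z f x) = 0"
    using has_sum_unique has_sum_0 by (metis (no_types, lifting))
  moreover have "contour_integral (rectpath (rect_lo \<omega> h) (rect_hi N h)) (\<lambda>z. green bc v z f x - green bc (\<lambda>_. 0) z f x) =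
     contour_integral \<Gamma> (\<lambda>z. green bc v z f x - green bc (\<lambda>_. 0) z f x)"
    unfolding bigbox_eq_rect
    by (rule contour_integral_rect_enlarge[OF v adm le(1,2) green_difference_holomorphic[OF v f x]])
  ultimately show ?thesis by (simp add: diff_op_def)
qed

section \<open>The bound with one constant for all scales\<close>

text \<open>For \<open>H \<ge> 1\<close> the term \<open>1 / N\<close> is below \<open>H / N\<close>. For \<open>H < 1\<close> the bound for \<open>H = 1\<close> is at most a constant
multiple of \<open>v\<^sup>*(1) \<le> v\<^sup>*(H)\<close> if \<open>v\<^sup>*(1) > 0\<close>; the constant depends on \<open>v\<close> through \<open>v\<^sup>*(1)\<close>. If
\<open>v\<^sup>*(1) = 0\<close> the operator vanishes.\<close>

lemma diff_op_uniform_bound: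
  assumes v: "v \<in> L1"
  obtains Nstar :: nat and C :: real where "C > 0" "Nstar \<ge> 1" "96 * norm_L1 v \<le> root 3 (real Nstar)"
    "\<And>N \<omega> h f x H. N \<ge> Nstar \<Longrightarrow> admissible bc v N \<omega> h \<Longrightarrow> f \<in> L1 \<Longrightarrow> x \<in> {0..pi} \<Longrightarrow> 0 < H \<Longrightarrow> H \<le> real N \<Longrightarrow>
       cmod (diff_op bc v N \<omega> h f x) \<le> norm_L1 f * (C * (vstar bc v H + H / real N))"
proof -
  define nv where "nv = norm_L1 v"
  have nv: "nv \<ge> 0" by (simp add: nv_def norm_L1_nonneg)
  obtain N0 :: nat where N0: "N0 \<ge> 1" "96 * nv \<le> root 3 (real N0)"
  proof -
    \<comment> \<open>A cube \<open>N\<close>, whose root is explicit.\<close>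
    obtain n :: nat where n: "real n \<ge> 96 * nv" using real_arch_simple by blast
    have "root 3 (real (Suc n ^ 3)) = real (Suc n)"
      using real_root_power_cancel[of 3 "real (Suc n)"] by (simp only: of_nat_power)
    then have "96 * nv \<le> root 3 (real (Suc n ^ 3))" using n by linarith
    then show ?thesis by (intro that[of "Suc n ^ 3"]) auto
  qed
  have large: "96 * norm_L1 v \<le> root 3 (real N)" if "N \<ge> N0" for N
    using N0(2) that by (auto simp: nv_def intro: order_trans)
  define C1 where "C1 = 384 + 32 * nv + 1769472 * nv\<^sup>2"
  have C1: "C1 \<ge> 384" using nv by (simp add: C1_def)
  have main: "cmod (diff_op bc v N \<omega> h f x) \<le> norm_L1 f * (C1 * (vstar bc v H + H / real N))"
    if "N \<ge> N0" "admissible bc v N \<omega> h" "f \<in> L1" "x \<in> {0..pi}" "1 \<le> H" for N \<omega> h f x H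
  proof -
    have N: "N \<ge> 1" using that N0 by simp
    have "cmod (diff_op bc v N \<omega> h f x) \<le> norm_L1 f * (384 * vstar bc v H + 32 * nv * (H / real N) + 1769472 * nv\<^sup>2 / real N)"
      using diff_op_bound[OF v N large[OF that(1)] that(2,3,4), of H] that(5) by (simp add: nv_def)
    also have "\<dots> \<le> norm_L1 f * (C1 * (vstar bc v H + H / real N))"
    proof (rule mult_left_mono[OF _ norm_L1_nonneg])
      have "1 / real N \<le> H / real N" using that(5) by (intro divide_right_mono) auto
      then have "1769472 * nv\<^sup>2 * (1 / real N) \<le> 1769472 * nv\<^sup>2 * (H / real N)" by (intro mult_left_mono) auto
      moreover have "0 \<le> (32 * nv + 1769472 * nv\<^sup>2) * vstar bc v H" using nv vstar_nonneg[OF v] by auto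
      moreover have "0 \<le> 384 * (H / real N)" using that(5) by auto
      ultimately show "384 * vstar bc v H + 32 * nv * (H / real N) + 1769472 * nv\<^sup>2 / real N \<le> C1 * (vstar bc v H + H / real N)"
        by (simp add: C1_def algebra_simps)
    qed
    finally show ?thesis .
  qed
  show ?thesis
  proof (cases "vstar bc v 1 = 0")
    case False
    define s where "s = vstar bc v 1"
    have s: "s > 0" using False vstar_nonneg[OF v, of bc 1] by (simp add: s_def)
    define C where "C = C1 * (1 + 1 / s)"
    have C: "C \<ge> C1" using C1 s by (simp add: C_def algebra_simps)
    then have C: "C \<ge> C1" "C > 0" using C1 by auto
    show ?thesis
    proof (rule that[OF C(2) N0(1)])
      show "96 * norm_L1 v \<le> root 3 (real N0)" using N0 by (simp add: nv_def)
      fix N \<omega> h f x and H :: real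
      assume a: "N \<ge> N0" "admissible bc v N \<omega> h" "f \<in> L1" "x \<in> {0..pi}" and H: "0 < H" "H \<le> real N"
      have N: "real N \<ge> 1" using a(1) N0 by simp
      have v0: "vstar bc v H \<ge> 0" by (rule vstar_nonneg[OF v])
      show "cmod (diff_op bc v N \<omega> h f x) \<le> norm_L1 f * (C * (vstar bc v H + H / real N))"
      proof (cases "1 \<le> H")
        case True
        have "C1 * (vstar bc v H + H / real N) \<le> C * (vstar bc v H + H / real N)"
          using C H v0 by (intro mult_right_mono) auto
        then show ?thesis using main[OF a True] norm_L1_nonneg[of f] by (meson mult_left_mono order_trans)
      next
        case False
        have sH: "s \<le> vstar bc v H" unfolding s_def by (rule vstar_antimono[OF v]) (use False in simp)
        have "1 / real N \<le> 1" using N by simp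
        then have "s + 1 / real N \<le> (1 + 1 / s) * s" using s by (simp add: algebra_simps)
        also have "\<dots> \<le> (1 + 1 / s) * (vstar bc v H + H / real N)"
        proof (rule mult_left_mono)
          have "0 \<le> H / real N" using H by simp
          then show "s \<le> vstar bc v H + H / real N" using sH by linarith
        qed (use s in simp)
        finally have "C1 * (s + 1 / real N) \<le> C1 * ((1 + 1 / s) * (vstar bc v H + H / real N))" using C1 by (intro mult_left_mono) auto
        then have "norm_L1 f * (C1 * (s + 1 / real N)) \<le> norm_L1 f * (C * (vstar bc v H + H / real N))"
          by (intro mult_left_mono norm_L1_nonneg) (simp add: C_def mult.assoc)
        then show ?thesis using main[OF a order_refl] by (simp add: s_def)
      qed
    qed
  next
    case True
    obtain c E where E: "negligible E" "\<And>x. x \<in> {0..pi} - E \<Longrightarrow> v x = c"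
      by (rule vstar_zero_imp_constant[OF v True]) (rule that)
    obtain N1 :: nat where N1: "2 * cmod c + 1 \<le> real N1" using real_arch_simple by blast
    show ?thesis
    proof (rule that[of 1 "max N0 N1"])
      show "max N0 N1 \<ge> 1" using N0 by simp
      show "96 * norm_L1 v \<le> root 3 (real (max N0 N1))" by (rule large) simp
      fix N \<omega> h f x and H :: real
      assume a: "N \<ge> max N0 N1" "admissible bc v N \<omega> h" "f \<in> L1" "x \<in> {0..pi}" and H: "0 < H" "H \<le> real N"
      have N: "N \<ge> 1" "2 * cmod c + 1 \<le> real N" using a(1) N0 N1 by auto
      have "diff_op bc v N \<omega> h f x = 0" by (rule diff_op_constant_potential[OF v E N a(2,3,4)])
      then show "cmod (diff_op bc v N \<omega> h f x) \<le> norm_L1 f * (1 * (vstar bc v H + H / real N))"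
        using norm_L1_nonneg[of f] vstar_nonneg[OF v, of bc H] H by simp
    qed simp
  qed
qed

theorem theorem7:
  fixes v :: "real \<Rightarrow> complex" and bc :: bcond
  assumes "v \<in> L1"
  shows "\<exists>Nstar::nat. \<exists>C::real. C > 0 \<and>
    (\<forall>N::nat. N \<ge> Nstar \<longrightarrow>
      (\<exists>\<omega> h. admissible bc v N \<omega> h) \<and>
      (\<forall>\<omega> h. admissible bc v N \<omega> h \<longrightarrow>
        (\<exists>T. extends_to_L1_C
               (\<lambda>f x. spectral_S bc v N \<omega> h f x - spectral_S bc (\<lambda>_. 0) N \<omega> h f x) T \<and>
             (\<forall>H::real. 0 < H \<and> H \<le> real N \<longrightarrow>
                opnorm_L1_C T \<le> ennreal (C * (vstar bc v H + H / real N))) \<and>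
             (\<forall>\<gamma>::real. 0 < \<gamma> \<and> \<gamma> < 1 \<longrightarrow>
                opnorm_L1_C T \<le> ennreal (C * (vstar bc v (real N powr \<gamma>) + real N powr (\<gamma> - 1)))))))"
proof -
  obtain Nstar :: nat and C :: real where C: "C > 0" "Nstar \<ge> 1" "96 * norm_L1 v \<le> root 3 (real Nstar)"
    and bound: "\<And>N \<omega> h f x H. N \<ge> Nstar \<Longrightarrow> admissible bc v N \<omega> h \<Longrightarrow> f \<in> L1 \<Longrightarrow> x \<in> {0..pi} \<Longrightarrow> 0 < H \<Longrightarrow> H \<le> real N \<Longrightarrow>
       cmod (diff_op bc v N \<omega> h f x) \<le> norm_L1 f * (C * (vstar bc v H + H / real N))"
    by (rule diff_op_uniform_bound[OF assms, of bc]) (rule that)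
  have op: "opnorm_L1_C (diff_op bc v N \<omega> h) \<le> ennreal (C * (vstar bc v H + H / real N))"
    if "N \<ge> Nstar" "admissible bc v N \<omega> h" "0 < H" "H \<le> real N" for N \<omega> h and H :: real
    by (rule opnorm_le[OF bound[OF that(1,2) _ _ that(3,4)]])
       (use C that vstar_nonneg[OF assms, of bc H] in auto)
  show ?thesis
  proof (rule exI[of _ Nstar], rule exI[of _ C], intro conjI allI impI C(1))
    fix N assume N: "Nstar \<le> N"
    have N1: "N \<ge> 1" "96 * norm_L1 v \<le> root 3 (real N)"
      using C N by (auto intro: order_trans)
    show "\<exists>\<omega> h. admissible bc v N \<omega> h" by (rule admissible_exists[OF assms N1])
    fix \<omega> h assume adm: "admissible bc v N \<omega> h"
    show "\<exists>T. extends_to_L1_C (\<lambda>f x. spectral_S bc v N \<omega> h f x - spectral_S bc (\<lambda>_. 0) N \<omega> h f x) T \<and>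
             (\<forall>H::real. 0 < H \<and> H \<le> real N \<longrightarrow>
                opnorm_L1_C T \<le> ennreal (C * (vstar bc v H + H / real N))) \<and>
             (\<forall>\<gamma>::real. 0 < \<gamma> \<and> \<gamma> < 1 \<longrightarrow>
                opnorm_L1_C T \<le> ennreal (C * (vstar bc v (real N powr \<gamma>) + real N powr (\<gamma> - 1))))"
    proof (rule exI[of _ "diff_op bc v N \<omega> h"], intro conjI allI impI diff_op_extends[OF assms N1 adm])
      fix H :: real assume "0 < H \<and> H \<le> real N"
      then show "opnorm_L1_C (diff_op bc v N \<omega> h) \<le> ennreal (C * (vstar bc v H + H / real N))"
        using op[OF N adm] by blast
    next
      fix \<gamma> :: real assume g: "0 < \<gamma> \<and> \<gamma> < 1"
      \<comment> \<open>The choice \<open>H = N\<^sup>\<gamma>\<close>, which does not exceed \<open>N\<close>.\<close>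
      have "real N powr \<gamma> \<le> real N powr 1" using g N1 by (intro powr_mono) auto
      moreover have "real N powr \<gamma> > 0" using N1 by simp
      moreover have "real N powr (\<gamma> - 1) = real N powr \<gamma> / real N" using N1 by (simp add: powr_diff)
      ultimately show "opnorm_L1_C (diff_op bc v N \<omega> h) \<le> ennreal (C * (vstar bc v (real N powr \<gamma>) + real N powr (\<gamma> - 1)))"
        using op[OF N adm, of "real N powr \<gamma>"] N1 by simp
    qed
  qed
qed

end
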